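(* Let $M$ be an $n$-dimensional smooth real manifold and $p:Z\to M$ a torus bundle with fibers real $n$-tori and zero section $s$. A semi-flat generalized almost complex structure $\mathcal{J}$ on $Z$, arising from the adapted generalized almost complex structure $\underline{\mathcal{J}}$ on $s^*T_{Z/M}\oplus T_M$, induces a pair of almost Dirac structures on $M$, $$\Delta=\underline{\mathcal{J}}(s^*T_{Z/M}),\qquad\widehat\Delta=\underline{\mathcal{J}}(s^*T_{Z/M}^\vee)\ \subseteq\ T_M\oplus T_M^\vee.$$ Each carries its own flat connection (transported via $\underline{\mathcal{J}}$ from the flat connections on $s^*T_{Z/M}$ and $s^*T_{Z/M}^\vee$), and these almost Dirac structures are exchanged under mirror symmetry (i.e. the pair associated with the mirror structure $\widehat{\mathcal{J}}$ on the dual torus bundle $\widehat Z$ is $(\widehat\Delta,\Delta)$). If $\mathcal{J}$ is integrable then $\Delta$ and $\widehat\Delta$ are integrable.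
   Context: Generalized almost complex structures. On $W\oplus W^\vee$ ($W$ a real vector bundle) use the pairing $\langle v+f,w+g\rangle=-\tfrac12(f(w)+g(v))$. A generalized almost complex structure on $W$ is an automorphism $\mathcal{J}$ of $W\oplus W^\vee$ which is orthogonal for this pairing and satisfies $\mathcal{J}^2=-1$. A generalized almost complex structure on a manifold $N$ is one on $W=T_N$. The Courant bracket is $[X+\xi,Y+\eta]=[X,Y]+\mathcal{L}_X\eta-\mathcal{L}_Y\xi+\tfrac12 d(\iota_Y\xi-\iota_X\eta)$. A generalized almost complex structure on $N$ is integrable if the sheaf of sections of its $(+i)$-eigenbundle in $(T_N\oplus T_N^\vee)\otimes\mathbb{C}$ is closed under the ($\mathbb{C}$-bilinearly extended) Courant bracket. An almost Dirac structure on $M$ is a maximally isotropic sub-bundle of $T_M\oplus T_M^\vee$; it is integrable (a Dirac structure) if its sections are closed under the Courant bracket. Torus bundles. $p:Z\to M$ is a smooth fiber bundle with fiber an $n$-torus and a global section $s$; its structure group is taken to be reduced to $GL(n,\mathbb{Z})$, so $Z$ is a bundle of Lie groups with zero section $s$. Put $V=s^*T_{Z/M}$, a rank $n$ vector bundle; translation along the fibers gives $T_{Z/M}\cong p^*V$. There is a bundle of lattices $\Lambda\subset \mathrm{tot}(V)$ with $Z\cong \mathrm{tot}(V)/\Lambda$, and $V$ carries the flat connection $\nabla$ for which local sections of $\Lambda$ are flat; $V^\vee$ carries the dual connection $\nabla^\vee$. On $X=\mathrm{tot}(V)\xrightarrow{\pi}M$, with tautological section $S$ of $\pi^*V$, the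 map $D=(\pi^*\nabla)(S):T_X\to\pi^*V$ splits the sequence $0\to\pi^*V\to T_X\to\pi^*T_M\to0$; it is invariant under translation by $\Lambda$, so it descends to a splitting of $0\to p^*V\xrightarrow{j}T_Z\xrightarrow{dp}p^*T_M\to0$, again denoted $D:T_Z\to p^*V$ ($D\circ j=1$), with corresponding $\alpha:p^*T_M\to T_Z$ ($dp\circ\alpha=1$, $D\circ\alpha=0$). Let $F:T_Z\oplus T_Z^\vee\to p^*V\oplus p^*T_M\oplus p^*V^\vee\oplus p^*T_M^\vee$, $F(w+\xi)=(Dw,\ dp\,w,\ j^\vee\xi,\ \alpha^\vee\xi)$, an isomorphism. The dual torus bundle is $\hat p:\widehat{Z}=\mathrm{tot}(V^\vee)/\widehat\Lambda\to M$, with $\widehat\Lambda=\mathrm{Hom}_{\mathbb{Z}}(\Lambda,\mathbb{Z})$ the dual lattice bundle; the same construction with $(V^\vee,\nabla^\vee,\widehat\Lambda)$ gives $\widehat F:T_{\widehat Z}\oplus T_{\widehat Z}^\vee\to \hat p^*V^\vee\oplus\hat p^*T_M\oplus\hat p^*V\oplus\hat p^*T_M^\vee$. The relative tangent bundle of $\widehat Z$ restricted to its zero section is $V^\vee$. Semi-flat and mirror. With $\dim M=n$ equal to the fiber dimension, a semi-flat generalized almost complex structure on $Z$ is one of the form $\mathcal{J}=F^{-1}(p^*\underline{\mathcal{J}})F$, where $\underline{\mathcal{J}}$ is a generalized almost complex structure on $V\oplus T_M$ which is adapted: $\underline{\mathcal{J}}(V\oplus V^\vee)=T_M\oplus T_M^\vee$.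 Its mirror is $\widehat{\mathcal{J}}=\widehat F^{-1}(\hat p^*\widehat{\underline{\mathcal{J}}})\widehat F$ on $\widehat Z$, where $\widehat{\underline{\mathcal{J}}}=\tau\underline{\mathcal{J}}\tau^{-1}$ and $\tau:V\oplus T_M\oplus V^\vee\oplus T_M^\vee\to V^\vee\oplus T_M\oplus V\oplus T_M^\vee$ interchanges the summands $V$ and $V^\vee$. *)

theory Defs
  imports "HOL-Analysis.Analysis" "HOL-Library.Function_Algebras"
begin

text \<open>Tangent vectors and covectors live in function spaces, with pointwise operations.\<close>

instantiation "fun" :: (type, real_vector) real_vector
begin
definition scaleR_fun :: "real \<Rightarrow> ('a \<Rightarrow> 'b) \<Rightarrow> 'a \<Rightarrow> 'b" where
  "scaleR_fun c f = (\<lambda>x. c *\<^sub>R f x)"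
instance
  by standard (simp_all add: scaleR_fun_def fun_eq_iff scaleR_add_right scaleR_add_left)
end

definition restr :: "'a set \<Rightarrow> ('a \<Rightarrow> 'b::zero) \<Rightarrow> 'a \<Rightarrow> 'b" where
  "restr S f = (\<lambda>x. if x \<in> S then f x else 0)"

definition linear_on_set :: "'a::real_vector set \<Rightarrow> ('a \<Rightarrow> 'b::real_vector) \<Rightarrow> bool" where
  "linear_on_set S f \<longleftrightarrow>
     (\<forall>u\<in>S. \<forall>v\<in>S. f (u + v) = f u + f v) \<and> (\<forall>c. \<forall>u\<in>S. f (c *\<^sub>R u) = c *\<^sub>R f u)"

text \<open>The dual of a subspace \<open>S\<close> of an ambient vector space.  A functional is extended by
  \<open>0\<close> outside \<open>S\<close>, so that equality of functions is equality of functionals on \<open>S\<close>.\<close>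

definition dual_space :: "'a::real_vector set \<Rightarrow> ('a \<Rightarrow> real) set" where
  "dual_space S = {f. linear_on_set S f \<and> (\<forall>x. x \<notin> S \<longrightarrow> f x = 0)}"

section \<open>Smooth manifolds\<close>

text \<open>The sets \<open>S\<close> and \<open>U\<close> on which smoothness is required are always open in the uses below.
  Since \<open>f' x\<close> is linear, asking that every directional derivative \<open>x \<mapsto> f' x v\<close> be \<open>C\<^sup>k\<close> is the
  usual condition in finite dimension.\<close>

fun Ck_on :: "nat \<Rightarrow> 'a::real_normed_vector set \<Rightarrow> ('a \<Rightarrow> 'b::real_normed_vector) \<Rightarrow> bool" where
  "Ck_on 0 S f = continuous_on S f"
| "Ck_on (Suc k) S f =
     (\<exists>f'. (\<forall>x\<in>S. (f has_derivative f' x) (at x)) \<and> (\<forall>v. Ck_on k S (\<lambda>x. f' x v)))"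

definition smooth_on :: "'a::real_normed_vector set \<Rightarrow> ('a \<Rightarrow> 'b::real_normed_vector) \<Rightarrow> bool" where
  "smooth_on S f \<longleftrightarrow> (\<forall>k. Ck_on k S f)"

text \<open>A chart is a domain together with a coordinate map, whose values off the domain are
  irrelevant.  A manifold is given by a (not necessarily maximal) atlas; its underlying set is the
  union of the chart domains and its topology is the one determined by the charts.\<close>

type_synonym ('a, 'e) chart = "'a set \<times> ('a \<Rightarrow> 'e)"
type_synonym ('a, 'e) atlas = "('a, 'e) chart set"

definition carrier :: "('a, 'e) atlas \<Rightarrow> 'a set" where
  "carrier A = \<Union> (fst ` A)"

definition chart_inv :: "('a, 'e) chart \<Rightarrow> 'e \<Rightarrow> 'a" where
  "chart_inv c = inv_into (fst c) (snd c)"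

definition mopen :: "('a, 'e::euclidean_space) atlas \<Rightarrow> 'a set \<Rightarrow> bool" where
  "mopen A U \<longleftrightarrow> U \<subseteq> carrier A \<and> (\<forall>c\<in>A. open (snd c ` (U \<inter> fst c)))"

definition smooth_manifold :: "('a, 'e::euclidean_space) atlas \<Rightarrow> bool" where
  "smooth_manifold A \<longleftrightarrow>
     (\<forall>c\<in>A. inj_on (snd c) (fst c) \<and> open (snd c ` fst c)) \<and>
     (\<forall>c\<in>A. \<forall>d\<in>A. open (snd c ` (fst c \<inter> fst d)) \<and>
        smooth_on (snd c ` (fst c \<inter> fst d)) (snd d \<circ> chart_inv c)) \<and>
     Hausdorff_space (topology (mopen A)) \<and> second_countable (topology (mopen A))"

definition smooth_fun ::
  "('a, 'e::euclidean_space) atlas \<Rightarrow> 'a set \<Rightarrow> ('a \<Rightarrow> 'b::real_normed_vector) \<Rightarrow> bool" where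
  "smooth_fun A U f \<longleftrightarrow> (\<forall>c\<in>A. smooth_on (snd c ` (U \<inter> fst c)) (f \<circ> chart_inv c))"

definition smooth_map ::
  "('a, 'e::euclidean_space) atlas \<Rightarrow> ('b, 'f::euclidean_space) atlas \<Rightarrow> ('a \<Rightarrow> 'b) \<Rightarrow> bool" where
  "smooth_map A B f \<longleftrightarrow> f ` carrier A \<subseteq> carrier B \<and>
     (\<forall>c\<in>A. \<forall>d\<in>B. open (snd c ` (fst c \<inter> f -` fst d)) \<and>
        smooth_on (snd c ` (fst c \<inter> f -` fst d)) (snd d \<circ> f \<circ> chart_inv c))"

definition diffeo ::
  "('a, 'e::euclidean_space) atlas \<Rightarrow> ('b, 'f::euclidean_space) atlas \<Rightarrow> ('a \<Rightarrow> 'b) \<Rightarrow> bool" where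
  "diffeo A B f \<longleftrightarrow> bij_betw f (carrier A) (carrier B) \<and>
     smooth_map A B f \<and> smooth_map B A (inv_into (carrier A) f)"

definition restrict_atlas :: "('a, 'e) atlas \<Rightarrow> 'a set \<Rightarrow> ('a, 'e) atlas" where
  "restrict_atlas A S = {(fst c \<inter> S, snd c) | c. c \<in> A}"

definition prod_atlas :: "('a, 'e) atlas \<Rightarrow> ('b, 'f) atlas \<Rightarrow> ('a \<times> 'b, 'e \<times> 'f) atlas" where
  "prod_atlas A B =
     {(fst c \<times> fst d, \<lambda>(x, y). (snd c x, snd d y)) | c d. c \<in> A \<and> d \<in> B}"

text \<open>The atlas on the target of a covering map \<open>q\<close> for which \<open>q\<close> is a local diffeomorphism:
  its charts are local inverses of \<open>q\<close> followed by charts of \<open>A\<close>.\<close>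

definition quotient_atlas ::
  "('a, 'e::euclidean_space) atlas \<Rightarrow> ('a \<Rightarrow> 'b) \<Rightarrow> ('b, 'e) atlas" where
  "quotient_atlas A q =
     {(q ` W, snd c \<circ> inv_into W q) | c W. c \<in> A \<and> W \<subseteq> fst c \<and> mopen A W \<and> inj_on q W}"

section \<open>Tangent vectors and derivatives\<close>

text \<open>A tangent vector at \<open>x\<close> is the family of its coordinate vectors in all charts around \<open>x\<close>,
  related by the derivatives of the transition maps (and \<open>0\<close> in the other charts).\<close>

type_synonym ('a, 'e) tvec = "('a, 'e) chart \<Rightarrow> 'e"

definition chart_deriv ::
  "('a, 'e::euclidean_space) chart \<Rightarrow> ('a \<Rightarrow> 'b::real_normed_vector) \<Rightarrow> 'a \<Rightarrow> 'e \<Rightarrow> 'b" where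
  "chart_deriv c f x a = frechet_derivative (f \<circ> chart_inv c) (at (snd c x)) a"

definition tangent_space :: "('a, 'e::euclidean_space) atlas \<Rightarrow> 'a \<Rightarrow> ('a, 'e) tvec set" where
  "tangent_space A x = {v.
     (\<forall>c\<in>A. \<forall>d\<in>A. x \<in> fst c \<longrightarrow> x \<in> fst d \<longrightarrow> v d = chart_deriv c (snd d) x (v c)) \<and>
     (\<forall>c. \<not> (c \<in> A \<and> x \<in> fst c) \<longrightarrow> v c = 0)}"

definition chart_at :: "('a, 'e) atlas \<Rightarrow> 'a \<Rightarrow> ('a, 'e) chart" where
  "chart_at A x = (SOME c. c \<in> A \<and> x \<in> fst c)"

definition dfun ::
  "('a, 'e::euclidean_space) atlas \<Rightarrow> ('a \<Rightarrow> 'b::real_normed_vector) \<Rightarrow> 'a \<Rightarrow> ('a, 'e) tvec \<Rightarrow> 'b"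
  where "dfun A f x v = chart_deriv (chart_at A x) f x (v (chart_at A x))"

definition mdiff ::
  "('a, 'e::euclidean_space) atlas \<Rightarrow> ('b, 'f::euclidean_space) atlas \<Rightarrow> ('a \<Rightarrow> 'b) \<Rightarrow>
   'a \<Rightarrow> ('a, 'e) tvec \<Rightarrow> ('b, 'f) tvec" where
  "mdiff A B f x v = (\<lambda>d. if d \<in> B \<and> f x \<in> fst d then dfun A (\<lambda>y. snd d (f y)) x v else 0)"

definition velocity :: "('a, 'e::euclidean_space) atlas \<Rightarrow> (real \<Rightarrow> 'a) \<Rightarrow> real \<Rightarrow> ('a, 'e) tvec" where
  "velocity A \<gamma> t =
     (\<lambda>c. if c \<in> A \<and> \<gamma> t \<in> fst c then vector_derivative (\<lambda>r. snd c (\<gamma> r)) (at t) else 0)"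

section \<open>Vector bundles\<close>

text \<open>The fibres are subspaces of one ambient vector space \<open>'v\<close>; the smooth structure is given by
  local trivialisations \<open>(U, \<theta>)\<close>, where \<open>\<theta> x\<close> is a linear isomorphism from the fibre over
  \<open>x \<in> U\<close> to the model space \<open>'f\<close>.  A point of the total space is a pair \<open>(x, v)\<close> with \<open>v\<close> in the
  fibre over \<open>x\<close>.\<close>

record ('m, 'v, 'f) vbundle =
  fibre :: "'m \<Rightarrow> 'v set"
  btriv :: "('m set \<times> ('m \<Rightarrow> 'v \<Rightarrow> 'f)) set"

definition tbundle ::
  "('a, 'e::euclidean_space) atlas \<Rightarrow> ('a, ('a, 'e) tvec, 'e) vbundle" where
  "tbundle A = \<lparr>fibre = tangent_space A, btriv = {(fst c, \<lambda>x v. v c) | c. c \<in> A}\<rparr>"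

definition bsum ::
  "('m, 'v, 'f) vbundle \<Rightarrow> ('m, 'w, 'g) vbundle \<Rightarrow> ('m, 'v \<times> 'w, 'f \<times> 'g) vbundle" where
  "bsum B C = \<lparr>fibre = (\<lambda>x. fibre B x \<times> fibre C x),
     btriv = {(fst s \<inter> fst t, \<lambda>x (v, w). (snd s x v, snd t x w)) | s t.
                s \<in> btriv B \<and> t \<in> btriv C}\<rparr>"

text \<open>The model space is identified with its dual through the inner product.\<close>

definition dual_bundle ::
  "('m, 'v::real_vector, 'f::euclidean_space) vbundle \<Rightarrow> ('m, 'v \<Rightarrow> real, 'f) vbundle" where
  "dual_bundle B = \<lparr>fibre = (\<lambda>x. dual_space (fibre B x)),
     btriv = {(fst t, \<lambda>x f. \<Sum>b\<in>Basis. f (inv_into (fibre B x) (snd t x) b) *\<^sub>R b) | t.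
                t \<in> btriv B}\<rparr>"

definition smooth_sections ::
  "('m, 'e::euclidean_space) atlas \<Rightarrow> ('m, 'v, 'f::euclidean_space) vbundle \<Rightarrow> 'm set \<Rightarrow>
   ('m \<Rightarrow> 'v) set" where
  "smooth_sections A B U = {\<sigma>. (\<forall>x\<in>U. \<sigma> x \<in> fibre B x) \<and>
     (\<forall>t\<in>btriv B. smooth_fun A (U \<inter> fst t) (\<lambda>x. snd t x (\<sigma> x)))}"

definition smooth_endo ::
  "('m, 'e::euclidean_space) atlas \<Rightarrow> ('m, 'v, 'f::euclidean_space) vbundle \<Rightarrow>
   ('m \<Rightarrow> 'v \<Rightarrow> 'v) \<Rightarrow> bool" where
  "smooth_endo A B J \<longleftrightarrow> (\<forall>s\<in>btriv B. \<forall>t\<in>btriv B. \<forall>a.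
     smooth_fun A (fst s \<inter> fst t) (\<lambda>x. snd t x (J x (inv_into (fibre B x) (snd s x) a))))"

definition triv_at :: "('m, 'v, 'f) vbundle \<Rightarrow> 'm \<Rightarrow> 'm set \<times> ('m \<Rightarrow> 'v \<Rightarrow> 'f)" where
  "triv_at B x = (SOME t. t \<in> btriv B \<and> x \<in> fst t)"

text \<open>The local section through \<open>v\<close> that is constant in a trivialisation around \<open>x\<close>.\<close>

definition const_ext :: "('m, 'v, 'f) vbundle \<Rightarrow> 'm \<Rightarrow> 'v \<Rightarrow> 'm \<Rightarrow> 'v" where
  "const_ext B x v = (let \<theta> = snd (triv_at B x) in (\<lambda>y. inv_into (fibre B y) (\<theta> y) (\<theta> x v)))"

definition tot_atlas ::
  "('m, 'e) atlas \<Rightarrow> ('m, 'v, 'f) vbundle \<Rightarrow> ('m \<times> 'v, 'e \<times> 'f) atlas" where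
  "tot_atlas A B =
     {({(x, v). x \<in> fst c \<and> x \<in> fst t \<and> v \<in> fibre B x}, \<lambda>(x, v). (snd c x, snd t x v)) | c t.
        c \<in> A \<and> t \<in> btriv B}"

definition subbundle ::
  "('m, 'e::euclidean_space) atlas \<Rightarrow> ('m, 'v::real_vector, 'f::euclidean_space) vbundle \<Rightarrow>
   ('m \<Rightarrow> 'v set) \<Rightarrow> bool" where
  "subbundle A B \<Delta> \<longleftrightarrow> (\<forall>x\<in>carrier A. \<exists>U (k::nat) e. mopen A U \<and> x \<in> U \<and>
     (\<forall>i<k. e i \<in> smooth_sections A B U) \<and>
     (\<forall>y\<in>U. inj_on (\<lambda>i. e i y) {..<k} \<and> independent ((\<lambda>i. e i y) ` {..<k}) \<and>
        span ((\<lambda>i. e i y) ` {..<k}) = \<Delta> y))"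

definition sub_sections ::
  "('m, 'e::euclidean_space) atlas \<Rightarrow> ('m, 'v, 'f::euclidean_space) vbundle \<Rightarrow>
   ('m \<Rightarrow> 'v set) \<Rightarrow> 'm set \<Rightarrow> ('m \<Rightarrow> 'v) set" where
  "sub_sections A B \<Delta> U = {\<sigma> \<in> smooth_sections A B U. \<forall>x\<in>U. \<sigma> x \<in> \<Delta> x}"

section \<open>Courant bracket\<close>

definition lie_bracket ::
  "('a, 'e::euclidean_space) atlas \<Rightarrow> ('a \<Rightarrow> ('a, 'e) tvec) \<Rightarrow> ('a \<Rightarrow> ('a, 'e) tvec) \<Rightarrow>
   'a \<Rightarrow> ('a, 'e) tvec" where
  "lie_bracket A X Y x = (\<lambda>c. if c \<in> A \<and> x \<in> fst c
     then chart_deriv c (\<lambda>y. Y y c) x (X x c) - chart_deriv c (\<lambda>y. X y c) x (Y x c) else 0)"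

text \<open>\<open>(L\<^sub>X \<eta>)(W) = X(\<eta>(W)) - \<eta>([X, W])\<close>, evaluated on a local extension \<open>W\<close> of \<open>w\<close>.\<close>

definition lie_form ::
  "('a, 'e::euclidean_space) atlas \<Rightarrow> ('a \<Rightarrow> ('a, 'e) tvec) \<Rightarrow> ('a \<Rightarrow> ('a, 'e) tvec \<Rightarrow> real) \<Rightarrow>
   'a \<Rightarrow> ('a, 'e) tvec \<Rightarrow> real" where
  "lie_form A X \<eta> x = restr (tangent_space A x) (\<lambda>w.
     let W = const_ext (tbundle A) x w
     in dfun A (\<lambda>y. \<eta> y (W y)) x (X x) - \<eta> x (lie_bracket A X W x))"

definition d0 ::
  "('a, 'e::euclidean_space) atlas \<Rightarrow> ('a \<Rightarrow> real) \<Rightarrow> 'a \<Rightarrow> ('a, 'e) tvec \<Rightarrow> real" where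
  "d0 A f x = restr (tangent_space A x) (dfun A f x)"

type_synonym 'v gen = "'v \<times> ('v \<Rightarrow> real)"

definition courant ::
  "('a, 'e::euclidean_space) atlas \<Rightarrow> ('a \<Rightarrow> ('a, 'e) tvec gen) \<Rightarrow> ('a \<Rightarrow> ('a, 'e) tvec gen) \<Rightarrow>
   'a \<Rightarrow> ('a, 'e) tvec gen" where
  "courant A \<sigma> \<tau> x =
     (let X = (\<lambda>y. fst (\<sigma> y)); \<xi> = (\<lambda>y. snd (\<sigma> y)); Y = (\<lambda>y. fst (\<tau> y)); \<eta> = (\<lambda>y. snd (\<tau> y))
      in (lie_bracket A X Y x,
          lie_form A X \<eta> x - lie_form A Y \<xi> x
            + (1/2) *\<^sub>R d0 A (\<lambda>y. \<xi> y (Y y) - \<eta> y (X y)) x))"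

text \<open>Its \<open>\<complex>\<close>-bilinear extension; a pair \<open>(a, b)\<close> stands for \<open>a + \<i> b\<close>.\<close>

definition courant_cx ::
  "('a, 'e::euclidean_space) atlas \<Rightarrow>
   ('a \<Rightarrow> ('a, 'e) tvec gen \<times> ('a, 'e) tvec gen) \<Rightarrow>
   ('a \<Rightarrow> ('a, 'e) tvec gen \<times> ('a, 'e) tvec gen) \<Rightarrow>
   'a \<Rightarrow> ('a, 'e) tvec gen \<times> ('a, 'e) tvec gen" where
  "courant_cx A \<sigma> \<tau> x =
     (let a = (\<lambda>y. fst (\<sigma> y)); b = (\<lambda>y. snd (\<sigma> y)); c = (\<lambda>y. fst (\<tau> y)); d = (\<lambda>y. snd (\<tau> y))
      in (courant A a c x - courant A b d x, courant A a d x + courant A b c x))"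

section \<open>Generalized almost complex structures and almost Dirac structures\<close>

definition pairing :: "'v gen \<Rightarrow> 'v gen \<Rightarrow> real" where
  "pairing u u' = - (1/2) * (snd u (fst u') + snd u' (fst u))"

definition gen_bundle ::
  "('m, 'v::real_vector, 'f::euclidean_space) vbundle \<Rightarrow> ('m, 'v gen, 'f \<times> 'f) vbundle" where
  "gen_bundle W = bsum W (dual_bundle W)"

definition gacs ::
  "('m, 'e::euclidean_space) atlas \<Rightarrow> ('m, 'v::real_vector, 'f::euclidean_space) vbundle \<Rightarrow>
   ('m \<Rightarrow> 'v gen \<Rightarrow> 'v gen) \<Rightarrow> bool" where
  "gacs A W J \<longleftrightarrow> smooth_endo A (gen_bundle W) J \<and>
     (\<forall>x\<in>carrier A. let E = fibre (gen_bundle W) x in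
        linear_on_set E (J x) \<and> bij_betw (J x) E E \<and>
        (\<forall>u\<in>E. \<forall>u'\<in>E. pairing (J x u) (J x u') = pairing u u') \<and>
        (\<forall>u\<in>E. J x (J x u) = - u))"

text \<open>Smooth sections of the \<open>(+\<i>)\<close>-eigenbundle: \<open>J (a + \<i> b) = \<i> (a + \<i> b) = - b + \<i> a\<close>.
  The complexification of a bundle \<open>E\<close> is \<open>bsum E E\<close>.\<close>

definition eigen_sections ::
  "('a, 'e::euclidean_space) atlas \<Rightarrow>
   ('a \<Rightarrow> ('a, 'e) tvec gen \<Rightarrow> ('a, 'e) tvec gen) \<Rightarrow> 'a set \<Rightarrow>
   ('a \<Rightarrow> ('a, 'e) tvec gen \<times> ('a, 'e) tvec gen) set" where
  "eigen_sections A J U =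
     {\<sigma> \<in> smooth_sections A (bsum (gen_bundle (tbundle A)) (gen_bundle (tbundle A))) U.
        \<forall>x\<in>U. (J x (fst (\<sigma> x)), J x (snd (\<sigma> x))) = (- snd (\<sigma> x), fst (\<sigma> x))}"

definition integrable_gacs ::
  "('a, 'e::euclidean_space) atlas \<Rightarrow>
   ('a \<Rightarrow> ('a, 'e) tvec gen \<Rightarrow> ('a, 'e) tvec gen) \<Rightarrow> bool" where
  "integrable_gacs A J \<longleftrightarrow> (\<forall>U. mopen A U \<longrightarrow>
     (\<forall>\<sigma>\<in>eigen_sections A J U. \<forall>\<tau>\<in>eigen_sections A J U.
        courant_cx A \<sigma> \<tau> \<in> eigen_sections A J U))"

definition isotropic :: "'v gen set \<Rightarrow> bool" where
  "isotropic S \<longleftrightarrow> (\<forall>u\<in>S. \<forall>u'\<in>S. pairing u u' = 0)"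

definition almost_dirac ::
  "('a, 'e::euclidean_space) atlas \<Rightarrow> ('a \<Rightarrow> ('a, 'e) tvec gen set) \<Rightarrow> bool" where
  "almost_dirac A \<Delta> \<longleftrightarrow> subbundle A (gen_bundle (tbundle A)) \<Delta> \<and>
     (\<forall>x\<in>carrier A. isotropic (\<Delta> x) \<and>
        (\<forall>S. subspace S \<and> S \<subseteq> fibre (gen_bundle (tbundle A)) x \<and> isotropic S \<and> \<Delta> x \<subseteq> S
           \<longrightarrow> S = \<Delta> x))"

definition integrable_dirac ::
  "('a, 'e::euclidean_space) atlas \<Rightarrow> ('a \<Rightarrow> ('a, 'e) tvec gen set) \<Rightarrow> bool" where
  "integrable_dirac A \<Delta> \<longleftrightarrow> (\<forall>U. mopen A U \<longrightarrow>
     (\<forall>\<sigma>\<in>sub_sections A (gen_bundle (tbundle A)) \<Delta> U.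
      \<forall>\<tau>\<in>sub_sections A (gen_bundle (tbundle A)) \<Delta> U.
        courant A \<sigma> \<tau> \<in> sub_sections A (gen_bundle (tbundle A)) \<Delta> U))"

section \<open>Connections\<close>

text \<open>\<open>D x w \<sigma>\<close> is the covariant derivative at \<open>x\<close> of the local section \<open>\<sigma>\<close> along the tangent
  vector \<open>w\<close>.\<close>

type_synonym ('m, 'e, 'v) conn = "'m \<Rightarrow> ('m, 'e) tvec \<Rightarrow> ('m \<Rightarrow> 'v) \<Rightarrow> 'v"

text \<open>\<open>D\<close> is a flat connection on the vector bundle with sheaf of smooth sections \<open>\<Gamma>\<close>.\<close>

definition flat_connection ::
  "('m, 'e::euclidean_space) atlas \<Rightarrow> ('m set \<Rightarrow> ('m \<Rightarrow> 'v::real_vector) set) \<Rightarrow>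
   ('m, 'e, 'v) conn \<Rightarrow> bool" where
  "flat_connection A \<Gamma> D \<longleftrightarrow>
     (\<forall>U. mopen A U \<longrightarrow>
       (\<forall>\<sigma>\<in>\<Gamma> U. \<forall>x\<in>U. linear_on_set (tangent_space A x) (\<lambda>w. D x w \<sigma>)) \<and>
       (\<forall>\<sigma>\<in>\<Gamma> U. \<forall>\<tau>\<in>\<Gamma> U. \<forall>x\<in>U. \<forall>w\<in>tangent_space A x.
          D x w (\<lambda>y. \<sigma> y + \<tau> y) = D x w \<sigma> + D x w \<tau>) \<and>
       (\<forall>\<sigma>\<in>\<Gamma> U. \<forall>f. smooth_fun A U f \<longrightarrow> (\<forall>x\<in>U. \<forall>w\<in>tangent_space A x.
          D x w (\<lambda>y. f y *\<^sub>R \<sigma> y) = dfun A f x w *\<^sub>R \<sigma> x + f x *\<^sub>R D x w \<sigma>)) \<and>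
       (\<forall>\<sigma>\<in>\<Gamma> U. \<forall>\<tau>. (\<forall>y\<in>U. \<tau> y = \<sigma> y) \<longrightarrow>
          (\<forall>x\<in>U. \<forall>w\<in>tangent_space A x. D x w \<tau> = D x w \<sigma>)) \<and>
       (\<forall>\<sigma>\<in>\<Gamma> U. \<forall>X\<in>smooth_sections A (tbundle A) U. (\<lambda>y. D y (X y) \<sigma>) \<in> \<Gamma> U) \<and>
       (\<forall>\<sigma>\<in>\<Gamma> U. \<forall>X\<in>smooth_sections A (tbundle A) U. \<forall>Y\<in>smooth_sections A (tbundle A) U.
          \<forall>x\<in>U. D x (X x) (\<lambda>y. D y (Y y) \<sigma>) - D x (Y x) (\<lambda>y. D y (X y) \<sigma>)
            - D x (lie_bracket A X Y x) \<sigma> = 0))"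

text \<open>For a bundle whose trivialisations differ by locally constant matrices: the connection for
  which the sections that are constant in a trivialisation are flat.\<close>

definition flat_conn ::
  "('m, 'e::euclidean_space) atlas \<Rightarrow> ('m, 'v, 'f::euclidean_space) vbundle \<Rightarrow> ('m, 'e, 'v) conn"
  where
  "flat_conn A B x w \<sigma> = (let \<theta> = snd (triv_at B x)
     in inv_into (fibre B x) (\<theta> x) (dfun A (\<lambda>y. \<theta> y (\<sigma> y)) x w))"

text \<open>The dual connection: \<open>(D\<^sup>\<or>\<^sub>w f)(\<sigma>(x)) = w(f(\<sigma>)) - f(D\<^sub>w \<sigma>)\<close>, for a local section \<open>\<sigma>\<close>
  with prescribed value at \<open>x\<close>.\<close>

definition dual_conn ::
  "('m, 'e::euclidean_space) atlas \<Rightarrow> ('m, 'v, 'f) vbundle \<Rightarrow> ('m, 'e, 'v) conn \<Rightarrow>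
   ('m, 'e, 'v \<Rightarrow> real) conn" where
  "dual_conn A B D x w f = restr (fibre B x) (\<lambda>v.
     let \<sigma> = const_ext B x v in dfun A (\<lambda>y. f y (\<sigma> y)) x w - f x (D x w \<sigma>))"

text \<open>The pullback \<open>h\<^sup>*D\<close> along \<open>h\<close>, acting on sections \<open>\<sigma>\<close> of \<open>h\<^sup>*B\<close>.  If \<open>(e\<^sub>b)\<close> is a local
  frame of \<open>B\<close> and \<open>\<sigma> = \<Sum>\<sigma>\<^sup>b h\<^sup>*e\<^sub>b\<close>, then
  \<open>(h\<^sup>*D)\<^sub>w \<sigma> = \<Sum> w(\<sigma>\<^sup>b) e\<^sub>b + \<Sum> \<sigma>\<^sup>b D\<^bsub>dh w\<^esub> e\<^sub>b\<close>; the second sum is the derivative of the section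
  with constant components \<open>\<sigma>\<^sup>b(y)\<close>.\<close>

definition pull_conn ::
  "('z, 'g::euclidean_space) atlas \<Rightarrow> ('m, 'e::euclidean_space) atlas \<Rightarrow> ('z \<Rightarrow> 'm) \<Rightarrow>
   ('m, 'v::real_vector, 'f::euclidean_space) vbundle \<Rightarrow> ('m, 'e, 'v) conn \<Rightarrow>
   ('z, 'g, 'v) conn" where
  "pull_conn N A h B D y w \<sigma> = (let \<theta> = snd (triv_at B (h y)) in
     inv_into (fibre B (h y)) (\<theta> (h y)) (dfun N (\<lambda>y'. \<theta> (h y') (\<sigma> y')) y w)
     + D (h y) (mdiff N A h y w) (const_ext B (h y) (\<sigma> y)))"

definition transport_conn ::
  "('m, 'v, 'f) vbundle \<Rightarrow> ('m \<Rightarrow> 'v \<Rightarrow> 'u) \<Rightarrow> ('m, 'e, 'v) conn \<Rightarrow> ('m, 'e, 'u) conn" where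
  "transport_conn B g D x w \<sigma> = g x (D x w (\<lambda>y. inv_into (fibre B y) (g y) (\<sigma> y)))"

section \<open>Torus bundles\<close>

definition torus_proj :: "real ^ 'n \<Rightarrow> (real ^ 'n) set" where
  "torus_proj a = {b. \<forall>i. b $ i - a $ i \<in> \<int>}"

definition torus_atlas :: "((real ^ 'n) set, real ^ 'n) atlas" where
  "torus_atlas = quotient_atlas {(UNIV, \<lambda>a. a)} torus_proj"

definition GL_int :: "(real ^ 'n ^ 'n) set" where
  "GL_int = {A. (\<forall>i j. A $ i $ j \<in> \<int>) \<and>
     (\<exists>B. (\<forall>i j. B $ i $ j \<in> \<int>) \<and> A ** B = mat 1 \<and> B ** A = mat 1)}"

text \<open>A local trivialisation \<open>(U, \<phi>)\<close> consists of an open \<open>U\<close> and the fibre component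
  \<open>\<phi> : p\<^sup>-\<^sup>1(U) \<rightarrow> \<real>\<^sup>n/\<int>\<^sup>n\<close> of a diffeomorphism \<open>p\<^sup>-\<^sup>1(U) \<rightarrow> U \<times> \<real>\<^sup>n/\<int>\<^sup>n\<close>.\<close>

record ('m, 'z, 'n) torus_data =
  base :: "('m, real ^ 'n) atlas"
  total :: "('z, (real ^ 'n) \<times> (real ^ 'n)) atlas"
  proj :: "'z \<Rightarrow> 'm"
  zero_sec :: "'m \<Rightarrow> 'z"
  trivs :: "('m set \<times> ('z \<Rightarrow> (real ^ 'n) set)) set"

definition over :: "('m, 'z, 'n::finite) torus_data \<Rightarrow> 'm set \<Rightarrow> 'z set" where
  "over T U = {z \<in> carrier (total T). proj T z \<in> U}"

text \<open>A bundle of tori with structure group \<open>GL(n, \<int>)\<close> (a discrete group, so transition functions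
  are locally constant) and its zero section.\<close>

definition torus_bundle :: "('m, 'z, 'n::finite) torus_data \<Rightarrow> bool" where
  "torus_bundle T \<longleftrightarrow>
     smooth_manifold (base T) \<and> smooth_manifold (total T) \<and>
     smooth_map (total T) (base T) (proj T) \<and> smooth_map (base T) (total T) (zero_sec T) \<and>
     (\<forall>x\<in>carrier (base T). proj T (zero_sec T x) = x) \<and>
     (\<forall>x\<in>carrier (base T). \<exists>t\<in>trivs T. x \<in> fst t) \<and>
     (\<forall>t\<in>trivs T. mopen (base T) (fst t) \<and>
        diffeo (restrict_atlas (total T) (over T (fst t)))
          (prod_atlas (restrict_atlas (base T) (fst t)) torus_atlas)
          (\<lambda>z. (proj T z, snd t z)) \<and>
        (\<forall>x\<in>fst t. snd t (zero_sec T x) = torus_proj 0)) \<and>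
     (\<forall>t\<in>trivs T. \<forall>t'\<in>trivs T. \<forall>x \<in> fst t \<inter> fst t'. \<exists>N. \<exists>G\<in>GL_int.
        mopen (base T) N \<and> x \<in> N \<and> N \<subseteq> fst t \<inter> fst t' \<and>
        (\<forall>z\<in>over T N. \<forall>a. snd t z = torus_proj a \<longrightarrow> snd t' z = torus_proj (G *v a)))"

text \<open>The point of \<open>Z\<close> over \<open>x\<close> with fibre coordinate \<open>[a]\<close>, and the velocity at \<open>0\<close> of the
  one-parameter subgroup \<open>r \<mapsto> [r a]\<close> of the fibre over \<open>x\<close>.\<close>

definition triv_point ::
  "('m, 'z, 'n::finite) torus_data \<Rightarrow> 'm set \<times> ('z \<Rightarrow> (real ^ 'n) set) \<Rightarrow> 'm \<Rightarrow> real ^ 'n \<Rightarrow> 'z"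
  where
  "triv_point T t x a = inv_into (over T (fst t)) (\<lambda>z. (proj T z, snd t z)) (x, torus_proj a)"

definition fibre_frame ::
  "('m, 'z, 'n::finite) torus_data \<Rightarrow> 'm set \<times> ('z \<Rightarrow> (real ^ 'n) set) \<Rightarrow> 'm \<Rightarrow> real ^ 'n \<Rightarrow>
   ('z, (real ^ 'n) \<times> (real ^ 'n)) tvec" where
  "fibre_frame T t x a = velocity (total T) (\<lambda>r. triv_point T t x (r *\<^sub>R a)) 0"

text \<open>\<open>V = s\<^sup>*T\<^bsub>Z/M\<^esub>\<close>: its fibre at \<open>x\<close> is the kernel of \<open>dp\<close> at \<open>s(x)\<close>, and it is trivialised
  by the local trivialisations of \<open>Z\<close>.\<close>

definition rel_tangent ::
  "('m, 'z, 'n::finite) torus_data \<Rightarrow>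
   ('m, ('z, (real ^ 'n) \<times> (real ^ 'n)) tvec, real ^ 'n) vbundle" where
  "rel_tangent T = \<lparr>
     fibre = (\<lambda>x. {v \<in> tangent_space (total T) (zero_sec T x).
                mdiff (total T) (base T) (proj T) (zero_sec T x) v = 0}),
     btriv = {(fst t, \<lambda>x. inv_into UNIV (fibre_frame T t x)) | t. t \<in> trivs T}\<rparr>"

text \<open>The covering \<open>tot(V) \<rightarrow> Z\<close>, fibrewise the exponential map of the torus, and the lattices
  \<open>\<Lambda>\<^sub>x \<subset> V\<^sub>x\<close> with \<open>Z = tot(V)/\<Lambda>\<close>.  In the trivialisations of \<open>V\<close>, \<open>\<Lambda>\<^sub>x\<close> is \<open>\<int>\<^sup>n\<close>, so that
  \<open>flat_conn (base T) (rel_tangent T)\<close> is the connection for which local sections of \<open>\<Lambda>\<close> are flat.\<close>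

definition expo ::
  "('m, 'z, 'n::finite) torus_data \<Rightarrow> 'm \<times> ('z, (real ^ 'n) \<times> (real ^ 'n)) tvec \<Rightarrow> 'z" where
  "expo T = (\<lambda>(x, v). let t = (SOME t. t \<in> trivs T \<and> x \<in> fst t)
     in triv_point T t x (inv_into UNIV (fibre_frame T t x) v))"

definition lattice ::
  "('m, 'z, 'n::finite) torus_data \<Rightarrow> 'm \<Rightarrow> ('z, (real ^ 'n) \<times> (real ^ 'n)) tvec set" where
  "lattice T x = {v \<in> fibre (rel_tangent T) x. expo T (x, v) = zero_sec T x}"

definition dual_lattice ::
  "('m, 'z, 'n::finite) torus_data \<Rightarrow> 'm \<Rightarrow> (('z, (real ^ 'n) \<times> (real ^ 'n)) tvec \<Rightarrow> real) set"
  where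
  "dual_lattice T x =
     {f \<in> dual_space (fibre (rel_tangent T) x). \<forall>v\<in>lattice T x. f v \<in> \<int>}"

text \<open>The quotient map \<open>tot(V\<^sup>\<or>) \<rightarrow> tot(V\<^sup>\<or>)/\<Lambda>\<^sup>\<or>\<close>; a point of the dual bundle is a base point
  together with a coset.\<close>

definition dual_quot ::
  "('m, 'z, 'n::finite) torus_data \<Rightarrow>
   'm \<times> (('z, (real ^ 'n) \<times> (real ^ 'n)) tvec \<Rightarrow> real) \<Rightarrow>
   'm \<times> (('z, (real ^ 'n) \<times> (real ^ 'n)) tvec \<Rightarrow> real) set" where
  "dual_quot T = (\<lambda>(x, f).
     (x, {g \<in> dual_space (fibre (rel_tangent T) x). g - f \<in> dual_lattice T x}))"

text \<open>What the construction of the splitting uses: a torus bundle \<open>p : Z \<rightarrow> M\<close> presented as the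
  quotient of \<open>tot(B)\<close> by a lattice bundle that is flat for the given connection on \<open>B\<close>.\<close>

record ('m, 'e, 'v, 'f, 'z) torus_pres =
  pbase :: "('m, 'e) atlas"
  ptotal :: "('z, 'e \<times> 'f) atlas"
  pproj :: "'z \<Rightarrow> 'm"
  pbundle :: "('m, 'v, 'f) vbundle"
  pconn :: "('m, 'e, 'v) conn"
  pquot :: "'m \<times> 'v \<Rightarrow> 'z"

definition pres :: "('m, 'z, 'n::finite) torus_data \<Rightarrow>
  ('m, real ^ 'n, ('z, (real ^ 'n) \<times> (real ^ 'n)) tvec, real ^ 'n, 'z) torus_pres" where
  "pres T = \<lparr>pbase = base T, ptotal = total T, pproj = proj T, pbundle = rel_tangent T,
     pconn = flat_conn (base T) (rel_tangent T), pquot = expo T\<rparr>"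

definition dual_pres :: "('m, 'z, 'n::finite) torus_data \<Rightarrow>
  ('m, real ^ 'n, ('z, (real ^ 'n) \<times> (real ^ 'n)) tvec \<Rightarrow> real, real ^ 'n,
   'm \<times> (('z, (real ^ 'n) \<times> (real ^ 'n)) tvec \<Rightarrow> real) set) torus_pres" where
  "dual_pres T = \<lparr>pbase = base T,
     ptotal = quotient_atlas (tot_atlas (base T) (dual_bundle (rel_tangent T))) (dual_quot T),
     pproj = fst, pbundle = dual_bundle (rel_tangent T),
     pconn = dual_conn (base T) (rel_tangent T) (flat_conn (base T) (rel_tangent T)),
     pquot = dual_quot T\<rparr>"

section \<open>Semi-flat structures and mirrors\<close>

text \<open>\<open>D = (\<pi>\<^sup>*\<nabla>)(S)\<close> on \<open>tot(B)\<close>, where \<open>S(x, v) = v\<close> is the tautological section, and the map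
  to which it descends on the quotient \<open>Z\<close>.\<close>

definition split_tot ::
  "('m, 'e::euclidean_space, 'v::real_vector, 'f::euclidean_space, 'z) torus_pres \<Rightarrow>
   'm \<times> 'v \<Rightarrow> ('m \<times> 'v, 'e \<times> 'f) tvec \<Rightarrow> 'v" where
  "split_tot P y w = pull_conn (tot_atlas (pbase P) (pbundle P)) (pbase P) fst
     (pbundle P) (pconn P) y w snd"

definition split_D ::
  "('m, 'e::euclidean_space, 'v::real_vector, 'f::euclidean_space, 'z) torus_pres \<Rightarrow>
   'z \<Rightarrow> ('z, 'e \<times> 'f) tvec \<Rightarrow> 'v" where
  "split_D P z w = (THE u. \<exists>y \<in> carrier (tot_atlas (pbase P) (pbundle P)).
     \<exists>w' \<in> tangent_space (tot_atlas (pbase P) (pbundle P)) y.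
       pquot P y = z \<and> mdiff (tot_atlas (pbase P) (pbundle P)) (ptotal P) (pquot P) y w' = w \<and>
       u = split_tot P y w')"

text \<open>\<open>j : p\<^sup>*B \<rightarrow> T\<^sub>Z\<close> is induced by the inclusion of vertical vectors \<open>\<pi>\<^sup>*B \<rightarrow> T\<^bsub>tot(B)\<^esub>\<close>;
  \<open>r \<mapsto> q(x, v + r u)\<close> is the translate of \<open>r \<mapsto> q(x, r u)\<close> by the point \<open>z = q(x, v)\<close>.\<close>

definition vert_j ::
  "('m, 'e::euclidean_space, 'v::real_vector, 'f::euclidean_space, 'z) torus_pres \<Rightarrow>
   'z \<Rightarrow> 'v \<Rightarrow> ('z, 'e \<times> 'f) tvec" where
  "vert_j P z u =
     (let v = (SOME v. v \<in> fibre (pbundle P) (pproj P z) \<and> pquot P (pproj P z, v) = z)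
      in velocity (ptotal P) (\<lambda>r. pquot P (pproj P z, v + r *\<^sub>R u)) 0)"

definition hor_alpha ::
  "('m, 'e::euclidean_space, 'v::real_vector, 'f::euclidean_space, 'z) torus_pres \<Rightarrow>
   'z \<Rightarrow> ('m, 'e) tvec \<Rightarrow> ('z, 'e \<times> 'f) tvec" where
  "hor_alpha P z t = (THE w. w \<in> tangent_space (ptotal P) z \<and>
     mdiff (ptotal P) (pbase P) (pproj P) z w = t \<and> split_D P z w = 0)"

text \<open>The identification of \<open>S\<^sup>\<or> \<oplus> R\<^sup>\<or>\<close> with \<open>(S \<oplus> R)\<^sup>\<or>\<close>.  Accordingly
  \<open>B \<oplus> T\<^sub>M \<oplus> B\<^sup>\<or> \<oplus> T\<^sub>M\<^sup>\<or>\<close> is rendered as \<open>gen_bundle (bsum B T\<^sub>M)\<close>.\<close>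

definition copair ::
  "'v set \<Rightarrow> 'w set \<Rightarrow> ('v \<Rightarrow> real) \<Rightarrow> ('w \<Rightarrow> real) \<Rightarrow> 'v \<times> 'w \<Rightarrow> real" where
  "copair S R f g = restr (S \<times> R) (\<lambda>(u, t). f u + g t)"

definition base_sum ::
  "('m, 'e::euclidean_space, 'v::real_vector, 'f::euclidean_space, 'z) torus_pres \<Rightarrow>
   ('m, 'v \<times> ('m, 'e) tvec, 'f \<times> 'e) vbundle" where
  "base_sum P = bsum (pbundle P) (tbundle (pbase P))"

definition iso_F ::
  "('m, 'e::euclidean_space, 'v::real_vector, 'f::euclidean_space, 'z) torus_pres \<Rightarrow>
   'z \<Rightarrow> ('z, 'e \<times> 'f) tvec gen \<Rightarrow> ('v \<times> ('m, 'e) tvec) gen" where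
  "iso_F P z = (\<lambda>(w, \<xi>).
     ((split_D P z w, mdiff (ptotal P) (pbase P) (pproj P) z w),
      copair (fibre (pbundle P) (pproj P z)) (tangent_space (pbase P) (pproj P z))
        (\<lambda>u. \<xi> (vert_j P z u)) (\<lambda>t. \<xi> (hor_alpha P z t))))"

text \<open>The inclusions of \<open>B \<oplus> B\<^sup>\<or>\<close> and \<open>T\<^sub>M \<oplus> T\<^sub>M\<^sup>\<or>\<close>.\<close>

definition incl_V ::
  "('m, 'e::euclidean_space, 'v::real_vector, 'f::euclidean_space, 'z) torus_pres \<Rightarrow>
   'm \<Rightarrow> 'v gen \<Rightarrow> ('v \<times> ('m, 'e) tvec) gen" where
  "incl_V P x = (\<lambda>(v, f).
     ((v, 0), copair (fibre (pbundle P) x) (tangent_space (pbase P) x) f (\<lambda>_. 0)))"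

definition incl_T ::
  "('m, 'e::euclidean_space, 'v::real_vector, 'f::euclidean_space, 'z) torus_pres \<Rightarrow>
   'm \<Rightarrow> ('m, 'e) tvec gen \<Rightarrow> ('v \<times> ('m, 'e) tvec) gen" where
  "incl_T P x = (\<lambda>(t, g).
     ((0, t), copair (fibre (pbundle P) x) (tangent_space (pbase P) x) (\<lambda>_. 0) g))"

type_synonym ('m, 'e, 'v) base_str =
  "'m \<Rightarrow> ('v \<times> ('m, 'e) tvec) gen \<Rightarrow> ('v \<times> ('m, 'e) tvec) gen"

definition adapted ::
  "('m, 'e::euclidean_space, 'v::real_vector, 'f::euclidean_space, 'z) torus_pres \<Rightarrow>
   ('m, 'e, 'v) base_str \<Rightarrow> bool" where
  "adapted P K \<longleftrightarrow> (\<forall>x\<in>carrier (pbase P).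
     K x ` incl_V P x ` fibre (gen_bundle (pbundle P)) x
       = incl_T P x ` fibre (gen_bundle (tbundle (pbase P))) x)"

text \<open>\<open>F\<^sup>-\<^sup>1 (p\<^sup>*K) F\<close>\<close>

definition induced_str ::
  "('m, 'e::euclidean_space, 'v::real_vector, 'f::euclidean_space, 'z) torus_pres \<Rightarrow>
   ('m, 'e, 'v) base_str \<Rightarrow> 'z \<Rightarrow> ('z, 'e \<times> 'f) tvec gen \<Rightarrow> ('z, 'e \<times> 'f) tvec gen" where
  "induced_str P K z u = inv_into (fibre (gen_bundle (tbundle (ptotal P))) z) (iso_F P z)
     (K (pproj P z) (iso_F P z u))"

text \<open>\<open>J\<close> is a semi-flat generalized almost complex structure arising from \<open>K\<close>.\<close>

definition semi_flat ::
  "('m, 'e::euclidean_space, 'v::real_vector, 'f::euclidean_space, 'z) torus_pres \<Rightarrow>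
   ('z \<Rightarrow> ('z, 'e \<times> 'f) tvec gen \<Rightarrow> ('z, 'e \<times> 'f) tvec gen) \<Rightarrow>
   ('m, 'e, 'v) base_str \<Rightarrow> bool" where
  "semi_flat P J K \<longleftrightarrow>
     gacs (ptotal P) (tbundle (ptotal P)) J \<and>
     gacs (pbase P) (base_sum P) K \<and> adapted P K \<and>
     (\<forall>z\<in>carrier (ptotal P). \<forall>u\<in>fibre (gen_bundle (tbundle (ptotal P))) z.
        J z u = induced_str P K z u)"

text \<open>The pair \<open>K(B)\<close> and \<open>K(B\<^sup>\<or>)\<close>, as subsets of \<open>T\<^sub>M \<oplus> T\<^sub>M\<^sup>\<or>\<close>, and the isomorphisms from \<open>B\<close>
  and \<open>B\<^sup>\<or>\<close> onto them given by \<open>K\<close>.\<close>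

definition Delta ::
  "('m, 'e::euclidean_space, 'v::real_vector, 'f::euclidean_space, 'z) torus_pres \<Rightarrow>
   ('m, 'e, 'v) base_str \<Rightarrow> 'm \<Rightarrow> ('m, 'e) tvec gen set" where
  "Delta P K x = {y \<in> fibre (gen_bundle (tbundle (pbase P))) x.
     incl_T P x y \<in> K x ` incl_V P x ` (fibre (pbundle P) x \<times> {0})}"

definition Delta_hat ::
  "('m, 'e::euclidean_space, 'v::real_vector, 'f::euclidean_space, 'z) torus_pres \<Rightarrow>
   ('m, 'e, 'v) base_str \<Rightarrow> 'm \<Rightarrow> ('m, 'e) tvec gen set" where
  "Delta_hat P K x = {y \<in> fibre (gen_bundle (tbundle (pbase P))) x.
     incl_T P x y \<in> K x ` incl_V P x ` ({0} \<times> fibre (dual_bundle (pbundle P)) x)}"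

definition to_Delta ::
  "('m, 'e::euclidean_space, 'v::real_vector, 'f::euclidean_space, 'z) torus_pres \<Rightarrow>
   ('m, 'e, 'v) base_str \<Rightarrow> 'm \<Rightarrow> 'v \<Rightarrow> ('m, 'e) tvec gen" where
  "to_Delta P K x v = inv_into (fibre (gen_bundle (tbundle (pbase P))) x) (incl_T P x)
     (K x (incl_V P x (v, 0)))"

definition to_Delta_hat ::
  "('m, 'e::euclidean_space, 'v::real_vector, 'f::euclidean_space, 'z) torus_pres \<Rightarrow>
   ('m, 'e, 'v) base_str \<Rightarrow> 'm \<Rightarrow> ('v \<Rightarrow> real) \<Rightarrow> ('m, 'e) tvec gen" where
  "to_Delta_hat P K x f = inv_into (fibre (gen_bundle (tbundle (pbase P))) x) (incl_T P x)
     (K x (incl_V P x (0, f)))"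

definition conn_Delta ::
  "('m, 'e::euclidean_space, 'v::real_vector, 'f::euclidean_space, 'z) torus_pres \<Rightarrow>
   ('m, 'e, 'v) base_str \<Rightarrow> ('m, 'e, ('m, 'e) tvec gen) conn" where
  "conn_Delta P K = transport_conn (pbundle P) (to_Delta P K) (pconn P)"

definition conn_Delta_hat ::
  "('m, 'e::euclidean_space, 'v::real_vector, 'f::euclidean_space, 'z) torus_pres \<Rightarrow>
   ('m, 'e, 'v) base_str \<Rightarrow> ('m, 'e, ('m, 'e) tvec gen) conn" where
  "conn_Delta_hat P K = transport_conn (dual_bundle (pbundle P)) (to_Delta_hat P K)
     (dual_conn (pbase P) (pbundle P) (pconn P))"

text \<open>\<open>\<tau>\<close> interchanges \<open>B\<close> and \<open>B\<^sup>\<or>\<close>: it sends \<open>((v, t), f \<oplus> g)\<close> to \<open>((f, t), ev\<^sub>v \<oplus> g)\<close>, where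
  \<open>B\<close> is identified with its double dual by evaluation.\<close>

definition tau_swap ::
  "('m, 'e::euclidean_space, 'v::real_vector, 'f::euclidean_space, 'z) torus_pres \<Rightarrow>
   'm \<Rightarrow> ('v \<times> ('m, 'e) tvec) gen \<Rightarrow> (('v \<Rightarrow> real) \<times> ('m, 'e) tvec) gen" where
  "tau_swap P x = (\<lambda>((v, t), h).
     ((restr (fibre (pbundle P) x) (\<lambda>u. h (u, 0)), t),
      copair (fibre (dual_bundle (pbundle P)) x) (tangent_space (pbase P) x)
        (\<lambda>f. f v) (\<lambda>r. h (0, r))))"

definition mirror_base ::
  "('m, 'e::euclidean_space, 'v::real_vector, 'f::euclidean_space, 'z) torus_pres \<Rightarrow>
   ('m, 'e, 'v) base_str \<Rightarrow> ('m, 'e, 'v \<Rightarrow> real) base_str" where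
  "mirror_base P K x u =
     tau_swap P x (K x (inv_into (fibre (gen_bundle (base_sum P)) x) (tau_swap P x) u))"

end

theory Submission
  imports Defs
begin

text \<open>In product charts of \<open>Z\<close> coming from flat trivialisations of \<open>V\<close>, the isomorphism \<open>F\<close> is the
  identity, so a section over \<open>M\<close> lifts to a section over \<open>Z\<close> whose coefficients do not depend on
  the fibre coordinates.  Let \<open>\<sigma>\<close> and \<open>\<tau>\<close> be sections of \<open>\<Delta> = K(V)\<close>, say \<open>\<sigma> = K a\<close> and \<open>\<tau> = K b\<close>
  with sections \<open>a\<close>, \<open>b\<close> of \<open>V\<close>.  The lifts of \<open>\<sigma> + \<i> a\<close> and \<open>\<tau> + \<i> b\<close> lie in the \<open>+\<i>\<close>-eigenbundle of
  \<open>J\<close>.  Since vertical sections that are constant along the fibres commute, their bracket has real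
  part the lift of \<open>[\<sigma>, \<tau>]\<close>, and its imaginary part \<open>[\<sigma>, b] + [a, \<tau>]\<close> lies in \<open>V\<close> again.  If \<open>J\<close> is
  integrable, then \<open>[\<sigma>, \<tau>]\<close> is \<open>K\<close> of that imaginary part, hence in \<open>\<Delta>\<close>.  The same works for
  \<open>V\<^sup>\<or>\<close> in place of \<open>V\<close>.

  \<open>\<Delta>\<close> is isotropic because \<open>K\<close> is orthogonal, and maximal because an element \<open>K(v + f)\<close> orthogonal to
  all of \<open>K(V)\<close> has \<open>f = 0\<close>.  As the mirror interchanges \<open>V\<close> and \<open>V\<^sup>\<or>\<close> and fixes \<open>T\<^sub>M \<oplus> T\<^sub>M\<^sup>\<or>\<close>, the
  first Dirac structure of the mirror is the second one of \<open>K\<close>, which reduces the statements about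
  \<open>K(V\<^sup>\<or>)\<close> to those about \<open>K(V)\<close>.\<close>

section \<open>Calculus of smooth maps\<close>

text \<open>A tangent vector is a family indexed by the charts of the given atlas, while the product
  charts of \<open>Z\<close> need only be compatible with that atlas. Every coordinate formula, up
  to the one for the Courant bracket, is therefore proved in an arbitrary compatible chart. The
  mirror settles the almost Dirac property and the connection for the dual of V, but not
  integrability: that the mirror of an integrable structure is integrable would be a theorem of its
  own. So the bracket is computed for lifts of sections v + f of the sum of V and its dual, assuming
  that all f vanish or that all v vanish. For mixed sections the bracket of two vertical lifts
  contains horizontal covectors such as the product of f1 with the derivative of v2, and the real
  part would no longer be the lift of [\<sigma>, \<tau>]. \<open>Z\<close> has an atlas of its own,
  whereas the dual torus bundle is a quotient of a total space. Both become instances of one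
  interface, so the mirror being semi-flat is a second instance and not a second
  computation.\<close>

lemma Ck_on_cong:
  assumes "open S" "\<And>x. x \<in> S \<Longrightarrow> f x = g x" "Ck_on k S f"
  shows "Ck_on k S g"
proof (cases k)
  case 0
  then show ?thesis using assms continuous_on_cong by fastforce
next
  case (Suc l)
  then obtain f' where f': "\<forall>x\<in>S. (f has_derivative f' x) (at x)" "\<forall>v. Ck_on l S (\<lambda>x. f' x v)"
    using assms(3) by auto
  have "\<forall>x\<in>S. (g has_derivative f' x) (at x)"
    using f'(1) has_derivative_transform_within_open[OF _ assms(1)] assms(2) by metis
  then show ?thesis using f'(2) Suc by auto
qed

lemma frechet_derivative_eq:
  "(f has_derivative f') (at x) \<Longrightarrow> frechet_derivative f (at x) v = f' v"
  by (metis frechet_derivative_at)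

text \<open>Derivatives are unique, so \<open>frechet_derivative\<close> can stand for the
  existentially quantified one. A witness that does not depend on the set is what makes the notion
  local in \<open>Ck_on_local\<close>.\<close>

lemma Ck_on_Suc_iff:
  assumes "open S"
  shows "Ck_on (Suc k) S f \<longleftrightarrow>
    (\<forall>x\<in>S. f differentiable (at x)) \<and> (\<forall>v. Ck_on k S (\<lambda>x. frechet_derivative f (at x) v))"
proof
  assume "Ck_on (Suc k) S f"
  then obtain f' where f': "\<forall>x\<in>S. (f has_derivative f' x) (at x)" "\<forall>v. Ck_on k S (\<lambda>x. f' x v)"
    by auto
  have "Ck_on k S (\<lambda>x. frechet_derivative f (at x) v)" for v
    by (rule Ck_on_cong[OF assms _ f'(2)[rule_format, of v]])
      (use f'(1) frechet_derivative_eq in force)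
  then show "(\<forall>x\<in>S. f differentiable (at x)) \<and> (\<forall>v. Ck_on k S (\<lambda>x. frechet_derivative f (at x) v))"
    using f' differentiable_def by blast
next
  assume *: "(\<forall>x\<in>S. f differentiable (at x)) \<and> (\<forall>v. Ck_on k S (\<lambda>x. frechet_derivative f (at x) v))"
  show "Ck_on (Suc k) S f"
    using * frechet_derivative_works by (auto intro!: exI[of _ "\<lambda>x. frechet_derivative f (at x)"])
qed

lemma Ck_on_Suc_imp: "open S \<Longrightarrow> Ck_on (Suc k) S f \<Longrightarrow> Ck_on k S f"
proof (induction k arbitrary: f)
  case 0
  then show ?case
    by (auto intro!: continuous_at_imp_continuous_on dest: has_derivative_continuous)
next
  case (Suc k)
  then show ?case by (metis Ck_on_Suc_iff)
qed

lemma Ck_on_subset: "Ck_on k S f \<Longrightarrow> R \<subseteq> S \<Longrightarrow> Ck_on k R f"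
proof (induction k arbitrary: f)
  case 0
  then show ?case using continuous_on_subset by auto
next
  case (Suc k)
  then show ?case by (auto, blast)
qed

lemma Ck_on_local:
  assumes "open S" "\<And>x. x \<in> S \<Longrightarrow> \<exists>U. open U \<and> x \<in> U \<and> Ck_on k U f"
  shows "Ck_on k S f"
  using assms(2)
proof (induction k arbitrary: f)
  case 0
  have "continuous (at x) f" if "x \<in> S" for x
    using 0[OF that] continuous_on_eq_continuous_at by auto
  then show ?case by (auto intro!: continuous_at_imp_continuous_on)
next
  case (Suc k)
  have "f differentiable (at x)" if "x \<in> S" for x
    using Suc.prems[OF that] by (auto simp: differentiable_def)
  moreover have "Ck_on k S (\<lambda>x. frechet_derivative f (at x) v)" for v
    by (rule Suc.IH) (metis Suc.prems Ck_on_Suc_iff)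
  ultimately show ?case by (simp add: Ck_on_Suc_iff[OF assms(1)] del: Ck_on.simps)
qed

lemma Ck_on_const: "Ck_on k S (\<lambda>x. c)"
proof (induction k arbitrary: c)
  case (Suc k)
  then show ?case by (auto intro!: exI[of _ "\<lambda>x v. 0"])
qed auto

lemma Ck_on_add: "Ck_on k S f \<Longrightarrow> Ck_on k S g \<Longrightarrow> Ck_on k S (\<lambda>x. f x + g x)"
proof (induction k arbitrary: f g)
  case 0
  then show ?case by (auto intro: continuous_intros)
next
  case (Suc k)
  then obtain f' g' where "\<forall>x\<in>S. (f has_derivative f' x) (at x)" "\<forall>v. Ck_on k S (\<lambda>x. f' x v)"
    "\<forall>x\<in>S. (g has_derivative g' x) (at x)" "\<forall>v. Ck_on k S (\<lambda>x. g' x v)"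
    by auto
  then show ?case
    using Suc.IH by (auto intro!: exI[of _ "\<lambda>x v. f' x v + g' x v"] derivative_intros)
qed

lemma Ck_on_bounded_linear:
  assumes "bounded_linear h"
  shows "Ck_on k S f \<Longrightarrow> Ck_on k S (\<lambda>x. h (f x))"
proof (induction k arbitrary: f)
  case 0
  then show ?case using bounded_linear.continuous_on[OF assms] by auto
next
  case (Suc k)
  then obtain f' where "\<forall>x\<in>S. (f has_derivative f' x) (at x)" "\<forall>v. Ck_on k S (\<lambda>x. f' x v)"
    by auto
  then show ?case
    using Suc.IH
    by (auto intro!: exI[of _ "\<lambda>x v. h (f' x v)"] bounded_linear.has_derivative[OF assms])
qed

lemma Ck_on_bilinear:
  assumes "bounded_bilinear h" "open S"
  shows "Ck_on k S f \<Longrightarrow> Ck_on k S g \<Longrightarrow> Ck_on k S (\<lambda>x. h (f x) (g x))"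
proof (induction k arbitrary: f g)
  case 0
  then show ?case using bounded_bilinear.continuous_on[OF assms(1)] by auto
next
  case (Suc k)
  then obtain f' g' where *: "\<forall>x\<in>S. (f has_derivative f' x) (at x)" "\<forall>v. Ck_on k S (\<lambda>x. f' x v)"
    "\<forall>x\<in>S. (g has_derivative g' x) (at x)" "\<forall>v. Ck_on k S (\<lambda>x. g' x v)"
    by auto
  have "Ck_on k S f" "Ck_on k S g"
    using Suc.prems Ck_on_Suc_imp assms(2) by blast+
  then show ?case
    using * Suc.IH
    by (auto intro!: exI[of _ "\<lambda>x v. h (f x) (g' x v) + h (f' x v) (g x)"]
        bounded_bilinear.FDERIV[OF assms(1)] Ck_on_add)
qed

lemma Ck_on_sum:
  "(\<And>i. i \<in> I \<Longrightarrow> Ck_on k S (f i)) \<Longrightarrow> Ck_on k S (\<lambda>x. \<Sum>i\<in>I. f i x)"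
  by (induction I rule: infinite_finite_induct) (auto intro: Ck_on_const Ck_on_add)

lemma linear_euclidean_expand:
  fixes h :: "'a::euclidean_space \<Rightarrow> 'b::real_vector"
  assumes "linear h"
  shows "h v = (\<Sum>b\<in>Basis. (v \<bullet> b) *\<^sub>R h b)"
proof -
  have "h v = h (\<Sum>b\<in>Basis. (v \<bullet> b) *\<^sub>R b)" by (simp add: euclidean_representation)
  also have "\<dots> = (\<Sum>b\<in>Basis. (v \<bullet> b) *\<^sub>R h b)"
    by (simp add: linear_sum[OF assms] linear_scale[OF assms])
  finally show ?thesis .
qed

text \<open>Only derivatives in a fixed direction are known to be C^k, but the chain rule
  differentiates \<open>g\<close> in the moving direction \<open>f' x v\<close>. Expanding that
  direction in the basis of the middle space turns the derivative into a sum of products covered by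
  the induction hypothesis.\<close>

lemma Ck_on_compose:
  fixes g :: "'b::euclidean_space \<Rightarrow> 'c::real_normed_vector"
  assumes "open S" "open R"
  shows "f ` S \<subseteq> R \<Longrightarrow> Ck_on k S f \<Longrightarrow> Ck_on k R g \<Longrightarrow> Ck_on k S (\<lambda>x. g (f x))"
proof (induction k arbitrary: f g)
  case 0
  then show ?case using continuous_on_compose2 by auto
next
  case (Suc k)
  then obtain f' g' where *: "\<forall>x\<in>S. (f has_derivative f' x) (at x)" "\<forall>v. Ck_on k S (\<lambda>x. f' x v)"
    "\<forall>x\<in>R. (g has_derivative g' x) (at x)" "\<forall>v. Ck_on k R (\<lambda>x. g' x v)"
    by auto
  have f: "Ck_on k S f" using Suc.prems Ck_on_Suc_imp assms(1) by blast
  have "((\<lambda>x. g (f x)) has_derivative (\<lambda>v. g' (f x) (f' x v))) (at x)" if "x \<in> S" for x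
    using * that Suc.prems(1) by (intro has_derivative_compose[of f "f' x" x UNIV g]) auto
  moreover have "Ck_on k S (\<lambda>x. g' (f x) (f' x v))" for v
  proof (rule Ck_on_cong[OF assms(1)])
    show "Ck_on k S (\<lambda>x. \<Sum>b\<in>Basis. (f' x v \<bullet> b) *\<^sub>R g' (f x) b)"
      by (intro Ck_on_sum Ck_on_bilinear[OF bounded_bilinear_scaleR assms(1)]
          Ck_on_bounded_linear[OF bounded_linear_inner_left] Suc.IH f Suc.prems(1))
        (use * in auto)
    show "(\<Sum>b\<in>Basis. (f' x v \<bullet> b) *\<^sub>R g' (f x) b) = g' (f x) (f' x v)" if "x \<in> S" for x
    proof -
      have "linear (g' (f x))"
        using * that Suc.prems(1) has_derivative_bounded_linear bounded_linear.linear
        by (metis image_subset_iff)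
      then show ?thesis using linear_euclidean_expand[of "g' (f x)" "f' x v"] by simp
    qed
  qed
  ultimately show ?case by (auto intro!: exI[of _ "\<lambda>x v. g' (f x) (f' x v)"])
qed

lemma smooth_on_cong:
  "open S \<Longrightarrow> (\<And>x. x \<in> S \<Longrightarrow> f x = g x) \<Longrightarrow> smooth_on S f \<longleftrightarrow> smooth_on S g"
  unfolding smooth_on_def using Ck_on_cong[of S f g] Ck_on_cong[of S g f] by auto

lemma smooth_on_subset: "smooth_on S f \<Longrightarrow> R \<subseteq> S \<Longrightarrow> smooth_on R f"
  unfolding smooth_on_def by (blast intro: Ck_on_subset)

lemma smooth_on_local:
  "open S \<Longrightarrow> (\<And>x. x \<in> S \<Longrightarrow> \<exists>U. open U \<and> x \<in> U \<and> smooth_on U f) \<Longrightarrow> smooth_on S f"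
  unfolding smooth_on_def by (meson Ck_on_local)

lemma smooth_on_const: "smooth_on S (\<lambda>x. c)"
  by (simp add: smooth_on_def Ck_on_const)

lemma smooth_on_add: "smooth_on S f \<Longrightarrow> smooth_on S g \<Longrightarrow> smooth_on S (\<lambda>x. f x + g x)"
  by (simp add: smooth_on_def Ck_on_add)

lemma smooth_on_bounded_linear:
  "bounded_linear h \<Longrightarrow> smooth_on S f \<Longrightarrow> smooth_on S (\<lambda>x. h (f x))"
  by (simp add: smooth_on_def Ck_on_bounded_linear)

lemma smooth_on_bilinear:
  "bounded_bilinear h \<Longrightarrow> open S \<Longrightarrow> smooth_on S f \<Longrightarrow> smooth_on S g \<Longrightarrow>
    smooth_on S (\<lambda>x. h (f x) (g x))"
  by (simp add: smooth_on_def Ck_on_bilinear)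

lemma smooth_on_compose:
  fixes g :: "'b::euclidean_space \<Rightarrow> 'c::real_normed_vector"
  shows "open S \<Longrightarrow> open R \<Longrightarrow> f ` S \<subseteq> R \<Longrightarrow> smooth_on S f \<Longrightarrow> smooth_on R g \<Longrightarrow>
    smooth_on S (\<lambda>x. g (f x))"
  by (simp add: smooth_on_def Ck_on_compose)

lemma smooth_on_id: "smooth_on S (\<lambda>x. x)"
  unfolding smooth_on_def
proof
  fix k show "Ck_on k S (\<lambda>x. x)"
    by (cases k) (auto intro!: exI[of _ "\<lambda>x v. v"] Ck_on_const continuous_intros)
qed

lemma smooth_on_imp_differentiable:
  "open S \<Longrightarrow> smooth_on S f \<Longrightarrow> x \<in> S \<Longrightarrow> f differentiable (at x)"
  unfolding smooth_on_def by (metis Ck_on_Suc_iff)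

lemma smooth_on_imp_continuous_on: "smooth_on S f \<Longrightarrow> continuous_on S f"
  unfolding smooth_on_def using Ck_on.simps(1) by metis

lemma smooth_on_frechet:
  "open S \<Longrightarrow> smooth_on S f \<Longrightarrow> smooth_on S (\<lambda>x. frechet_derivative f (at x) v)"
  unfolding smooth_on_def by (metis Ck_on_Suc_iff)

section \<open>Symmetry of second derivatives\<close>

text \<open>Mean value theorem twice: along \<open>v\<close> for the increment of
  \<open>\<phi>\<close> in direction \<open>w\<close>, then along \<open>w\<close> for the
  derivative that results. The bound on \<open>h\<close> keeps the whole parallelogram inside the
  ball. The left-hand side is symmetric in \<open>v\<close> and \<open>w\<close>, the right-hand
  side is not.\<close>

lemma mixed_difference_mean_value:
  fixes \<phi> :: "'a::real_normed_vector \<Rightarrow> real"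
  assumes h: "h > 0" "h * (norm v + norm w) < \<delta>"
    and d: "\<And>y. y \<in> ball x \<delta> \<Longrightarrow> (\<phi> has_derivative \<phi>' y) (at y)"
    and d2: "\<And>y. y \<in> ball x \<delta> \<Longrightarrow> ((\<lambda>y. \<phi>' y v) has_derivative \<phi>'' y) (at y)"
  shows "\<exists>y\<in>ball x \<delta>. \<phi> (x + h *\<^sub>R v + h *\<^sub>R w) - \<phi> (x + h *\<^sub>R v) - \<phi> (x + h *\<^sub>R w) + \<phi> x
    = h * h * \<phi>'' y w"
proof -
  have in_ball: "x + s *\<^sub>R v + t *\<^sub>R w \<in> ball x \<delta>" if "0 \<le> s" "s \<le> h" "0 \<le> t" "t \<le> h" for s t
  proof -
    have "norm (s *\<^sub>R v + t *\<^sub>R w) \<le> s * norm v + t * norm w"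
      using norm_triangle_ineq[of "s *\<^sub>R v" "t *\<^sub>R w"] that by simp
    also have "\<dots> \<le> h * norm v + h * norm w"
      using that by (intro add_mono mult_right_mono) auto
    finally show ?thesis
      using h(2) norm_minus_cancel[of "s *\<^sub>R v + t *\<^sub>R w"]
      by (simp add: dist_norm algebra_simps)
  qed
  have der: "((\<lambda>s. \<phi> (x + s *\<^sub>R v + t *\<^sub>R w)) has_real_derivative \<phi>' (x + s *\<^sub>R v + t *\<^sub>R w) v) (at s)"
    if "0 \<le> s" "s \<le> h" "0 \<le> t" "t \<le> h" for s t
  proof -
    have "((\<lambda>s. \<phi> (x + s *\<^sub>R v + t *\<^sub>R w)) has_derivative (\<lambda>r. \<phi>' (x + s *\<^sub>R v + t *\<^sub>R w) (r *\<^sub>R v))) (at s)"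
      by (rule has_derivative_compose[of "\<lambda>s. x + s *\<^sub>R v + t *\<^sub>R w" "\<lambda>r. r *\<^sub>R v" s UNIV \<phi>])
        (auto intro!: derivative_eq_intros d[OF in_ball[OF that]])
    moreover have "\<phi>' (x + s *\<^sub>R v + t *\<^sub>R w) (r *\<^sub>R v) = \<phi>' (x + s *\<^sub>R v + t *\<^sub>R w) v * r" for r
      using has_derivative_bounded_linear[OF d[OF in_ball[OF that]]]
      by (simp add: bounded_linear.linear linear_scale)
    ultimately show ?thesis by (simp add: has_field_derivative_def)
  qed
  have der2: "((\<lambda>t. \<phi>' (x + s *\<^sub>R v + t *\<^sub>R w) v) has_real_derivative \<phi>'' (x + s *\<^sub>R v + t *\<^sub>R w) w) (at t)"
    if "0 \<le> s" "s \<le> h" "0 \<le> t" "t \<le> h" for s t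
  proof -
    have "((\<lambda>t. \<phi>' (x + s *\<^sub>R v + t *\<^sub>R w) v) has_derivative (\<lambda>r. \<phi>'' (x + s *\<^sub>R v + t *\<^sub>R w) (r *\<^sub>R w))) (at t)"
      by (rule has_derivative_compose[of "\<lambda>t. x + s *\<^sub>R v + t *\<^sub>R w" "\<lambda>r. r *\<^sub>R w" t UNIV "\<lambda>y. \<phi>' y v"])
        (auto intro!: derivative_eq_intros d2[OF in_ball[OF that]])
    moreover have "\<phi>'' (x + s *\<^sub>R v + t *\<^sub>R w) (r *\<^sub>R w) = \<phi>'' (x + s *\<^sub>R v + t *\<^sub>R w) w * r" for r
      using has_derivative_bounded_linear[OF d2[OF in_ball[OF that]]]
      by (simp add: bounded_linear.linear linear_scale)
    ultimately show ?thesis by (simp add: has_field_derivative_def)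
  qed
  have dd: "((\<lambda>s. \<phi> (x + s *\<^sub>R v + h *\<^sub>R w) - \<phi> (x + s *\<^sub>R v + 0 *\<^sub>R w)) has_real_derivative
      \<phi>' (x + s *\<^sub>R v + h *\<^sub>R w) v - \<phi>' (x + s *\<^sub>R v + 0 *\<^sub>R w) v) (at s)" if "0 \<le> s" "s \<le> h" for s
    by (rule DERIV_diff) (use that h(1) der[of s h] der[of s 0] in auto)
  obtain s where s: "0 < s" "s < h"
    "(\<phi> (x + h *\<^sub>R v + h *\<^sub>R w) - \<phi> (x + h *\<^sub>R v + 0 *\<^sub>R w)) - (\<phi> (x + 0 *\<^sub>R v + h *\<^sub>R w) - \<phi> (x + 0 *\<^sub>R v + 0 *\<^sub>R w))
     = (h - 0) * (\<phi>' (x + s *\<^sub>R v + h *\<^sub>R w) v - \<phi>' (x + s *\<^sub>R v + 0 *\<^sub>R w) v)"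
    using MVT2[of 0 h "\<lambda>s. \<phi> (x + s *\<^sub>R v + h *\<^sub>R w) - \<phi> (x + s *\<^sub>R v + 0 *\<^sub>R w)"
        "\<lambda>s. \<phi>' (x + s *\<^sub>R v + h *\<^sub>R w) v - \<phi>' (x + s *\<^sub>R v + 0 *\<^sub>R w) v", OF h(1) dd]
    by blast
  obtain t where t: "0 < t" "t < h"
    "\<phi>' (x + s *\<^sub>R v + h *\<^sub>R w) v - \<phi>' (x + s *\<^sub>R v + 0 *\<^sub>R w) v = (h - 0) * \<phi>'' (x + s *\<^sub>R v + t *\<^sub>R w) w"
    using MVT2[of 0 h "\<lambda>t. \<phi>' (x + s *\<^sub>R v + t *\<^sub>R w) v" "\<lambda>t. \<phi>'' (x + s *\<^sub>R v + t *\<^sub>R w) w"] h(1) s der2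
    by auto
  have "\<phi> (x + h *\<^sub>R v + h *\<^sub>R w) - \<phi> (x + h *\<^sub>R v) - \<phi> (x + h *\<^sub>R w) + \<phi> x
      = h * h * \<phi>'' (x + s *\<^sub>R v + t *\<^sub>R w) w"
    using s(3) t(3) by simp
  then show ?thesis using in_ball[of s t] s t by auto
qed

text \<open>Both mixed derivatives, each at some point near \<open>x\<close>, equal the same second
  difference divided by \<open>h * h\<close>; their continuity at \<open>x\<close> then forbids a
  gap between them.\<close>

lemma symmetric_second_derivative_real:
  fixes \<phi> :: "'a::real_normed_vector \<Rightarrow> real"
  assumes S: "open S" "x \<in> S" and sm: "smooth_on S \<phi>"
  shows "frechet_derivative (\<lambda>y. frechet_derivative \<phi> (at y) v) (at x) w =
    frechet_derivative (\<lambda>y. frechet_derivative \<phi> (at y) w) (at x) v"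
proof (rule ccontr)
  let ?D = "\<lambda>v y. frechet_derivative \<phi> (at y) v"
  let ?A = "\<lambda>v w y. frechet_derivative (?D v) (at y) w"
  assume ne: "?A v w x \<noteq> ?A w v x"
  \<comment> \<open>Half of the supposed gap: a common value within \<open>e\<close> of both mixed
    derivatives at \<open>x\<close> contradicts the triangle inequality.\<close>
  define e where "e = \<bar>?A v w x - ?A w v x\<bar> / 2"
  have e: "e > 0" using ne by (simp add: e_def)
  have cont: "isCont (?A v w) x" for v w
    using smooth_on_imp_continuous_on[OF smooth_on_frechet[OF S(1) smooth_on_frechet[OF S(1) sm]]]
      S continuous_on_eq_continuous_at by blast
  obtain d1 where d1: "d1 > 0" "\<And>y. dist y x < d1 \<Longrightarrow> dist (?A v w y) (?A v w x) < e"
    using cont[of v w] e unfolding continuous_at_eps_delta by blast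
  obtain d2 where d2: "d2 > 0" "\<And>y. dist y x < d2 \<Longrightarrow> dist (?A w v y) (?A w v x) < e"
    using cont[of w v] e unfolding continuous_at_eps_delta by blast
  obtain d3 where d3: "d3 > 0" "ball x d3 \<subseteq> S" using S open_contains_ball by blast
  define d where "d = min d1 (min d2 d3)"
  have d: "d > 0" "ball x d \<subseteq> S" using d1 d2 d3 by (auto simp: d_def)
  \<comment> \<open>The summand 1 keeps the denominator positive when \<open>v\<close> and
    \<open>w\<close> vanish, and the factor 2 makes the bound in \<open>hd\<close> strict.\<close>
  define h where "h = d / (2 * (norm v + norm w + 1))"
  have pos: "norm v + norm w + 1 > 0" by (simp add: add_nonneg_pos)
  have h: "h > 0" using d pos by (simp add: h_def)
  have hd: "h * (norm v + norm w) < d"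
  proof -
    have "h * (norm v + norm w) \<le> h * (norm v + norm w + 1)" using h by simp
    also have "\<dots> = d / 2" using pos by (simp add: h_def field_simps)
    finally show ?thesis using d by simp
  qed
  have der: "(\<phi> has_derivative frechet_derivative \<phi> (at y)) (at y)" if "y \<in> ball x d" for y
    using smooth_on_imp_differentiable[OF S(1) sm] that d frechet_derivative_works by blast
  have der2: "(?D v has_derivative frechet_derivative (?D v) (at y)) (at y)" if "y \<in> ball x d" for y v
    using smooth_on_imp_differentiable[OF S(1) smooth_on_frechet[OF S(1) sm]] that d
      frechet_derivative_works by blast
  obtain y1 where y1: "y1 \<in> ball x d"
    "\<phi> (x + h *\<^sub>R v + h *\<^sub>R w) - \<phi> (x + h *\<^sub>R v) - \<phi> (x + h *\<^sub>R w) + \<phi> x = h * h * ?A v w y1"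
    using mixed_difference_mean_value[OF h hd der der2] by blast
  obtain y2 where y2: "y2 \<in> ball x d"
    "\<phi> (x + h *\<^sub>R w + h *\<^sub>R v) - \<phi> (x + h *\<^sub>R w) - \<phi> (x + h *\<^sub>R v) + \<phi> x = h * h * ?A w v y2"
    using mixed_difference_mean_value[OF h hd[unfolded add.commute[of "norm v"]] der der2] by blast
  have eq: "?A v w y1 = ?A w v y2"
  proof -
    have "x + h *\<^sub>R w + h *\<^sub>R v = x + h *\<^sub>R v + h *\<^sub>R w" by simp
    note * = y2(2)[unfolded this]
    have "h * h * ?A v w y1 = h * h * ?A w v y2" by (subst y1(2)[symmetric], subst *[symmetric]) simp
    then show ?thesis using h by simp
  qed
  have "dist (?A v w y1) (?A v w x) < e" "dist (?A w v y2) (?A w v x) < e"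
    using d1(2)[of y1] d2(2)[of y2] y1 y2 by (auto simp: d_def dist_commute)
  moreover have False if "\<bar>a - b\<bar> < \<bar>b - d\<bar> / 2" "\<bar>a - d\<bar> < \<bar>b - d\<bar> / 2" for a b d :: real
    using that by (auto simp: abs_if split: if_splits)
  ultimately show False using eq unfolding dist_real_def e_def by metis
qed

lemma frechet_derivative_bounded_linear:
  assumes "bounded_linear h" "f differentiable (at x)"
  shows "frechet_derivative (\<lambda>y. h (f y)) (at x) v = h (frechet_derivative f (at x) v)"
  by (rule frechet_derivative_eq,
      rule bounded_linear.has_derivative[OF assms(1) assms(2)[unfolded frechet_derivative_works]])

lemma symmetric_second_derivative:
  fixes f :: "'a::real_normed_vector \<Rightarrow> 'b::euclidean_space"
  assumes S: "open S" "x \<in> S" and sm: "smooth_on S f"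
  shows "frechet_derivative (\<lambda>y. frechet_derivative f (at y) v) (at x) w =
    frechet_derivative (\<lambda>y. frechet_derivative f (at y) w) (at x) v"
proof (rule euclidean_eqI)
  fix b :: 'b assume "b \<in> Basis"
  have *: "frechet_derivative (\<lambda>y. frechet_derivative (\<lambda>y. f y \<bullet> b) (at y) v) (at x) w =
      frechet_derivative (\<lambda>y. frechet_derivative f (at y) v) (at x) w \<bullet> b" for v w
  proof -
    have d: "(\<lambda>y. frechet_derivative f (at y) v) differentiable (at x)"
      using smooth_on_imp_differentiable[OF S(1) smooth_on_frechet[OF S(1) sm] S(2)] .
    have "frechet_derivative (\<lambda>y. frechet_derivative (\<lambda>y. f y \<bullet> b) (at y) v) (at x) w =
        frechet_derivative (\<lambda>y. frechet_derivative f (at y) v \<bullet> b) (at x) w"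
    proof (rule frechet_derivative_eq)
      show "((\<lambda>y. frechet_derivative (\<lambda>y. f y \<bullet> b) (at y) v) has_derivative
          frechet_derivative (\<lambda>y. frechet_derivative f (at y) v \<bullet> b) (at x)) (at x)"
      proof (rule has_derivative_transform_within_open[OF _ S])
        show "((\<lambda>y. frechet_derivative f (at y) v \<bullet> b) has_derivative
          frechet_derivative (\<lambda>y. frechet_derivative f (at y) v \<bullet> b) (at x)) (at x)"
          using d by (auto simp: frechet_derivative_works[symmetric]
              intro!: differentiable_inner)
        show "frechet_derivative f (at y) v \<bullet> b = frechet_derivative (\<lambda>y. f y \<bullet> b) (at y) v"
          if "y \<in> S" for y
          using frechet_derivative_bounded_linear[OF bounded_linear_inner_left
              smooth_on_imp_differentiable[OF S(1) sm that]] by simp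
      qed
    qed
    then show ?thesis
      using frechet_derivative_bounded_linear[OF bounded_linear_inner_left d] by simp
  qed
  have "smooth_on S (\<lambda>y. f y \<bullet> b)"
    by (rule smooth_on_bounded_linear[OF bounded_linear_inner_left sm])
  then show "frechet_derivative (\<lambda>y. frechet_derivative f (at y) v) (at x) w \<bullet> b =
      frechet_derivative (\<lambda>y. frechet_derivative f (at y) w) (at x) v \<bullet> b"
    using symmetric_second_derivative_real[OF S, of "\<lambda>y. f y \<bullet> b" v w] * by simp
qed

lemma frechet_derivative_chain:
  assumes "f differentiable (at x)" "g differentiable (at (f x))"
  shows "frechet_derivative (\<lambda>y. g (f y)) (at x) v =
    frechet_derivative g (at (f x)) (frechet_derivative f (at x) v)"
  by (rule frechet_derivative_eq,
      rule has_derivative_compose[OF assms(1)[unfolded frechet_derivative_works]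
        assms(2)[unfolded frechet_derivative_works]])

text \<open>No differentiability is assumed: the two functions have the same derivatives at
  \<open>x\<close>, possibly none, so the choice operator in \<open>frechet_derivative\<close>
  returns the same map.\<close>

lemma frechet_derivative_cong_open:
  assumes "open S" "x \<in> S" "\<And>y. y \<in> S \<Longrightarrow> f y = g y"
  shows "frechet_derivative f (at x) = frechet_derivative g (at x)"
proof -
  have "(f has_derivative f') (at x) \<longleftrightarrow> (g has_derivative f') (at x)" for f'
    using has_derivative_transform_within_open[OF _ assms(1,2)] assms(3) by metis
  then show ?thesis by (simp add: frechet_derivative_def)
qed

lemma smooth_on_Pair:
  fixes f :: "'a::real_normed_vector \<Rightarrow> 'b::real_normed_vector"
    and g :: "'a \<Rightarrow> 'c::real_normed_vector"
  assumes "smooth_on S f" "smooth_on S g"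
  shows "smooth_on S (\<lambda>x. (f x, g x))"
proof -
  have "bounded_linear (\<lambda>u::'b. (u, 0::'c))" "bounded_linear (\<lambda>u::'c. (0::'b, u))"
    by (intro bounded_linear_Pair bounded_linear_zero bounded_linear_ident)+
  from smooth_on_add[OF smooth_on_bounded_linear[OF this(1) assms(1)]
      smooth_on_bounded_linear[OF this(2) assms(2)]]
  show ?thesis by simp
qed

section \<open>Charts and smooth functions\<close>

lemma chart_inv_left: "inj_on (snd c) (fst c) \<Longrightarrow> x \<in> fst c \<Longrightarrow> chart_inv c (snd c x) = x"
  by (simp add: chart_inv_def)

lemma chart_inv_right: "y \<in> snd c ` fst c \<Longrightarrow> snd c (chart_inv c y) = y \<and> chart_inv c y \<in> fst c"
  by (simp add: chart_inv_def f_inv_into_f inv_into_into)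

lemma open_vimage_within:
  assumes "continuous_on S f" "open S" "open R"
  shows "open {x \<in> S. f x \<in> R}"
proof -
  have "{x \<in> S. f x \<in> R} = S \<inter> f -` R" by auto
  then show ?thesis using assms continuous_on_open_vimage by (metis Int_commute)
qed

section \<open>Atlases and compatible charts\<close>

text \<open>The part of \<open>smooth_manifold\<close> on which local calculus rests. For total
  spaces of bundles and for lattice quotients exactly this part is established.\<close>

locale satlas =
  fixes A :: "('a, 'e::euclidean_space) atlas"
  assumes chart_inj: "c \<in> A \<Longrightarrow> inj_on (snd c) (fst c)"
    and chart_open: "c \<in> A \<Longrightarrow> open (snd c ` fst c)"
    and overlap_open: "c \<in> A \<Longrightarrow> d \<in> A \<Longrightarrow> open (snd c ` (fst c \<inter> fst d))"
    and overlap_smooth: "c \<in> A \<Longrightarrow> d \<in> A \<Longrightarrow>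
      smooth_on (snd c ` (fst c \<inter> fst d)) (snd d \<circ> chart_inv c)"

lemma smooth_manifold_satlas: "smooth_manifold A \<Longrightarrow> satlas A"
  unfolding smooth_manifold_def satlas_def by simp

text \<open>A chart of the maximal atlas, which need not belong to \<open>A\<close> itself.\<close>

definition mchart :: "('a, 'e::euclidean_space) atlas \<Rightarrow> ('a, 'e) chart \<Rightarrow> bool" where
  "mchart A c \<longleftrightarrow> fst c \<subseteq> carrier A \<and> inj_on (snd c) (fst c) \<and>
     (\<forall>d\<in>A. open (snd c ` (fst c \<inter> fst d)) \<and> open (snd d ` (fst c \<inter> fst d)) \<and>
        smooth_on (snd c ` (fst c \<inter> fst d)) (snd d \<circ> chart_inv c) \<and>
        smooth_on (snd d ` (fst c \<inter> fst d)) (snd c \<circ> chart_inv d))"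

lemma mchart_inj: "mchart A c \<Longrightarrow> inj_on (snd c) (fst c)"
  by (simp add: mchart_def)

lemma mchartD:
  assumes "mchart A c" "d \<in> A"
  shows "open (snd c ` (fst c \<inter> fst d))" "open (snd d ` (fst c \<inter> fst d))"
    "smooth_on (snd c ` (fst c \<inter> fst d)) (snd d \<circ> chart_inv c)"
    "smooth_on (snd d ` (fst c \<inter> fst d)) (snd c \<circ> chart_inv d)"
  using assms by (simp_all add: mchart_def)

lemma mopen_chart: "mopen A U \<Longrightarrow> d \<in> A \<Longrightarrow> open (snd d ` (U \<inter> fst d))"
  by (simp add: mopen_def)

lemma mchart_carrier: "mchart A c \<Longrightarrow> x \<in> fst c \<Longrightarrow> x \<in> carrier A"
  unfolding mchart_def by blast

lemma mchart_inv: "mchart A c \<Longrightarrow> x \<in> fst c \<Longrightarrow> chart_inv c (snd c x) = x"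
  by (simp add: mchart_inj chart_inv_left)

section \<open>Germs of smooth functions\<close>

text \<open>Smoothness over open sets is reduced to germs in \<open>smooth_fun_iff\<close>. From
  then on calculations take place at a point, and \<open>near\<close> collects the finitely many
  conditions that hold on some neighbourhood.\<close>

definition smooth_at :: "('a, 'e::euclidean_space) atlas \<Rightarrow> 'a \<Rightarrow> ('a \<Rightarrow> 'b::real_normed_vector) \<Rightarrow> bool"
  where "smooth_at A x f \<longleftrightarrow> (\<exists>U. mopen A U \<and> x \<in> U \<and> smooth_fun A U f)"

definition near :: "('a, 'e::euclidean_space) atlas \<Rightarrow> 'a \<Rightarrow> ('a \<Rightarrow> bool) \<Rightarrow> bool"
  where "near A x P \<longleftrightarrow> (\<exists>U. mopen A U \<and> x \<in> U \<and> (\<forall>y\<in>U. P y))"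

lemma smooth_fun_subset: "smooth_fun A U f \<Longrightarrow> V \<subseteq> U \<Longrightarrow> smooth_fun A V f"
  unfolding smooth_fun_def by (meson Int_mono image_mono order_refl smooth_on_subset)

lemma carrier_chart: "x \<in> carrier A \<Longrightarrow> \<exists>c\<in>A. x \<in> fst c"
  unfolding carrier_def by (metis UN_E)

lemma chart_at: "x \<in> carrier A \<Longrightarrow> chart_at A x \<in> A \<and> x \<in> fst (chart_at A x)"
  unfolding chart_at_def by (rule someI_ex) (metis carrier_chart)

context satlas
begin

lemma chart_carrier: "c \<in> A \<Longrightarrow> x \<in> fst c \<Longrightarrow> x \<in> carrier A"
  by (auto simp: carrier_def)

lemma chart_mchart: "c \<in> A \<Longrightarrow> mchart A c"
  unfolding mchart_def
proof (intro conjI ballI)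
  fix d assume c: "c \<in> A" and d: "d \<in> A"
  show "open (snd c ` (fst c \<inter> fst d))" "smooth_on (snd c ` (fst c \<inter> fst d)) (snd d \<circ> chart_inv c)"
    using overlap_open overlap_smooth c d by blast+
  show "open (snd d ` (fst c \<inter> fst d))" "smooth_on (snd d ` (fst c \<inter> fst d)) (snd c \<circ> chart_inv d)"
    using overlap_open[OF d c] overlap_smooth[OF d c] by (simp_all add: Int_commute)
qed (use chart_inj chart_carrier in blast)+

lemma mopen_fst: "mchart A c \<Longrightarrow> mopen A (fst c)"
  by (auto simp: mopen_def mchart_def)

lemma mopen_Int: assumes "mopen A U" "mopen A V" shows "mopen A (U \<inter> V)"
proof -
  have "snd c ` (U \<inter> V \<inter> fst c) = snd c ` (U \<inter> fst c) \<inter> snd c ` (V \<inter> fst c)" if "c \<in> A" for c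
    using chart_inj[OF that] unfolding inj_on_def by blast
  then show ?thesis using assms by (auto simp: mopen_def)
qed

lemma mopen_carrier: "mopen A (carrier A)"
proof -
  have "snd c ` (carrier A \<inter> fst c) = snd c ` fst c" if "c \<in> A" for c
    using chart_carrier[OF that] by auto
  then show ?thesis using chart_open by (auto simp: mopen_def)
qed

lemma mopen_subset_carrier: "mopen A U \<Longrightarrow> x \<in> U \<Longrightarrow> x \<in> carrier A"
  by (auto simp: mopen_def)

lemma mopen_Union: assumes "\<And>U. U \<in> \<U> \<Longrightarrow> mopen A U" shows "mopen A (\<Union>\<U>)"
proof -
  have "snd c ` (\<Union>\<U> \<inter> fst c) = (\<Union>U\<in>\<U>. snd c ` (U \<inter> fst c))"
    for c :: "('a, 'e) chart" by auto
  moreover have "open (\<Union>U\<in>\<U>. snd c ` (U \<inter> fst c))" if "c \<in> A" for c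
    using assms that by (intro open_UN ballI) (simp add: mopen_def)
  moreover have "\<Union>\<U> \<subseteq> carrier A" using assms by (simp add: mopen_def Sup_le_iff)
  ultimately show ?thesis unfolding mopen_def by simp
qed

lemma mopen_near: assumes "\<And>x. x \<in> U \<Longrightarrow> near A x (\<lambda>y. y \<in> U)" shows "mopen A U"
proof -
  have "U = \<Union>{V. mopen A V \<and> V \<subseteq> U}"
    using assms unfolding near_def by blast
  also have "mopen A \<dots>" by (rule mopen_Union) auto
  finally show ?thesis .
qed

lemma mopen_preimage:
  assumes "mchart A c" "open S"
  shows "mopen A {x \<in> fst c. snd c x \<in> S}"
  unfolding mopen_def
proof (intro conjI ballI)
  show "{x \<in> fst c. snd c x \<in> S} \<subseteq> carrier A" using assms(1) by (auto simp: mchart_def)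
  fix d assume d: "d \<in> A"
  let ?Q = "snd d ` (fst c \<inter> fst d)"
  have "snd d ` ({x \<in> fst c. snd c x \<in> S} \<inter> fst d) = {y \<in> ?Q. (snd c \<circ> chart_inv d) y \<in> S}"
    using chart_inv_left[OF chart_inj[OF d]] by force
  moreover have "open {y \<in> ?Q. (snd c \<circ> chart_inv d) y \<in> S}"
    by (intro open_vimage_within smooth_on_imp_continuous_on mchartD[OF assms(1) d] assms(2))
  ultimately show "open (snd d ` ({x \<in> fst c. snd c x \<in> S} \<inter> fst d))" by simp
qed

text \<open>\<open>mopen\<close> tests openness in charts of the atlas only. Around each point one
  such chart exists, and continuity of the transition map from \<open>c\<close> carries openness
  over.\<close>

lemma mopen_image:
  assumes c: "mchart A c" and U: "mopen A U"
  shows "open (snd c ` (U \<inter> fst c))"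
proof -
  have "\<exists>R. open R \<and> p \<in> R \<and> R \<subseteq> snd c ` (U \<inter> fst c)" if "p \<in> snd c ` (U \<inter> fst c)" for p
  proof -
    obtain x where x: "x \<in> U" "x \<in> fst c" "p = snd c x" using \<open>p \<in> _\<close> by auto
    obtain d where d: "d \<in> A" "x \<in> fst d" using carrier_chart[OF mopen_subset_carrier[OF U x(1)]] by blast
    let ?R = "{q \<in> snd c ` (fst c \<inter> fst d). (snd d \<circ> chart_inv c) q \<in> snd d ` (U \<inter> fst d)}"
    have "open ?R"
      by (intro open_vimage_within smooth_on_imp_continuous_on mchartD[OF c d(1)] mopen_chart[OF U d(1)])
    moreover have "p \<in> ?R" using x d mchart_inv[OF c] by auto
    moreover have "?R \<subseteq> snd c ` (U \<inter> fst c)"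
    proof
      fix q assume q: "q \<in> ?R"
      then obtain y where y: "y \<in> fst c" "y \<in> fst d" "q = snd c y" by blast
      then have "snd d y \<in> snd d ` (U \<inter> fst d)" using q mchart_inv[OF c y(1)] by simp
      then have "y \<in> U" using y chart_inj[OF d(1)] unfolding inj_on_def by blast
      then show "q \<in> snd c ` (U \<inter> fst c)" using y by blast
    qed
    ultimately show ?thesis by blast
  qed
  then show ?thesis by (subst open_subopen) blast
qed

lemma mchart_open: "mchart A c \<Longrightarrow> open (snd c ` fst c)"
  using mopen_image[OF _ mopen_fst, of c c] by simp

text \<open>Compatibility with the atlas is all that is known of either chart, so near each point
  the transition is factored through a chart of the atlas.\<close>

lemma transition_smooth:
  assumes c: "mchart A c" and d: "mchart A d"
  shows "smooth_on (snd c ` (fst c \<inter> fst d)) (snd d \<circ> chart_inv c)"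
proof (rule smooth_on_local)
  show "open (snd c ` (fst c \<inter> fst d))"
    using mopen_image[OF c mopen_fst[OF d]] by (simp add: Int_commute)
  fix p assume "p \<in> snd c ` (fst c \<inter> fst d)"
  then obtain x where x: "x \<in> fst c" "x \<in> fst d" "p = snd c x" by auto
  obtain e where e: "e \<in> A" "x \<in> fst e" using carrier_chart[OF mchart_carrier[OF c x(1)]] by blast
  let ?W = "fst c \<inter> fst d \<inter> fst e"
  have W: "mopen A ?W" using c d e by (simp add: mopen_Int mopen_fst chart_mchart)
  have o: "open (snd c ` ?W)" "open (snd e ` ?W)"
    using mopen_image[OF c W] mopen_image[OF chart_mchart[OF e(1)] W]
    by (simp_all add: Int_ac Int_absorb1)
  have inv: "chart_inv c (snd c y) = y" "chart_inv e (snd e y) = y" if "y \<in> ?W" for y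
    using that mchart_inv[OF c] mchart_inv[OF chart_mchart[OF e(1)]] by auto
  have "smooth_on (snd c ` ?W) (\<lambda>q. (snd d \<circ> chart_inv e) ((snd e \<circ> chart_inv c) q))"
  proof (rule smooth_on_compose[OF o, where g = "snd d \<circ> chart_inv e" and f = "snd e \<circ> chart_inv c"])
    show "(snd e \<circ> chart_inv c) ` snd c ` ?W \<subseteq> snd e ` ?W" using inv by auto
    show "smooth_on (snd c ` ?W) (snd e \<circ> chart_inv c)"
      using c e by (auto simp: mchart_def intro: smooth_on_subset)
    show "smooth_on (snd e ` ?W) (snd d \<circ> chart_inv e)"
      using d e by (auto simp: mchart_def intro: smooth_on_subset)
  qed
  then have "smooth_on (snd c ` ?W) (snd d \<circ> chart_inv c)"
    by (subst smooth_on_cong[OF o(1), of _ "\<lambda>q. (snd d \<circ> chart_inv e) ((snd e \<circ> chart_inv c) q)"])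
      (auto simp: inv)
  then show "\<exists>U. open U \<and> p \<in> U \<and> smooth_on U (snd d \<circ> chart_inv c)"
    using o x e by (intro exI[of _ "snd c ` ?W"]) auto
qed

lemma nearI: "mopen A U \<Longrightarrow> x \<in> U \<Longrightarrow> (\<And>y. y \<in> U \<Longrightarrow> P y) \<Longrightarrow> near A x P"
  by (auto simp: near_def)

lemma near_mono: "near A x P \<Longrightarrow> (\<And>y. y \<in> carrier A \<Longrightarrow> P y \<Longrightarrow> Q y) \<Longrightarrow> near A x Q"
  unfolding near_def using mopen_subset_carrier by meson

lemma near_conj: "near A x P \<Longrightarrow> near A x Q \<Longrightarrow> near A x (\<lambda>y. P y \<and> Q y)"
  unfolding near_def by (meson IntD1 IntD2 IntI mopen_Int)

lemma near_point: "near A x P \<Longrightarrow> P x"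
  by (auto simp: near_def)

lemma near_near: "near A x P \<Longrightarrow> near A x (\<lambda>y. near A y P)"
  unfolding near_def by blast

lemma smooth_at_carrier: "smooth_at A x f \<Longrightarrow> x \<in> carrier A"
  unfolding smooth_at_def using mopen_subset_carrier by blast

text \<open>Transition maps are smooth in both directions, so one compatible chart decides for all.
  This is what allows product charts to be used on \<open>Z\<close>.\<close>

lemma smooth_at_chart_iff:
  assumes c: "mchart A c" and x: "x \<in> fst c"
  shows "smooth_at A x f \<longleftrightarrow>
    (\<exists>S. open S \<and> snd c x \<in> S \<and> S \<subseteq> snd c ` fst c \<and> smooth_on S (f \<circ> chart_inv c))"
proof
  assume "smooth_at A x f"
  then obtain U where U: "mopen A U" "x \<in> U" "smooth_fun A U f" by (auto simp: smooth_at_def)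
  obtain d where d: "d \<in> A" "x \<in> fst d" using carrier_chart[OF mchart_carrier[OF c x]] by blast
  have md: "mchart A d" using d chart_mchart by blast
  let ?W = "U \<inter> fst c \<inter> fst d"
  have W: "mopen A ?W" using U c md by (simp add: mopen_Int mopen_fst)
  have o: "open (snd c ` ?W)" "open (snd d ` ?W)"
    using mopen_image[OF c W] mopen_image[OF md W] by (simp_all add: Int_ac Int_absorb1)
  have inv: "chart_inv c (snd c y) = y" "chart_inv d (snd d y) = y" if "y \<in> ?W" for y
    using that mchart_inv[OF c] mchart_inv[OF md] by auto
  have "smooth_on (snd c ` ?W) (\<lambda>q. (f \<circ> chart_inv d) ((snd d \<circ> chart_inv c) q))"
  proof (rule smooth_on_compose[OF o, where g = "f \<circ> chart_inv d" and f = "snd d \<circ> chart_inv c"])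
    show "(snd d \<circ> chart_inv c) ` snd c ` ?W \<subseteq> snd d ` ?W" using inv by auto
    show "smooth_on (snd c ` ?W) (snd d \<circ> chart_inv c)"
      by (rule smooth_on_subset[OF transition_smooth[OF c md]]) auto
    have "smooth_on (snd d ` (U \<inter> fst d)) (f \<circ> chart_inv d)"
      using U(3) d by (simp add: smooth_fun_def)
    then show "smooth_on (snd d ` ?W) (f \<circ> chart_inv d)" by (rule smooth_on_subset) auto
  qed
  then have "smooth_on (snd c ` ?W) (f \<circ> chart_inv c)"
    by (subst smooth_on_cong[OF o(1), of _ "\<lambda>q. (f \<circ> chart_inv d) ((snd d \<circ> chart_inv c) q)"])
      (auto simp: inv)
  then show "\<exists>S. open S \<and> snd c x \<in> S \<and> S \<subseteq> snd c ` fst c \<and> smooth_on S (f \<circ> chart_inv c)"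
    using o U x d by (intro exI[of _ "snd c ` ?W"]) auto
next
  assume "\<exists>S. open S \<and> snd c x \<in> S \<and> S \<subseteq> snd c ` fst c \<and> smooth_on S (f \<circ> chart_inv c)"
  then obtain S where S: "open S" "snd c x \<in> S" "smooth_on S (f \<circ> chart_inv c)" by blast
  let ?U = "{y \<in> fst c. snd c y \<in> S}"
  have U: "mopen A ?U" by (rule mopen_preimage[OF c S(1)])
  have "smooth_fun A ?U f"
    unfolding smooth_fun_def
  proof
    fix d assume d: "d \<in> A"
    then have md: "mchart A d" using chart_mchart by blast
    have o: "open (snd d ` (?U \<inter> fst d))" using U d by (auto simp: mopen_def)
    have inv: "chart_inv c (snd c y) = y" "chart_inv d (snd d y) = y" if "y \<in> ?U \<inter> fst d" for y
      using that mchart_inv[OF c] mchart_inv[OF md] by auto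
    have "smooth_on (snd d ` (?U \<inter> fst d)) (\<lambda>q. (f \<circ> chart_inv c) ((snd c \<circ> chart_inv d) q))"
    proof (rule smooth_on_compose[OF o S(1), where g = "f \<circ> chart_inv c" and f = "snd c \<circ> chart_inv d"])
      show "(snd c \<circ> chart_inv d) ` snd d ` (?U \<inter> fst d) \<subseteq> S" using inv by auto
      show "smooth_on (snd d ` (?U \<inter> fst d)) (snd c \<circ> chart_inv d)"
        by (rule smooth_on_subset[OF transition_smooth[OF md c]]) auto
    qed (rule S)
    then show "smooth_on (snd d ` (?U \<inter> fst d)) (f \<circ> chart_inv d)"
      by (subst smooth_on_cong[OF o, of _ "\<lambda>q. (f \<circ> chart_inv c) ((snd c \<circ> chart_inv d) q)"])
        (auto simp: inv)
  qed
  then show "smooth_at A x f" unfolding smooth_at_def using U S x by blast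
qed

lemma smooth_fun_iff: "mopen A U \<Longrightarrow> smooth_fun A U f \<longleftrightarrow> (\<forall>x\<in>U. smooth_at A x f)"
proof
  show "mopen A U \<Longrightarrow> smooth_fun A U f \<Longrightarrow> \<forall>x\<in>U. smooth_at A x f" by (auto simp: smooth_at_def)
  assume U: "mopen A U" and *: "\<forall>x\<in>U. smooth_at A x f"
  show "smooth_fun A U f"
    unfolding smooth_fun_def
  proof
    fix c assume c: "c \<in> A"
    show "smooth_on (snd c ` (U \<inter> fst c)) (f \<circ> chart_inv c)"
    proof (rule smooth_on_local)
      show "open (snd c ` (U \<inter> fst c))" using U c by (auto simp: mopen_def)
      fix p assume "p \<in> snd c ` (U \<inter> fst c)"
      then obtain x where "x \<in> U" "x \<in> fst c" "p = snd c x" by blast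
      then show "\<exists>V. open V \<and> p \<in> V \<and> smooth_on V (f \<circ> chart_inv c)"
        using * smooth_at_chart_iff[OF chart_mchart[OF c], of x f] by metis
    qed
  qed
qed

lemma smooth_at_near: "smooth_at A x f \<Longrightarrow> near A x (\<lambda>y. smooth_at A y f)"
  unfolding near_def using smooth_fun_iff smooth_at_def by metis

lemma smooth_at_cong:
  assumes "near A x (\<lambda>y. f y = g y)" "smooth_at A x f" shows "smooth_at A x g"
proof -
  obtain U where U: "mopen A U" "x \<in> U" "\<forall>y\<in>U. f y = g y" using assms(1) by (auto simp: near_def)
  obtain V where V: "mopen A V" "x \<in> V" "smooth_fun A V f" using assms(2) by (auto simp: smooth_at_def)
  have W: "mopen A (U \<inter> V)" using U V mopen_Int by blast
  have "smooth_fun A (U \<inter> V) g"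
    unfolding smooth_fun_def
  proof
    fix c assume c: "c \<in> A"
    have o: "open (snd c ` (U \<inter> V \<inter> fst c))" using W c by (auto simp: mopen_def)
    have "smooth_on (snd c ` (U \<inter> V \<inter> fst c)) (f \<circ> chart_inv c)"
      using smooth_fun_subset[OF V(3), of "U \<inter> V"] c by (auto simp: smooth_fun_def)
    then show "smooth_on (snd c ` (U \<inter> V \<inter> fst c)) (g \<circ> chart_inv c)"
      by (subst (asm) smooth_on_cong[OF o, of _ "g \<circ> chart_inv c"])
        (use U chart_inv_left[OF chart_inj[OF c]] in auto)
  qed
  then show ?thesis unfolding smooth_at_def using W U V by blast
qed

text \<open>Common reduction for the closure properties of germs: \<open>f\<close> and
  \<open>g\<close> are smooth on different neighbourhoods, which are intersected in one chart. Unary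
  operations use it with \<open>f\<close> twice.\<close>

lemma smooth_at_2:
  assumes f: "smooth_at A x f" and g: "smooth_at A x g"
    and h: "\<And>S. open S \<Longrightarrow> smooth_on S (f \<circ> chart_inv (chart_at A x)) \<Longrightarrow>
       smooth_on S (g \<circ> chart_inv (chart_at A x)) \<Longrightarrow> smooth_on S (h \<circ> chart_inv (chart_at A x))"
  shows "smooth_at A x h"
proof -
  let ?c = "chart_at A x"
  have c: "mchart A ?c" "x \<in> fst ?c" using chart_at[OF smooth_at_carrier[OF f]] chart_mchart by auto
  obtain S R where "open S" "snd ?c x \<in> S" "S \<subseteq> snd ?c ` fst ?c" "smooth_on S (f \<circ> chart_inv ?c)"
    "open R" "snd ?c x \<in> R" "smooth_on R (g \<circ> chart_inv ?c)"
    using f g smooth_at_chart_iff[OF c] by metis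
  then show ?thesis
    unfolding smooth_at_chart_iff[OF c] using h[of "S \<inter> R"]
    by (intro exI[of _ "S \<inter> R"]) (auto intro: smooth_on_subset)
qed

lemma smooth_at_const: "x \<in> carrier A \<Longrightarrow> smooth_at A x (\<lambda>y. k)"
  unfolding smooth_at_def using mopen_carrier
  by (auto simp: smooth_fun_def o_def smooth_on_const intro!: exI[of _ "carrier A"])

lemma smooth_at_bounded_linear: "bounded_linear h \<Longrightarrow> smooth_at A x f \<Longrightarrow> smooth_at A x (\<lambda>y. h (f y))"
  by (rule smooth_at_2[of x f f]) (auto simp: o_def intro: smooth_on_bounded_linear)

lemma smooth_at_bilinear:
  "bounded_bilinear h \<Longrightarrow> smooth_at A x f \<Longrightarrow> smooth_at A x g \<Longrightarrow> smooth_at A x (\<lambda>y. h (f y) (g y))"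
  by (rule smooth_at_2[of x f g]) (auto simp: o_def intro: smooth_on_bilinear)

lemma smooth_at_add: "smooth_at A x f \<Longrightarrow> smooth_at A x g \<Longrightarrow> smooth_at A x (\<lambda>y. f y + g y)"
  by (rule smooth_at_2[of x f g]) (auto simp: o_def intro: smooth_on_add)

lemma smooth_at_minus: "smooth_at A x f \<Longrightarrow> smooth_at A x (\<lambda>y. - f y)"
  by (rule smooth_at_bounded_linear[OF bounded_linear_minus[OF bounded_linear_ident]])

lemma smooth_at_diff: "smooth_at A x f \<Longrightarrow> smooth_at A x g \<Longrightarrow> smooth_at A x (\<lambda>y. f y - g y)"
  using smooth_at_add[OF _ smooth_at_minus, of x f g] by simp

lemma smooth_at_Pair: "smooth_at A x f \<Longrightarrow> smooth_at A x g \<Longrightarrow> smooth_at A x (\<lambda>y. (f y, g y))"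
  by (rule smooth_at_2[of x f g]) (auto simp: o_def intro: smooth_on_Pair)

lemma smooth_at_fst: "smooth_at A x f \<Longrightarrow> smooth_at A x (\<lambda>y. fst (f y))"
  by (rule smooth_at_bounded_linear[OF bounded_linear_fst])

lemma smooth_at_snd: "smooth_at A x f \<Longrightarrow> smooth_at A x (\<lambda>y. snd (f y))"
  by (rule smooth_at_bounded_linear[OF bounded_linear_snd])

lemma smooth_at_scaleR: "smooth_at A x f \<Longrightarrow> smooth_at A x g \<Longrightarrow> smooth_at A x (\<lambda>y. f y *\<^sub>R g y)"
  by (rule smooth_at_bilinear[OF bounded_bilinear_scaleR])

lemma smooth_at_inner: "smooth_at A x f \<Longrightarrow> smooth_at A x g \<Longrightarrow> smooth_at A x (\<lambda>y. f y \<bullet> g y)"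
  by (rule smooth_at_bilinear[OF bounded_bilinear_inner])

lemma smooth_at_sum:
  "x \<in> carrier A \<Longrightarrow> (\<And>i. i \<in> I \<Longrightarrow> smooth_at A x (f i)) \<Longrightarrow> smooth_at A x (\<lambda>y. \<Sum>i\<in>I. f i y)"
  by (induction I rule: infinite_finite_induct) (auto intro: smooth_at_const smooth_at_add)

lemma smooth_at_compose:
  fixes g :: "'b::euclidean_space \<Rightarrow> 'c::real_normed_vector"
  assumes f: "smooth_at A x f" and g: "open R" "f x \<in> R" "smooth_on R g"
  shows "smooth_at A x (\<lambda>y. g (f y))"
proof -
  let ?c = "chart_at A x"
  have c: "mchart A ?c" "x \<in> fst ?c" using chart_at[OF smooth_at_carrier[OF f]] chart_mchart by auto
  obtain S where S: "open S" "snd ?c x \<in> S" "S \<subseteq> snd ?c ` fst ?c" "smooth_on S (f \<circ> chart_inv ?c)"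
    using f smooth_at_chart_iff[OF c] by metis
  let ?Q = "{q \<in> S. (f \<circ> chart_inv ?c) q \<in> R}"
  have Q: "open ?Q" using S g by (intro open_vimage_within smooth_on_imp_continuous_on)
  have "smooth_on ?Q (\<lambda>q. g ((f \<circ> chart_inv ?c) q))"
    by (rule smooth_on_compose[OF Q g(1) _ _ g(3), where f = "f \<circ> chart_inv ?c"]) (auto intro: smooth_on_subset[OF S(4)])
  then show ?thesis unfolding smooth_at_chart_iff[OF c]
    using Q S g mchart_inv[OF c] by (intro exI[of _ ?Q]) (auto simp: o_def)
qed

lemma smooth_at_chart:
  assumes "mchart A c" "x \<in> fst c" shows "smooth_at A x (snd c)"
  unfolding smooth_at_chart_iff[OF assms]
proof (intro exI conjI)
  show "open (snd c ` fst c)" by (rule mchart_open[OF assms(1)])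
  then show "smooth_on (snd c ` fst c) (snd c \<circ> chart_inv c)"
    by (subst smooth_on_cong[of _ _ "\<lambda>x. x"])
      (auto simp: chart_inv_left[OF mchart_inj[OF assms(1)]] smooth_on_id)
qed (use assms in auto)

lemma near_of_continuous:
  fixes f :: "'a \<Rightarrow> 'b::euclidean_space"
  assumes f: "smooth_at A x f" and R: "open R" "f x \<in> R"
  shows "near A x (\<lambda>y. f y \<in> R)"
proof -
  let ?c = "chart_at A x"
  have c: "mchart A ?c" "x \<in> fst ?c" using chart_at[OF smooth_at_carrier[OF f]] chart_mchart by auto
  obtain S where S: "open S" "snd ?c x \<in> S" "S \<subseteq> snd ?c ` fst ?c" "smooth_on S (f \<circ> chart_inv ?c)"
    using f smooth_at_chart_iff[OF c] by metis
  let ?Q = "{q \<in> S. (f \<circ> chart_inv ?c) q \<in> R}"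
  have Q: "open ?Q" using S R by (intro open_vimage_within smooth_on_imp_continuous_on)
  show ?thesis
    by (rule nearI[OF mopen_preimage[OF c(1) Q]]) (use S R c mchart_inv[OF c(1)] in auto)
qed

section \<open>Derivatives in a chart\<close>

lemma differentiable_chart:
  assumes "mchart A c" "x \<in> fst c" "smooth_at A x f"
  shows "(f \<circ> chart_inv c) differentiable (at (snd c x))"
  using assms smooth_at_chart_iff[OF assms(1,2)] smooth_on_imp_differentiable by blast

lemma chart_deriv_linear:
  assumes "mchart A c" "x \<in> fst c" "smooth_at A x f"
  shows "linear (chart_deriv c f x)"
  using differentiable_chart[OF assms] unfolding chart_deriv_def
  by (metis (mono_tags, lifting) frechet_derivative_works eta_contract_eq has_derivative_linear)

lemma chart_deriv_cong:
  assumes "mchart A c" "x \<in> fst c" "near A x (\<lambda>y. f y = g y)"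
  shows "chart_deriv c f x a = chart_deriv c g x a"
proof -
  obtain U where U: "mopen A U" "x \<in> U" "\<forall>y\<in>U. f y = g y" using assms(3) by (auto simp: near_def)
  have "frechet_derivative (f \<circ> chart_inv c) (at (snd c x)) =
      frechet_derivative (g \<circ> chart_inv c) (at (snd c x))"
    by (rule frechet_derivative_cong_open[OF mopen_image[OF assms(1) U(1)]])
      (use U assms mchart_inv[OF assms(1)] in auto)
  then show ?thesis by (simp add: chart_deriv_def)
qed

lemma chart_deriv_const: "chart_deriv c (\<lambda>y. k) x a = 0"
  unfolding chart_deriv_def o_def by (rule frechet_derivative_eq) (rule has_derivative_const)

lemma chart_deriv_bilinear:
  assumes c: "mchart A c" "x \<in> fst c" and f: "smooth_at A x f" and g: "smooth_at A x g"
    and h: "bounded_bilinear h"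
  shows "chart_deriv c (\<lambda>y. h (f y) (g y)) x a =
    h (f x) (chart_deriv c g x a) + h (chart_deriv c f x a) (g x)"
proof -
  let ?F = "f \<circ> chart_inv c" and ?G = "g \<circ> chart_inv c"
  have "((\<lambda>p. h (?F p) (?G p)) has_derivative
      (\<lambda>v. h (?F (snd c x)) (frechet_derivative ?G (at (snd c x)) v) +
        h (frechet_derivative ?F (at (snd c x)) v) (?G (snd c x)))) (at (snd c x))"
    by (rule bounded_bilinear.FDERIV[OF h differentiable_chart[OF c f, unfolded frechet_derivative_works]
          differentiable_chart[OF c g, unfolded frechet_derivative_works]])
  from frechet_derivative_eq[OF this] show ?thesis
    by (simp add: chart_deriv_def o_def mchart_inv[OF c])
qed

lemma chart_deriv_add:
  assumes c: "mchart A c" "x \<in> fst c" and f: "smooth_at A x f" and g: "smooth_at A x g"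
  shows "chart_deriv c (\<lambda>y. f y + g y) x a = chart_deriv c f x a + chart_deriv c g x a"
  using has_derivative_add[OF differentiable_chart[OF c f, unfolded frechet_derivative_works]
      differentiable_chart[OF c g, unfolded frechet_derivative_works], THEN frechet_derivative_eq]
  by (simp add: chart_deriv_def o_def)

lemma chart_deriv_bounded_linear:
  assumes c: "mchart A c" "x \<in> fst c" and f: "smooth_at A x f" and h: "bounded_linear h"
  shows "chart_deriv c (\<lambda>y. h (f y)) x a = h (chart_deriv c f x a)"
  using frechet_derivative_bounded_linear[OF h differentiable_chart[OF c f]]
  by (simp add: chart_deriv_def o_def)

lemma chart_deriv_minus:
  assumes c: "mchart A c" "x \<in> fst c" and f: "smooth_at A x f"
  shows "chart_deriv c (\<lambda>y. - f y) x a = - chart_deriv c f x a"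
  by (rule chart_deriv_bounded_linear[OF assms bounded_linear_minus[OF bounded_linear_ident]])

lemma chart_deriv_diff:
  assumes c: "mchart A c" "x \<in> fst c" and f: "smooth_at A x f" and g: "smooth_at A x g"
  shows "chart_deriv c (\<lambda>y. f y - g y) x a = chart_deriv c f x a - chart_deriv c g x a"
  using chart_deriv_add[OF c f smooth_at_minus[OF g]] chart_deriv_minus[OF c g] by simp

lemma chart_deriv_Pair:
  assumes c: "mchart A c" "x \<in> fst c" and f: "smooth_at A x f" and g: "smooth_at A x g"
  shows "chart_deriv c (\<lambda>y. (f y, g y)) x a = (chart_deriv c f x a, chart_deriv c g x a)"
  using has_derivative_Pair[OF differentiable_chart[OF c f, unfolded frechet_derivative_works]
      differentiable_chart[OF c g, unfolded frechet_derivative_works], THEN frechet_derivative_eq]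
  by (simp add: chart_deriv_def o_def)

lemma chart_deriv_self:
  assumes c: "mchart A c" "x \<in> fst c"
  shows "chart_deriv c (snd c) x a = a"
proof -
  have "frechet_derivative (snd c \<circ> chart_inv c) (at (snd c x)) =
      frechet_derivative (\<lambda>p. p) (at (snd c x))"
    by (rule frechet_derivative_cong_open[OF mchart_open[OF c(1)]])
      (use c mchart_inv[OF c(1)] in auto)
  then show ?thesis by (simp add: chart_deriv_def)
qed

lemma chart_deriv_chain:
  assumes c: "mchart A c" "x \<in> fst c" and d: "mchart A d" "x \<in> fst d" and f: "smooth_at A x f"
  shows "chart_deriv c f x a = chart_deriv d f x (chart_deriv c (snd d) x a)"
proof -
  have W: "mopen A (fst c \<inter> fst d)" using c d mopen_Int mopen_fst by blast
  have "frechet_derivative (f \<circ> chart_inv c) (at (snd c x)) =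
     frechet_derivative (\<lambda>p. (f \<circ> chart_inv d) ((snd d \<circ> chart_inv c) p)) (at (snd c x))"
    by (rule frechet_derivative_cong_open[OF mopen_image[OF c(1) W]])
      (use c d mchart_inv[OF c(1)] mchart_inv[OF d(1)] in auto)
  then show ?thesis
    using frechet_derivative_chain[of "snd d \<circ> chart_inv c" "snd c x" "f \<circ> chart_inv d" a]
      differentiable_chart[OF c smooth_at_chart[OF d]] differentiable_chart[OF d f]
    by (simp add: chart_deriv_def mchart_inv[OF c])
qed

lemma smooth_at_chart_deriv:
  assumes c: "mchart A c" "x \<in> fst c" and f: "smooth_at A x f"
  shows "smooth_at A x (\<lambda>y. chart_deriv c f y a)"
proof -
  obtain S where S: "open S" "snd c x \<in> S" "S \<subseteq> snd c ` fst c" "smooth_on S (f \<circ> chart_inv c)"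
    using f smooth_at_chart_iff[OF c] by metis
  have "smooth_on S ((\<lambda>y. chart_deriv c f y a) \<circ> chart_inv c)"
    by (subst smooth_on_cong[OF S(1), of _ "\<lambda>p. frechet_derivative (f \<circ> chart_inv c) (at p) a"])
      (use S chart_inv_right[of _ c] smooth_on_frechet[OF S(1,4)] in \<open>auto simp: chart_deriv_def\<close>)
  then show ?thesis using S smooth_at_chart_iff[OF c] by metis
qed

text \<open>The direction \<open>X y\<close> moves, so it is expanded in the basis. Linearity of the
  derivative is available wherever \<open>f\<close> is smooth, that is near
  \<open>x\<close>.\<close>

lemma smooth_at_chart_deriv_field:
  fixes X :: "'a \<Rightarrow> 'e"
  assumes c: "mchart A c" "x \<in> fst c" and f: "smooth_at A x f" and X: "smooth_at A x X"
  shows "smooth_at A x (\<lambda>y. chart_deriv c f y (X y))"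
proof (rule smooth_at_cong)
  have "near A x (\<lambda>y. y \<in> fst c)" by (rule nearI[OF mopen_fst[OF c(1)] c(2)])
  then show "near A x (\<lambda>y. (\<Sum>b\<in>Basis. (X y \<bullet> b) *\<^sub>R chart_deriv c f y b) = chart_deriv c f y (X y))"
    by (rule near_mono[OF near_conj[OF _ smooth_at_near[OF f]]])
      (use linear_euclidean_expand chart_deriv_linear[OF c(1)] in metis)
  show "smooth_at A x (\<lambda>y. \<Sum>b\<in>Basis. (X y \<bullet> b) *\<^sub>R chart_deriv c f y b)"
    by (intro smooth_at_sum smooth_at_scaleR smooth_at_chart_deriv[OF c f] smooth_at_carrier[OF f]
        smooth_at_bounded_linear[OF bounded_linear_inner_left X])
qed

lemma chart_deriv_symmetric:
  fixes f :: "'a \<Rightarrow> 'b::euclidean_space"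
  assumes c: "mchart A c" "x \<in> fst c" and f: "smooth_at A x f"
  shows "chart_deriv c (\<lambda>y. chart_deriv c f y a) x b = chart_deriv c (\<lambda>y. chart_deriv c f y b) x a"
proof -
  obtain S where S: "open S" "snd c x \<in> S" "S \<subseteq> snd c ` fst c" "smooth_on S (f \<circ> chart_inv c)"
    using f smooth_at_chart_iff[OF c] by metis
  have "chart_deriv c (\<lambda>y. chart_deriv c f y a) x =
      frechet_derivative (\<lambda>p. frechet_derivative (f \<circ> chart_inv c) (at p) a) (at (snd c x))" for a
    unfolding chart_deriv_def
    by (rule ext, subst frechet_derivative_cong_open[OF S(1,2), of _ "\<lambda>p. frechet_derivative (f \<circ> chart_inv c) (at p) a"])
      (use S chart_inv_right[of _ c] in auto)
  then show ?thesis using symmetric_second_derivative[OF S(1,2,4)] by simp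
qed

end

section \<open>Coordinates of tangent vectors and covectors\<close>

text \<open>The coordinate vector of \<open>v\<close> in a chart that need not index the family
  \<open>v\<close>: the coordinate map of \<open>c\<close> is differentiated along \<open>v\<close>,
  and \<open>dfun\<close> does this in some chart of the atlas. For charts of the atlas it gives
  back \<open>v c\<close>, see \<open>tco_atlas\<close>.\<close>

definition tco :: "('a, 'e::euclidean_space) atlas \<Rightarrow> ('a, 'e) chart \<Rightarrow> 'a \<Rightarrow> ('a, 'e) tvec \<Rightarrow> 'e"
  where "tco A c x v = dfun A (snd c) x v"

definition tinv :: "('a, 'e::euclidean_space) atlas \<Rightarrow> ('a, 'e) chart \<Rightarrow> 'a \<Rightarrow> 'e \<Rightarrow> ('a, 'e) tvec"
  where "tinv A c x a = (\<lambda>d. if d \<in> A \<and> x \<in> fst d then chart_deriv c (snd d) x a else 0)"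

text \<open>The components of a covector on the coordinate basis vectors, collected into one vector,
  so that applying the covector becomes the inner product with \<open>tco\<close>; see
  \<open>covector_apply\<close>.\<close>

definition cco ::
  "('a, 'e::euclidean_space) atlas \<Rightarrow> ('a, 'e) chart \<Rightarrow> 'a \<Rightarrow> (('a, 'e) tvec \<Rightarrow> real) \<Rightarrow> 'e"
  where "cco A c x \<xi> = (\<Sum>b\<in>Basis. \<xi> (tinv A c x b) *\<^sub>R b)"

definition cinv ::
  "('a, 'e::euclidean_space) atlas \<Rightarrow> ('a, 'e) chart \<Rightarrow> 'a \<Rightarrow> 'e \<Rightarrow> ('a, 'e) tvec \<Rightarrow> real"
  where "cinv A c x \<alpha> = restr (tangent_space A x) (\<lambda>v. \<alpha> \<bullet> tco A c x v)"

text \<open>Germ version of \<open>smooth_sections\<close>. Membership in the fibres is demanded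
  separately because a trivialisation says nothing about vectors outside the fibre.\<close>

definition sec :: "('m, 'e::euclidean_space) atlas \<Rightarrow> ('m, 'v, 'f::euclidean_space) vbundle \<Rightarrow>
   'm \<Rightarrow> ('m \<Rightarrow> 'v) \<Rightarrow> bool" where
  "sec A B x \<sigma> \<longleftrightarrow> near A x (\<lambda>y. \<sigma> y \<in> fibre B y) \<and>
     (\<forall>t\<in>btriv B. x \<in> fst t \<longrightarrow> smooth_at A x (\<lambda>y. snd t y (\<sigma> y)))"

definition open_trivs :: "('m, 'e::euclidean_space) atlas \<Rightarrow> ('m, 'v, 'f::euclidean_space) vbundle \<Rightarrow> bool"
  where "open_trivs A B \<longleftrightarrow> (\<forall>t\<in>btriv B. mopen A (fst t)) \<and>
    (\<forall>x\<in>carrier A. \<exists>t\<in>btriv B. x \<in> fst t)"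

lemma linear_on_setD:
  assumes "linear_on_set S f"
  shows "u \<in> S \<Longrightarrow> v \<in> S \<Longrightarrow> f (u + v) = f u + f v" "u \<in> S \<Longrightarrow> f (c *\<^sub>R u) = c *\<^sub>R f u"
  using assms by (auto simp: linear_on_set_def)

lemma linear_on_set_compose:
  assumes "linear h" "\<And>a. h a \<in> S" "linear_on_set S f"
  shows "linear (\<lambda>a. f (h a))"
  using assms by (auto intro!: linearI simp: linear_add linear_scale linear_on_setD)

lemma dual_spaceD:
  "f \<in> dual_space S \<Longrightarrow> linear_on_set S f" "f \<in> dual_space S \<Longrightarrow> x \<notin> S \<Longrightarrow> f x = 0"
  by (auto simp: dual_space_def)

lemma dual_space_eqI:
  "f \<in> dual_space S \<Longrightarrow> g \<in> dual_space S \<Longrightarrow> (\<And>v. v \<in> S \<Longrightarrow> f v = g v) \<Longrightarrow> f = g"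
  by (rule ext) (metis dual_spaceD(2))

lemma subspace_dual_space: "subspace (dual_space S)"
  unfolding subspace_def dual_space_def linear_on_set_def
  by (auto simp: scaleR_fun_def algebra_simps)

lemma restr_linear_dual:
  assumes "subspace S" "linear_on_set S f" shows "restr S f \<in> dual_space S"
  using assms unfolding dual_space_def linear_on_set_def restr_def
  by (auto simp: subspace_add subspace_scale)

lemma linear_on_set_linear: "linear f \<Longrightarrow> linear_on_set S f"
  by (auto simp: linear_on_set_def linear_add linear_scale)

lemma euclidean_sum_inner: "(\<Sum>b\<in>Basis. f b *\<^sub>R b) \<bullet> (a::'a::euclidean_space) = (\<Sum>b\<in>Basis. (a \<bullet> b) * f b)"
  unfolding inner_sum_left by (simp add: inner_commute mult.commute)

definition dual_triv :: "('m, 'v::real_vector, 'f::euclidean_space) vbundle \<Rightarrow>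
   'm set \<times> ('m \<Rightarrow> 'v \<Rightarrow> 'f) \<Rightarrow> 'm \<Rightarrow> ('v \<Rightarrow> real) \<Rightarrow> 'f" where
  "dual_triv B t x f = (\<Sum>b\<in>Basis. f (inv_into (fibre B x) (snd t x) b) *\<^sub>R b)"

lemma fibre_tbundle [simp]: "fibre (tbundle A) = tangent_space A"
  by (simp add: tbundle_def)

lemma fibre_dual_bundle [simp]: "fibre (dual_bundle B) x = dual_space (fibre B x)"
  by (simp add: dual_bundle_def)

lemma fibre_bsum [simp]: "fibre (bsum B C) x = fibre B x \<times> fibre C x"
  by (simp add: bsum_def)

lemma fibre_gen_bundle [simp]: "fibre (gen_bundle B) x = fibre B x \<times> dual_space (fibre B x)"
  by (simp add: gen_bundle_def)

lemma btriv_tbundle: "t \<in> btriv (tbundle A) \<longleftrightarrow> (\<exists>c\<in>A. t = (fst c, \<lambda>x v. v c))"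
  unfolding tbundle_def vbundle.simps mem_Collect_eq by blast

lemma btriv_dual: "t \<in> btriv (dual_bundle B) \<longleftrightarrow> (\<exists>s\<in>btriv B. t = (fst s, dual_triv B s))"
  unfolding dual_bundle_def dual_triv_def[abs_def] vbundle.simps mem_Collect_eq by blast

lemma btriv_bsum: "t \<in> btriv (bsum B C) \<longleftrightarrow>
    (\<exists>s\<in>btriv B. \<exists>r\<in>btriv C. t = (fst s \<inter> fst r, \<lambda>x u. (snd s x (fst u), snd r x (snd u))))"
  unfolding bsum_def case_prod_unfold vbundle.simps mem_Collect_eq by blast

lemma btriv_bsumE:
  assumes "t \<in> btriv (bsum B C)"
  obtains s r where "s \<in> btriv B" "r \<in> btriv C"
    "t = (fst s \<inter> fst r, \<lambda>x u. (snd s x (fst u), snd r x (snd u)))"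
proof -
  from assms have "\<exists>s\<in>btriv B. \<exists>r\<in>btriv C. t = (fst s \<inter> fst r, \<lambda>x u. (snd s x (fst u), snd r x (snd u)))"
    by (simp only: btriv_bsum)
  then show thesis by (elim bexE) (rule that)
qed

context satlas
begin

lemma tangentD:
  assumes "v \<in> tangent_space A x" "c \<in> A" "d \<in> A" "x \<in> fst c" "x \<in> fst d"
  shows "v d = chart_deriv c (snd d) x (v c)"
  using assms unfolding tangent_space_def by blast

lemma tangent_outside:
  "v \<in> tangent_space A x \<Longrightarrow> \<not> (c \<in> A \<and> x \<in> fst c) \<Longrightarrow> v c = 0"
  unfolding tangent_space_def by blast

lemma chart_at_mchart: "x \<in> carrier A \<Longrightarrow> mchart A (chart_at A x) \<and> x \<in> fst (chart_at A x)"
  using chart_at[of x A] chart_mchart[of "chart_at A x"] by simp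

text \<open>The chain rule removes the arbitrary \<open>chart_at\<close> from \<open>dfun\<close>;
  from here on derivatives are computed in whichever compatible chart is convenient.\<close>

lemma dfun_tco:
  assumes c: "mchart A c" "x \<in> fst c" and f: "smooth_at A x f"
  shows "dfun A f x v = chart_deriv c f x (tco A c x v)"
  using chart_deriv_chain[of "chart_at A x" x c f] chart_at_mchart[OF mchart_carrier[OF c]] c f
  by (simp add: dfun_def tco_def)

lemma tco_change:
  "mchart A c \<Longrightarrow> x \<in> fst c \<Longrightarrow> mchart A d \<Longrightarrow> x \<in> fst d \<Longrightarrow>
    tco A d x v = chart_deriv c (snd d) x (tco A c x v)"
  using dfun_tco[of c x "snd d"] smooth_at_chart by (simp add: tco_def)

lemma linear_dfun: assumes "smooth_at A x f" shows "linear (dfun A f x)"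
proof -
  have l: "linear (chart_deriv (chart_at A x) f x)"
    using chart_deriv_linear chart_at_mchart[OF smooth_at_carrier[OF assms]] assms by blast
  show ?thesis
    by (rule linearI) (simp_all add: dfun_def linear_add[OF l] linear_scale[OF l] scaleR_fun_def)
qed

lemma dfun_cong:
  assumes "near A x (\<lambda>y. f y = g y)" shows "dfun A f x v = dfun A g x v"
proof -
  have "x \<in> carrier A" using assms unfolding near_def using mopen_subset_carrier by blast
  then show ?thesis using chart_deriv_cong[OF _ _ assms] chart_at_mchart by (simp add: dfun_def)
qed

lemma dfun_const: "dfun A (\<lambda>y. k) x v = 0"
  by (simp add: dfun_def chart_deriv_const)

lemma linear_tco: "mchart A c \<Longrightarrow> x \<in> fst c \<Longrightarrow> linear (tco A c x)"
  using linear_dfun[OF smooth_at_chart] unfolding tco_def[abs_def] .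

lemma tco_atlas:
  assumes "c \<in> A" "x \<in> fst c" "v \<in> tangent_space A x"
  shows "tco A c x v = v c"
proof -
  have x: "x \<in> carrier A" using chart_carrier assms by blast
  show ?thesis
    using tangentD[OF assms(3) _ assms(1) _ assms(2), of "chart_at A x"] chart_at[OF x]
    by (simp add: tco_def dfun_def)
qed

lemma linear_tinv: assumes c: "mchart A c" "x \<in> fst c" shows "linear (tinv A c x)"
proof (rule linearI)
  have l: "linear (chart_deriv c (snd d) x)" if "d \<in> A" "x \<in> fst d" for d
    using chart_deriv_linear[OF c smooth_at_chart] chart_mchart that by blast
  show "tinv A c x (a + b) = tinv A c x a + tinv A c x b" for a b
    by (rule ext) (simp add: tinv_def linear_add[OF l])
  show "tinv A c x (k *\<^sub>R a) = k *\<^sub>R tinv A c x a" for k a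
    by (rule ext) (simp add: tinv_def linear_scale[OF l] scaleR_fun_def)
qed

lemma tinv_in: assumes c: "mchart A c" "x \<in> fst c" shows "tinv A c x a \<in> tangent_space A x"
proof -
  have "chart_deriv c (snd e) x a = chart_deriv d (snd e) x (chart_deriv c (snd d) x a)"
    if "d \<in> A" "x \<in> fst d" "e \<in> A" "x \<in> fst e" for d e
    using chart_deriv_chain[OF c chart_mchart[OF that(1)] that(2) smooth_at_chart[OF chart_mchart[OF that(3)] that(4)]] .
  note * = this
  show ?thesis
    unfolding tangent_space_def mem_Collect_eq
  proof (intro conjI ballI allI impI)
    fix d e assume "d \<in> A" "e \<in> A" "x \<in> fst d" "x \<in> fst e"
    then show "tinv A c x a e = chart_deriv d (snd e) x (tinv A c x a d)"
      using *[of d e] by (simp add: tinv_def)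
  qed (auto simp only: tinv_def if_False)
qed

lemma tco_tinv: assumes c: "mchart A c" "x \<in> fst c" shows "tco A c x (tinv A c x a) = a"
proof -
  note d = chart_at[OF mchart_carrier[OF c]]
  note md = chart_at_mchart[OF mchart_carrier[OF c]]
  have "tco A c x (tinv A c x a)
      = chart_deriv (chart_at A x) (snd c) x (chart_deriv c (snd (chart_at A x)) x a)"
    using d by (simp add: tco_def dfun_def tinv_def)
  also have "\<dots> = a"
    using chart_deriv_chain[OF c _ _ smooth_at_chart[OF c], of "chart_at A x" a] md chart_deriv_self[OF c]
    by simp
  finally show ?thesis .
qed

lemma tinv_tco:
  assumes c: "mchart A c" "x \<in> fst c" and v: "v \<in> tangent_space A x"
  shows "tinv A c x (tco A c x v) = v"
proof
  fix d
  note e = chart_at[OF mchart_carrier[OF c]]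
  note me = chart_at_mchart[OF mchart_carrier[OF c]]
  show "tinv A c x (tco A c x v) d = v d"
  proof (cases "d \<in> A \<and> x \<in> fst d")
    case True
    then have md: "mchart A d" "x \<in> fst d" using chart_mchart by blast+
    have "tinv A c x (tco A c x v) d = chart_deriv (chart_at A x) (snd d) x (v (chart_at A x))"
      using chart_deriv_chain[OF _ _ c smooth_at_chart[OF md], of "chart_at A x"] me True
      by (simp add: tinv_def tco_def dfun_def)
    also have "\<dots> = v d"
      using tangentD[OF v, of "chart_at A x" d] e True by simp
    finally show ?thesis .
  next
    case False
    then show ?thesis using tangent_outside[OF v] by (auto simp: tinv_def)
  qed
qed

lemma tco_inject:
  assumes c: "mchart A c" "x \<in> fst c" and "v \<in> tangent_space A x" "w \<in> tangent_space A x"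
    "tco A c x v = tco A c x w"
  shows "v = w"
  using assms tinv_tco[OF c] by metis

lemma subspace_tangent: assumes "x \<in> carrier A" shows "subspace (tangent_space A x)"
proof -
  let ?c = "chart_at A x"
  note c = chart_at_mchart[OF assms]
  have "tangent_space A x = range (tinv A ?c x)"
    using tinv_in tinv_tco c by (metis UNIV_I image_eqI image_subsetI subsetI subset_antisym)
  then show ?thesis using linear_subspace_image[OF linear_tinv subspace_UNIV] c by simp
qed

lemma inv_into_tangent:
  assumes "c \<in> A" "x \<in> fst c"
  shows "inv_into (tangent_space A x) (\<lambda>v. v c) a = tinv A c x a"
proof -
  have c: "mchart A c" "x \<in> fst c" using chart_mchart assms by auto
  have "inj_on (\<lambda>v. v c) (tangent_space A x)"
    by (rule inj_onI) (use tco_inject[OF c] tco_atlas[OF assms] in simp)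
  moreover have "tinv A c x a c = a" using tco_tinv[OF c] tco_atlas[OF assms] tinv_in[OF c] by metis
  ultimately show ?thesis using inv_into_f_f[of "\<lambda>v. v c"] tinv_in[OF c] by metis
qed

lemma linear_cco: "linear (cco A c x)"
  by (rule linearI)
    (simp_all add: cco_def scaleR_fun_def algebra_simps sum.distrib scaleR_sum_right)

lemma linear_covector_tinv:
  assumes c: "mchart A c" "x \<in> fst c" and "\<xi> \<in> dual_space (tangent_space A x)"
  shows "linear (\<lambda>a. \<xi> (tinv A c x a))"
  using linear_on_set_compose[OF linear_tinv[OF c] tinv_in[OF c] dual_spaceD(1)[OF assms(3)]] .

lemma cco_inner:
  assumes c: "mchart A c" "x \<in> fst c" and xi: "\<xi> \<in> dual_space (tangent_space A x)"
  shows "cco A c x \<xi> \<bullet> a = \<xi> (tinv A c x a)"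
  using linear_euclidean_expand[OF linear_covector_tinv[OF assms], of a]
  by (simp add: cco_def euclidean_sum_inner)

lemma covector_apply:
  assumes c: "mchart A c" "x \<in> fst c" and "\<xi> \<in> dual_space (tangent_space A x)" "v \<in> tangent_space A x"
  shows "\<xi> v = cco A c x \<xi> \<bullet> tco A c x v"
  using cco_inner[OF c assms(3)] tinv_tco[OF c assms(4)] by simp

lemma cinv_in: assumes c: "mchart A c" "x \<in> fst c" shows "cinv A c x \<alpha> \<in> dual_space (tangent_space A x)"
  unfolding cinv_def
proof (rule restr_linear_dual[OF subspace_tangent[OF mchart_carrier[OF c]] linear_on_set_linear])
  show "linear (\<lambda>v. \<alpha> \<bullet> tco A c x v)"
    using linear_tco[OF c] by (auto intro!: linearI simp: linear_add linear_scale inner_add_right)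
qed

lemma cco_cinv: assumes c: "mchart A c" "x \<in> fst c" shows "cco A c x (cinv A c x \<alpha>) = \<alpha>"
  by (rule euclidean_eqI)
    (simp add: cco_inner[OF c cinv_in[OF c]], simp add: cinv_def restr_def tinv_in[OF c] tco_tinv[OF c])

lemma cinv_cco:
  assumes c: "mchart A c" "x \<in> fst c" and "\<xi> \<in> dual_space (tangent_space A x)"
  shows "cinv A c x (cco A c x \<xi>) = \<xi>"
  using covector_apply[OF c assms(3)] dual_spaceD(2)[OF assms(3)]
  by (auto simp: cinv_def restr_def)

text \<open>The transpose of \<open>tco_change\<close>: covectors are pulled back, so the transition
  is differentiated from \<open>d\<close> to \<open>c\<close>.\<close>

lemma cco_change:
  assumes c: "mchart A c" "x \<in> fst c" and d: "mchart A d" "x \<in> fst d"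
    and xi: "\<xi> \<in> dual_space (tangent_space A x)"
  shows "cco A d x \<xi> \<bullet> a = cco A c x \<xi> \<bullet> chart_deriv d (snd c) x a"
  using cco_inner[OF d xi] covector_apply[OF c xi tinv_in[OF d]] tco_change[OF d c] tco_tinv[OF d]
  by simp

section \<open>Smooth sections\<close>

lemma near_chart: "mchart A c \<Longrightarrow> x \<in> fst c \<Longrightarrow> near A x (\<lambda>y. y \<in> fst c)"
  by (rule nearI[OF mopen_fst])

lemma smooth_at_tco_change:
  assumes c: "mchart A c" "x \<in> fst c" and d: "mchart A d" "x \<in> fst d"
    and X: "smooth_at A x (\<lambda>y. tco A c y (X y))"
  shows "smooth_at A x (\<lambda>y. tco A d y (X y))"
proof (rule smooth_at_cong[OF _ smooth_at_chart_deriv_field[OF c smooth_at_chart[OF d] X]])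
  show "near A x (\<lambda>y. chart_deriv c (snd d) y (tco A c y (X y)) = tco A d y (X y))"
    by (rule near_mono[OF near_conj[OF near_chart[OF c] near_chart[OF d]]])
      (use tco_change c d in metis)
qed

lemma smooth_at_cco_change:
  assumes c: "mchart A c" "x \<in> fst c" and d: "mchart A d" "x \<in> fst d"
    and xi: "near A x (\<lambda>y. \<xi> y \<in> dual_space (tangent_space A y))"
    and sm: "smooth_at A x (\<lambda>y. cco A c y (\<xi> y))"
  shows "smooth_at A x (\<lambda>y. cco A d y (\<xi> y))"
proof (rule smooth_at_cong)
  show "near A x (\<lambda>y. (\<Sum>b\<in>Basis. (cco A c y (\<xi> y) \<bullet> chart_deriv d (snd c) y b) *\<^sub>R b) = cco A d y (\<xi> y))"
  proof (rule near_mono[OF near_conj[OF near_conj[OF near_chart[OF c] near_chart[OF d]] xi]])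
    fix y assume y: "(y \<in> fst c \<and> y \<in> fst d) \<and> \<xi> y \<in> dual_space (tangent_space A y)"
    then have "cco A d y (\<xi> y) \<bullet> b = cco A c y (\<xi> y) \<bullet> chart_deriv d (snd c) y b" for b
      using cco_change c(1) d(1) by blast
    then show "(\<Sum>b\<in>Basis. (cco A c y (\<xi> y) \<bullet> chart_deriv d (snd c) y b) *\<^sub>R b) = cco A d y (\<xi> y)"
      using euclidean_representation[of "cco A d y (\<xi> y)"] by simp
  qed
  show "smooth_at A x (\<lambda>y. \<Sum>b\<in>Basis. (cco A c y (\<xi> y) \<bullet> chart_deriv d (snd c) y b) *\<^sub>R b)"
    by (intro smooth_at_sum smooth_at_scaleR smooth_at_inner sm smooth_at_chart_deriv[OF d smooth_at_chart[OF c]] smooth_at_const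
        smooth_at_carrier[OF sm])
qed

text \<open>The passage between sheaves and germs. Trivialisation domains must be open, since
  smoothness on \<open>U \<inter> fst t\<close> is smoothness at its points only when that set is
  open.\<close>

lemma smooth_sections_iff:
  assumes U: "mopen A U" and B: "open_trivs A B"
  shows "\<sigma> \<in> smooth_sections A B U \<longleftrightarrow> (\<forall>x\<in>U. sec A B x \<sigma>)"
proof -
  have *: "smooth_fun A (U \<inter> fst t) f \<longleftrightarrow> (\<forall>x\<in>U. x \<in> fst t \<longrightarrow> smooth_at A x f)"
    if "t \<in> btriv B" for t and f :: "'a \<Rightarrow> 'h::real_normed_vector"
    using smooth_fun_iff[OF mopen_Int[OF U], of "fst t"] B that by (auto simp: open_trivs_def)
  have **: "near A x (\<lambda>y. \<sigma> y \<in> fibre B y)" if "\<forall>x\<in>U. \<sigma> x \<in> fibre B x" "x \<in> U" for x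
    using that by (intro nearI[OF U]) auto
  show ?thesis
  proof
    assume "\<sigma> \<in> smooth_sections A B U"
    then have a: "\<forall>x\<in>U. \<sigma> x \<in> fibre B x" "\<And>t. t \<in> btriv B \<Longrightarrow> smooth_fun A (U \<inter> fst t) (\<lambda>x. snd t x (\<sigma> x))"
      unfolding smooth_sections_def by blast+
    show "\<forall>x\<in>U. sec A B x \<sigma>" unfolding sec_def
    proof (intro ballI conjI impI)
      fix x t assume "x \<in> U" "t \<in> btriv B" "x \<in> fst t"
      then show "smooth_at A x (\<lambda>y. snd t y (\<sigma> y))" using a(2) *[of t "\<lambda>x. snd t x (\<sigma> x)"] by blast
    qed (use ** a in blast)
  next
    assume a: "\<forall>x\<in>U. sec A B x \<sigma>"
    then have "\<forall>x\<in>U. \<sigma> x \<in> fibre B x" unfolding sec_def using near_point by metis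
    then show "\<sigma> \<in> smooth_sections A B U" unfolding smooth_sections_def mem_Collect_eq
    proof (intro conjI ballI)
      fix t assume t: "t \<in> btriv B"
      show "smooth_fun A (U \<inter> fst t) (\<lambda>x. snd t x (\<sigma> x))"
        unfolding *[OF t] using a t unfolding sec_def by blast
    qed blast
  qed
qed

lemma open_trivs_tbundle: "open_trivs A (tbundle A)"
  unfolding open_trivs_def Ball_def Bex_def btriv_tbundle
proof (intro conjI allI impI)
  fix x assume "x \<in> carrier A"
  then obtain c where "c \<in> A" "x \<in> fst c" using carrier_chart by metis
  then show "\<exists>t. (\<exists>c. c \<in> A \<and> t = (fst c, \<lambda>x v. v c)) \<and> x \<in> fst t" by (metis fst_conv)
qed (metis mopen_fst chart_mchart fst_conv)

lemma open_trivs_dual: "open_trivs A B \<Longrightarrow> open_trivs A (dual_bundle B)"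
  unfolding open_trivs_def Ball_def Bex_def btriv_dual by (metis fst_conv)

lemma open_trivs_bsum: "open_trivs A B \<Longrightarrow> open_trivs A C \<Longrightarrow> open_trivs A (bsum B C)"
  unfolding open_trivs_def
proof (elim conjE, intro conjI ballI)
  assume B: "\<forall>t\<in>btriv B. mopen A (fst t)" "\<forall>x\<in>carrier A. \<exists>t\<in>btriv B. x \<in> fst t"
    and C: "\<forall>t\<in>btriv C. mopen A (fst t)" "\<forall>x\<in>carrier A. \<exists>t\<in>btriv C. x \<in> fst t"
  show "mopen A (fst t)" if "t \<in> btriv (bsum B C)" for t
    using that B C mopen_Int unfolding btriv_bsum by fastforce
  fix x assume "x \<in> carrier A"
  then obtain s r where "s \<in> btriv B" "r \<in> btriv C" "x \<in> fst s" "x \<in> fst r"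
    using B C by meson
  then show "\<exists>t\<in>btriv (bsum B C). x \<in> fst t"
    unfolding Bex_def btriv_bsum
    by (intro exI[of _ "(fst s \<inter> fst r, \<lambda>x u. (snd s x (fst u), snd r x (snd u)))"])
      (metis IntI fst_conv)
qed

text \<open>The sum is trivialised only by pairs of trivialisations, so to extract one component
  some trivialisation of the other summand around \<open>x\<close> is needed; the covering condition
  in \<open>open_trivs\<close> supplies it.\<close>

lemma sec_bsum:
  assumes B: "open_trivs A B" and C: "open_trivs A C" and x: "x \<in> carrier A"
  shows "sec A (bsum B C) x \<sigma> \<longleftrightarrow> sec A B x (\<lambda>y. fst (\<sigma> y)) \<and> sec A C x (\<lambda>y. snd (\<sigma> y))"
proof
  assume *: "sec A (bsum B C) x \<sigma>"
  have n: "near A x (\<lambda>y. fst (\<sigma> y) \<in> fibre B y)" "near A x (\<lambda>y. snd (\<sigma> y) \<in> fibre C y)"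
    using * by (auto simp: sec_def mem_Times_iff elim!: near_mono)
  have sm: "smooth_at A x (\<lambda>y. (snd s y (fst (\<sigma> y)), snd t y (snd (\<sigma> y))))"
    if "s \<in> btriv B" "t \<in> btriv C" "x \<in> fst s" "x \<in> fst t" for s t
  proof -
    have "(fst s \<inter> fst t, \<lambda>x u. (snd s x (fst u), snd t x (snd u))) \<in> btriv (bsum B C)"
      unfolding btriv_bsum using that by blast
    then show ?thesis using *[unfolded sec_def, THEN conjunct2, THEN bspec] that by fastforce
  qed
  obtain s t where "s \<in> btriv B" "x \<in> fst s" "t \<in> btriv C" "x \<in> fst t"
    using B C x unfolding open_trivs_def by meson
  then show "sec A B x (\<lambda>y. fst (\<sigma> y)) \<and> sec A C x (\<lambda>y. snd (\<sigma> y))"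
    unfolding sec_def using n smooth_at_fst[OF sm] smooth_at_snd[OF sm] by auto
next
  assume *: "sec A B x (\<lambda>y. fst (\<sigma> y)) \<and> sec A C x (\<lambda>y. snd (\<sigma> y))"
  have "near A x (\<lambda>y. \<sigma> y \<in> fibre (bsum B C) y)"
    by (rule near_mono[OF near_conj[of x "\<lambda>y. fst (\<sigma> y) \<in> fibre B y" "\<lambda>y. snd (\<sigma> y) \<in> fibre C y"]])
      (use * in \<open>auto simp: sec_def mem_Times_iff\<close>)
  moreover have "smooth_at A x (\<lambda>y. snd t y (\<sigma> y))" if t: "t \<in> btriv (bsum B C)" "x \<in> fst t" for t
  proof -
    obtain s r where "s \<in> btriv B" "r \<in> btriv C" "t = (fst s \<inter> fst r, \<lambda>x u. (snd s x (fst u), snd r x (snd u)))"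
      using t(1) by (rule btriv_bsumE)
    moreover from this have "smooth_at A x (\<lambda>y. snd s y (fst (\<sigma> y)))" "smooth_at A x (\<lambda>y. snd r y (snd (\<sigma> y)))"
      using * t(2) unfolding sec_def by auto
    ultimately show ?thesis using smooth_at_Pair by simp
  qed
  ultimately show "sec A (bsum B C) x \<sigma>" by (simp add: sec_def)
qed

lemma sec_tbundle:
  assumes c: "mchart A c" "x \<in> fst c"
  shows "sec A (tbundle A) x X \<longleftrightarrow>
    near A x (\<lambda>y. X y \<in> tangent_space A y) \<and> smooth_at A x (\<lambda>y. tco A c y (X y))"
proof -
  have eq: "near A x (\<lambda>y. tco A d y (X y) = X y d)"
    if "near A x (\<lambda>y. X y \<in> tangent_space A y)" "d \<in> A" "x \<in> fst d" for d
    by (rule near_mono[OF near_conj[OF that(1) near_chart[OF chart_mchart[OF that(2)] that(3)]]])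
      (use that tco_atlas in blast)
  have eq': "near A x (\<lambda>y. X y d = tco A d y (X y))"
    if "near A x (\<lambda>y. X y \<in> tangent_space A y)" "d \<in> A" "x \<in> fst d" for d
    using near_mono[OF eq[OF that]] by auto
  have tr: "smooth_at A x (\<lambda>y. snd t y (X y))" if "near A x (\<lambda>y. X y \<in> tangent_space A y)"
    "smooth_at A x (\<lambda>y. tco A c y (X y))" "t \<in> btriv (tbundle A)" "x \<in> fst t" for t
  proof -
    obtain d where d: "d \<in> A" "t = (fst d, \<lambda>x v. v d)" using \<open>t \<in> _\<close> unfolding btriv_tbundle by blast
    then show ?thesis using smooth_at_cong[OF eq smooth_at_tco_change[OF c chart_mchart]] that by simp
  qed
  show ?thesis
  proof
    assume *: "sec A (tbundle A) x X"
    have n: "near A x (\<lambda>y. X y \<in> tangent_space A y)" using * by (simp add: sec_def)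
    obtain d where d: "d \<in> A" "x \<in> fst d" using carrier_chart[OF mchart_carrier[OF c]] by metis
    have "(fst d, \<lambda>x v. v d) \<in> btriv (tbundle A)" using d btriv_tbundle by blast
    then have "smooth_at A x (\<lambda>y. X y d)" using *[unfolded sec_def, THEN conjunct2, THEN bspec] d(2) by fastforce
    then show "near A x (\<lambda>y. X y \<in> tangent_space A y) \<and> smooth_at A x (\<lambda>y. tco A c y (X y))"
      using n smooth_at_tco_change[OF chart_mchart[OF d(1)] d(2) c smooth_at_cong[OF eq'[OF n d]]] by blast
  qed (use tr in \<open>simp add: sec_def\<close>)
qed

lemma dual_triv_eq:
  assumes "d \<in> A" "y \<in> fst d"
  shows "(\<Sum>b\<in>Basis. f (inv_into (tangent_space A y) (\<lambda>v. v d) b) *\<^sub>R b) = cco A d y f"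
  using inv_into_tangent[OF assms] by (simp add: cco_def)

lemma sec_dual_tbundle:
  assumes c: "mchart A c" "x \<in> fst c"
  shows "sec A (dual_bundle (tbundle A)) x \<xi> \<longleftrightarrow>
    near A x (\<lambda>y. \<xi> y \<in> dual_space (tangent_space A y)) \<and> smooth_at A x (\<lambda>y. cco A c y (\<xi> y))"
proof -
  define th where "th d = dual_triv (tbundle A) (fst d, \<lambda>x v. v d)" for d
  have bt: "t \<in> btriv (dual_bundle (tbundle A)) \<longleftrightarrow> (\<exists>d\<in>A. t = (fst d, th d))" for t
    unfolding btriv_dual Bex_def btriv_tbundle th_def by auto
  have eq: "near A x (\<lambda>y. th d y (\<xi> y) = cco A d y (\<xi> y))" "near A x (\<lambda>y. cco A d y (\<xi> y) = th d y (\<xi> y))"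
    if "d \<in> A" "x \<in> fst d" for d
    using near_mono[OF near_chart[OF chart_mchart[OF that(1)] that(2)]] dual_triv_eq[OF that(1)]
    unfolding th_def dual_triv_def by simp_all
  obtain d where d: "d \<in> A" "x \<in> fst d" using carrier_chart[OF mchart_carrier[OF c]] by metis
  have fib: "fibre (dual_bundle (tbundle A)) = (\<lambda>x. dual_space (tangent_space A x))"
    by (simp add: fun_eq_iff)
  show ?thesis
  proof
    assume *: "sec A (dual_bundle (tbundle A)) x \<xi>"
    have n: "near A x (\<lambda>y. \<xi> y \<in> dual_space (tangent_space A y))" using * by (simp add: sec_def fib)
    have "(fst d, th d) \<in> btriv (dual_bundle (tbundle A))" using bt d by blast
    then have "smooth_at A x (\<lambda>y. th d y (\<xi> y))" using *[unfolded sec_def, THEN conjunct2, THEN bspec] d(2) by fastforce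
    then show "near A x (\<lambda>y. \<xi> y \<in> dual_space (tangent_space A y)) \<and> smooth_at A x (\<lambda>y. cco A c y (\<xi> y))"
      using n smooth_at_cco_change[OF chart_mchart[OF d(1)] d(2) c n smooth_at_cong[OF eq(1)[OF d]]] by blast
  next
    assume *: "near A x (\<lambda>y. \<xi> y \<in> dual_space (tangent_space A y)) \<and> smooth_at A x (\<lambda>y. cco A c y (\<xi> y))"
    have "smooth_at A x (\<lambda>y. th d y (\<xi> y))" if "d \<in> A" "x \<in> fst d" for d
      using smooth_at_cong[OF eq(2)[OF that] smooth_at_cco_change[OF c chart_mchart[OF that(1)] that(2)]] * by blast
    then show "sec A (dual_bundle (tbundle A)) x \<xi>"
      using * unfolding sec_def fib Ball_def bt by auto
  qed
qed

section \<open>The Courant bracket in coordinates\<close>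

lemma chart_deriv_scaleR:
  assumes c: "mchart A c" "x \<in> fst c" and f: "smooth_at A x f" and g: "smooth_at A x g"
  shows "chart_deriv c (\<lambda>y. f y *\<^sub>R g y) x a =
    f x *\<^sub>R chart_deriv c g x a + chart_deriv c f x a *\<^sub>R g x"
  by (rule chart_deriv_bilinear[OF assms bounded_bilinear_scaleR])

lemma chart_deriv_inner:
  assumes c: "mchart A c" "x \<in> fst c" and f: "smooth_at A x f" and g: "smooth_at A x g"
  shows "chart_deriv c (\<lambda>y. f y \<bullet> g y) x a = f x \<bullet> chart_deriv c g x a + chart_deriv c f x a \<bullet> g x"
  by (rule chart_deriv_bilinear[OF assms bounded_bilinear_inner])

lemma chart_deriv_sum:
  assumes c: "mchart A c" "x \<in> fst c"
  shows "(\<And>i. i \<in> I \<Longrightarrow> smooth_at A x (f i)) \<Longrightarrow>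
    chart_deriv c (\<lambda>y. \<Sum>i\<in>I. f i y) x a = (\<Sum>i\<in>I. chart_deriv c (f i) x a)"
proof (induction I rule: infinite_finite_induct)
  case (insert i I)
  then show ?case
    using chart_deriv_add[OF c, of "f i" "\<lambda>y. \<Sum>i\<in>I. f i y"] smooth_at_sum[OF mchart_carrier[OF c], of I f]
    by simp
qed (simp_all add: chart_deriv_const)

text \<open>Product rule for a derivative taken in a moving direction, again by expansion in the
  basis. The second term has the direction frozen at \<open>x\<close>, which makes it a second
  derivative of \<open>f\<close> to which symmetry applies.\<close>

lemma chart_deriv_field:
  fixes X :: "'a \<Rightarrow> 'e"
  assumes c: "mchart A c" "x \<in> fst c" and f: "smooth_at A x f" and X: "smooth_at A x X"
  shows "chart_deriv c (\<lambda>y. chart_deriv c f y (X y)) x a =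
    chart_deriv c f x (chart_deriv c X x a) + chart_deriv c (\<lambda>y. chart_deriv c f y (X x)) x a"
proof -
  have nl: "near A x (\<lambda>y. linear (chart_deriv c f y))"
    by (rule near_mono[OF near_conj[OF near_chart[OF c] smooth_at_near[OF f]]])
      (use chart_deriv_linear[OF c(1)] in blast)
  have e: "chart_deriv c (\<lambda>y. chart_deriv c f y (Z y)) x a =
      chart_deriv c (\<lambda>y. \<Sum>b\<in>Basis. (Z y \<bullet> b) *\<^sub>R chart_deriv c f y b) x a" for Z
    by (rule chart_deriv_cong[OF c near_mono[OF nl]]) (rule linear_euclidean_expand)
  have sX: "smooth_at A x (\<lambda>y. X y \<bullet> b)" for b
    by (rule smooth_at_bounded_linear[OF bounded_linear_inner_left X])
  have sk: "smooth_at A x (\<lambda>y. X x \<bullet> b)" for b by (rule smooth_at_const[OF mchart_carrier[OF c]])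
  have l: "linear (chart_deriv c f x)" by (rule chart_deriv_linear[OF c f])
  have "chart_deriv c (\<lambda>y. chart_deriv c f y (X y)) x a =
      (\<Sum>b\<in>Basis. (X x \<bullet> b) *\<^sub>R chart_deriv c (\<lambda>y. chart_deriv c f y b) x a +
         (chart_deriv c X x a \<bullet> b) *\<^sub>R chart_deriv c f x b)"
    by (subst e, subst chart_deriv_sum[OF c])
      (auto simp: chart_deriv_scaleR[OF c sX smooth_at_chart_deriv[OF c f]]
        chart_deriv_bounded_linear[OF c X bounded_linear_inner_left]
        intro!: smooth_at_scaleR sX smooth_at_chart_deriv[OF c f])
  moreover have "chart_deriv c (\<lambda>y. chart_deriv c f y (X x)) x a =
      (\<Sum>b\<in>Basis. (X x \<bullet> b) *\<^sub>R chart_deriv c (\<lambda>y. chart_deriv c f y b) x a)"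
    by (subst e, subst chart_deriv_sum[OF c])
      (auto simp: chart_deriv_scaleR[OF c sk smooth_at_chart_deriv[OF c f]] chart_deriv_const
        intro!: smooth_at_scaleR sk smooth_at_chart_deriv[OF c f])
  moreover have "chart_deriv c f x (chart_deriv c X x a) =
      (\<Sum>b\<in>Basis. (chart_deriv c X x a \<bullet> b) *\<^sub>R chart_deriv c f x b)"
    by (rule linear_euclidean_expand[OF l])
  ultimately show ?thesis by (simp add: sum.distrib add.commute)
qed

definition bracket_co ::
  "('a, 'e) chart \<Rightarrow> ('a \<Rightarrow> ('a, 'e) tvec) \<Rightarrow> ('a \<Rightarrow> ('a, 'e) tvec) \<Rightarrow> 'a \<Rightarrow> 'e" where
  "bracket_co c X Y x = chart_deriv c (\<lambda>y. tco A c y (Y y)) x (tco A c x (X x))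
     - chart_deriv c (\<lambda>y. tco A c y (X y)) x (tco A c x (Y x))"

text \<open>The second derivatives of the transition map enter once from \<open>X\<close> and once
  from \<open>Y\<close>, and cancel by symmetry; the first-order terms transform as a
  vector.\<close>

lemma bracket_co_change:
  assumes c: "mchart A c" "x \<in> fst c" and d: "mchart A d" "x \<in> fst d"
    and X: "smooth_at A x (\<lambda>y. tco A d y (X y))" and Y: "smooth_at A x (\<lambda>y. tco A d y (Y y))"
  shows "bracket_co c X Y x = chart_deriv d (snd c) x (bracket_co d X Y x)"
proof -
  have n: "near A x (\<lambda>y. tco A c y (Z y) = chart_deriv d (snd c) y (tco A d y (Z y)))" for Z
    by (rule near_mono[OF near_conj[OF near_chart[OF c] near_chart[OF d]]])
      (use tco_change c d in metis)
  have half: "chart_deriv c (\<lambda>y. tco A c y (Z y)) x (tco A c x v) =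
      chart_deriv d (snd c) x (chart_deriv d (\<lambda>y. tco A d y (Z y)) x (tco A d x v)) +
      chart_deriv d (\<lambda>y. chart_deriv d (snd c) y (tco A d x (Z x))) x (tco A d x v)"
    if Z: "smooth_at A x (\<lambda>y. tco A d y (Z y))" for Z v
  proof -
    have "chart_deriv c (\<lambda>y. tco A c y (Z y)) x (tco A c x v)
        = chart_deriv d (\<lambda>y. tco A c y (Z y)) x (tco A d x v)"
      using chart_deriv_chain[OF d c smooth_at_tco_change[OF d c Z], of "tco A d x v"] tco_change[OF d c]
      by simp
    also have "\<dots> = chart_deriv d (\<lambda>y. chart_deriv d (snd c) y (tco A d y (Z y))) x (tco A d x v)"
      by (rule chart_deriv_cong[OF d n])
    finally show ?thesis using chart_deriv_field[OF d smooth_at_chart[OF c] Z] by simp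
  qed
  have "linear (chart_deriv d (snd c) x)" by (rule chart_deriv_linear[OF d smooth_at_chart[OF c]])
  then show ?thesis
    unfolding bracket_co_def half[OF X] half[OF Y]
    using chart_deriv_symmetric[OF d smooth_at_chart[OF c], of "tco A d x (X x)" "tco A d x (Y x)"]
    by (simp add: linear_diff)
qed

lemma lie_bracket_co:
  assumes c: "mchart A c" "x \<in> fst c"
    and X: "sec A (tbundle A) x X" and Y: "sec A (tbundle A) x Y"
  shows "lie_bracket A X Y x = tinv A c x (bracket_co c X Y x)"
proof
  fix d
  show "lie_bracket A X Y x d = tinv A c x (bracket_co c X Y x) d"
  proof (cases "d \<in> A \<and> x \<in> fst d")
    case True
    then have d: "d \<in> A" "x \<in> fst d" "mchart A d" using chart_mchart by blast+
    have n: "near A x (\<lambda>y. Z y d = tco A d y (Z y))" and p: "Z x d = tco A d x (Z x)"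
      if Z: "sec A (tbundle A) x Z" for Z
    proof -
      show "near A x (\<lambda>y. Z y d = tco A d y (Z y))"
        by (rule near_mono[OF near_conj[of _ "\<lambda>y. Z y \<in> tangent_space A y"]])
          (use Z d near_chart[OF d(3,2)] tco_atlas[OF d(1)] in \<open>auto simp: sec_def\<close>)
      then show "Z x d = tco A d x (Z x)" by (rule near_point)
    qed
    have "lie_bracket A X Y x d = bracket_co d X Y x"
      using True by (simp add: lie_bracket_def bracket_co_def p[OF X] p[OF Y]
          chart_deriv_cong[OF d(3,2) n[OF X]] chart_deriv_cong[OF d(3,2) n[OF Y]])
    then show ?thesis
      using True bracket_co_change[OF d(3,2) c] X Y sec_tbundle[OF c] by (simp add: tinv_def)
  qed (auto simp: lie_bracket_def tinv_def)
qed

lemma lie_bracket_tangent: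
  assumes "sec A (tbundle A) x X" "sec A (tbundle A) x Y" "x \<in> carrier A"
  shows "lie_bracket A X Y x \<in> tangent_space A x"
  using lie_bracket_co[OF _ _ assms(1,2)] tinv_in chart_at_mchart[OF assms(3)] by metis

lemma tco_lie_bracket:
  assumes c: "mchart A c" "x \<in> fst c"
    and X: "sec A (tbundle A) x X" and Y: "sec A (tbundle A) x Y"
  shows "tco A c x (lie_bracket A X Y x) = bracket_co c X Y x"
  using lie_bracket_co[OF assms] tco_tinv[OF c] by simp

lemma const_ext_tbundle:
  assumes x: "x \<in> carrier A" and w: "w \<in> tangent_space A x"
  shows "sec A (tbundle A) x (const_ext (tbundle A) x w) \<and> const_ext (tbundle A) x w x = w"
proof -
  have "\<exists>t. t \<in> btriv (tbundle A) \<and> x \<in> fst t"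
    using open_trivs_tbundle x unfolding open_trivs_def by blast
  then have "triv_at (tbundle A) x \<in> btriv (tbundle A) \<and> x \<in> fst (triv_at (tbundle A) x)"
    unfolding triv_at_def by (rule someI_ex)
  then obtain c where c: "c \<in> A" "x \<in> fst c" "triv_at (tbundle A) x = (fst c, \<lambda>x v. v c)"
    unfolding btriv_tbundle by (metis fst_conv)
  have m: "mchart A c" using c chart_mchart by blast
  have W: "const_ext (tbundle A) x w y = tinv A c y (w c)" if "y \<in> fst c" for y
    using inv_into_tangent[OF c(1) that] c(3) by (simp add: const_ext_def)
  have n: "near A x (\<lambda>y. const_ext (tbundle A) x w y \<in> tangent_space A y)"
    by (rule near_mono[OF near_chart[OF m c(2)]]) (use W tinv_in[OF m] in simp)
  have "near A x (\<lambda>y. w c = tco A c y (const_ext (tbundle A) x w y))"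
    by (rule near_mono[OF near_chart[OF m c(2)]]) (use W tco_tinv[OF m] in simp)
  then have "smooth_at A x (\<lambda>y. tco A c y (const_ext (tbundle A) x w y))"
    by (rule smooth_at_cong[OF _ smooth_at_const[OF x]])
  then show ?thesis
    using sec_tbundle[OF m c(2)] n W[OF c(2)] tinv_tco[OF m c(2) w] tco_atlas[OF c(1,2) w] by simp
qed

lemma near_covector_apply:
  assumes c: "mchart A c" "x \<in> fst c"
    and "sec A (tbundle A) x X" "sec A (dual_bundle (tbundle A)) x \<xi>"
  shows "near A x (\<lambda>y. \<xi> y (X y) = cco A c y (\<xi> y) \<bullet> tco A c y (X y))"
  by (rule near_mono[OF near_conj[OF near_chart[OF c]
          near_conj[of x "\<lambda>y. X y \<in> tangent_space A y" "\<lambda>y. \<xi> y \<in> dual_space (tangent_space A y)"]]])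
    (use assms sec_tbundle[OF c] sec_dual_tbundle[OF c] covector_apply[OF c(1)] in blast)+

text \<open>The derivative of the auxiliary extension \<open>W\<close> occurs in the derivative of
  \<open>\<eta>(W)\<close> and again inside \<open>\<eta>([X, W])\<close>. The two occurrences
  cancel, so the result depends only on the value \<open>w\<close> and is linear in it.\<close>

lemma lie_form_co:
  assumes c: "mchart A c" "x \<in> fst c"
    and X: "sec A (tbundle A) x X" and eta: "sec A (dual_bundle (tbundle A)) x \<eta>"
  shows "lie_form A X \<eta> x \<in> dual_space (tangent_space A x)"
    "cco A c x (lie_form A X \<eta> x) \<bullet> a = chart_deriv c (\<lambda>y. cco A c y (\<eta> y)) x (tco A c x (X x)) \<bullet> a
      + cco A c x (\<eta> x) \<bullet> chart_deriv c (\<lambda>y. tco A c y (X y)) x a"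
proof -
  note x = mchart_carrier[OF c]
  let ?L = "\<lambda>a. chart_deriv c (\<lambda>y. cco A c y (\<eta> y)) x (tco A c x (X x)) \<bullet> a
      + cco A c x (\<eta> x) \<bullet> chart_deriv c (\<lambda>y. tco A c y (X y)) x a"
  have sX: "smooth_at A x (\<lambda>y. tco A c y (X y))" using X sec_tbundle[OF c] by blast
  have se: "smooth_at A x (\<lambda>y. cco A c y (\<eta> y))" and etax: "\<eta> x \<in> dual_space (tangent_space A x)"
    using eta sec_dual_tbundle[OF c] near_point by blast+
  have main: "lie_form A X \<eta> x w = ?L (tco A c x w)" if w: "w \<in> tangent_space A x" for w
  proof -
    define W where "W = const_ext (tbundle A) x w"
    have W: "sec A (tbundle A) x W" "W x = w" using const_ext_tbundle[OF x w] by (simp_all add: W_def)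
    have sW: "smooth_at A x (\<lambda>y. tco A c y (W y))" using W sec_tbundle[OF c] by blast
    have "dfun A (\<lambda>y. \<eta> y (W y)) x (X x)
        = dfun A (\<lambda>y. cco A c y (\<eta> y) \<bullet> tco A c y (W y)) x (X x)"
      by (rule dfun_cong[OF near_covector_apply[OF c W(1) eta]])
    also have "\<dots> = cco A c x (\<eta> x) \<bullet> chart_deriv c (\<lambda>y. tco A c y (W y)) x (tco A c x (X x))
       + chart_deriv c (\<lambda>y. cco A c y (\<eta> y)) x (tco A c x (X x)) \<bullet> tco A c x w"
      using dfun_tco[OF c smooth_at_inner[OF se sW]] chart_deriv_inner[OF c se sW] W(2) by simp
    finally have 1: "dfun A (\<lambda>y. \<eta> y (W y)) x (X x) = \<dots>" .
    have 2: "\<eta> x (lie_bracket A X W x) = cco A c x (\<eta> x) \<bullet> bracket_co c X W x"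
      using covector_apply[OF c etax lie_bracket_tangent[OF X W(1) x]] tco_lie_bracket[OF c X W(1)]
      by simp
    have "lie_form A X \<eta> x w = dfun A (\<lambda>y. \<eta> y (W y)) x (X x) - \<eta> x (lie_bracket A X W x)"
      using w by (simp add: lie_form_def restr_def W_def Let_def)
    then show ?thesis unfolding 1 2 bracket_co_def using W(2) by (simp add: inner_diff_right)
  qed
  have lin: "linear ?L"
    using chart_deriv_linear[OF c sX]
    by (auto intro!: linearI simp: linear_add linear_scale inner_add_right algebra_simps)
  have "lie_form A X \<eta> x = restr (tangent_space A x) (\<lambda>w. ?L (tco A c x w))"
    using main by (auto simp: restr_def fun_eq_iff lie_form_def)
  also have "\<dots> \<in> dual_space (tangent_space A x)"
    using linear_compose[OF linear_tco[OF c] lin]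
    by (intro restr_linear_dual[OF subspace_tangent[OF x]] linear_on_set_linear) (simp add: o_def)
  finally show in_dual: "lie_form A X \<eta> x \<in> dual_space (tangent_space A x)" .
  show "cco A c x (lie_form A X \<eta> x) \<bullet> a = ?L a"
    using cco_inner[OF c in_dual] main[OF tinv_in[OF c]] tco_tinv[OF c] by simp
qed

lemma d0_co:
  assumes c: "mchart A c" "x \<in> fst c" and f: "smooth_at A x f"
  shows "d0 A f x \<in> dual_space (tangent_space A x)"
    "cco A c x (d0 A f x) \<bullet> a = chart_deriv c f x a"
proof -
  show in_dual: "d0 A f x \<in> dual_space (tangent_space A x)"
    unfolding d0_def
    by (intro restr_linear_dual linear_on_set_linear subspace_tangent mchart_carrier[OF c] linear_dfun f)
  show "cco A c x (d0 A f x) \<bullet> a = chart_deriv c f x a"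
    unfolding cco_inner[OF c in_dual]
    by (simp add: d0_def restr_def tinv_in[OF c] dfun_tco[OF c f] tco_tinv[OF c])
qed

lemma sec_gen:
  assumes "x \<in> carrier A"
  shows "sec A (gen_bundle (tbundle A)) x \<sigma> \<longleftrightarrow>
    sec A (tbundle A) x (\<lambda>y. fst (\<sigma> y)) \<and> sec A (dual_bundle (tbundle A)) x (\<lambda>y. snd (\<sigma> y))"
  unfolding gen_bundle_def
  by (rule sec_bsum[OF open_trivs_tbundle open_trivs_dual[OF open_trivs_tbundle] assms])

text \<open>\<open>L\<^sub>X \<eta> - L\<^sub>Y \<xi> + d(\<xi>(Y) - \<eta>(X))/2\<close>, evaluated on \<open>a\<close>.\<close>

definition courant_co ::
  "('a, 'e) chart \<Rightarrow> ('a \<Rightarrow> ('a, 'e) tvec gen) \<Rightarrow> ('a \<Rightarrow> ('a, 'e) tvec gen) \<Rightarrow> 'a \<Rightarrow> 'e \<Rightarrow> real" where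
  "courant_co c \<sigma> \<tau> x a =
     (let X = (\<lambda>y. tco A c y (fst (\<sigma> y))); \<xi> = (\<lambda>y. cco A c y (snd (\<sigma> y)));
          Y = (\<lambda>y. tco A c y (fst (\<tau> y))); \<eta> = (\<lambda>y. cco A c y (snd (\<tau> y)))
      in chart_deriv c \<eta> x (X x) \<bullet> a + \<eta> x \<bullet> chart_deriv c X x a
        - (chart_deriv c \<xi> x (Y x) \<bullet> a + \<xi> x \<bullet> chart_deriv c Y x a)
        + (1/2) * (\<xi> x \<bullet> chart_deriv c Y x a + chart_deriv c \<xi> x a \<bullet> Y x
            - (\<eta> x \<bullet> chart_deriv c X x a + chart_deriv c \<eta> x a \<bullet> X x)))"

lemma courant_coordinates:
  assumes c: "mchart A c" "x \<in> fst c"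
    and s: "sec A (gen_bundle (tbundle A)) x \<sigma>" and t: "sec A (gen_bundle (tbundle A)) x \<tau>"
  shows "fst (courant A \<sigma> \<tau> x) \<in> tangent_space A x"
    "snd (courant A \<sigma> \<tau> x) \<in> dual_space (tangent_space A x)"
    "tco A c x (fst (courant A \<sigma> \<tau> x)) = bracket_co c (\<lambda>y. fst (\<sigma> y)) (\<lambda>y. fst (\<tau> y)) x"
    "cco A c x (snd (courant A \<sigma> \<tau> x)) \<bullet> a = courant_co c \<sigma> \<tau> x a"
proof -
  note x = mchart_carrier[OF c]
  let ?X = "\<lambda>y. fst (\<sigma> y)" and ?Y = "\<lambda>y. fst (\<tau> y)" and ?xi = "\<lambda>y. snd (\<sigma> y)" and ?eta = "\<lambda>y. snd (\<tau> y)"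
  have X: "sec A (tbundle A) x ?X" and xi: "sec A (dual_bundle (tbundle A)) x ?xi"
    and Y: "sec A (tbundle A) x ?Y" and eta: "sec A (dual_bundle (tbundle A)) x ?eta"
    using s t sec_gen[OF x] by blast+
  have sX: "smooth_at A x (\<lambda>y. tco A c y (?X y))" and sY: "smooth_at A x (\<lambda>y. tco A c y (?Y y))"
    using X[unfolded sec_tbundle[OF c]] Y[unfolded sec_tbundle[OF c]] by simp_all
  have sxi: "smooth_at A x (\<lambda>y. cco A c y (?xi y))" and seta: "smooth_at A x (\<lambda>y. cco A c y (?eta y))"
    using xi[unfolded sec_dual_tbundle[OF c]] eta[unfolded sec_dual_tbundle[OF c]] by simp_all
  let ?h = "\<lambda>y. snd (\<sigma> y) (fst (\<tau> y)) - snd (\<tau> y) (fst (\<sigma> y))"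
  let ?h' = "\<lambda>y. cco A c y (?xi y) \<bullet> tco A c y (?Y y) - cco A c y (?eta y) \<bullet> tco A c y (?X y)"
  \<comment> \<open>The function under d applies covectors as functionals; near \<open>x\<close> it
    is an inner product of coordinates, which the product rule can differentiate.\<close>
  have n: "near A x (\<lambda>y. ?h' y = ?h y)"
    by (rule near_mono[OF near_conj[OF near_covector_apply[OF c Y xi] near_covector_apply[OF c X eta]]])
      simp
  have sh': "smooth_at A x ?h'" by (intro smooth_at_diff smooth_at_inner sX sY sxi seta)
  have sh: "smooth_at A x ?h" by (rule smooth_at_cong[OF n sh'])
  have dh: "chart_deriv c ?h x a = cco A c x (?xi x) \<bullet> chart_deriv c (\<lambda>y. tco A c y (?Y y)) x a
      + chart_deriv c (\<lambda>y. cco A c y (?xi y)) x a \<bullet> tco A c x (?Y x)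
      - (cco A c x (?eta x) \<bullet> chart_deriv c (\<lambda>y. tco A c y (?X y)) x a
      + chart_deriv c (\<lambda>y. cco A c y (?eta y)) x a \<bullet> tco A c x (?X x))"
    unfolding chart_deriv_cong[OF c n, symmetric]
    by (simp add: chart_deriv_diff[OF c] chart_deriv_inner[OF c] smooth_at_inner sX sY sxi seta)
  have f: "fst (courant A \<sigma> \<tau> x) = lie_bracket A ?X ?Y x"
    "snd (courant A \<sigma> \<tau> x) = lie_form A ?X ?eta x - lie_form A ?Y ?xi x + (1/2) *\<^sub>R d0 A ?h x"
    by (simp_all add: courant_def Let_def)
  show "fst (courant A \<sigma> \<tau> x) \<in> tangent_space A x"
    unfolding f by (rule lie_bracket_tangent[OF X Y x])
  show "tco A c x (fst (courant A \<sigma> \<tau> x)) = bracket_co c ?X ?Y x"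
    unfolding f by (rule tco_lie_bracket[OF c X Y])
  show "snd (courant A \<sigma> \<tau> x) \<in> dual_space (tangent_space A x)"
    unfolding f
    by (intro subspace_add subspace_diff subspace_scale subspace_dual_space lie_form_co(1)[OF c]
        d0_co(1)[OF c] X Y xi eta sh)
  show "cco A c x (snd (courant A \<sigma> \<tau> x)) \<bullet> a = courant_co c \<sigma> \<tau> x a"
    unfolding f
    by (simp add: linear_add[OF linear_cco] linear_diff[OF linear_cco] linear_scale[OF linear_cco]
        inner_add_left inner_diff_left lie_form_co(2)[OF c X eta] lie_form_co(2)[OF c Y xi]
        d0_co(2)[OF c sh] dh courant_co_def Let_def)
qed

text \<open>\<open>sec\<close> quantifies over all trivialisations around \<open>x\<close>, possibly
  infinitely many, whose neighbourhoods cannot be intersected. Testing in a single chart leaves four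
  conditions, each of which spreads to a neighbourhood.\<close>

lemma near_sec:
  assumes "x \<in> carrier A" "sec A (gen_bundle (tbundle A)) x \<sigma>"
  shows "near A x (\<lambda>y. sec A (gen_bundle (tbundle A)) y \<sigma>)"
proof -
  let ?c = "chart_at A x"
  have c: "mchart A ?c" "x \<in> fst ?c" using chart_at_mchart[OF assms(1)] by auto
  have *: "near A y (\<lambda>y. fst (\<sigma> y) \<in> tangent_space A y) \<and> smooth_at A y (\<lambda>y. tco A ?c y (fst (\<sigma> y))) \<and>
      near A y (\<lambda>y. snd (\<sigma> y) \<in> dual_space (tangent_space A y)) \<and> smooth_at A y (\<lambda>y. cco A ?c y (snd (\<sigma> y)))
      \<longleftrightarrow> sec A (gen_bundle (tbundle A)) y \<sigma>" if "y \<in> fst ?c" for y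
    unfolding sec_gen[OF mchart_carrier[OF c(1) that]] sec_tbundle[OF c(1) that]
      sec_dual_tbundle[OF c(1) that] by simp
  note ** = *[OF c(2), THEN iffD2, OF assms(2)]
  have "near A x (\<lambda>y. near A y (\<lambda>y. fst (\<sigma> y) \<in> tangent_space A y) \<and>
      smooth_at A y (\<lambda>y. tco A ?c y (fst (\<sigma> y))) \<and>
      near A y (\<lambda>y. snd (\<sigma> y) \<in> dual_space (tangent_space A y)) \<and> smooth_at A y (\<lambda>y. cco A ?c y (snd (\<sigma> y))))"
    using ** by (intro near_conj near_near smooth_at_near) blast+
  from near_conj[OF this near_chart[OF c]] show ?thesis
  proof (rule near_mono)
    fix y assume y: "(near A y (\<lambda>y. fst (\<sigma> y) \<in> tangent_space A y) \<and>
      smooth_at A y (\<lambda>y. tco A ?c y (fst (\<sigma> y))) \<and>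
      near A y (\<lambda>y. snd (\<sigma> y) \<in> dual_space (tangent_space A y)) \<and>
      smooth_at A y (\<lambda>y. cco A ?c y (snd (\<sigma> y)))) \<and> y \<in> fst ?c"
    show "sec A (gen_bundle (tbundle A)) y \<sigma>"
      by (rule *[THEN iffD1, OF conjunct2[OF y] conjunct1[OF y]])
  qed
qed

text \<open>The coordinate formulas for the bracket hold at every point near \<open>x\<close>, and
  they are built from smooth coordinates and their first derivatives.\<close>

lemma sec_courant:
  assumes x: "x \<in> carrier A"
    and s: "sec A (gen_bundle (tbundle A)) x \<sigma>" and t: "sec A (gen_bundle (tbundle A)) x \<tau>"
  shows "sec A (gen_bundle (tbundle A)) x (courant A \<sigma> \<tau>)"
proof -
  let ?c = "chart_at A x"
  have c: "mchart A ?c" "x \<in> fst ?c" using chart_at_mchart[OF x] by auto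
  have n: "near A x (\<lambda>y. y \<in> fst ?c \<and> sec A (gen_bundle (tbundle A)) y \<sigma> \<and> sec A (gen_bundle (tbundle A)) y \<tau>)"
    by (intro near_conj near_chart c near_sec x s t)
  have sm: "smooth_at A x (\<lambda>y. tco A ?c y (fst (\<sigma> y)))" "smooth_at A x (\<lambda>y. tco A ?c y (fst (\<tau> y)))"
    "smooth_at A x (\<lambda>y. cco A ?c y (snd (\<sigma> y)))" "smooth_at A x (\<lambda>y. cco A ?c y (snd (\<tau> y)))"
    using s[unfolded sec_gen[OF x] sec_tbundle[OF c] sec_dual_tbundle[OF c]]
      t[unfolded sec_gen[OF x] sec_tbundle[OF c] sec_dual_tbundle[OF c]] by simp_all
  have t1: "near A x (\<lambda>y. fst (courant A \<sigma> \<tau> y) \<in> tangent_space A y)"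
    "near A x (\<lambda>y. snd (courant A \<sigma> \<tau> y) \<in> dual_space (tangent_space A y))"
    by (rule near_mono[OF n], use courant_coordinates[OF c(1)] in blast)+
  have t2: "near A x (\<lambda>y. bracket_co ?c (\<lambda>y. fst (\<sigma> y)) (\<lambda>y. fst (\<tau> y)) y = tco A ?c y (fst (courant A \<sigma> \<tau> y)))"
    by (rule near_mono[OF n]) (use courant_coordinates(3)[OF c(1)] in metis)
  have t3: "near A x (\<lambda>y. (\<Sum>b\<in>Basis. courant_co ?c \<sigma> \<tau> y b *\<^sub>R b) = cco A ?c y (snd (courant A \<sigma> \<tau> y)))"
  proof (rule near_mono[OF n])
    fix y assume "y \<in> fst ?c \<and> sec A (gen_bundle (tbundle A)) y \<sigma> \<and> sec A (gen_bundle (tbundle A)) y \<tau>"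
    then have "courant_co ?c \<sigma> \<tau> y b = cco A ?c y (snd (courant A \<sigma> \<tau> y)) \<bullet> b" for b
      using courant_coordinates(4)[OF c(1)] by metis
    then show "(\<Sum>b\<in>Basis. courant_co ?c \<sigma> \<tau> y b *\<^sub>R b) = cco A ?c y (snd (courant A \<sigma> \<tau> y))"
      by (simp add: euclidean_representation)
  qed
  have "smooth_at A x (bracket_co ?c (\<lambda>y. fst (\<sigma> y)) (\<lambda>y. fst (\<tau> y)))"
    unfolding bracket_co_def[abs_def] by (intro smooth_at_diff smooth_at_chart_deriv_field[OF c] sm)
  moreover have "smooth_at A x (\<lambda>y. \<Sum>b\<in>Basis. courant_co ?c \<sigma> \<tau> y b *\<^sub>R b)"
    unfolding courant_co_def Let_def
    by (intro smooth_at_sum[OF x] smooth_at_scaleR smooth_at_add smooth_at_diff smooth_at_inner smooth_at_chart_deriv_field[OF c]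
        smooth_at_bilinear[OF bounded_bilinear_mult] smooth_at_chart_deriv[OF c] sm smooth_at_const[OF x])
  ultimately show ?thesis
    unfolding sec_gen[OF x] sec_tbundle[OF c] sec_dual_tbundle[OF c]
    using smooth_at_cong[OF t2] smooth_at_cong[OF t3] t1 by blast
qed

end

section \<open>Smooth maps and their derivatives\<close>

lemma scaleR_fun_apply: "(k *\<^sub>R f) x = k *\<^sub>R f x"
  by (simp add: scaleR_fun_def)

text \<open>Continuity is a separate clause: the coordinate expression of \<open>f\<close> has a
  meaning only where \<open>f\<close> stays in the domain of the chart.\<close>

definition smooth_map_at :: "('a, 'e::euclidean_space) atlas \<Rightarrow> ('b, 'f::euclidean_space) atlas \<Rightarrow> 'a \<Rightarrow>
    ('a \<Rightarrow> 'b) \<Rightarrow> bool" where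
  "smooth_map_at A B x f \<longleftrightarrow> x \<in> carrier A \<and> f x \<in> carrier B \<and>
     (\<forall>V. mopen B V \<longrightarrow> f x \<in> V \<longrightarrow> near A x (\<lambda>y. f y \<in> V)) \<and>
     (\<forall>d\<in>B. f x \<in> fst d \<longrightarrow> smooth_at A x (\<lambda>y. snd d (f y)))"

lemma smooth_map_atD:
  assumes "smooth_map_at A B x f"
  shows "x \<in> carrier A" "f x \<in> carrier B" "mopen B V \<Longrightarrow> f x \<in> V \<Longrightarrow> near A x (\<lambda>y. f y \<in> V)"
    "d \<in> B \<Longrightarrow> f x \<in> fst d \<Longrightarrow> smooth_at A x (\<lambda>y. snd d (f y))"
  using assms unfolding smooth_map_at_def by blast+

locale satlas2 = A: satlas A + B: satlas B
  for A :: "('a, 'e::euclidean_space) atlas" and B :: "('b, 'f::euclidean_space) atlas"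
begin

lemma smooth_map_at_smooth_at:
  assumes f: "smooth_map_at A B x f" and g: "smooth_at B (f x) g"
  shows "smooth_at A x (\<lambda>y. g (f y))"
proof -
  obtain e where e: "e \<in> B" "f x \<in> fst e" using carrier_chart[OF smooth_map_atD(2)[OF f]] by metis
  note me = B.chart_mchart[OF e(1)]
  obtain S where S: "open S" "snd e (f x) \<in> S" "S \<subseteq> snd e ` fst e" "smooth_on S (g \<circ> chart_inv e)"
    using g B.smooth_at_chart_iff[OF me e(2)] by metis
  have "smooth_at A x (\<lambda>y. (g \<circ> chart_inv e) (snd e (f y)))"
    by (rule A.smooth_at_compose[OF smooth_map_atD(4)[OF f e] S(1,2,4)])
  moreover have "near A x (\<lambda>y. (g \<circ> chart_inv e) (snd e (f y)) = g (f y))"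
    by (rule A.near_mono[OF smooth_map_atD(3)[OF f B.mopen_fst[OF me] e(2)]]) (simp add: mchart_inv[OF me])
  ultimately show ?thesis by (rule A.smooth_at_cong[rotated])
qed

lemma smooth_map_at_mchart: "smooth_map_at A B x f \<Longrightarrow> mchart B d \<Longrightarrow> f x \<in> fst d \<Longrightarrow> smooth_at A x (\<lambda>y. snd d (f y))"
  by (rule smooth_map_at_smooth_at) (auto intro: B.smooth_at_chart)

lemma smooth_map_at_near:
  assumes f: "smooth_map_at A B x f" and P: "near B (f x) P" shows "near A x (\<lambda>y. P (f y))"
proof -
  obtain V where V: "mopen B V" "f x \<in> V" "\<forall>z\<in>V. P z" using P unfolding near_def by blast
  show ?thesis by (rule A.near_mono[OF smooth_map_atD(3)[OF f V(1,2)]]) (use V in blast)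
qed

lemma smooth_map_atI:
  assumes d: "mchart B d" "f x \<in> fst d" and n: "near A x (\<lambda>y. f y \<in> fst d)"
    and s: "smooth_at A x (\<lambda>y. snd d (f y))"
  shows "smooth_map_at A B x f"
  unfolding smooth_map_at_def
proof (intro conjI allI impI ballI)
  show "x \<in> carrier A" by (rule A.smooth_at_carrier[OF s])
  show "f x \<in> carrier B" by (rule mchart_carrier[OF d])
  show "near A x (\<lambda>y. f y \<in> V)" if V: "mopen B V" "f x \<in> V" for V
  proof (rule A.near_mono[OF A.near_conj[OF n A.near_of_continuous[OF s B.mopen_image[OF d(1) V(1)]]]])
    show "snd d (f x) \<in> snd d ` (V \<inter> fst d)" using V d by blast
    show "f y \<in> V" if "f y \<in> fst d \<and> snd d (f y) \<in> snd d ` (V \<inter> fst d)" for y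
      using that mchart_inj[OF d(1)] unfolding inj_on_def by blast
  qed
  show "smooth_at A x (\<lambda>y. snd e (f y))" if e: "e \<in> B" "f x \<in> fst e" for e
  proof -
    note me = B.chart_mchart[OF e(1)]
    have "smooth_at A x (\<lambda>y. (snd e \<circ> chart_inv d) (snd d (f y)))"
    proof (rule A.smooth_at_compose[OF s _ _ B.transition_smooth[OF d(1) me]])
      show "open (snd d ` (fst d \<inter> fst e))"
        using B.mopen_image[OF d(1) B.mopen_fst[OF me]] by (simp add: Int_commute)
      show "snd d (f x) \<in> snd d ` (fst d \<inter> fst e)" using d e by blast
    qed
    moreover have "near A x (\<lambda>y. (snd e \<circ> chart_inv d) (snd d (f y)) = snd e (f y))"
      by (rule A.near_mono[OF n]) (simp add: mchart_inv[OF d(1)])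
    ultimately show ?thesis by (rule A.smooth_at_cong[rotated])
  qed
qed

lemma smooth_map_smooth_map_at:
  assumes f: "smooth_map A B f" and x: "x \<in> carrier A"
  shows "smooth_map_at A B x f"
proof -
  obtain c where c: "c \<in> A" "x \<in> fst c" using carrier_chart[OF x] by metis
  have "f x \<in> carrier B" using f x by (auto simp: smooth_map_def)
  then obtain d where d: "d \<in> B" "f x \<in> fst d" using carrier_chart by metis
  note mc = A.chart_mchart[OF c(1)]
  let ?S = "snd c ` (fst c \<inter> f -` fst d)"
  have S: "open ?S" "smooth_on ?S (snd d \<circ> f \<circ> chart_inv c)"
    using f c d unfolding smooth_map_def by blast+
  show ?thesis
  proof (rule smooth_map_atI[of d f, OF B.chart_mchart[OF d(1)] d(2)])
    show "near A x (\<lambda>y. f y \<in> fst d)"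
    proof (rule A.nearI[OF A.mopen_preimage[OF mc S(1)]])
      show "x \<in> {x \<in> fst c. snd c x \<in> ?S}" using c d by blast
      show "f y \<in> fst d" if "y \<in> {x \<in> fst c. snd c x \<in> ?S}" for y
        using that mchart_inj[OF mc] unfolding inj_on_def by blast
    qed
    show "smooth_at A x (\<lambda>y. snd d (f y))"
      unfolding A.smooth_at_chart_iff[OF mc c(2)]
      using S c d by (intro exI[of _ ?S]) (auto simp: o_def)
  qed
qed

lemma dfun_comp_chart:
  assumes f: "smooth_map_at A B x f" and d: "mchart B d" "f x \<in> fst d" and g: "smooth_at B (f x) g"
  shows "dfun A (\<lambda>y. g (f y)) x v = chart_deriv d g (f x) (dfun A (\<lambda>y. snd d (f y)) x v)"
proof -
  let ?c = "chart_at A x"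
  have c: "mchart A ?c" "x \<in> fst ?c" using A.chart_at_mchart[OF smooth_map_atD(1)[OF f]] by auto
  obtain U where U: "mopen A U" "x \<in> U" "\<forall>y\<in>U. f y \<in> fst d"
    using smooth_map_atD(3)[OF f B.mopen_fst[OF d(1)] d(2)] unfolding near_def by blast
  have "frechet_derivative ((\<lambda>y. g (f y)) \<circ> chart_inv ?c) (at (snd ?c x)) =
      frechet_derivative (\<lambda>p. (g \<circ> chart_inv d) (((\<lambda>y. snd d (f y)) \<circ> chart_inv ?c) p)) (at (snd ?c x))"
    by (rule frechet_derivative_cong_open[OF A.mopen_image[OF c(1) U(1)]])
      (use U c mchart_inv[OF c(1)] mchart_inv[OF d(1)] in auto)
  then show ?thesis
    using frechet_derivative_chain[of "(\<lambda>y. snd d (f y)) \<circ> chart_inv ?c" "snd ?c x" "g \<circ> chart_inv d"]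
      A.differentiable_chart[OF c smooth_map_at_mchart[OF f d]] B.differentiable_chart[OF d g]
    by (simp add: dfun_def chart_deriv_def mchart_inv[OF c])
qed

lemma mdiff_in:
  assumes f: "smooth_map_at A B x f" shows "mdiff A B f x v \<in> tangent_space B (f x)"
  unfolding tangent_space_def mem_Collect_eq
proof (intro conjI ballI allI impI)
  fix d e assume d: "d \<in> B" and e: "e \<in> B" and fd: "f x \<in> fst d" and fe: "f x \<in> fst e"
  show "mdiff A B f x v e = chart_deriv d (snd e) (f x) (mdiff A B f x v d)"
    using dfun_comp_chart[OF f B.chart_mchart[OF d] fd B.smooth_at_chart[OF B.chart_mchart[OF e] fe], of v]
      d e fd fe by (simp add: mdiff_def)
qed (auto simp only: mdiff_def if_False)

lemma tco_mdiff:
  assumes f: "smooth_map_at A B x f" and d: "mchart B d" "f x \<in> fst d"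
  shows "tco B d (f x) (mdiff A B f x v) = dfun A (\<lambda>y. snd d (f y)) x v"
proof -
  note e = chart_at[OF smooth_map_atD(2)[OF f]]
  have "tco B d (f x) (mdiff A B f x v)
      = chart_deriv (chart_at B (f x)) (snd d) (f x) (dfun A (\<lambda>y. snd (chart_at B (f x)) (f y)) x v)"
    using e by (simp add: tco_def dfun_def[of B] mdiff_def)
  then show ?thesis
    using dfun_comp_chart[OF f _ _ B.smooth_at_chart[OF d], of "chart_at B (f x)" v] e B.chart_mchart by simp
qed

lemma dfun_comp:
  assumes f: "smooth_map_at A B x f" and g: "smooth_at B (f x) g"
  shows "dfun A (\<lambda>y. g (f y)) x v = dfun B g (f x) (mdiff A B f x v)"
proof -
  have d: "mchart B (chart_at B (f x))" "f x \<in> fst (chart_at B (f x))"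
    using B.chart_at_mchart[OF smooth_map_atD(2)[OF f]] by auto
  show ?thesis
    using dfun_comp_chart[OF f d g] B.dfun_tco[OF d g] tco_mdiff[OF f d] by simp
qed

end

context satlas
begin

text \<open>\<open>velocity\<close> reads the curve in charts of the atlas. By the chain rule a
  single compatible chart containing the curve near time 0 determines all these readings.\<close>

lemma velocity_eq:
  assumes k: "mchart A k" "\<gamma> 0 \<in> fst k" and S: "open S" "0 \<in> S" "\<And>r. r \<in> S \<Longrightarrow> \<gamma> r \<in> fst k"
    and d: "((\<lambda>r. snd k (\<gamma> r)) has_vector_derivative b) (at 0)"
  shows "velocity A \<gamma> 0 = tinv A k (\<gamma> 0) b"
proof
  fix c
  show "velocity A \<gamma> 0 c = tinv A k (\<gamma> 0) b c"
  proof (cases "c \<in> A \<and> \<gamma> 0 \<in> fst c")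
    case True
    let ?g = "snd c \<circ> chart_inv k"
    have "(?g has_derivative frechet_derivative ?g (at (snd k (\<gamma> 0)))) (at (snd k (\<gamma> 0)))"
      using differentiable_chart[OF k smooth_at_chart[OF chart_mchart]] True frechet_derivative_works by blast
    from vector_derivative_diff_chain_within[of _ _ _ UNIV ?g, OF d has_derivative_at_withinI[OF this]]
    have "((?g \<circ> (\<lambda>r. snd k (\<gamma> r))) has_vector_derivative
        frechet_derivative ?g (at (snd k (\<gamma> 0))) b) (at 0)" .
    then have "((\<lambda>r. snd c (\<gamma> r)) has_vector_derivative frechet_derivative ?g (at (snd k (\<gamma> 0))) b) (at 0)"
      by (rule has_vector_derivative_transform_within_open[OF _ S(1,2)])
        (simp add: mchart_inv[OF k(1) S(3)])
    then show ?thesis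
      using True by (simp add: velocity_def tinv_def chart_deriv_def vector_derivative_at)
  qed (auto simp: velocity_def tinv_def)
qed

lemma dfun_linear:
  fixes f :: "'a \<Rightarrow> 'b::euclidean_space"
  assumes "linear h" "smooth_at A x f"
  shows "dfun A (\<lambda>y. h (f y)) x v = h (dfun A f x v)"
  using chart_deriv_bounded_linear[OF _ _ assms(2), of "chart_at A x" h]
    chart_at_mchart[OF smooth_at_carrier[OF assms(2)]] assms(1)
  by (simp add: dfun_def linear_conv_bounded_linear)

lemma dfun_add:
  "smooth_at A x f \<Longrightarrow> smooth_at A x g \<Longrightarrow> dfun A (\<lambda>y. f y + g y) x v = dfun A f x v + dfun A g x v"
  using chart_deriv_add[of "chart_at A x" x f g] chart_at_mchart[OF smooth_at_carrier, of x f]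
  by (simp add: dfun_def)

lemma dfun_scaleR:
  "smooth_at A x f \<Longrightarrow> smooth_at A x g \<Longrightarrow>
    dfun A (\<lambda>y. f y *\<^sub>R g y) x v = dfun A f x v *\<^sub>R g x + f x *\<^sub>R dfun A g x v"
  using chart_deriv_scaleR[of "chart_at A x" x f g] chart_at_mchart[OF smooth_at_carrier, of x f]
  by (simp add: dfun_def)

lemma smooth_at_dfun_field:
  assumes f: "smooth_at A x f" and X: "sec A (tbundle A) x X"
  shows "smooth_at A x (\<lambda>y. dfun A f y (X y))"
proof -
  let ?c = "chart_at A x"
  have c: "mchart A ?c" "x \<in> fst ?c" using chart_at_mchart[OF smooth_at_carrier[OF f]] by auto
  have "near A x (\<lambda>y. chart_deriv ?c f y (tco A ?c y (X y)) = dfun A f y (X y))"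
    by (rule near_mono[OF near_conj[OF near_chart[OF c] smooth_at_near[OF f]]])
      (use dfun_tco[OF c(1)] in metis)
  then show ?thesis
    by (rule smooth_at_cong[OF _ smooth_at_chart_deriv_field[OF c f]]) (use X sec_tbundle[OF c] in blast)
qed

text \<open>The second derivatives of \<open>f\<close> cancel by symmetry. For a connection that
  differentiates components this identity is the vanishing of the curvature.\<close>

lemma dfun_lie_bracket:
  fixes f :: "'a \<Rightarrow> 'b::euclidean_space"
  assumes f: "smooth_at A x f" and X: "sec A (tbundle A) x X" and Y: "sec A (tbundle A) x Y"
  shows "dfun A (\<lambda>y. dfun A f y (Y y)) x (X x) - dfun A (\<lambda>y. dfun A f y (X y)) x (Y x)
    = dfun A f x (lie_bracket A X Y x)"
proof -
  let ?c = "chart_at A x"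
  have c: "mchart A ?c" "x \<in> fst ?c" using chart_at_mchart[OF smooth_at_carrier[OF f]] by auto
  have *: "dfun A (\<lambda>y. dfun A f y (Y y)) x v =
      chart_deriv ?c f x (chart_deriv ?c (\<lambda>y. tco A ?c y (Y y)) x (tco A ?c x v)) +
      chart_deriv ?c (\<lambda>y. chart_deriv ?c f y (tco A ?c x (Y x))) x (tco A ?c x v)"
    if Y: "sec A (tbundle A) x Y" for Y v
  proof -
    have sY: "smooth_at A x (\<lambda>y. tco A ?c y (Y y))" using Y sec_tbundle[OF c] by blast
    have n: "near A x (\<lambda>y. dfun A f y (Y y) = chart_deriv ?c f y (tco A ?c y (Y y)))"
      by (rule near_mono[OF near_conj[OF near_chart[OF c] smooth_at_near[OF f]]])
        (use dfun_tco[OF c(1)] in metis)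
    show ?thesis
      unfolding dfun_cong[OF n] dfun_tco[OF c smooth_at_chart_deriv_field[OF c f sY]]
      by (rule chart_deriv_field[OF c f sY])
  qed
  show ?thesis
    unfolding *[OF X] *[OF Y] dfun_tco[OF c f] tco_lie_bracket[OF c X Y] bracket_co_def
    using chart_deriv_symmetric[OF c f, of "tco A ?c x (X x)" "tco A ?c x (Y x)"]
    by (simp add: linear_diff[OF chart_deriv_linear[OF c f]])
qed

end

section \<open>Vector bundles and flat bundles\<close>

text \<open>Changes of trivialisation are required to be smooth on each fixed coordinate vector
  \<open>a\<close>; by linearity this amounts to smooth matrix entries.\<close>

locale smooth_bundle = satlas A
  for A :: "('m, 'e::euclidean_space) atlas" +
  fixes B :: "('m, 'v::real_vector, 'f::euclidean_space) vbundle"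
  assumes trivs_open: "open_trivs A B"
    and fibre_subspace: "t \<in> btriv B \<Longrightarrow> x \<in> fst t \<Longrightarrow> subspace (fibre B x)"
    and triv_linear: "t \<in> btriv B \<Longrightarrow> x \<in> fst t \<Longrightarrow> linear_on_set (fibre B x) (snd t x)"
    and triv_bij: "t \<in> btriv B \<Longrightarrow> x \<in> fst t \<Longrightarrow> bij_betw (snd t x) (fibre B x) UNIV"
    and transition_smooth_triv: "s \<in> btriv B \<Longrightarrow> t \<in> btriv B \<Longrightarrow> x \<in> fst s \<Longrightarrow> x \<in> fst t \<Longrightarrow>
      smooth_at A x (\<lambda>y. snd s y (inv_into (fibre B y) (snd t y) a))"
begin

definition vinv :: "'m set \<times> ('m \<Rightarrow> 'v \<Rightarrow> 'f) \<Rightarrow> 'm \<Rightarrow> 'f \<Rightarrow> 'v" where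
  "vinv t x = inv_into (fibre B x) (snd t x)"

lemma vinv_in: "t \<in> btriv B \<Longrightarrow> x \<in> fst t \<Longrightarrow> vinv t x a \<in> fibre B x"
  using triv_bij[of t x] by (auto simp: vinv_def bij_betw_def intro: inv_into_into)

lemma triv_vinv: "t \<in> btriv B \<Longrightarrow> x \<in> fst t \<Longrightarrow> snd t x (vinv t x a) = a"
  using triv_bij[of t x] by (simp add: vinv_def bij_betw_inv_into_right)

lemma vinv_triv: "t \<in> btriv B \<Longrightarrow> x \<in> fst t \<Longrightarrow> v \<in> fibre B x \<Longrightarrow> vinv t x (snd t x v) = v"
  using triv_bij[of t x] by (simp add: vinv_def bij_betw_inv_into_left)

lemma vinv_eqI: "t \<in> btriv B \<Longrightarrow> x \<in> fst t \<Longrightarrow> v \<in> fibre B x \<Longrightarrow> snd t x v = a \<Longrightarrow> vinv t x a = v"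
  using vinv_triv by blast

lemma linear_vinv: assumes "t \<in> btriv B" "x \<in> fst t" shows "linear (vinv t x)"
proof (rule linearI)
  note l = linear_on_setD[OF triv_linear[OF assms]]
  show "vinv t x (a + b) = vinv t x a + vinv t x b" for a b
    by (rule vinv_eqI[OF assms subspace_add[OF fibre_subspace[OF assms] vinv_in vinv_in]])
      (simp_all add: assms l vinv_in triv_vinv)
  show "vinv t x (k *\<^sub>R a) = k *\<^sub>R vinv t x a" for k a
    by (rule vinv_eqI[OF assms subspace_scale[OF fibre_subspace[OF assms] vinv_in]])
      (simp_all add: assms l vinv_in triv_vinv)
qed

lemma triv_open: "t \<in> btriv B \<Longrightarrow> mopen A (fst t)"
  using trivs_open unfolding open_trivs_def by blast

lemma near_triv: "t \<in> btriv B \<Longrightarrow> x \<in> fst t \<Longrightarrow> near A x (\<lambda>y. y \<in> fst t)"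
  by (rule nearI[OF triv_open])

lemma triv_carrier: "t \<in> btriv B \<Longrightarrow> x \<in> fst t \<Longrightarrow> x \<in> carrier A"
  using triv_open mopen_subset_carrier by blast

lemma triv_cover: "x \<in> carrier A \<Longrightarrow> \<exists>t\<in>btriv B. x \<in> fst t"
  using trivs_open unfolding open_trivs_def by blast

lemma subspace_fibre: "x \<in> carrier A \<Longrightarrow> subspace (fibre B x)"
  using triv_cover fibre_subspace by blast

lemma triv_at: assumes "x \<in> carrier A" shows "triv_at B x \<in> btriv B" "x \<in> fst (triv_at B x)"
proof -
  have "\<exists>t. t \<in> btriv B \<and> x \<in> fst t" using triv_cover[OF assms] by blast
  then have "triv_at B x \<in> btriv B \<and> x \<in> fst (triv_at B x)"
    unfolding triv_at_def by (rule someI_ex)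
  then show "triv_at B x \<in> btriv B" "x \<in> fst (triv_at B x)" by auto
qed

text \<open>In another trivialisation the components are a matrix with smooth entries applied to the
  given ones, so one trivialisation decides.\<close>

lemma sec_triv:
  assumes t: "t \<in> btriv B" "x \<in> fst t"
  shows "sec A B x \<sigma> \<longleftrightarrow> near A x (\<lambda>y. \<sigma> y \<in> fibre B y) \<and> smooth_at A x (\<lambda>y. snd t y (\<sigma> y))"
proof
  assume *: "near A x (\<lambda>y. \<sigma> y \<in> fibre B y) \<and> smooth_at A x (\<lambda>y. snd t y (\<sigma> y))"
  have "smooth_at A x (\<lambda>y. snd s y (\<sigma> y))" if s: "s \<in> btriv B" "x \<in> fst s" for s
  proof (rule smooth_at_cong)
    show "near A x (\<lambda>y. (\<Sum>b\<in>Basis. (snd t y (\<sigma> y) \<bullet> b) *\<^sub>R snd s y (vinv t y b)) = snd s y (\<sigma> y))"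
    proof (rule near_mono[OF near_conj[OF near_conj[OF near_triv[OF t] near_triv[OF s]] conjunct1[OF *]]])
      fix y assume y: "(y \<in> fst t \<and> y \<in> fst s) \<and> \<sigma> y \<in> fibre B y"
      have "linear (\<lambda>a. snd s y (vinv t y a))"
        using linear_on_set_compose[OF linear_vinv vinv_in triv_linear] t s y by blast
      from linear_euclidean_expand[OF this, of "snd t y (\<sigma> y)"]
      show "(\<Sum>b\<in>Basis. (snd t y (\<sigma> y) \<bullet> b) *\<^sub>R snd s y (vinv t y b)) = snd s y (\<sigma> y)"
        using vinv_triv[OF t(1)] y by simp
    qed
    show "smooth_at A x (\<lambda>y. \<Sum>b\<in>Basis. (snd t y (\<sigma> y) \<bullet> b) *\<^sub>R snd s y (vinv t y b))"
      unfolding vinv_def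
      by (intro smooth_at_sum smooth_at_scaleR smooth_at_bounded_linear[OF bounded_linear_inner_left] conjunct2[OF *]
          transition_smooth_triv s t triv_carrier[OF t])
  qed
  then show "sec A B x \<sigma>" using * by (simp add: sec_def)
qed (use t in \<open>simp add: sec_def\<close>)

lemma sec_vinv: "t \<in> btriv B \<Longrightarrow> x \<in> fst t \<Longrightarrow> sec A B x (\<lambda>y. vinv t y a)"
  unfolding sec_def vinv_def
  by (auto intro!: transition_smooth_triv near_mono[OF near_triv] simp: vinv_in[unfolded vinv_def])

lemma const_ext:
  assumes x: "x \<in> carrier A" and v: "v \<in> fibre B x"
  shows "sec A B x (const_ext B x v)" "const_ext B x v x = v"
    "near A x (\<lambda>y. snd (triv_at B x) y (const_ext B x v y) = snd (triv_at B x) x v)"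
proof -
  note t = triv_at[OF x]
  have e: "const_ext B x v y = vinv (triv_at B x) y (snd (triv_at B x) x v)" for y
    by (simp add: const_ext_def vinv_def Let_def)
  show "const_ext B x v x = v" using e vinv_triv[OF t v] by simp
  show n: "near A x (\<lambda>y. snd (triv_at B x) y (const_ext B x v y) = snd (triv_at B x) x v)"
    by (rule near_mono[OF near_triv[OF t]]) (simp add: e triv_vinv[OF t(1)])
  have "near A x (\<lambda>y. snd (triv_at B x) x v = snd (triv_at B x) y (const_ext B x v y))"
    by (rule near_mono[OF n]) simp
  then have "smooth_at A x (\<lambda>y. snd (triv_at B x) y (const_ext B x v y))"
    by (rule smooth_at_cong[OF _ smooth_at_const[OF x]])
  moreover have "near A x (\<lambda>y. const_ext B x v y \<in> fibre B y)"
    by (rule near_mono[OF near_triv[OF t]]) (simp add: e vinv_in[OF t(1)])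
  ultimately show "sec A B x (const_ext B x v)" using sec_triv[OF t] by blast
qed

lemma dual_triv_inner:
  assumes t: "t \<in> btriv B" "x \<in> fst t" and f: "f \<in> dual_space (fibre B x)"
  shows "dual_triv B t x f \<bullet> a = f (vinv t x a)"
  using linear_euclidean_expand[OF linear_on_set_compose[OF linear_vinv[OF t] vinv_in[OF t] dual_spaceD(1)[OF f]], of a]
  by (simp add: dual_triv_def euclidean_sum_inner vinv_def)

lemma dual_apply:
  assumes t: "t \<in> btriv B" "x \<in> fst t" and f: "f \<in> dual_space (fibre B x)" and v: "v \<in> fibre B x"
  shows "f v = dual_triv B t x f \<bullet> snd t x v"
  using dual_triv_inner[OF t f] vinv_triv[OF t v] by simp

definition dinv :: "'m set \<times> ('m \<Rightarrow> 'v \<Rightarrow> 'f) \<Rightarrow> 'm \<Rightarrow> 'f \<Rightarrow> 'v \<Rightarrow> real" where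
  "dinv t x \<alpha> = restr (fibre B x) (\<lambda>v. \<alpha> \<bullet> snd t x v)"

lemma dinv_in: assumes t: "t \<in> btriv B" "x \<in> fst t" shows "dinv t x \<alpha> \<in> dual_space (fibre B x)"
  unfolding dinv_def
  by (rule restr_linear_dual[OF fibre_subspace[OF t]])
    (use linear_on_setD[OF triv_linear[OF t]] in \<open>simp add: linear_on_set_def inner_add_right\<close>)

lemma dual_triv_dinv: assumes t: "t \<in> btriv B" "x \<in> fst t" shows "dual_triv B t x (dinv t x \<alpha>) = \<alpha>"
  by (rule euclidean_eqI)
    (simp add: dual_triv_inner[OF t dinv_in[OF t]], simp add: dinv_def restr_def vinv_in[OF t] triv_vinv[OF t])

lemma dinv_dual_triv:
  assumes t: "t \<in> btriv B" "x \<in> fst t" and f: "f \<in> dual_space (fibre B x)"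
  shows "dinv t x (dual_triv B t x f) = f"
  by (rule dual_space_eqI[OF dinv_in[OF t] f]) (simp add: dinv_def restr_def dual_apply[OF t f, symmetric])

lemma linear_dual_triv: "linear (dual_triv B t x)"
  by (rule linearI)
    (simp_all add: dual_triv_def scaleR_fun_def algebra_simps sum.distrib scaleR_sum_right)

lemma inv_into_dual_triv:
  assumes t: "t \<in> btriv B" "x \<in> fst t"
  shows "inv_into (dual_space (fibre B x)) (dual_triv B t x) a = dinv t x a"
proof -
  have "inj_on (dual_triv B t x) (dual_space (fibre B x))"
    by (rule inj_on_inverseI[of _ "dinv t x"]) (rule dinv_dual_triv[OF t])
  then show ?thesis using inv_into_f_f[OF _ dinv_in[OF t]] dual_triv_dinv[OF t] by metis
qed

lemma smooth_bundle_dual: "smooth_bundle A (dual_bundle B)"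
proof
  show "open_trivs A (dual_bundle B)" by (rule open_trivs_dual[OF trivs_open])
  fix t x assume "t \<in> btriv (dual_bundle B)" "x \<in> fst t"
  then obtain s where s: "s \<in> btriv B" "x \<in> fst s" "t = (fst s, dual_triv B s)"
    unfolding btriv_dual by auto
  show "subspace (fibre (dual_bundle B) x)" by (simp add: subspace_dual_space)
  show "linear_on_set (fibre (dual_bundle B) x) (snd t x)"
    using linear_on_set_linear[OF linear_dual_triv] s(3) by simp
  show "bij_betw (snd t x) (fibre (dual_bundle B) x) UNIV"
    by (rule bij_betw_byWitness[of _ "dinv s x"])
      (use s dinv_in[OF s(1,2)] dual_triv_dinv[OF s(1,2)] dinv_dual_triv[OF s(1,2)] in auto)
next
  fix s t x a assume "s \<in> btriv (dual_bundle B)" "t \<in> btriv (dual_bundle B)" "x \<in> fst s" "x \<in> fst t"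
  then obtain s' t' where s: "s' \<in> btriv B" "x \<in> fst s'" "s = (fst s', dual_triv B s')"
    and t: "t' \<in> btriv B" "x \<in> fst t'" "t = (fst t', dual_triv B t')"
    unfolding btriv_dual by auto
  show "smooth_at A x (\<lambda>y. snd s y (inv_into (fibre (dual_bundle B) y) (snd t y) a))"
  proof (rule smooth_at_cong)
    show "near A x (\<lambda>y. (\<Sum>b\<in>Basis. (a \<bullet> snd t' y (vinv s' y b)) *\<^sub>R b) =
        snd s y (inv_into (fibre (dual_bundle B) y) (snd t y) a))"
      by (rule near_mono[OF near_conj[OF near_triv[OF s(1,2)] near_triv[OF t(1,2)]]])
        (simp add: s(3) t(3) inv_into_dual_triv[OF t(1)] dual_triv_def dinv_def restr_def
          vinv_in[OF s(1)] vinv_def[symmetric])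
    show "smooth_at A x (\<lambda>y. \<Sum>b\<in>Basis. (a \<bullet> snd t' y (vinv s' y b)) *\<^sub>R b)"
      unfolding vinv_def
      by (intro smooth_at_sum smooth_at_scaleR smooth_at_inner smooth_at_const transition_smooth_triv triv_carrier[OF t(1,2)]
          s(1,2) t(1,2))
  qed
qed

end

section \<open>Flat bundles and their connections\<close>

text \<open>\<open>G\<close> is chosen before the neighbourhood: one matrix serves all nearby
  \<open>y\<close>, so transition functions are locally constant.\<close>

locale flat_bundle = smooth_bundle A B
  for A :: "('m, 'e::euclidean_space) atlas" and B :: "('m, 'v::real_vector, 'f::euclidean_space) vbundle" +
  assumes transition_const: "s \<in> btriv B \<Longrightarrow> t \<in> btriv B \<Longrightarrow> x \<in> fst s \<Longrightarrow> x \<in> fst t \<Longrightarrow>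
      \<exists>G. linear G \<and> near A x (\<lambda>y. \<forall>v\<in>fibre B y. snd t y v = G (snd s y v))"
begin

text \<open>Differentiation commutes with a constant matrix. Here flatness enters: differentiating
  components gives the same vector in every trivialisation.\<close>

lemma vinv_dfun_indep:
  assumes s: "s \<in> btriv B" "x \<in> fst s" and t: "t \<in> btriv B" "x \<in> fst t" and sg: "sec A B x \<sigma>"
  shows "vinv s x (dfun A (\<lambda>y. snd s y (\<sigma> y)) x w) = vinv t x (dfun A (\<lambda>y. snd t y (\<sigma> y)) x w)"
proof -
  obtain G where G: "linear G" "near A x (\<lambda>y. \<forall>v\<in>fibre B y. snd s y v = G (snd t y v))"
    using transition_const[OF t(1) s(1) t(2) s(2)] by blast
  have n: "near A x (\<lambda>y. snd s y (\<sigma> y) = G (snd t y (\<sigma> y)))"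
    by (rule near_mono[OF near_conj[of x "\<lambda>y. \<sigma> y \<in> fibre B y", OF _ G(2)]])
      (use sg in \<open>auto simp: sec_def\<close>)
  have st: "smooth_at A x (\<lambda>y. snd t y (\<sigma> y))" using sg t by (simp add: sec_def)
  show ?thesis
    unfolding dfun_cong[OF n] dfun_linear[OF G(1) st]
    using near_point[OF G(2)] vinv_in[OF t] triv_vinv[OF t] by (intro vinv_eqI[OF s]) auto
qed

text \<open>\<open>D\<close> is the connection whose flat sections are the locally constant ones.\<close>

definition flat_for :: "('m, 'e, 'v) conn \<Rightarrow> bool" where
  "flat_for D \<longleftrightarrow> (\<forall>t\<in>btriv B. \<forall>x\<in>fst t. \<forall>\<sigma> w. sec A B x \<sigma> \<longrightarrow>
     D x w \<sigma> = vinv t x (dfun A (\<lambda>y. snd t y (\<sigma> y)) x w))"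

lemma flat_forD:
  "flat_for D \<Longrightarrow> t \<in> btriv B \<Longrightarrow> x \<in> fst t \<Longrightarrow> sec A B x \<sigma> \<Longrightarrow>
    D x w \<sigma> = vinv t x (dfun A (\<lambda>y. snd t y (\<sigma> y)) x w)"
  by (simp add: flat_for_def)

lemma flat_for_flat_conn: "flat_for (flat_conn A B)"
  unfolding flat_for_def
proof (intro ballI allI impI)
  fix t x \<sigma> w assume t: "t \<in> btriv B" "x \<in> fst t" and s: "sec A B x \<sigma>"
  show "flat_conn A B x w \<sigma> = vinv t x (dfun A (\<lambda>y. snd t y (\<sigma> y)) x w)"
    using vinv_dfun_indep[OF triv_at[OF triv_carrier[OF t]] t s] by (simp add: flat_conn_def vinv_def)
qed

text \<open>The auxiliary sections in \<open>dual_conn\<close> and \<open>pull_conn\<close> are of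
  this form, so the terms in which the connection acts on them disappear.\<close>

lemma flat_for_const_ext:
  assumes D: "flat_for D" and x: "x \<in> carrier A" and v: "v \<in> fibre B x"
  shows "D x w (const_ext B x v) = 0"
  using flat_forD[OF D triv_at[OF x] const_ext(1)[OF x v]] dfun_cong[OF const_ext(3)[OF x v]]
    linear_0[OF linear_vinv[OF triv_at[OF x]]] by (simp add: dfun_const)

text \<open>Dual coordinates change by the adjoint of the transition in the opposite direction, and
  the adjoint of a constant matrix is constant.\<close>

lemma flat_bundle_dual: "flat_bundle A (dual_bundle B)"
proof (intro flat_bundle.intro flat_bundle_axioms.intro smooth_bundle_dual)
  fix s t x assume "s \<in> btriv (dual_bundle B)" "t \<in> btriv (dual_bundle B)" "x \<in> fst s" "x \<in> fst t"
  then obtain s' t' where s: "s' \<in> btriv B" "x \<in> fst s'" "s = (fst s', dual_triv B s')"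
    and t: "t' \<in> btriv B" "x \<in> fst t'" "t = (fst t', dual_triv B t')"
    unfolding btriv_dual by auto
  obtain G where G: "linear G" "near A x (\<lambda>y. \<forall>v\<in>fibre B y. snd s' y v = G (snd t' y v))"
    using transition_const[OF t(1) s(1) t(2) s(2)] by blast
  show "\<exists>G. linear G \<and> near A x (\<lambda>y. \<forall>v\<in>fibre (dual_bundle B) y. snd t y v = G (snd s y v))"
  proof (intro exI conjI)
    show "linear (adjoint G)" by (rule adjoint_linear[OF G(1)])
    show "near A x (\<lambda>y. \<forall>v\<in>fibre (dual_bundle B) y. snd t y v = adjoint G (snd s y v))"
    proof (rule near_mono[OF near_conj[OF near_conj[OF near_triv[OF s(1,2)] near_triv[OF t(1,2)]] G(2)]], intro ballI)
      fix y f assume y: "(y \<in> fst s' \<and> y \<in> fst t') \<and> (\<forall>v\<in>fibre B y. snd s' y v = G (snd t' y v))"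
        and "f \<in> fibre (dual_bundle B) y"
      then have f: "f \<in> dual_space (fibre B y)" by simp
      have yt: "y \<in> fst t'" and ys: "y \<in> fst s'" using y by auto
      show "snd t y f = adjoint G (snd s y f)"
      proof (rule euclidean_eqI)
        fix b :: 'f
        have "snd t y f \<bullet> b = f (vinv t' y b)" using dual_triv_inner[OF t(1) yt f] t by simp
        also have "\<dots> = dual_triv B s' y f \<bullet> snd s' y (vinv t' y b)"
          by (rule dual_apply[OF s(1) ys f vinv_in[OF t(1) yt]])
        also have "\<dots> = dual_triv B s' y f \<bullet> G b"
          using y vinv_in[OF t(1) yt] triv_vinv[OF t(1) yt] by simp
        finally show "snd t y f \<bullet> b = adjoint G (snd s y f) \<bullet> b"
          using adjoint_works[OF G(1)] s by (simp add: inner_commute)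
      qed
    qed
  qed
qed

end

text \<open>Along a section constant in the trivialisation, \<open>f(\<sigma>)\<close> is the inner
  product of the components of \<open>f\<close> with a fixed vector. The derivative therefore falls
  on \<open>f\<close> alone, and the term with \<open>D\<close> is zero.\<close>

lemma (in flat_bundle) flat_for_dual_conn:
  assumes D: "flat_for D"
  shows "flat_bundle.flat_for A (dual_bundle B) (dual_conn A B D)"
proof -
  interpret du: flat_bundle A "dual_bundle B" by (rule flat_bundle_dual)
  show ?thesis
    unfolding du.flat_for_def
  proof (intro ballI allI impI)
    fix t x f w assume t: "t \<in> btriv (dual_bundle B)" "x \<in> fst t" and s: "sec A (dual_bundle B) x f"
    have x: "x \<in> carrier A" by (rule du.triv_carrier[OF t])
    let ?t = "triv_at B x"
    let ?r = "(fst ?t, dual_triv B ?t)"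
    note t0 = triv_at[OF x]
    have r: "?r \<in> btriv (dual_bundle B)" "x \<in> fst ?r" using t0 unfolding btriv_dual by auto
    have sm: "smooth_at A x (\<lambda>y. dual_triv B ?t y (f y))"
      using s[unfolded du.sec_triv[OF r]] by simp
    have nf: "near A x (\<lambda>y. f y \<in> dual_space (fibre B y))" using s by (simp add: sec_def)
    have fx: "f x \<in> dual_space (fibre B x)" using nf near_point by fast
    have f0: "f x 0 = 0"
      using dual_apply[OF t0 fx subspace_0[OF fibre_subspace[OF t0]]]
        linear_on_setD(2)[OF triv_linear[OF t0] subspace_0[OF fibre_subspace[OF t0]], of 0] by simp
    have "dual_conn A B D x w f = dinv ?t x (dfun A (\<lambda>y. dual_triv B ?t y (f y)) x w)"
    proof -
      have "dfun A (\<lambda>y. f y (const_ext B x v y)) x w - f x (D x w (const_ext B x v))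
        = dfun A (\<lambda>y. dual_triv B ?t y (f y)) x w \<bullet> snd ?t x v" if v: "v \<in> fibre B x" for v
      proof -
        have n: "near A x (\<lambda>y. f y (const_ext B x v y) = dual_triv B ?t y (f y) \<bullet> snd ?t x v)"
        proof (rule near_mono[OF near_conj[OF near_conj[OF near_triv[OF t0] nf]
                near_conj[OF const_ext(3)[OF x v], of "\<lambda>y. const_ext B x v y \<in> fibre B y"]]])
          show "near A x (\<lambda>y. const_ext B x v y \<in> fibre B y)"
            using const_ext(1)[OF x v] by (simp add: sec_def)
        qed (use dual_apply[OF t0(1)] in metis)
        have "linear (\<lambda>u. u \<bullet> snd ?t x v)" by (auto intro!: linearI simp: inner_add_left)
        then show ?thesis
          unfolding dfun_cong[OF n] flat_for_const_ext[OF D x v] f0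
          using dfun_linear[OF _ sm, of "\<lambda>u. u \<bullet> snd ?t x v"] by simp
      qed
      then show ?thesis by (auto simp: dual_conn_def dinv_def restr_def Let_def fun_eq_iff)
    qed
    also have "\<dots> = du.vinv ?r x (dfun A (\<lambda>y. snd ?r y (f y)) x w)"
      by (rule sym, rule du.vinv_eqI[OF r]) (simp_all add: dinv_in[OF t0] dual_triv_dinv[OF t0])
    also have "\<dots> = du.vinv t x (dfun A (\<lambda>y. snd t y (f y)) x w)"
      by (rule du.vinv_dfun_indep[OF r t s])
    finally show "dual_conn A B D x w f = du.vinv t x (dfun A (\<lambda>y. snd t y (f y)) x w)" .
  qed
qed

text \<open>A locally constant transition sends a fixed coordinate vector to a locally constant one,
  so the smoothness condition of \<open>smooth_bundle\<close> comes for free.\<close>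

lemma flat_bundleI:
  assumes "satlas A" and o: "open_trivs A B"
    and fs: "\<And>t x. t \<in> btriv B \<Longrightarrow> x \<in> fst t \<Longrightarrow> subspace (fibre B x)"
    and tl: "\<And>t x. t \<in> btriv B \<Longrightarrow> x \<in> fst t \<Longrightarrow> linear_on_set (fibre B x) (snd t x)"
    and tb: "\<And>t x. t \<in> btriv B \<Longrightarrow> x \<in> fst t \<Longrightarrow> bij_betw (snd t x) (fibre B x) UNIV"
    and tc: "\<And>s t x. s \<in> btriv B \<Longrightarrow> t \<in> btriv B \<Longrightarrow> x \<in> fst s \<Longrightarrow> x \<in> fst t \<Longrightarrow>
      \<exists>G. linear G \<and> near A x (\<lambda>y. \<forall>v\<in>fibre B y. snd t y v = G (snd s y v))"
  shows "flat_bundle A B"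
proof -
  interpret satlas A by fact
  have "smooth_at A x (\<lambda>y. snd s y (inv_into (fibre B y) (snd t y) a))"
    if s: "s \<in> btriv B" "x \<in> fst s" and t: "t \<in> btriv B" "x \<in> fst t" for s t x a
  proof -
    obtain G where G: "near A x (\<lambda>y. \<forall>v\<in>fibre B y. snd s y v = G (snd t y v))"
      using tc[OF t(1) s(1) t(2) s(2)] by blast
    have ot: "mopen A (fst t)" using o t unfolding open_trivs_def by blast
    have "near A x (\<lambda>y. y \<in> fst t)" by (rule nearI[OF ot t(2)])
    then have "near A x (\<lambda>y. G a = snd s y (inv_into (fibre B y) (snd t y) a))"
    proof (rule near_mono[OF near_conj[OF _ G]])
      fix y assume y: "y \<in> fst t \<and> (\<forall>v\<in>fibre B y. snd s y v = G (snd t y v))"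
      then have b: "bij_betw (snd t y) (fibre B y) UNIV" using tb t by blast
      have "inv_into (fibre B y) (snd t y) a \<in> fibre B y"
        using b by (auto simp: bij_betw_def intro: inv_into_into)
      then show "G a = snd s y (inv_into (fibre B y) (snd t y) a)"
        using y bij_betw_inv_into_right[OF b, of a] by simp
    qed
    then show ?thesis by (rule smooth_at_cong[OF _ smooth_at_const]) (use mopen_subset_carrier[OF ot t(2)] in simp)
  qed
  then show ?thesis
    by unfold_locales (use o fs tl tb tc in auto)
qed

text \<open>The image \<open>\<Delta>\<close> has no trivialisations of its own: smoothness is
  measured in the ambient bundle \<open>C\<close>. The assumptions \<open>fwd\<close> and
  \<open>bwd\<close>, that \<open>g\<close> and its inverse preserve smooth germs, replace them, and
  each axiom is checked on components in a flat trivialisation of \<open>B\<close>.\<close>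

lemma (in flat_bundle) flat_connection_transport:
  fixes C :: "('m, 'u::real_vector, 'g::euclidean_space) vbundle" and g :: "'m \<Rightarrow> 'v \<Rightarrow> 'u"
  assumes D: "flat_for D" and C: "open_trivs A C"
    and bij: "\<And>y. y \<in> carrier A \<Longrightarrow> bij_betw (g y) (fibre B y) (\<Delta> y)"
    and lin: "\<And>y. y \<in> carrier A \<Longrightarrow> linear_on_set (fibre B y) (g y)"
    and bwd: "\<And>x \<sigma>. sec A C x \<sigma> \<Longrightarrow> near A x (\<lambda>y. \<sigma> y \<in> \<Delta> y) \<Longrightarrow>
      sec A B x (\<lambda>y. inv_into (fibre B y) (g y) (\<sigma> y))"
    and fwd: "\<And>x s. sec A B x s \<Longrightarrow> sec A C x (\<lambda>y. g y (s y))"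
  shows "flat_connection A (sub_sections A C \<Delta>) (transport_conn B g D)"
proof -
  define h where "h y = inv_into (fibre B y) (g y)" for y
  define N where "N = transport_conn B g D"
  have N: "N x w \<sigma> = g x (D x w (\<lambda>y. h y (\<sigma> y)))" for x w \<sigma>
    by (simp add: N_def transport_conn_def h_def)
  have hg: "h y (g y v) = v" if "y \<in> carrier A" "v \<in> fibre B y" for y v
    using bij[OF that(1)] that(2) by (simp add: h_def bij_betw_inv_into_left)
  have h_in: "h y u \<in> fibre B y" if "y \<in> carrier A" "u \<in> \<Delta> y" for y u
    using bij[OF that(1)] that(2) by (auto simp: h_def bij_betw_def intro: inv_into_into)
  have gh: "g y (h y u) = u" if "y \<in> carrier A" "u \<in> \<Delta> y" for y u
    using bij[OF that(1)] that(2) by (simp add: h_def bij_betw_inv_into_right)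
  have g_in: "g y v \<in> \<Delta> y" if "y \<in> carrier A" "v \<in> fibre B y" for y v
    using bij[OF that(1)] that(2) by (auto simp: bij_betw_def)
  have h_add: "h y (u + u') = h y u + h y u'" if "y \<in> carrier A" "u \<in> \<Delta> y" "u' \<in> \<Delta> y" for y u u'
    using hg[OF that(1) subspace_add[OF subspace_fibre[OF that(1)] h_in[OF that(1,2)] h_in[OF that(1,3)]]]
      linear_on_setD(1)[OF lin[OF that(1)] h_in[OF that(1,2)] h_in[OF that(1,3)]] gh that by simp
  have h_scale: "h y (k *\<^sub>R u) = k *\<^sub>R h y u" if "y \<in> carrier A" "u \<in> \<Delta> y" for y u k
    using hg[OF that(1) subspace_scale[OF subspace_fibre[OF that(1)] h_in[OF that]], of k]
      linear_on_setD(2)[OF lin[OF that(1)] h_in[OF that], of k] gh that by simp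
  have Gam: "\<sigma> \<in> sub_sections A C \<Delta> U \<longleftrightarrow> (\<forall>x\<in>U. sec A C x \<sigma> \<and> \<sigma> x \<in> \<Delta> x)" if "mopen A U" for \<sigma> U
    using smooth_sections_iff[OF that C] by (auto simp: sub_sections_def)
  have main: "flat_connection A (sub_sections A C \<Delta>) N"
    unfolding flat_connection_def
  proof (intro allI impI, goal_cases)
    case (1 U)
    have car: "y \<in> carrier A" if "y \<in> U" for y using mopen_subset_carrier[OF 1 that] .
    have nU: "near A x P" if "x \<in> U" "\<And>y. y \<in> U \<Longrightarrow> P y" for x P
      using nearI[OF 1] that by blast
    have sh: "sec A B x (\<lambda>y. h y (\<sigma> y))" if "\<sigma> \<in> sub_sections A C \<Delta> U" "x \<in> U" for \<sigma> x
      unfolding h_def using Gam[OF 1] that by (intro bwd nU) auto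
    have dl: "\<sigma> y \<in> \<Delta> y" if "\<sigma> \<in> sub_sections A C \<Delta> U" "y \<in> U" for \<sigma> y
      using that by (simp add: sub_sections_def)
    let ?t = "\<lambda>x. triv_at B x"
    let ?c = "\<lambda>x \<sigma> y. snd (?t x) y (h y (\<sigma> y))"
    have Nf: "N x w \<sigma> = g x (vinv (?t x) x (dfun A (?c x \<sigma>) x w))"
      if "\<sigma> \<in> sub_sections A C \<Delta> U" "x \<in> U" for \<sigma> x w
      unfolding N using flat_forD[OF D triv_at[OF car[OF that(2)]] sh[OF that]] by simp
    have sc: "smooth_at A x (?c x \<sigma>)" if "\<sigma> \<in> sub_sections A C \<Delta> U" "x \<in> U" for \<sigma> x
      using sh[OF that] triv_at[OF car[OF that(2)]] by (simp add: sec_def)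
    have nt: "near A x (\<lambda>y. y \<in> U \<and> y \<in> fst (?t x))" if "x \<in> U" for x
      using near_conj[OF nU[OF that, of "\<lambda>y. y \<in> U"] near_triv[OF triv_at[OF car[OF that]]]] by simp
    have lgv: "g x (vinv (?t x) x (a + b)) = g x (vinv (?t x) x a) + g x (vinv (?t x) x b)"
      "g x (vinv (?t x) x (k *\<^sub>R a)) = k *\<^sub>R g x (vinv (?t x) x a)" if "x \<in> U" for x a b k
      using linear_vinv[OF triv_at[OF car[OF that]]] vinv_in[OF triv_at[OF car[OF that]]]
        linear_on_setD[OF lin[OF car[OF that]]] by (simp_all add: linear_add linear_scale)
    \<comment> \<open>The components of the derivative are the derivatives of the components on a
      whole neighbourhood, so they may be differentiated a second time for the curvature.\<close>
    have ND: "sec A B x (\<lambda>y. D y (X y) (\<lambda>z. h z (\<sigma> z)))" "near A x (\<lambda>y. snd (?t x) y (h y (N y (X y) \<sigma>)) = dfun A (?c x \<sigma>) y (X y))"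
      if s: "\<sigma> \<in> sub_sections A C \<Delta> U" and X: "X \<in> smooth_sections A (tbundle A) U" and x: "x \<in> U" for \<sigma> x X
    proof -
      note t = triv_at[OF car[OF x]]
      have sX: "sec A (tbundle A) x X" using X x smooth_sections_iff[OF 1 open_trivs_tbundle] by blast
      have e: "D y (X y) (\<lambda>z. h z (\<sigma> z)) = vinv (?t x) y (dfun A (?c x \<sigma>) y (X y))" if "y \<in> U" "y \<in> fst (?t x)" for y
        using flat_forD[OF D t(1) that(2) sh[OF s that(1)]] .
      have n: "near A x (\<lambda>y. dfun A (?c x \<sigma>) y (X y) = snd (?t x) y (D y (X y) (\<lambda>z. h z (\<sigma> z))))"
        by (rule near_mono[OF nt[OF x]]) (simp add: e triv_vinv[OF t(1)])
      have m: "near A x (\<lambda>y. D y (X y) (\<lambda>z. h z (\<sigma> z)) \<in> fibre B y)"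
        by (rule near_mono[OF nt[OF x]]) (simp add: e vinv_in[OF t(1)])
      show "sec A B x (\<lambda>y. D y (X y) (\<lambda>z. h z (\<sigma> z)))"
        using sec_triv[OF t] m smooth_at_cong[OF n smooth_at_dfun_field[OF sc[OF s x] sX]] by blast
      show "near A x (\<lambda>y. snd (?t x) y (h y (N y (X y) \<sigma>)) = dfun A (?c x \<sigma>) y (X y))"
        by (rule near_mono[OF nt[OF x]]) (simp add: N e triv_vinv[OF t(1)] vinv_in[OF t(1)] hg)
    qed
    have Nin: "(\<lambda>y. N y (X y) \<sigma>) \<in> sub_sections A C \<Delta> U"
      if s: "\<sigma> \<in> sub_sections A C \<Delta> U" and X: "X \<in> smooth_sections A (tbundle A) U" for \<sigma> X
      unfolding Gam[OF 1]
    proof (intro ballI conjI)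
      fix x assume x: "x \<in> U"
      note sD = ND(1)[OF s X x]
      show "sec A C x (\<lambda>y. N y (X y) \<sigma>)" using fwd[OF sD] by (simp add: N)
      have "D x (X x) (\<lambda>z. h z (\<sigma> z)) \<in> fibre B x"
        using sD near_point[of x "\<lambda>y. D y (X y) (\<lambda>z. h z (\<sigma> z)) \<in> fibre B y"] by (simp add: sec_def)
      then show "N x (X x) \<sigma> \<in> \<Delta> x" unfolding N by (rule g_in[OF car[OF x]])
    qed
    have c1: "linear_on_set (tangent_space A x) (\<lambda>w. N x w \<sigma>)"
      if "\<sigma> \<in> sub_sections A C \<Delta> U" "x \<in> U" for \<sigma> x
      using linear_dfun[OF sc[OF that]] lgv[OF that(2)]
      by (simp add: linear_on_set_def Nf[OF that] linear_add linear_scale)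
    have c2: "N x w (\<lambda>y. \<sigma> y + \<tau> y) = N x w \<sigma> + N x w \<tau>"
      if s: "\<sigma> \<in> sub_sections A C \<Delta> U" and t: "\<tau> \<in> sub_sections A C \<Delta> U" and x: "x \<in> U" for \<sigma> \<tau> x w
    proof -
      note t0 = triv_at[OF car[OF x]]
      have n: "near A x (\<lambda>y. ?c x (\<lambda>y. \<sigma> y + \<tau> y) y = ?c x \<sigma> y + ?c x \<tau> y)"
        by (rule near_mono[OF nt[OF x]])
          (use h_add car dl s t h_in linear_on_setD(1)[OF triv_linear[OF t0(1)]] in simp)
      have n': "near A x (\<lambda>y. ?c x \<sigma> y + ?c x \<tau> y = ?c x (\<lambda>y. \<sigma> y + \<tau> y) y)"
        by (rule near_mono[OF n]) simp
      have m: "near A x (\<lambda>y. h y (\<sigma> y + \<tau> y) \<in> fibre B y)"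
        by (rule nU[OF x]) (use h_add car dl s t h_in subspace_add[OF subspace_fibre] in simp)
      have "sec A B x (\<lambda>y. h y (\<sigma> y + \<tau> y))"
        using sec_triv[OF t0] m smooth_at_cong[OF n' smooth_at_add[OF sc[OF s x] sc[OF t x]]] by blast
      then have "N x w (\<lambda>y. \<sigma> y + \<tau> y) = g x (vinv (?t x) x (dfun A (?c x (\<lambda>y. \<sigma> y + \<tau> y)) x w))"
        unfolding N using flat_forD[OF D t0] by simp
      then show ?thesis
        unfolding dfun_cong[OF n] Nf[OF s x] Nf[OF t x] dfun_add[OF sc[OF s x] sc[OF t x]] lgv[OF x] .
    qed
    have c3: "N x w (\<lambda>y. f y *\<^sub>R \<sigma> y) = dfun A f x w *\<^sub>R \<sigma> x + f x *\<^sub>R N x w \<sigma>"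
      if s: "\<sigma> \<in> sub_sections A C \<Delta> U" and f: "smooth_fun A U f" and x: "x \<in> U" for \<sigma> f x w
    proof -
      note t0 = triv_at[OF car[OF x]]
      have sf: "smooth_at A x f" using f x smooth_fun_iff[OF 1] by blast
      have n: "near A x (\<lambda>y. ?c x (\<lambda>y. f y *\<^sub>R \<sigma> y) y = f y *\<^sub>R ?c x \<sigma> y)"
        by (rule near_mono[OF nt[OF x]])
          (use h_scale car dl s h_in linear_on_setD(2)[OF triv_linear[OF t0(1)]] in simp)
      have n': "near A x (\<lambda>y. f y *\<^sub>R ?c x \<sigma> y = ?c x (\<lambda>y. f y *\<^sub>R \<sigma> y) y)"
        by (rule near_mono[OF n]) simp
      have m: "near A x (\<lambda>y. h y (f y *\<^sub>R \<sigma> y) \<in> fibre B y)"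
        by (rule nU[OF x]) (use h_scale car dl s h_in subspace_scale[OF subspace_fibre] in simp)
      have "sec A B x (\<lambda>y. h y (f y *\<^sub>R \<sigma> y))"
        using sec_triv[OF t0] m smooth_at_cong[OF n' smooth_at_scaleR[OF sf sc[OF s x]]] by blast
      then have "N x w (\<lambda>y. f y *\<^sub>R \<sigma> y) = g x (vinv (?t x) x (dfun A (?c x (\<lambda>y. f y *\<^sub>R \<sigma> y)) x w))"
        unfolding N using flat_forD[OF D t0] by simp
      then show ?thesis
        unfolding dfun_cong[OF n] Nf[OF s x] dfun_scaleR[OF sf sc[OF s x]] lgv[OF x]
        by (simp add: vinv_triv[OF t0] h_in car x dl s gh)
    qed
    have c4: "N x w \<tau> = N x w \<sigma>"
      if s: "\<sigma> \<in> sub_sections A C \<Delta> U" and e: "\<forall>y\<in>U. \<tau> y = \<sigma> y" and x: "x \<in> U" for \<sigma> \<tau> x w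
    proof -
      \<comment> \<open>The formula \<open>Nf\<close> is for sections; \<open>\<tau>\<close> is only
        known to agree with one on \<open>U\<close>, so it must first be recognised as a
        section.\<close>
      have "\<tau> \<in> sub_sections A C \<Delta> U"
      proof -
        have "sec A C y \<tau>" if y: "y \<in> U" for y
        proof -
          have sy: "sec A C y \<sigma>" using s y Gam[OF 1] by blast
          have m: "near A y (\<lambda>z. \<tau> z \<in> fibre C z)"
            by (rule near_mono[OF near_conj[OF nU[OF y, of "\<lambda>z. z \<in> U"], of "\<lambda>z. \<sigma> z \<in> fibre C z"]])
              (use e sy in \<open>auto simp: sec_def\<close>)
          have "near A y (\<lambda>z. snd r z (\<sigma> z) = snd r z (\<tau> z))" for r :: "'m set \<times> ('m \<Rightarrow> 'u \<Rightarrow> 'g)"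
            by (rule nU[OF y]) (use e in simp)
          from m smooth_at_cong[OF this] sy show ?thesis unfolding sec_def by blast
        qed
        then show ?thesis using Gam[OF 1] s e by simp
      qed
      moreover have "near A x (\<lambda>y. ?c x \<tau> y = ?c x \<sigma> y)" by (rule nU[OF x]) (use e in simp)
      ultimately show ?thesis using Nf[OF _ x] s dfun_cong[of x "?c x \<tau>" "?c x \<sigma>"] by simp
    qed
    have c6: "N x (X x) (\<lambda>y. N y (Y y) \<sigma>) - N x (Y x) (\<lambda>y. N y (X y) \<sigma>) - N x (lie_bracket A X Y x) \<sigma> = 0"
      if s: "\<sigma> \<in> sub_sections A C \<Delta> U" and X: "X \<in> smooth_sections A (tbundle A) U"
        and Y: "Y \<in> smooth_sections A (tbundle A) U" and x: "x \<in> U" for \<sigma> X Y x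
    proof -
      have sX: "sec A (tbundle A) x X" and sY: "sec A (tbundle A) x Y"
        using X Y x smooth_sections_iff[OF 1 open_trivs_tbundle] by blast+
      \<comment> \<open>The linear map from components to the fibre of \<open>\<Delta>\<close> at
        \<open>x\<close>. Pulled out of all three terms, it leaves \<open>dfun_lie_bracket\<close>
        for the components.\<close>
      define lg where "lg a = g x (vinv (?t x) x a)" for a
      have lg: "linear lg" unfolding lg_def by (rule linearI) (simp_all add: lgv[OF x])
      have "N x (X x) (\<lambda>y. N y (Y y) \<sigma>) = lg (dfun A (\<lambda>y. dfun A (?c x \<sigma>) y (Y y)) x (X x))"
        using Nf[OF Nin[OF s Y] x] dfun_cong[OF ND(2)[OF s Y x]] by (simp add: lg_def)
      moreover have "N x (Y x) (\<lambda>y. N y (X y) \<sigma>) = lg (dfun A (\<lambda>y. dfun A (?c x \<sigma>) y (X y)) x (Y x))"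
        using Nf[OF Nin[OF s X] x] dfun_cong[OF ND(2)[OF s X x]] by (simp add: lg_def)
      moreover have "N x (lie_bracket A X Y x) \<sigma> = lg (dfun A (?c x \<sigma>) x (lie_bracket A X Y x))"
        using Nf[OF s x] by (simp add: lg_def)
      ultimately show ?thesis
        using dfun_lie_bracket[OF sc[OF s x] sX sY, symmetric] by (simp add: linear_diff[OF lg])
    qed
    show ?case
      by (intro conjI ballI allI impI; rule c1 c2 c3 c4 Nin c6; assumption)
  qed
  then show ?thesis by (simp add: N_def)
qed

section \<open>Sums and duals of bundles\<close>

definition fpart :: "'v set \<Rightarrow> ('v \<times> 'w::zero \<Rightarrow> real) \<Rightarrow> 'v \<Rightarrow> real" where
  "fpart S h = restr S (\<lambda>v. h (v, 0))"

definition spart :: "'w set \<Rightarrow> ('v::zero \<times> 'w \<Rightarrow> real) \<Rightarrow> 'w \<Rightarrow> real" where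
  "spart R h = restr R (\<lambda>w. h (0, w))"

text \<open>Normal form v + w + f + g of an element of the sum of S, R and their duals. Pointwise
  algebra is done on such quadruples.\<close>

definition mk :: "'v set \<Rightarrow> 'w set \<Rightarrow> 'v \<Rightarrow> 'w \<Rightarrow> ('v \<Rightarrow> real) \<Rightarrow> ('w \<Rightarrow> real) \<Rightarrow> ('v \<times> 'w) gen" where
  "mk S R v w f g = ((v, w), copair S R f g)"

lemma dual_space_zero: "f \<in> dual_space S \<Longrightarrow> subspace S \<Longrightarrow> f 0 = 0"
  using linear_on_setD(2)[OF dual_spaceD(1), of f S 0 0] subspace_0 by fastforce

lemma zero_dual_space: "0 \<in> dual_space S"
  by (rule subspace_0[OF subspace_dual_space])

lemma pairing_mk:
  assumes "v \<in> S" "w \<in> R" "v' \<in> S" "w' \<in> R"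
  shows "pairing (mk S R v w f g) (mk S R v' w' f' g') = - (1/2) * (f v' + g w' + (f' v + g' w))"
  using assms by (simp add: pairing_def mk_def copair_def restr_def)

lemma mk_add:
  "mk S R v w f g + mk S R v' w' f' g' = mk S R (v + v') (w + w') (f + f') (g + g')"
  by (auto simp: mk_def copair_def restr_def fun_eq_iff)

lemma mk_scaleR: "k *\<^sub>R mk S R v w f g = mk S R (k *\<^sub>R v) (k *\<^sub>R w) (k *\<^sub>R f) (k *\<^sub>R g)"
  by (auto simp: mk_def copair_def restr_def fun_eq_iff scaleR_fun_apply algebra_simps)

context
  fixes S :: "'v::real_vector set" and R :: "'w::real_vector set"
  assumes S: "subspace S" and R: "subspace R"
begin

lemma fpart_in: "h \<in> dual_space (S \<times> R) \<Longrightarrow> fpart S h \<in> dual_space S"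
  unfolding fpart_def
proof (rule restr_linear_dual[OF S])
  assume h: "h \<in> dual_space (S \<times> R)"
  show "linear_on_set S (\<lambda>v. h (v, 0))"
    using linear_on_setD(1)[OF dual_spaceD(1)[OF h], of "(_, 0)" "(_, 0)"]
      linear_on_setD(2)[OF dual_spaceD(1)[OF h], of "(_, 0)"] subspace_0[OF R]
    by (auto simp: linear_on_set_def)
qed

lemma spart_in: "h \<in> dual_space (S \<times> R) \<Longrightarrow> spart R h \<in> dual_space R"
  unfolding spart_def
proof (rule restr_linear_dual[OF R])
  assume h: "h \<in> dual_space (S \<times> R)"
  show "linear_on_set R (\<lambda>w. h (0, w))"
    using linear_on_setD(1)[OF dual_spaceD(1)[OF h], of "(0, _)" "(0, _)"]
      linear_on_setD(2)[OF dual_spaceD(1)[OF h], of "(0, _)"] subspace_0[OF S]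
    by (auto simp: linear_on_set_def)
qed

lemma copair_in:
  assumes "f \<in> dual_space S" "g \<in> dual_space R" shows "copair S R f g \<in> dual_space (S \<times> R)"
  unfolding copair_def
  by (rule restr_linear_dual[OF subspace_Times[OF S R]])
    (use linear_on_setD[OF dual_spaceD(1)[OF assms(1)]] linear_on_setD[OF dual_spaceD(1)[OF assms(2)]]
      in \<open>auto simp: linear_on_set_def algebra_simps\<close>)

lemma dual_space_split:
  assumes "h \<in> dual_space (S \<times> R)" "v \<in> S" "w \<in> R"
  shows "h (v, w) = fpart S h v + spart R h w"
  using linear_on_setD(1)[OF dual_spaceD(1)[OF assms(1)], of "(v, 0)" "(0, w)"] assms
    subspace_0[OF S] subspace_0[OF R] by (simp add: fpart_def spart_def restr_def)

lemma copair_parts: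
  assumes h: "h \<in> dual_space (S \<times> R)" shows "copair S R (fpart S h) (spart R h) = h"
proof (rule dual_space_eqI[OF copair_in[OF fpart_in[OF h] spart_in[OF h]] h])
  fix u assume "u \<in> S \<times> R"
  then show "copair S R (fpart S h) (spart R h) u = h u"
    using dual_space_split[OF h] by (auto simp: copair_def restr_def)
qed

lemma fpart_copair:
  assumes "f \<in> dual_space S" "g \<in> dual_space R"
  shows "fpart S (copair S R f g) = f"
  using dual_spaceD(2)[OF assms(1)] subspace_0[OF R] dual_space_zero[OF assms(2) R]
  by (auto simp: fpart_def copair_def restr_def)

lemma spart_copair:
  assumes "f \<in> dual_space S" "g \<in> dual_space R"
  shows "spart R (copair S R f g) = g"
  using dual_spaceD(2)[OF assms(2)] subspace_0[OF S] dual_space_zero[OF assms(1) S]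
  by (auto simp: spart_def copair_def restr_def)

lemma mk_in:
  "v \<in> S \<Longrightarrow> w \<in> R \<Longrightarrow> f \<in> dual_space S \<Longrightarrow> g \<in> dual_space R \<Longrightarrow>
    mk S R v w f g \<in> (S \<times> R) \<times> dual_space (S \<times> R)"
  using copair_in by (simp add: mk_def)

lemma mk_cases:
  assumes "u \<in> (S \<times> R) \<times> dual_space (S \<times> R)"
  obtains v w f g where "v \<in> S" "w \<in> R" "f \<in> dual_space S" "g \<in> dual_space R" "u = mk S R v w f g"
proof
  show "fst (fst u) \<in> S" "snd (fst u) \<in> R" "fpart S (snd u) \<in> dual_space S" "spart R (snd u) \<in> dual_space R"
    using assms fpart_in spart_in by auto
  show "u = mk S R (fst (fst u)) (snd (fst u)) (fpart S (snd u)) (spart R (snd u))"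
    using assms copair_parts by (auto simp: mk_def)
qed

lemma mk_inject:
  assumes "f \<in> dual_space S" "g \<in> dual_space R" "f' \<in> dual_space S" "g' \<in> dual_space R"
  shows "mk S R v w f g = mk S R v' w' f' g' \<longleftrightarrow> v = v' \<and> w = w' \<and> f = f' \<and> g = g'"
  using fpart_copair[OF assms(1,2)] fpart_copair[OF assms(3,4)]
    spart_copair[OF assms(1,2)] spart_copair[OF assms(3,4)] by (auto simp: mk_def)

end

lemma linear_on_set_inv_into:
  assumes "subspace S" "bij_betw f S R" "linear_on_set S f"
  shows "linear_on_set R (inv_into S f)"
  unfolding linear_on_set_def
proof (intro conjI ballI allI)
  note i = bij_betw_inv_into_left[OF assms(2)] and r = bij_betw_inv_into_right[OF assms(2)]
  have m: "inv_into S f u \<in> S" if "u \<in> R" for u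
    using assms(2) that by (auto simp: bij_betw_def intro: inv_into_into)
  show "inv_into S f (u + v) = inv_into S f u + inv_into S f v" if "u \<in> R" "v \<in> R" for u v
    using i[OF subspace_add[OF assms(1) m[OF that(1)] m[OF that(2)]]]
      linear_on_setD(1)[OF assms(3) m[OF that(1)] m[OF that(2)]] r that by simp
  show "inv_into S f (c *\<^sub>R u) = c *\<^sub>R inv_into S f u" if "u \<in> R" for u c
    using i[OF subspace_scale[OF assms(1) m[OF that]], of c] linear_on_setD(2)[OF assms(3) m[OF that]] r that
    by simp
qed

lemma (in satlas) sec_cong:
  assumes "near A x (\<lambda>y. \<sigma> y = \<tau> y)" "sec A B x \<sigma>" shows "sec A B x \<tau>"
  unfolding sec_def
proof (intro conjI ballI impI)
  show "near A x (\<lambda>y. \<tau> y \<in> fibre B y)"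
    by (rule near_mono[OF near_conj[OF assms(1), of "\<lambda>y. \<sigma> y \<in> fibre B y"]])
      (use assms(2) in \<open>auto simp: sec_def\<close>)
  fix t assume t: "t \<in> btriv B" "x \<in> fst t"
  show "smooth_at A x (\<lambda>y. snd t y (\<tau> y))"
    by (rule smooth_at_cong[OF near_mono[OF assms(1)], of "\<lambda>y. snd t y (\<sigma> y)"])
      (use assms(2) t in \<open>auto simp: sec_def\<close>)
qed

lemma (in satlas) smooth_bundle_tbundle: "smooth_bundle A (tbundle A)"
proof
  show "open_trivs A (tbundle A)" by (rule open_trivs_tbundle)
  fix t x assume "t \<in> btriv (tbundle A)" "x \<in> fst t"
  then obtain c where c: "c \<in> A" "x \<in> fst c" "t = (fst c, \<lambda>x v. v c)"
    unfolding btriv_tbundle by (metis fst_conv)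
  have m: "mchart A c" "x \<in> fst c" using chart_mchart c by auto
  show "subspace (fibre (tbundle A) x)" using subspace_tangent mchart_carrier[OF m] by simp
  show "linear_on_set (fibre (tbundle A) x) (snd t x)"
    using c(3) by (simp add: linear_on_set_def scaleR_fun_apply)
  have e: "v c = tco A c x v" if "v \<in> tangent_space A x" for v
    using tco_atlas[OF c(1,2) that] by simp
  show "bij_betw (snd t x) (fibre (tbundle A) x) UNIV"
    by (rule bij_betw_byWitness[of _ "tinv A c x"])
      (use tinv_in[OF m] tinv_tco[OF m] tco_tinv[OF m] in \<open>auto simp: c(3) e\<close>)
next
  fix s t x a assume "s \<in> btriv (tbundle A)" "t \<in> btriv (tbundle A)" "x \<in> fst s" "x \<in> fst t"
  then obtain d c where d: "d \<in> A" "x \<in> fst d" "s = (fst d, \<lambda>x v. v d)"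
    and c: "c \<in> A" "x \<in> fst c" "t = (fst c, \<lambda>x v. v c)"
    unfolding btriv_tbundle by (metis fst_conv)
  note m = chart_mchart[OF c(1)] and n = chart_mchart[OF d(1)]
  show "smooth_at A x (\<lambda>y. snd s y (inv_into (fibre (tbundle A) y) (snd t y) a))"
    by (rule smooth_at_cong[OF near_mono[OF near_conj[OF near_chart[OF m c(2)] near_chart[OF n d(2)]]]
          smooth_at_chart_deriv[OF m c(2) smooth_at_chart[OF n d(2)]]])
      (simp add: c(3) d(3) inv_into_tangent[OF c(1)] tinv_def d(1))
qed

context smooth_bundle
begin

lemma sec_zero: assumes "x \<in> carrier A" shows "sec A B x (\<lambda>y. 0)"
proof -
  obtain t where t: "t \<in> btriv B" "x \<in> fst t" using triv_cover[OF assms] by blast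
  show ?thesis
    by (rule sec_cong[OF near_mono[OF near_triv[OF t]] sec_vinv[OF t, of 0]])
      (simp add: linear_0[OF linear_vinv[OF t(1)]])
qed

lemma sec_minus: assumes x: "x \<in> carrier A" and s: "sec A B x \<sigma>" shows "sec A B x (\<lambda>y. - \<sigma> y)"
proof -
  obtain t where t: "t \<in> btriv B" "x \<in> fst t" using triv_cover[OF x] by blast
  have n: "near A x (\<lambda>y. y \<in> fst t \<and> \<sigma> y \<in> fibre B y)"
    using near_conj[OF near_triv[OF t], of "\<lambda>y. \<sigma> y \<in> fibre B y"] s by (simp add: sec_def)
  have m: "near A x (\<lambda>y. - \<sigma> y \<in> fibre B y)"
    by (rule near_mono[OF n]) (use subspace_neg[OF fibre_subspace[OF t(1)]] in blast)
  have e: "near A x (\<lambda>y. - snd t y (\<sigma> y) = snd t y (- \<sigma> y))"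
    by (rule near_mono[OF n])
      (use linear_on_setD(2)[OF triv_linear[OF t(1)], of _ _ "-1"] in \<open>auto simp: scaleR_minus1_left\<close>)
  have "smooth_at A x (\<lambda>y. snd t y (\<sigma> y))" using s t by (simp add: sec_def)
  then show ?thesis
    unfolding sec_triv[OF t] using m smooth_at_cong[OF e smooth_at_minus] by simp
qed

section \<open>Double duals and bundle endomorphisms\<close>

definition ev :: "'m \<Rightarrow> 'v \<Rightarrow> ('v \<Rightarrow> real) \<Rightarrow> real" where
  "ev x v = restr (dual_space (fibre B x)) (\<lambda>f. f v)"

lemma ev_in: "ev x v \<in> dual_space (dual_space (fibre B x))"
  unfolding ev_def
  by (rule restr_linear_dual[OF subspace_dual_space]) (simp add: linear_on_set_def scaleR_fun_apply)

text \<open>Trivialising the double dual after evaluation gives back the original trivialisation.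
  Reflexivity and the comparison of smooth structures both follow from it.\<close>

lemma dual_triv_ev:
  assumes t: "t \<in> btriv B" "x \<in> fst t" and v: "v \<in> fibre B x"
  shows "dual_triv (dual_bundle B) (fst t, dual_triv B t) x (ev x v) = snd t x v"
proof -
  have "ev x v (dinv t x b) = b \<bullet> snd t x v" for b
    using dinv_in[OF t] v by (simp add: ev_def restr_def dinv_def)
  then show ?thesis
    using euclidean_representation[of "snd t x v"]
    by (simp add: dual_triv_def[of "dual_bundle B"] inv_into_dual_triv[OF t] inner_commute)
qed

text \<open>The ambient vector space is arbitrary; it is the trivialisation that makes the fibre
  finite-dimensional and represents \<open>\<phi>\<close> by a coordinate vector, hence by
  evaluation at a vector.\<close>

lemma double_dual:
  assumes x: "x \<in> carrier A" and p: "\<phi> \<in> dual_space (dual_space (fibre B x))"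
  shows "\<exists>v\<in>fibre B x. ev x v = \<phi>"
proof -
  obtain t where t: "t \<in> btriv B" "x \<in> fst t" using triv_cover[OF x] by blast
  let ?t = "(fst t, dual_triv B t)"
  interpret du: smooth_bundle A "dual_bundle B" by (rule smooth_bundle_dual)
  have t': "?t \<in> btriv (dual_bundle B)" "x \<in> fst ?t" using t unfolding btriv_dual by auto
  let ?a = "dual_triv (dual_bundle B) ?t x \<phi>"
  have "\<phi> f = ev x (vinv t x ?a) f" if f: "f \<in> dual_space (fibre B x)" for f
    using du.dual_apply[OF t', of \<phi> f] p f dual_triv_inner[OF t f, of ?a]
    by (simp add: ev_def restr_def inner_commute)
  then have "ev x (vinv t x ?a) = \<phi>" using dual_space_eqI[OF ev_in p] by metis
  then show ?thesis using vinv_in[OF t] by blast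
qed

lemma ev_inject:
  assumes x: "x \<in> carrier A" and v: "v \<in> fibre B x" and w: "w \<in> fibre B x" and e: "ev x v = ev x w"
  shows "v = w"
proof -
  obtain t where t: "t \<in> btriv B" "x \<in> fst t" using triv_cover[OF x] by blast
  have "snd t x v = snd t x w" using dual_triv_ev[OF t v] dual_triv_ev[OF t w] e by simp
  then show ?thesis using vinv_triv[OF t] v w by metis
qed

lemma sec_ev_iff:
  assumes x: "x \<in> carrier A" and n: "near A x (\<lambda>y. v y \<in> fibre B y)"
  shows "sec A (dual_bundle (dual_bundle B)) x (\<lambda>y. ev y (v y)) \<longleftrightarrow> sec A B x v"
proof -
  obtain t where t: "t \<in> btriv B" "x \<in> fst t" using triv_cover[OF x] by blast
  let ?t = "(fst t, dual_triv B t)"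
  let ?tt = "(fst t, dual_triv (dual_bundle B) ?t)"
  interpret du: smooth_bundle A "dual_bundle B" by (rule smooth_bundle_dual)
  interpret dd: smooth_bundle A "dual_bundle (dual_bundle B)" by (rule du.smooth_bundle_dual)
  have "?t \<in> btriv (dual_bundle B)" using t unfolding btriv_dual by auto
  then have t': "?tt \<in> btriv (dual_bundle (dual_bundle B))"
    unfolding btriv_dual[of _ "dual_bundle B"] by (rule bexI[rotated]) simp
  have t2: "x \<in> fst ?tt" using t by simp
  note t' = t' t2
  have e: "near A x (\<lambda>y. snd ?tt y (ev y (v y)) = snd t y (v y))"
    by (rule near_mono[OF near_conj[OF near_triv[OF t] n]]) (simp add: dual_triv_ev[OF t(1)])
  have e': "near A x (\<lambda>y. snd t y (v y) = snd ?tt y (ev y (v y)))"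
    by (rule near_mono[OF e]) simp
  have m: "near A x (\<lambda>y. ev y (v y) \<in> fibre (dual_bundle (dual_bundle B)) y)"
    by (rule near_mono[OF n]) (simp add: ev_in)
  show ?thesis
    unfolding dd.sec_triv[OF t'] sec_triv[OF t] using m n smooth_at_cong[OF e] smooth_at_cong[OF e'] by blast
qed

text \<open>\<open>smooth_endo\<close> speaks of matrix entries in pairs of trivialisations.
  Preservation of section germs says the same and is stable under composition, which is what
  conjugation by \<open>tau_swap\<close> and by \<open>iso_F\<close> needs.\<close>

lemma smooth_endo_iff:
  assumes L: "\<And>x. x \<in> carrier A \<Longrightarrow> linear_on_set (fibre B x) (J x)"
    and M: "\<And>x u. x \<in> carrier A \<Longrightarrow> u \<in> fibre B x \<Longrightarrow> J x u \<in> fibre B x"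
  shows "smooth_endo A B J \<longleftrightarrow> (\<forall>x\<in>carrier A. \<forall>u. sec A B x u \<longrightarrow> sec A B x (\<lambda>y. J y (u y)))"
proof
  assume J: "smooth_endo A B J"
  show "\<forall>x\<in>carrier A. \<forall>u. sec A B x u \<longrightarrow> sec A B x (\<lambda>y. J y (u y))"
  proof (intro ballI allI impI)
    fix x u assume x: "x \<in> carrier A" and u: "sec A B x u"
    obtain t where t: "t \<in> btriv B" "x \<in> fst t" using triv_cover[OF x] by blast
    have sm: "smooth_at A x (\<lambda>y. snd t y (J y (vinv t y a)))" for a
    proof -
      have "smooth_fun A (fst t \<inter> fst t) (\<lambda>y. snd t y (J y (inv_into (fibre B y) (snd t y) a)))"
        using J t unfolding smooth_endo_def by blast
      then show ?thesis
        unfolding Int_absorb smooth_fun_iff[OF triv_open[OF t(1)]] vinv_def using t(2) by blast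
    qed
    have nu: "near A x (\<lambda>y. u y \<in> fibre B y)" and su: "smooth_at A x (\<lambda>y. snd t y (u y))"
      using u t by (auto simp: sec_def)
    have m: "near A x (\<lambda>y. J y (u y) \<in> fibre B y)"
      by (rule near_mono[OF nu]) (rule M)
    have e: "near A x (\<lambda>y. (\<Sum>b\<in>Basis. (snd t y (u y) \<bullet> b) *\<^sub>R snd t y (J y (vinv t y b))) = snd t y (J y (u y)))"
    proof (rule near_mono[OF near_conj[OF near_triv[OF t] nu]])
      fix y assume c: "y \<in> carrier A" and y: "y \<in> fst t \<and> u y \<in> fibre B y"
      have lin: "linear_on_set (fibre B y) (\<lambda>v. snd t y (J y v))"
        using linear_on_setD[OF L[OF c]] linear_on_setD[OF triv_linear[OF t(1)]] M[OF c] y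
        by (simp add: linear_on_set_def)
      have "linear (\<lambda>a. snd t y (J y (vinv t y a)))"
        using linear_on_set_compose[OF linear_vinv vinv_in lin] t y by blast
      from linear_euclidean_expand[OF this, of "snd t y (u y)"]
      show "(\<Sum>b\<in>Basis. (snd t y (u y) \<bullet> b) *\<^sub>R snd t y (J y (vinv t y b))) = snd t y (J y (u y))"
        using vinv_triv[OF t(1)] y by simp
    qed
    have "smooth_at A x (\<lambda>y. \<Sum>b\<in>Basis. (snd t y (u y) \<bullet> b) *\<^sub>R snd t y (J y (vinv t y b)))"
      by (intro smooth_at_sum smooth_at_scaleR sm x smooth_at_bounded_linear[OF bounded_linear_inner_left su])
    from smooth_at_cong[OF e this] m show "sec A B x (\<lambda>y. J y (u y))"
      unfolding sec_triv[OF t] by simp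
  qed
next
  assume *: "\<forall>x\<in>carrier A. \<forall>u. sec A B x u \<longrightarrow> sec A B x (\<lambda>y. J y (u y))"
  show "smooth_endo A B J"
    unfolding smooth_endo_def
  proof (intro ballI allI)
    fix s t a assume s: "s \<in> btriv B" and t: "t \<in> btriv B"
    show "smooth_fun A (fst s \<inter> fst t) (\<lambda>x. snd t x (J x (inv_into (fibre B x) (snd s x) a)))"
      unfolding smooth_fun_iff[OF mopen_Int[OF triv_open[OF s] triv_open[OF t]]] vinv_def[symmetric]
    proof
      fix x assume x: "x \<in> fst s \<inter> fst t"
      then have "sec A B x (\<lambda>y. J y (vinv s y a))"
        using * sec_vinv[OF s] triv_carrier[OF s] by blast
      then show "smooth_at A x (\<lambda>y. snd t y (J y (vinv s y a)))" using t x by (simp add: sec_def)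
    qed
  qed
qed

text \<open>Bijectivity is not checked separately: since J squares to -1, the inverse is -J.\<close>

lemma gacsI:
  assumes "\<And>x. x \<in> carrier A \<Longrightarrow> linear_on_set (fibre (gen_bundle B) x) (J x)"
    and "\<And>x u. x \<in> carrier A \<Longrightarrow> u \<in> fibre (gen_bundle B) x \<Longrightarrow> J x u \<in> fibre (gen_bundle B) x"
    and "\<And>x u u'. x \<in> carrier A \<Longrightarrow> u \<in> fibre (gen_bundle B) x \<Longrightarrow> u' \<in> fibre (gen_bundle B) x \<Longrightarrow>
      pairing (J x u) (J x u') = pairing u u'"
    and "\<And>x u. x \<in> carrier A \<Longrightarrow> u \<in> fibre (gen_bundle B) x \<Longrightarrow> J x (J x u) = - u"
    and "\<And>x u. x \<in> carrier A \<Longrightarrow> sec A (gen_bundle B) x u \<Longrightarrow> sec A (gen_bundle B) x (\<lambda>y. J y (u y))"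
    and G: "smooth_bundle A (gen_bundle B)"
  shows "gacs A B J"
proof -
  interpret G: smooth_bundle A "gen_bundle B" by fact
  have "bij_betw (J x) (fibre (gen_bundle B) x) (fibre (gen_bundle B) x)" if x: "x \<in> carrier A" for x
  proof (rule bij_betw_byWitness[of _ "\<lambda>u. - J x u"])
    note neg = subspace_neg[OF G.subspace_fibre[OF x]]
    have m: "J x (- J x u) = u" if u: "u \<in> fibre (gen_bundle B) x" for u
      using linear_on_setD(2)[OF assms(1)[OF x] assms(2)[OF x u], of "-1"] assms(4)[OF x u]
      by (simp add: scaleR_minus1_left)
    then show "\<forall>u\<in>fibre (gen_bundle B) x. J x (- J x u) = u" by blast
    show "\<forall>u\<in>fibre (gen_bundle B) x. - J x (J x u) = u" using assms(4)[OF x] by simp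
    show "J x ` fibre (gen_bundle B) x \<subseteq> fibre (gen_bundle B) x" using assms(2)[OF x] by blast
    show "(\<lambda>u. - J x u) ` fibre (gen_bundle B) x \<subseteq> fibre (gen_bundle B) x"
      using assms(2)[OF x] neg by blast
  qed
  moreover have "smooth_endo A (gen_bundle B) J"
    using G.smooth_endo_iff[of J] assms(1,2,5) by blast
  ultimately show ?thesis unfolding gacs_def Let_def using assms(1,3,4) by blast
qed

end

locale two_bundles = B: smooth_bundle A B + C: smooth_bundle A C
  for A :: "('m, 'e::euclidean_space) atlas"
    and B :: "('m, 'v::real_vector, 'f::euclidean_space) vbundle"
    and C :: "('m, 'w::real_vector, 'g::euclidean_space) vbundle"
begin

lemma bij_prod_triv:
  assumes s: "s \<in> btriv B" "x \<in> fst s" and r: "r \<in> btriv C" "x \<in> fst r"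
  shows "bij_betw (\<lambda>u. (snd s x (fst u), snd r x (snd u))) (fibre B x \<times> fibre C x) UNIV"
    "inv_into (fibre B x \<times> fibre C x) (\<lambda>u. (snd s x (fst u), snd r x (snd u))) a =
      (B.vinv s x (fst a), C.vinv r x (snd a))"
proof -
  let ?f = "\<lambda>u. (snd s x (fst u), snd r x (snd u))"
  show b: "bij_betw ?f (fibre B x \<times> fibre C x) UNIV"
    by (rule bij_betw_byWitness[of _ "\<lambda>a. (B.vinv s x (fst a), C.vinv r x (snd a))"])
      (use B.vinv_in[OF s] C.vinv_in[OF r] B.triv_vinv[OF s] C.triv_vinv[OF r]
        B.vinv_triv[OF s] C.vinv_triv[OF r] in auto)
  have "?f (B.vinv s x (fst a), C.vinv r x (snd a)) = a"
    using B.triv_vinv[OF s] C.triv_vinv[OF r] by simp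
  then show "inv_into (fibre B x \<times> fibre C x) ?f a = (B.vinv s x (fst a), C.vinv r x (snd a))"
    using inv_into_f_f[OF bij_betw_imp_inj_on[OF b], of "(B.vinv s x (fst a), C.vinv r x (snd a))"]
      B.vinv_in[OF s] C.vinv_in[OF r] by simp
qed

lemma smooth_bundle_bsum: "smooth_bundle A (bsum B C)"
proof
  show "open_trivs A (bsum B C)" by (rule B.open_trivs_bsum[OF B.trivs_open C.trivs_open])
  fix t x assume t: "t \<in> btriv (bsum B C)" "x \<in> fst t"
  obtain s r where s: "s \<in> btriv B" and r: "r \<in> btriv C"
    and te: "t = (fst s \<inter> fst r, \<lambda>x u. (snd s x (fst u), snd r x (snd u)))"
    using t(1) by (rule btriv_bsumE)
  have xs: "x \<in> fst s" and xr: "x \<in> fst r" using t(2) te by auto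
  show "subspace (fibre (bsum B C) x)"
    using subspace_Times[OF B.fibre_subspace[OF s xs] C.fibre_subspace[OF r xr]] by simp
  show "linear_on_set (fibre (bsum B C) x) (snd t x)"
    using linear_on_setD[OF B.triv_linear[OF s xs]] linear_on_setD[OF C.triv_linear[OF r xr]]
    by (auto simp: te linear_on_set_def)
  show "bij_betw (snd t x) (fibre (bsum B C) x) UNIV"
    using bij_prod_triv(1)[OF s xs r xr] te by simp
next
  fix p t x a assume p: "p \<in> btriv (bsum B C)" and t: "t \<in> btriv (bsum B C)"
    and xp: "x \<in> fst p" and xt: "x \<in> fst t"
  obtain s r where s: "s \<in> btriv B" and r: "r \<in> btriv C"
    and te: "t = (fst s \<inter> fst r, \<lambda>x u. (snd s x (fst u), snd r x (snd u)))"
    using t by (rule btriv_bsumE)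
  obtain s' r' where s': "s' \<in> btriv B" and r': "r' \<in> btriv C"
    and pe: "p = (fst s' \<inter> fst r', \<lambda>x u. (snd s' x (fst u), snd r' x (snd u)))"
    using p by (rule btriv_bsumE)
  have x: "x \<in> fst s" "x \<in> fst r" "x \<in> fst s'" "x \<in> fst r'" using xp xt te pe by auto
  have "near A x (\<lambda>y. (snd s' y (B.vinv s y (fst a)), snd r' y (C.vinv r y (snd a)))
      = snd p y (inv_into (fibre (bsum B C) y) (snd t y) a))"
    by (rule B.near_mono[OF B.near_conj[OF B.near_triv[OF s x(1)] C.near_triv[OF r x(2)]]])
      (simp add: te pe bij_prod_triv(2)[OF s _ r])
  then show "smooth_at A x (\<lambda>y. snd p y (inv_into (fibre (bsum B C) y) (snd t y) a))"
    by (rule B.smooth_at_cong)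
      (use B.sec_vinv[OF s x(1)] C.sec_vinv[OF r x(2)] s' r' x in \<open>auto simp: sec_def intro!: B.smooth_at_Pair\<close>)
qed

text \<open>The basis of a product is the union of the two bases, so the dual trivialisation of a
  sum is the pair of dual trivialisations. Membership of \<open>h\<close> in the dual has to be kept
  as a condition, because \<open>fpart\<close> and \<open>spart\<close> look at the two axes only
  and cannot detect a failure of linearity elsewhere.\<close>

lemma sec_dual_bsum:
  assumes x: "x \<in> carrier A"
  shows "sec A (dual_bundle (bsum B C)) x h \<longleftrightarrow>
    near A x (\<lambda>y. h y \<in> dual_space (fibre B y \<times> fibre C y)) \<and>
    sec A (dual_bundle B) x (\<lambda>y. fpart (fibre B y) (h y)) \<and>
    sec A (dual_bundle C) x (\<lambda>y. spart (fibre C y) (h y))"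
proof -
  obtain s where s: "s \<in> btriv B" "x \<in> fst s" using B.triv_cover[OF x] by blast
  obtain r where r: "r \<in> btriv C" "x \<in> fst r" using C.triv_cover[OF x] by blast
  define q where "q = (fst s \<inter> fst r, \<lambda>x u. (snd s x (fst u), snd r x (snd u)))"
  have q: "q \<in> btriv (bsum B C)" "x \<in> fst q" using s r unfolding btriv_bsum q_def by auto
  interpret BC: smooth_bundle A "bsum B C" by (rule smooth_bundle_bsum)
  interpret dBC: smooth_bundle A "dual_bundle (bsum B C)" by (rule BC.smooth_bundle_dual)
  interpret dB: smooth_bundle A "dual_bundle B" by (rule B.smooth_bundle_dual)
  interpret dC: smooth_bundle A "dual_bundle C" by (rule C.smooth_bundle_dual)
  have ds: "(fst s, dual_triv B s) \<in> btriv (dual_bundle B)" "x \<in> fst (fst s, dual_triv B s)"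
    using s unfolding btriv_dual by auto
  have dr: "(fst r, dual_triv C r) \<in> btriv (dual_bundle C)" "x \<in> fst (fst r, dual_triv C r)"
    using r unfolding btriv_dual by auto
  have dq: "(fst q, dual_triv (bsum B C) q) \<in> btriv (dual_bundle (bsum B C))"
    "x \<in> fst (fst q, dual_triv (bsum B C) q)"
    using q unfolding btriv_dual by auto
  have e: "dual_triv (bsum B C) q y f =
      (dual_triv B s y (fpart (fibre B y) f), dual_triv C r y (spart (fibre C y) f))"
    if y: "y \<in> fst s" "y \<in> fst r" for y f
  proof -
    have z: "B.vinv s y 0 = 0" "C.vinv r y 0 = 0"
      using linear_0[OF B.linear_vinv[OF s(1) y(1)]] linear_0[OF C.linear_vinv[OF r(1) y(2)]] by auto
    have i: "inv_into (fibre (bsum B C) y) (snd q y) a = (B.vinv s y (fst a), C.vinv r y (snd a))" for a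
      using bij_prod_triv(2)[OF s(1) y(1) r(1) y(2)] by (simp add: q_def)
    show ?thesis
      unfolding dual_triv_def sum_Basis_prod_eq i B.vinv_def[symmetric] C.vinv_def[symmetric]
      by (rule prod_eqI)
        (simp_all add: fst_sum snd_sum z fpart_def spart_def restr_def B.vinv_in[OF s(1) y(1)] C.vinv_in[OF r(1) y(2)])
  qed
  have n: "near A x (\<lambda>y. y \<in> fst s \<and> y \<in> fst r)"
    by (rule B.near_conj[OF B.near_triv[OF s] C.near_triv[OF r]])
  have n1: "near A x (\<lambda>y. dual_triv (bsum B C) q y (h y) =
      (dual_triv B s y (fpart (fibre B y) (h y)), dual_triv C r y (spart (fibre C y) (h y))))"
    by (rule B.near_mono[OF n]) (simp add: e)
  have n2: "near A x (\<lambda>y. (dual_triv B s y (fpart (fibre B y) (h y)), dual_triv C r y (spart (fibre C y) (h y)))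
      = dual_triv (bsum B C) q y (h y))"
    by (rule B.near_mono[OF n1]) simp
  have sm: "smooth_at A x (\<lambda>y. dual_triv (bsum B C) q y (h y)) \<longleftrightarrow>
      smooth_at A x (\<lambda>y. dual_triv B s y (fpart (fibre B y) (h y))) \<and>
      smooth_at A x (\<lambda>y. dual_triv C r y (spart (fibre C y) (h y)))"
  proof
    assume "smooth_at A x (\<lambda>y. dual_triv (bsum B C) q y (h y))"
    from B.smooth_at_cong[OF n1 this]
    show "smooth_at A x (\<lambda>y. dual_triv B s y (fpart (fibre B y) (h y))) \<and>
        smooth_at A x (\<lambda>y. dual_triv C r y (spart (fibre C y) (h y)))"
      using B.smooth_at_fst B.smooth_at_snd by fastforce
  next
    assume "smooth_at A x (\<lambda>y. dual_triv B s y (fpart (fibre B y) (h y))) \<and>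
        smooth_at A x (\<lambda>y. dual_triv C r y (spart (fibre C y) (h y)))"
    then show "smooth_at A x (\<lambda>y. dual_triv (bsum B C) q y (h y))"
      using B.smooth_at_cong[OF n2 B.smooth_at_Pair] by blast
  qed
  have m: "near A x (\<lambda>y. fpart (fibre B y) (h y) \<in> dual_space (fibre B y))"
    "near A x (\<lambda>y. spart (fibre C y) (h y) \<in> dual_space (fibre C y))"
    if "near A x (\<lambda>y. h y \<in> dual_space (fibre B y \<times> fibre C y))"
    by (rule B.near_mono[OF B.near_conj[OF n that]],
        use fpart_in spart_in B.fibre_subspace[OF s(1)] C.fibre_subspace[OF r(1)] in blast)+
  show ?thesis
    unfolding dBC.sec_triv[OF dq] dB.sec_triv[OF ds] dC.sec_triv[OF dr] using sm m by auto
qed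

end

lemma two_bundles_dual: "smooth_bundle A B \<Longrightarrow> two_bundles A B (dual_bundle B)"
  by (simp add: smooth_bundle.smooth_bundle_dual two_bundles_def)

lemma smooth_bundle_gen: "smooth_bundle A B \<Longrightarrow> smooth_bundle A (gen_bundle B)"
  unfolding gen_bundle_def by (rule two_bundles.smooth_bundle_bsum[OF two_bundles_dual])

section \<open>The almost Dirac structures of an adapted structure\<close>

locale flat_pres =
  fixes P :: "('m, 'e::euclidean_space, 'v::real_vector, 'f::euclidean_space, 'z) torus_pres"
  assumes flat_bundle_P: "flat_bundle (pbase P) (pbundle P)"
    and flat_for_P: "flat_bundle.flat_for (pbase P) (pbundle P) (pconn P)"
begin

sublocale flat_bundle "pbase P" "pbundle P" by (rule flat_bundle_P)

abbreviation "A \<equiv> pbase P"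
abbreviation "B \<equiv> pbundle P"
abbreviation "V x \<equiv> fibre (pbundle P) x"
abbreviation "TM x \<equiv> tangent_space (pbase P) x"
abbreviation "E x \<equiv> fibre (gen_bundle (base_sum P)) x"
abbreviation "mkE x v w f g \<equiv> mk (V x) (TM x) v w f g"

lemma tangent_bundle: "smooth_bundle A (tbundle A)" by (rule smooth_bundle_tbundle)

lemma two_bundles_BT: "two_bundles A B (tbundle A)"
  using tangent_bundle by (simp add: two_bundles_def smooth_bundle_axioms)

lemma smooth_base_sum: "smooth_bundle A (base_sum P)"
  unfolding base_sum_def by (rule two_bundles.smooth_bundle_bsum[OF two_bundles_BT])

lemma smooth_E: "smooth_bundle A (gen_bundle (base_sum P))"
  by (rule smooth_bundle_gen[OF smooth_base_sum])

lemma fibre_base_sum: "fibre (base_sum P) x = V x \<times> TM x"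
  by (simp add: base_sum_def)

lemma fibre_E: "E x = (V x \<times> TM x) \<times> dual_space (V x \<times> TM x)"
  by (simp add: fibre_base_sum)

context
  fixes x assumes x: "x \<in> carrier A"
begin

lemma subspace_V: "subspace (V x)" by (rule subspace_fibre[OF x])
lemma subspace_TM: "subspace (TM x)" by (rule subspace_tangent[OF x])

lemmas E_mk_in = mk_in[OF subspace_V subspace_TM, folded fibre_E]
  and E_mk_cases = mk_cases[OF subspace_V subspace_TM, folded fibre_E]
  and E_mk_inject = mk_inject[OF subspace_V subspace_TM]
  and V0 = subspace_0[OF subspace_V] and T0 = subspace_0[OF subspace_TM]
  and E_fpart = fpart_copair[OF subspace_V subspace_TM]
  and E_spart = spart_copair[OF subspace_V subspace_TM]

end

lemma incl_V_mk: "incl_V P x (v, f) = mkE x v 0 f 0"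
  by (simp add: incl_V_def mk_def zero_fun_def)

lemma incl_T_mk: "incl_T P x (w, g) = mkE x 0 w 0 g"
  by (simp add: incl_T_def mk_def zero_fun_def)

text \<open>Projection of an element of \<open>E x\<close> to the sum of V and its dual;
  \<open>cT\<close> is the complementary projection to the tangent and cotangent part. They are left
  inverses of \<open>incl_V\<close> and \<open>incl_T\<close>.\<close>

definition cV :: "('v \<times> ('m, 'e) tvec) gen \<Rightarrow> 'm \<Rightarrow> 'v gen" where
  "cV u x = (fst (fst u), fpart (V x) (snd u))"

definition cT :: "('v \<times> ('m, 'e) tvec) gen \<Rightarrow> 'm \<Rightarrow> ('m, 'e) tvec gen" where
  "cT u x = (snd (fst u), spart (TM x) (snd u))"

lemma c_mk:
  assumes "x \<in> carrier A" "f \<in> dual_space (V x)" "g \<in> dual_space (TM x)"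
  shows "cV (mkE x v w f g) x = (v, f)" "cT (mkE x v w f g) x = (w, g)"
  using E_fpart[OF assms] E_spart[OF assms] by (simp_all add: cV_def cT_def mk_def)

lemma incl_in:
  assumes x: "x \<in> carrier A"
  shows "a \<in> V x \<times> dual_space (V x) \<Longrightarrow> incl_V P x a \<in> E x"
    "b \<in> TM x \<times> dual_space (TM x) \<Longrightarrow> incl_T P x b \<in> E x"
  by (auto simp: incl_V_mk incl_T_mk V0[OF x] T0[OF x] zero_dual_space simp del: fibre_gen_bundle
      intro!: E_mk_in[OF x])

lemma pairing_incl_T:
  assumes x: "x \<in> carrier A" and "b \<in> TM x \<times> dual_space (TM x)" "b' \<in> TM x \<times> dual_space (TM x)"
  shows "pairing (incl_T P x b) (incl_T P x b') = pairing b b'"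
  using assms(2,3) V0[OF x]
  by (cases b; cases b') (simp add: incl_T_mk pairing_mk pairing_def[of "(_, _)"])

lemma c_incl:
  assumes x: "x \<in> carrier A"
  shows "a \<in> V x \<times> dual_space (V x) \<Longrightarrow> cV (incl_V P x a) x = a"
    "a \<in> V x \<times> dual_space (V x) \<Longrightarrow> cT (incl_V P x a) x = 0"
    "b \<in> TM x \<times> dual_space (TM x) \<Longrightarrow> cT (incl_T P x b) x = b"
    "b \<in> TM x \<times> dual_space (TM x) \<Longrightarrow> cV (incl_T P x b) x = 0"
  by (auto simp: incl_V_mk incl_T_mk c_mk[OF x] zero_dual_space zero_prod_def)

lemma c_eq:
  assumes x: "x \<in> carrier A" and "u \<in> E x" "u' \<in> E x" "cV u x = cV u' x" "cT u x = cT u' x"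
  shows "u = u'"
  by (rule E_mk_cases[OF x assms(2)], rule E_mk_cases[OF x assms(3)])
    (use assms(4,5) c_mk[OF x] in auto)

lemma incl_V_inj: "x \<in> carrier A \<Longrightarrow> inj_on (incl_V P x) (V x \<times> dual_space (V x))"
  by (rule inj_onI) (metis c_incl(1))

lemma incl_T_inj: "x \<in> carrier A \<Longrightarrow> inj_on (incl_T P x) (TM x \<times> dual_space (TM x))"
  by (rule inj_onI) (metis c_incl(3))

lemma incl_linear:
  "incl_V P x (a + b) = incl_V P x a + incl_V P x b" "incl_V P x (k *\<^sub>R a) = k *\<^sub>R incl_V P x a"
  "incl_T P x (c + d) = incl_T P x c + incl_T P x d" "incl_T P x (k *\<^sub>R c) = k *\<^sub>R incl_T P x c"
  by (auto simp: incl_V_def incl_T_def copair_def restr_def fun_eq_iff scaleR_fun_apply algebra_simps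
      split: prod.split)

lemma sec_E:
  assumes x: "x \<in> carrier A"
  shows "sec A (gen_bundle (base_sum P)) x u \<longleftrightarrow> near A x (\<lambda>y. u y \<in> E y) \<and>
    sec A B x (\<lambda>y. fst (cV (u y) y)) \<and> sec A (tbundle A) x (\<lambda>y. fst (cT (u y) y)) \<and>
    sec A (dual_bundle B) x (\<lambda>y. snd (cV (u y) y)) \<and>
    sec A (dual_bundle (tbundle A)) x (\<lambda>y. snd (cT (u y) y))"
proof -
  interpret BT: two_bundles A B "tbundle A" by (rule two_bundles_BT)
  have "sec A (gen_bundle (base_sum P)) x u \<longleftrightarrow>
      sec A (base_sum P) x (\<lambda>y. fst (u y)) \<and> sec A (dual_bundle (base_sum P)) x (\<lambda>y. snd (u y))"
    unfolding gen_bundle_def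
    by (rule sec_bsum[OF smooth_bundle.trivs_open[OF smooth_base_sum]
          smooth_bundle.trivs_open[OF smooth_bundle.smooth_bundle_dual[OF smooth_base_sum]] x])
  also have "sec A (base_sum P) x (\<lambda>y. fst (u y)) \<longleftrightarrow>
      sec A B x (\<lambda>y. fst (fst (u y))) \<and> sec A (tbundle A) x (\<lambda>y. snd (fst (u y)))"
    unfolding base_sum_def by (rule sec_bsum[OF trivs_open open_trivs_tbundle x])
  also have "sec A (dual_bundle (base_sum P)) x (\<lambda>y. snd (u y)) \<longleftrightarrow>
      near A x (\<lambda>y. snd (u y) \<in> dual_space (V y \<times> TM y)) \<and>
      sec A (dual_bundle B) x (\<lambda>y. fpart (V y) (snd (u y))) \<and>
      sec A (dual_bundle (tbundle A)) x (\<lambda>y. spart (TM y) (snd (u y)))"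
    using BT.sec_dual_bsum[OF x, of "\<lambda>y. snd (u y)"] by (simp add: base_sum_def)
  finally have 1: "sec A (gen_bundle (base_sum P)) x u \<longleftrightarrow>
      (sec A B x (\<lambda>y. fst (fst (u y))) \<and> sec A (tbundle A) x (\<lambda>y. snd (fst (u y)))) \<and>
      near A x (\<lambda>y. snd (u y) \<in> dual_space (V y \<times> TM y)) \<and>
      sec A (dual_bundle B) x (\<lambda>y. fpart (V y) (snd (u y))) \<and>
      sec A (dual_bundle (tbundle A)) x (\<lambda>y. spart (TM y) (snd (u y)))" .
  have n: "near A x (\<lambda>y. u y \<in> E y)" if "sec A (gen_bundle (base_sum P)) x u"
    using that by (simp add: sec_def del: fibre_gen_bundle)
  have n2: "near A x (\<lambda>y. snd (u y) \<in> dual_space (V y \<times> TM y))" if "near A x (\<lambda>y. u y \<in> E y)"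
    by (rule near_mono[OF that]) (auto simp: fibre_base_sum)
  show ?thesis using 1 n n2 by (auto simp only: cV_def cT_def fst_conv snd_conv)
qed

end

locale adapted_str = flat_pres P
  for P :: "('m, 'e::euclidean_space, 'v::real_vector, 'f::euclidean_space, 'z) torus_pres" +
  fixes K :: "('m, 'e, 'v) base_str"
  assumes gacs_K: "gacs (pbase P) (base_sum P) K" and adapted_K: "adapted P K"
begin

lemma K_pointwise:
  assumes "x \<in> carrier A"
  shows "linear_on_set (E x) (K x)" "u \<in> E x \<Longrightarrow> K x u \<in> E x"
    "u \<in> E x \<Longrightarrow> u' \<in> E x \<Longrightarrow> pairing (K x u) (K x u') = pairing u u'"
    "u \<in> E x \<Longrightarrow> K x (K x u) = - u"
proof -
  have *: "linear_on_set (E x) (K x) \<and> bij_betw (K x) (E x) (E x) \<and>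
        (\<forall>u\<in>E x. \<forall>u'\<in>E x. pairing (K x u) (K x u') = pairing u u') \<and>
        (\<forall>u\<in>E x. K x (K x u) = - u)"
    using gacs_K assms unfolding gacs_def Let_def by blast
  then show "linear_on_set (E x) (K x)"
    "u \<in> E x \<Longrightarrow> u' \<in> E x \<Longrightarrow> pairing (K x u) (K x u') = pairing u u'"
    "u \<in> E x \<Longrightarrow> K x (K x u) = - u" by blast+
  show "u \<in> E x \<Longrightarrow> K x u \<in> E x" using * unfolding bij_betw_def by blast
qed

lemma K_neg: "x \<in> carrier A \<Longrightarrow> u \<in> E x \<Longrightarrow> K x (- u) = - K x u"
  using linear_on_setD(2)[OF K_pointwise(1), of x u "-1"] by (simp add: scaleR_minus1_left)

lemma K_inj: "x \<in> carrier A \<Longrightarrow> u \<in> E x \<Longrightarrow> u' \<in> E x \<Longrightarrow> K x u = K x u' \<Longrightarrow> u = u'"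
  using K_pointwise(4)[of x u] K_pointwise(4)[of x u'] by (metis minus_equation_iff)

lemma sec_K: "x \<in> carrier A \<Longrightarrow> sec A (gen_bundle (base_sum P)) x u \<Longrightarrow>
    sec A (gen_bundle (base_sum P)) x (\<lambda>y. K y (u y))"
  using smooth_bundle.smooth_endo_iff[OF smooth_E K_pointwise(1) K_pointwise(2)] gacs_K
  unfolding gacs_def by blast

lemma K_incl_V:
  assumes x: "x \<in> carrier A" and a: "a \<in> V x \<times> dual_space (V x)"
  shows "cT (K x (incl_V P x a)) x \<in> TM x \<times> dual_space (TM x)"
    "incl_T P x (cT (K x (incl_V P x a)) x) = K x (incl_V P x a)"
proof -
  have "K x (incl_V P x a) \<in> incl_T P x ` (TM x \<times> dual_space (TM x))"
    using adapted_K x a unfolding adapted_def by fastforce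
  then obtain b where "b \<in> TM x \<times> dual_space (TM x)" "K x (incl_V P x a) = incl_T P x b" by blast
  then show "cT (K x (incl_V P x a)) x \<in> TM x \<times> dual_space (TM x)"
    "incl_T P x (cT (K x (incl_V P x a)) x) = K x (incl_V P x a)"
    using c_incl(3)[OF x] by auto
qed

text \<open>If K a = b then K b = - a, so the equality of images in \<open>adapted\<close> can be
  read backwards: K also carries the tangent part into the sum of V and its dual.\<close>

lemma K_incl_T:
  assumes x: "x \<in> carrier A" and b: "b \<in> TM x \<times> dual_space (TM x)"
  shows "cV (K x (incl_T P x b)) x \<in> V x \<times> dual_space (V x)"
    "incl_V P x (cV (K x (incl_T P x b)) x) = K x (incl_T P x b)"
proof -
  have "incl_T P x b \<in> K x ` incl_V P x ` (V x \<times> dual_space (V x))"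
    using adapted_K x b unfolding adapted_def by fastforce
  then obtain a where a: "a \<in> V x \<times> dual_space (V x)" "incl_T P x b = K x (incl_V P x a)" by blast
  have a': "- a \<in> V x \<times> dual_space (V x)"
    using a(1) subspace_neg[OF subspace_Times[OF subspace_V[OF x] subspace_dual_space]] by blast
  have "K x (incl_T P x b) = incl_V P x (- a)"
    using a K_pointwise(4)[OF x incl_in(1)[OF x a(1)]] incl_linear(2)[of x "-1" a]
    by (simp add: scaleR_minus1_left)
  then show "cV (K x (incl_T P x b)) x \<in> V x \<times> dual_space (V x)"
    "incl_V P x (cV (K x (incl_T P x b)) x) = K x (incl_T P x b)"
    using c_incl(1)[OF x a'] a' by auto
qed

lemma inv_incl_T:
  assumes x: "x \<in> carrier A" and a: "a \<in> V x \<times> dual_space (V x)"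
  shows "inv_into (fibre (gen_bundle (tbundle A)) x) (incl_T P x) (K x (incl_V P x a))
    = cT (K x (incl_V P x a)) x"
  using inv_into_f_f[OF incl_T_inj[OF x] K_incl_V(1)[OF x a]] K_incl_V(2)[OF x a] by simp

lemma to_Delta_eq:
  "x \<in> carrier A \<Longrightarrow> v \<in> V x \<Longrightarrow> to_Delta P K x v = cT (K x (incl_V P x (v, 0))) x"
  "x \<in> carrier A \<Longrightarrow> f \<in> dual_space (V x) \<Longrightarrow> to_Delta_hat P K x f = cT (K x (incl_V P x (0, f))) x"
  unfolding to_Delta_def to_Delta_hat_def
  by (rule inv_incl_T; simp add: zero_dual_space V0)+

lemma incl_to_Delta:
  assumes x: "x \<in> carrier A"
  shows "v \<in> V x \<Longrightarrow> incl_T P x (to_Delta P K x v) = K x (incl_V P x (v, 0))"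
    "v \<in> V x \<Longrightarrow> to_Delta P K x v \<in> TM x \<times> dual_space (TM x)"
    "f \<in> dual_space (V x) \<Longrightarrow> incl_T P x (to_Delta_hat P K x f) = K x (incl_V P x (0, f))"
    "f \<in> dual_space (V x) \<Longrightarrow> to_Delta_hat P K x f \<in> TM x \<times> dual_space (TM x)"
proof -
  have m: "(v, 0) \<in> V x \<times> dual_space (V x)" if "v \<in> V x" for v using that zero_dual_space by auto
  have m': "(0, f) \<in> V x \<times> dual_space (V x)" if "f \<in> dual_space (V x)" for f
    using that V0[OF x] by auto
  show "v \<in> V x \<Longrightarrow> incl_T P x (to_Delta P K x v) = K x (incl_V P x (v, 0))"
    "v \<in> V x \<Longrightarrow> to_Delta P K x v \<in> TM x \<times> dual_space (TM x)"
    using to_Delta_eq(1)[OF x] K_incl_V[OF x m] by auto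
  show "f \<in> dual_space (V x) \<Longrightarrow> incl_T P x (to_Delta_hat P K x f) = K x (incl_V P x (0, f))"
    "f \<in> dual_space (V x) \<Longrightarrow> to_Delta_hat P K x f \<in> TM x \<times> dual_space (TM x)"
    using to_Delta_eq(2)[OF x] K_incl_V[OF x m'] by auto
qed

lemma Delta_image:
  assumes x: "x \<in> carrier A"
  shows "Delta P K x = to_Delta P K x ` V x"
    "Delta_hat P K x = to_Delta_hat P K x ` dual_space (V x)"
proof -
  note j = inj_onD[OF incl_T_inj[OF x]]
  \<comment> \<open>Stated for an arbitrary parametrisation \<open>h\<close>, so that V and its dual
    are treated by the same argument.\<close>
  have g: "{y \<in> fibre (gen_bundle (tbundle A)) x. incl_T P x y \<in> K x ` incl_V P x ` h ` S} = d ` S"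
    if S: "\<And>s. s \<in> S \<Longrightarrow> incl_T P x (d s) = K x (incl_V P x (h s)) \<and> d s \<in> TM x \<times> dual_space (TM x)"
    for S :: "'s set" and h d
  proof (intro set_eqI iffI)
    fix y assume "y \<in> {y \<in> fibre (gen_bundle (tbundle A)) x. incl_T P x y \<in> K x ` incl_V P x ` h ` S}"
    then obtain s where s: "s \<in> S" "incl_T P x y = K x (incl_V P x (h s))" "y \<in> TM x \<times> dual_space (TM x)"
      by auto
    then have "y = d s" using S[OF s(1)] by (intro j) auto
    then show "y \<in> d ` S" using s by blast
  next
    fix y assume "y \<in> d ` S"
    then obtain s where s: "s \<in> S" "y = d s" by blast
    then show "y \<in> {y \<in> fibre (gen_bundle (tbundle A)) x. incl_T P x y \<in> K x ` incl_V P x ` h ` S}"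
      using S[OF s(1)] by simp
  qed
  have e: "V x \<times> {0} = (\<lambda>v. (v, 0)) ` V x" "{0} \<times> fibre (dual_bundle B) x = (\<lambda>f. (0, f)) ` dual_space (V x)"
    by auto
  show "Delta P K x = to_Delta P K x ` V x"
    unfolding Delta_def e using incl_to_Delta(1,2)[OF x] by (intro g) blast
  show "Delta_hat P K x = to_Delta_hat P K x ` dual_space (V x)"
    unfolding Delta_hat_def e using incl_to_Delta(3,4)[OF x] by (intro g) blast
qed

lemma bij_to_Delta:
  assumes x: "x \<in> carrier A" shows "bij_betw (to_Delta P K x) (V x) (Delta P K x)"
  unfolding bij_betw_def
proof
  show "inj_on (to_Delta P K x) (V x)"
  proof (rule inj_onI)
    fix v w assume v: "v \<in> V x" and w: "w \<in> V x" and "to_Delta P K x v = to_Delta P K x w"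
    then have "K x (incl_V P x (v, 0)) = K x (incl_V P x (w, 0))" using incl_to_Delta(1)[OF x] by metis
    then have "incl_V P x (v, 0) = incl_V P x (w, 0)"
      using K_inj[OF x incl_in(1)[OF x] incl_in(1)[OF x]] v w zero_dual_space by blast
    then show "v = w" using inj_onD[OF incl_V_inj[OF x]] v w zero_dual_space by blast
  qed
qed (simp add: Delta_image(1)[OF x])

lemma linear_to_Delta:
  assumes x: "x \<in> carrier A" shows "linear_on_set (V x) (to_Delta P K x)"
  unfolding linear_on_set_def
proof (intro conjI ballI allI)
  have m: "incl_V P x (v, 0) \<in> E x" if "v \<in> V x" for v
    using incl_in(1)[OF x] that zero_dual_space by blast
  note j = inj_onD[OF incl_T_inj[OF x]]
  note TT = subspace_Times[OF subspace_TM[OF x] subspace_dual_space[of "TM x"]]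
  note i = incl_to_Delta(1,2)[OF x] and L = linear_on_setD[OF K_pointwise(1)[OF x]]
  show "to_Delta P K x (v + w) = to_Delta P K x v + to_Delta P K x w" if v: "v \<in> V x" and w: "w \<in> V x" for v w
  proof (rule j)
    note vw = subspace_add[OF subspace_V[OF x] v w]
    show "incl_T P x (to_Delta P K x (v + w)) = incl_T P x (to_Delta P K x v + to_Delta P K x w)"
      using i(1)[OF vw] i(1)[OF v] i(1)[OF w] L(1)[OF m[OF v] m[OF w]]
        incl_linear(1)[of x "(v, 0)" "(w, 0)"] by (simp add: incl_linear(3))
    show "to_Delta P K x (v + w) \<in> TM x \<times> dual_space (TM x)" by (rule i(2)[OF vw])
    show "to_Delta P K x v + to_Delta P K x w \<in> TM x \<times> dual_space (TM x)"
      by (rule subspace_add[OF TT i(2)[OF v] i(2)[OF w]])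
  qed
  show "to_Delta P K x (k *\<^sub>R v) = k *\<^sub>R to_Delta P K x v" if v: "v \<in> V x" for v k
  proof (rule j)
    note kv = subspace_scale[OF subspace_V[OF x] v]
    show "incl_T P x (to_Delta P K x (k *\<^sub>R v)) = incl_T P x (k *\<^sub>R to_Delta P K x v)"
      using i(1)[OF kv] i(1)[OF v] L(2)[OF m[OF v]]
        incl_linear(2)[of x k "(v, 0)"] by (simp add: incl_linear(4))
    show "to_Delta P K x (k *\<^sub>R v) \<in> TM x \<times> dual_space (TM x)" by (rule i(2)[OF kv])
    show "k *\<^sub>R to_Delta P K x v \<in> TM x \<times> dual_space (TM x)"
      by (rule subspace_scale[OF TT i(2)[OF v]])
  qed
qed

lemma sec_incl_V:
  assumes x: "x \<in> carrier A" and v: "sec A B x v" and f: "sec A (dual_bundle B) x f"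
  shows "sec A (gen_bundle (base_sum P)) x (\<lambda>y. incl_V P y (v y, f y))"
proof -
  have n: "near A x (\<lambda>y. (v y, f y) \<in> V y \<times> dual_space (V y))"
    by (rule near_mono[OF near_conj[of x "\<lambda>y. v y \<in> V y" "\<lambda>y. f y \<in> dual_space (V y)"]])
      (use v f in \<open>auto simp: sec_def\<close>)
  note z = smooth_bundle.sec_zero[OF tangent_bundle x]
    smooth_bundle.sec_zero[OF smooth_bundle.smooth_bundle_dual[OF tangent_bundle] x]
  show ?thesis
    unfolding sec_E[OF x]
  proof (intro conjI)
    show "near A x (\<lambda>y. incl_V P y (v y, f y) \<in> E y)"
      by (rule near_mono[OF n]) (rule incl_in(1))
    show "sec A B x (\<lambda>y. fst (cV (incl_V P y (v y, f y)) y))"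
      by (rule sec_cong[OF near_mono[OF n] v]) (simp add: c_incl(1))
    show "sec A (dual_bundle B) x (\<lambda>y. snd (cV (incl_V P y (v y, f y)) y))"
      by (rule sec_cong[OF near_mono[OF n] f]) (simp add: c_incl(1))
    show "sec A (tbundle A) x (\<lambda>y. fst (cT (incl_V P y (v y, f y)) y))"
      by (rule sec_cong[OF near_mono[OF n] z(1)]) (simp add: c_incl(2))
    show "sec A (dual_bundle (tbundle A)) x (\<lambda>y. snd (cT (incl_V P y (v y, f y)) y))"
      by (rule sec_cong[OF near_mono[OF n] z(2)]) (simp add: c_incl(2))
  qed
qed

lemma sec_incl_T:
  assumes x: "x \<in> carrier A" and s: "sec A (gen_bundle (tbundle A)) x \<sigma>"
  shows "sec A (gen_bundle (base_sum P)) x (\<lambda>y. incl_T P y (\<sigma> y))"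
proof -
  have n: "near A x (\<lambda>y. \<sigma> y \<in> TM y \<times> dual_space (TM y))"
    using s by (simp add: sec_def)
  have s': "sec A (tbundle A) x (\<lambda>y. fst (\<sigma> y))" "sec A (dual_bundle (tbundle A)) x (\<lambda>y. snd (\<sigma> y))"
    using s sec_gen[OF x] by blast+
  note z = sec_zero[OF x] smooth_bundle.sec_zero[OF smooth_bundle_dual x]
  show ?thesis
    unfolding sec_E[OF x]
  proof (intro conjI)
    show "near A x (\<lambda>y. incl_T P y (\<sigma> y) \<in> E y)"
      by (rule near_mono[OF n]) (rule incl_in(2))
    show "sec A B x (\<lambda>y. fst (cV (incl_T P y (\<sigma> y)) y))"
      by (rule sec_cong[OF near_mono[OF n] z(1)]) (simp add: c_incl(4))
    show "sec A (dual_bundle B) x (\<lambda>y. snd (cV (incl_T P y (\<sigma> y)) y))"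
      by (rule sec_cong[OF near_mono[OF n] z(2)]) (simp add: c_incl(4))
    show "sec A (tbundle A) x (\<lambda>y. fst (cT (incl_T P y (\<sigma> y)) y))"
      by (rule sec_cong[OF near_mono[OF n] s'(1)]) (simp add: c_incl(3))
    show "sec A (dual_bundle (tbundle A)) x (\<lambda>y. snd (cT (incl_T P y (\<sigma> y)) y))"
      by (rule sec_cong[OF near_mono[OF n] s'(2)]) (simp add: c_incl(3))
  qed
qed

lemma sec_to_Delta:
  assumes s: "sec A B x s" shows "sec A (gen_bundle (tbundle A)) x (\<lambda>y. to_Delta P K y (s y))"
proof -
  have n: "near A x (\<lambda>y. s y \<in> V y)" using s by (simp add: sec_def)
  have x: "x \<in> carrier A" using n unfolding near_def using mopen_subset_carrier by blast
  let ?u = "\<lambda>y. K y (incl_V P y (s y, 0))"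
  have "sec A (gen_bundle (base_sum P)) x ?u"
    by (intro sec_K sec_incl_V x s smooth_bundle.sec_zero[OF smooth_bundle_dual x])
  then have "sec A (gen_bundle (tbundle A)) x (\<lambda>y. cT (?u y) y)"
    unfolding sec_E[OF x] sec_gen[OF x] by blast
  then show ?thesis
    by (rule sec_cong[OF near_mono[OF n], rotated]) (simp add: to_Delta_eq(1))
qed

text \<open>The inverse of K is -K. This closed form shows that the inverse of
  \<open>to_Delta\<close> preserves smoothness, about which \<open>inv_into\<close> by itself says
  nothing.\<close>

lemma inv_to_Delta:
  assumes x: "x \<in> carrier A" and d: "\<sigma> \<in> Delta P K x"
  shows "inv_into (V x) (to_Delta P K x) \<sigma> = fst (cV (- K x (incl_T P x \<sigma>)) x)"
proof -
  obtain v where v: "v \<in> V x" "\<sigma> = to_Delta P K x v" using d Delta_image(1)[OF x] by blast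
  have m: "(v, 0) \<in> V x \<times> dual_space (V x)" using v zero_dual_space by blast
  have "K x (incl_T P x \<sigma>) = - incl_V P x (v, 0)"
    using incl_to_Delta(1)[OF x v(1)] K_pointwise(4)[OF x incl_in(1)[OF x m]] v(2) by simp
  then have "fst (cV (- K x (incl_T P x \<sigma>)) x) = v" using c_incl(1)[OF x m] by simp
  then show ?thesis using bij_betw_inv_into_left[OF bij_to_Delta[OF x] v(1)] v(2) by simp
qed

lemma sec_from_Delta:
  assumes s: "sec A (gen_bundle (tbundle A)) x \<sigma>" and d: "near A x (\<lambda>y. \<sigma> y \<in> Delta P K y)"
  shows "sec A B x (\<lambda>y. inv_into (V y) (to_Delta P K y) (\<sigma> y))"
proof -
  have x: "x \<in> carrier A" using d unfolding near_def using mopen_subset_carrier by blast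
  let ?u = "\<lambda>y. - K y (incl_T P y (\<sigma> y))"
  have "sec A (gen_bundle (base_sum P)) x ?u"
    by (intro smooth_bundle.sec_minus[OF smooth_E] sec_K sec_incl_T x s)
  then have "sec A B x (\<lambda>y. fst (cV (?u y) y))"
    unfolding sec_E[OF x] by blast
  then show ?thesis
    by (rule sec_cong[OF near_mono[OF d], rotated]) (simp add: inv_to_Delta)
qed

lemma flat_connection_Delta:
  "flat_connection A (sub_sections A (gen_bundle (tbundle A)) (Delta P K)) (conn_Delta P K)"
  unfolding conn_Delta_def
  by (rule flat_connection_transport[OF flat_for_P _ bij_to_Delta linear_to_Delta sec_from_Delta sec_to_Delta])
    (rule smooth_bundle.trivs_open[OF smooth_bundle_gen[OF tangent_bundle]])

section \<open>Isotropy, maximality and local frames\<close>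

lemma isotropic_Delta:
  assumes x: "x \<in> carrier A" shows "isotropic (Delta P K x)"
  unfolding isotropic_def
proof (intro ballI)
  fix u u' assume "u \<in> Delta P K x" "u' \<in> Delta P K x"
  then obtain v v' where v: "v \<in> V x" "u = to_Delta P K x v" and v': "v' \<in> V x" "u' = to_Delta P K x v'"
    using Delta_image(1)[OF x] by blast
  have m: "(v, 0) \<in> V x \<times> dual_space (V x)" "(v', 0) \<in> V x \<times> dual_space (V x)"
    using v v' zero_dual_space by blast+
  have "pairing u u' = pairing (incl_V P x (v, 0)) (incl_V P x (v', 0))"
    using pairing_incl_T[OF x incl_to_Delta(2)[OF x v(1)] incl_to_Delta(2)[OF x v'(1)]] v v'
      incl_to_Delta(1)[OF x] K_pointwise(3)[OF x incl_in(1)[OF x m(1)] incl_in(1)[OF x m(2)]] by simp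
  also have "\<dots> = 0" using v v' T0[OF x] by (simp add: incl_V_mk pairing_mk)
  finally show "pairing u u' = 0" .
qed

lemma maximal_Delta:
  assumes x: "x \<in> carrier A" and S: "S \<subseteq> TM x \<times> dual_space (TM x)" "isotropic S" "Delta P K x \<subseteq> S"
  shows "S = Delta P K x"
proof
  show "S \<subseteq> Delta P K x"
  proof
    fix u assume u: "u \<in> S"
    then have uT: "u \<in> TM x \<times> dual_space (TM x)" using S(1) by blast
    obtain a where a: "a = cV (K x (incl_T P x u)) x" "a \<in> V x \<times> dual_space (V x)"
      "incl_V P x a = K x (incl_T P x u)"
      using K_incl_T[OF x uT] by auto
    have "snd a v = 0" if v: "v \<in> V x" for v
    proof -
      have m: "(v, 0) \<in> V x \<times> dual_space (V x)" using v zero_dual_space by blast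
      have d: "to_Delta P K x v \<in> TM x \<times> dual_space (TM x)" by (rule incl_to_Delta(2)[OF x v])
      have "0 = pairing u (to_Delta P K x v)"
        using S(2,3) u Delta_image(1)[OF x] v unfolding isotropic_def by fastforce
      also have "\<dots> = pairing (incl_T P x u) (incl_T P x (to_Delta P K x v))"
        using pairing_incl_T[OF x uT d] by simp
      also have "\<dots> = pairing (K x (incl_T P x u)) (K x (incl_T P x (to_Delta P K x v)))"
        by (rule K_pointwise(3)[OF x incl_in(2)[OF x uT] incl_in(2)[OF x d], symmetric])
      \<comment> \<open>K applied to K v is -v, so orthogonality of \<open>u\<close> to K v becomes
        the vanishing of the functional \<open>snd a\<close> on \<open>v\<close>.\<close>
      also have "K x (incl_T P x (to_Delta P K x v)) = incl_V P x (- (v, 0))"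
        using incl_to_Delta(1)[OF x v] K_pointwise(4)[OF x incl_in(1)[OF x m]]
          incl_linear(2)[of x "-1" "(v, 0)"] by (simp only: scaleR_minus1_left)
      also have "pairing (K x (incl_T P x u)) \<dots> = (1/2) * snd a v"
        using a(2) v T0[OF x] subspace_neg[OF subspace_V[OF x] v] linear_on_setD(2)[OF dual_spaceD(1), of "snd a" "V x" v "-1"]
        by (cases a) (auto simp: a(3)[symmetric] incl_V_mk pairing_mk)
      finally show ?thesis by simp
    qed
    then have a2: "snd a = 0"
      using a(2) by (intro dual_space_eqI[of "snd a" "V x" 0]) (auto simp: zero_dual_space)
    have na: "- fst a \<in> V x" using a(2) subspace_neg[OF subspace_V[OF x]] by auto
    have "incl_T P x u = - K x (incl_V P x a)"
      using K_pointwise(4)[OF x incl_in(2)[OF x uT]] a(3) by simp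
    also have "\<dots> = K x (incl_V P x (- a))"
      using K_neg[OF x incl_in(1)[OF x a(2)]] incl_linear(2)[of x "-1" a] by (simp add: scaleR_minus1_left)
    also have "- a = (- fst a, 0)" using a2 by (cases a) simp
    finally have "incl_T P x u = K x (incl_V P x (- fst a, 0))" .
    then show "u \<in> Delta P K x" unfolding Delta_def using uT na by auto
  qed
qed (rule S(3))

text \<open>The frame is the image under \<open>to_Delta\<close> of the sections of V that are
  constant in a trivialisation, one for each basis vector; \<open>h\<close> numbers the basis
  because \<open>subbundle\<close> asks for frames indexed by an initial segment.\<close>

lemma subbundle_Delta: "subbundle A (gen_bundle (tbundle A)) (Delta P K)"
  unfolding subbundle_def
proof
  fix x assume x: "x \<in> carrier A"
  obtain t where t: "t \<in> btriv B" "x \<in> fst t" using triv_cover[OF x] by blast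
  obtain h where h: "bij_betw h {..<card (Basis :: 'f set)} (Basis :: 'f set)"
    using ex_bij_betw_nat_finite[OF finite_Basis] by (metis atLeast0LessThan)
  let ?k = "card (Basis :: 'f set)"
  define e where "e i y = to_Delta P K y (vinv t y (h i))" for i y
  have "\<forall>i<?k. e i \<in> smooth_sections A (gen_bundle (tbundle A)) (fst t)"
  proof (intro allI impI)
    fix i
    show "e i \<in> smooth_sections A (gen_bundle (tbundle A)) (fst t)"
      unfolding smooth_sections_iff[OF triv_open[OF t(1)] smooth_bundle.trivs_open[OF smooth_bundle_gen[OF tangent_bundle]]]
        e_def[abs_def] using sec_to_Delta[OF sec_vinv[OF t(1)]] by blast
  qed
  moreover have "inj_on (\<lambda>i. e i y) {..<?k} \<and> independent ((\<lambda>i. e i y) ` {..<?k}) \<and>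
       span ((\<lambda>i. e i y) ` {..<?k}) = Delta P K y" if y: "y \<in> fst t" for y
  proof -
    have yc: "y \<in> carrier A" by (rule triv_carrier[OF t(1) y])
    let ?L = "\<lambda>a. to_Delta P K y (vinv t y a)"
    have L: "linear ?L"
      by (rule linear_on_set_compose[OF linear_vinv[OF t(1) y] vinv_in[OF t(1) y] linear_to_Delta[OF yc]])
    have inj: "inj ?L"
    proof (rule injI)
      fix a b assume "?L a = ?L b"
      then have "vinv t y a = vinv t y b"
        using bij_betw_imp_inj_on[OF bij_to_Delta[OF yc]] vinv_in[OF t(1) y] unfolding inj_on_def by blast
      then show "a = b" using triv_vinv[OF t(1) y] by metis
    qed
    have im: "(\<lambda>i. e i y) ` {..<?k} = ?L ` Basis"
      using bij_betw_imp_surj_on[OF h] unfolding e_def by (metis (no_types, lifting) image_cong image_image)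
    have r: "range ?L = Delta P K y"
    proof -
      have "range (vinv t y) = V y" using vinv_in[OF t(1) y] vinv_triv[OF t(1) y]
        by (metis UNIV_I image_eqI image_subsetI subsetI subset_antisym)
      then show ?thesis unfolding Delta_image(1)[OF yc] by (metis image_image)
    qed
    have "inj_on (\<lambda>i. e i y) {..<?k}"
      using comp_inj_on[OF bij_betw_imp_inj_on[OF h] inj_on_subset[OF inj]] by (simp add: o_def e_def)
    moreover have "independent (?L ` Basis)"
      using linear_independent_injective_image[OF L independent_Basis] inj inj_on_subset by blast
    moreover have "span (?L ` Basis) = Delta P K y"
      using linear_span_image[OF L, of Basis] r by simp
    ultimately show ?thesis unfolding im by blast
  qed
  ultimately show "\<exists>U (k::nat) e. mopen A U \<and> x \<in> U \<and>
     (\<forall>i<k. e i \<in> smooth_sections A (gen_bundle (tbundle A)) U) \<and>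
     (\<forall>y\<in>U. inj_on (\<lambda>i. e i y) {..<k} \<and> independent ((\<lambda>i. e i y) ` {..<k}) \<and>
        span ((\<lambda>i. e i y) ` {..<k}) = Delta P K y)"
    using triv_open[OF t(1)] t(2) by (intro exI[of _ "fst t"] exI[of _ ?k] exI[of _ e]) blast
qed

lemma almost_dirac_Delta: "almost_dirac A (Delta P K)"
  unfolding almost_dirac_def
proof (intro conjI ballI allI impI subbundle_Delta)
  fix x assume x: "x \<in> carrier A"
  show "isotropic (Delta P K x)" by (rule isotropic_Delta[OF x])
  fix S assume "subspace S \<and> S \<subseteq> fibre (gen_bundle (tbundle A)) x \<and> isotropic S \<and> Delta P K x \<subseteq> S"
  then show "S = Delta P K x" by (intro maximal_Delta[OF x]) auto
qed

end

section \<open>The mirror structure\<close>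

lemma inv_into_cong_fun: "(\<And>x. x \<in> S \<Longrightarrow> f x = g x) \<Longrightarrow> inv_into S f y = inv_into S g y"
  by (simp add: inv_into_def cong: conj_cong)

lemma linear_on_set_cong:
  "subspace S \<Longrightarrow> (\<And>x. x \<in> S \<Longrightarrow> f x = g x) \<Longrightarrow> linear_on_set S f \<Longrightarrow> linear_on_set S g"
  by (simp add: linear_on_set_def subspace_add subspace_scale)

text \<open>The families of the mirror and of K are known to agree over the carrier only, so
  properties are transferred pointwise and not by rewriting with an equality of functions.\<close>

lemma subbundle_cong:
  assumes "satlas A" "\<And>x. x \<in> carrier A \<Longrightarrow> \<Delta> x = \<Delta>' x" "subbundle A C \<Delta>"
  shows "subbundle A C \<Delta>'"
  unfolding subbundle_def
proof
  interpret satlas A by fact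
  fix x assume "x \<in> carrier A"
  then obtain U k and e where U: "mopen A U" "x \<in> U" "\<forall>i<k. e i \<in> smooth_sections A C U"
     "\<forall>y\<in>U. inj_on (\<lambda>i. e i y) {..<(k::nat)} \<and> independent ((\<lambda>i. e i y) ` {..<k}) \<and>
        span ((\<lambda>i. e i y) ` {..<k}) = \<Delta> y"
    using assms(3) unfolding subbundle_def by blast
  then show "\<exists>U (k::nat) e. mopen A U \<and> x \<in> U \<and> (\<forall>i<k. e i \<in> smooth_sections A C U) \<and>
     (\<forall>y\<in>U. inj_on (\<lambda>i. e i y) {..<k} \<and> independent ((\<lambda>i. e i y) ` {..<k}) \<and>
        span ((\<lambda>i. e i y) ` {..<k}) = \<Delta>' y)"
    using assms(2) mopen_subset_carrier[OF U(1)] by (intro exI[of _ U] exI[of _ k] exI[of _ e]) simp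
qed

lemma almost_dirac_cong:
  assumes "satlas A" "\<And>x. x \<in> carrier A \<Longrightarrow> \<Delta> x = \<Delta>' x" "almost_dirac A \<Delta>"
  shows "almost_dirac A \<Delta>'"
proof -
  have "subbundle A (gen_bundle (tbundle A)) \<Delta>'"
    by (rule subbundle_cong[OF assms(1,2)]) (use assms(3) in \<open>auto simp: almost_dirac_def\<close>)
  then show ?thesis using assms(2,3) unfolding almost_dirac_def by simp
qed

text \<open>The comparison with the mirror takes place over M, so of the dual presentation only the
  base, the bundle and the connection are prescribed.\<close>

locale mirror_pair = adapted_str P K
  for P :: "('m, 'e::euclidean_space, 'v::real_vector, 'f::euclidean_space, 'z) torus_pres"
    and K :: "('m, 'e, 'v) base_str" +
  fixes Q :: "('m, 'e, 'v \<Rightarrow> real, 'f, 'z2) torus_pres"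
  assumes base_eq: "pbase Q = pbase P" and bundle_eq: "pbundle Q = dual_bundle (pbundle P)"
    and conn_eq: "pconn Q = dual_conn (pbase P) (pbundle P) (pconn P)"
begin

sublocale Q: flat_pres Q
  by (rule flat_pres.intro; unfold base_eq bundle_eq conn_eq;
      rule flat_bundle_dual flat_for_dual_conn[OF flat_for_P])

abbreviation "E' x \<equiv> fibre (gen_bundle (base_sum Q)) x"
abbreviation "dV x \<equiv> dual_space (V x)"

lemma ev_add:
  assumes "v \<in> V x" "w \<in> V x" shows "ev x (v + w) = ev x v + ev x w"
  using linear_on_setD(1)[OF dual_spaceD(1) assms] by (auto simp: ev_def restr_def fun_eq_iff)

lemma ev_scale:
  assumes "v \<in> V x" shows "ev x (k *\<^sub>R v) = k *\<^sub>R ev x v"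
  using linear_on_setD(2)[OF dual_spaceD(1) assms] by (auto simp: ev_def restr_def fun_eq_iff scaleR_fun_apply)

lemma ev_0: assumes x: "x \<in> carrier A" shows "ev x 0 = 0"
  using ev_scale[OF V0[OF x], of 0] by simp

lemma tau_mk:
  assumes x: "x \<in> carrier A" and "v \<in> V x" "w \<in> TM x" and f: "f \<in> dV x" and g: "g \<in> dual_space (TM x)"
  shows "tau_swap P x (mkE x v w f g) = mk (dV x) (TM x) f w (ev x v) g"
proof -
  have "restr (V x) (\<lambda>u. copair (V x) (TM x) f g (u, 0)) = f"
    using E_fpart[OF x f g] by (simp add: fpart_def)
  moreover have "copair (dV x) (TM x) (\<lambda>f. f v) (\<lambda>r. copair (V x) (TM x) f g (0, r))
      = copair (dV x) (TM x) (ev x v) g"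
    using V0[OF x] dual_space_zero[OF f subspace_V[OF x]]
    by (auto simp: copair_def restr_def ev_def fun_eq_iff)
  ultimately show ?thesis by (simp add: tau_swap_def mk_def)
qed

lemma tau_in: assumes x: "x \<in> carrier A" and u: "u \<in> E x" shows "tau_swap P x u \<in> E' x"
  by (rule E_mk_cases[OF x u])
    (use Q.E_mk_in[of x, unfolded base_eq bundle_eq fibre_dual_bundle, OF x] ev_in tau_mk[OF x] in
      \<open>simp del: fibre_gen_bundle\<close>)

lemma c_tau:
  assumes x: "x \<in> carrier A" and u: "u \<in> E x"
  shows "Q.cV (tau_swap P x u) x = (snd (cV u x), ev x (fst (cV u x)))"
    "Q.cT (tau_swap P x u) x = cT u x"
proof -
  obtain v w f g where c: "v \<in> V x" "w \<in> TM x" "f \<in> dV x" "g \<in> dual_space (TM x)" "u = mkE x v w f g"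
    using E_mk_cases[OF x u] by blast
  note q = Q.c_mk[of x, unfolded base_eq bundle_eq fibre_dual_bundle, OF x ev_in c(4)]
  show "Q.cV (tau_swap P x u) x = (snd (cV u x), ev x (fst (cV u x)))"
    "Q.cT (tau_swap P x u) x = cT u x"
    unfolding c(5) tau_mk[OF x c(1-4)] q c_mk[OF x c(3,4)] by simp_all
qed

lemma tau_incl_V:
  assumes x: "x \<in> carrier A" and "v \<in> V x" "f \<in> dV x"
  shows "tau_swap P x (incl_V P x (v, f)) = incl_V Q x (f, ev x v)"
  unfolding incl_V_mk Q.incl_V_mk tau_mk[OF x assms(2) T0[OF x] assms(3) zero_dual_space]
  by (simp add: base_eq bundle_eq)

lemma tau_incl_T:
  assumes x: "x \<in> carrier A" and b: "b \<in> TM x \<times> dual_space (TM x)"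
  shows "tau_swap P x (incl_T P x b) = incl_T Q x b"
proof -
  obtain w g where b': "b = (w, g)" "w \<in> TM x" "g \<in> dual_space (TM x)" using b by auto
  show ?thesis
    unfolding b' incl_T_mk Q.incl_T_mk tau_mk[OF x V0[OF x] b'(2) zero_dual_space b'(3)] ev_0[OF x]
    by (simp add: base_eq bundle_eq)
qed

lemma tau_linear: assumes x: "x \<in> carrier A" shows "linear_on_set (E x) (tau_swap P x)"
  unfolding linear_on_set_def
proof (intro conjI ballI allI)
  fix u assume u: "u \<in> E x"
  obtain v w f g where c: "v \<in> V x" "w \<in> TM x" "f \<in> dV x" "g \<in> dual_space (TM x)" "u = mkE x v w f g"
    using E_mk_cases[OF x u] by blast
  note SV = subspace_V[OF x] and ST = subspace_TM[OF x]
  show "tau_swap P x (k *\<^sub>R u) = k *\<^sub>R tau_swap P x u" for k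
    unfolding c(5) mk_scaleR tau_mk[OF x c(1-4)]
    by (subst tau_mk[OF x]) (auto simp: ev_scale[OF c(1)] intro!: subspace_scale SV ST subspace_dual_space c)
  fix u' assume u': "u' \<in> E x"
  obtain v' w' f' g' where d: "v' \<in> V x" "w' \<in> TM x" "f' \<in> dV x" "g' \<in> dual_space (TM x)" "u' = mkE x v' w' f' g'"
    using E_mk_cases[OF x u'] by blast
  show "tau_swap P x (u + u') = tau_swap P x u + tau_swap P x u'"
    unfolding c(5) d(5) mk_add tau_mk[OF x c(1-4)] tau_mk[OF x d(1-4)]
    by (subst tau_mk[OF x]) (auto simp: ev_add[OF c(1) d(1)] intro!: subspace_add SV ST subspace_dual_space c d)
qed

lemma tau_pairing:
  assumes x: "x \<in> carrier A" and u: "u \<in> E x" and u': "u' \<in> E x"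
  shows "pairing (tau_swap P x u) (tau_swap P x u') = pairing u u'"
proof -
  obtain v w f g where c: "v \<in> V x" "w \<in> TM x" "f \<in> dV x" "g \<in> dual_space (TM x)" "u = mkE x v w f g"
    using E_mk_cases[OF x u] by blast
  obtain v' w' f' g' where d: "v' \<in> V x" "w' \<in> TM x" "f' \<in> dV x" "g' \<in> dual_space (TM x)" "u' = mkE x v' w' f' g'"
    using E_mk_cases[OF x u'] by blast
  show ?thesis
    unfolding c(5) d(5) tau_mk[OF x c(1-4)] tau_mk[OF x d(1-4)]
    by (subst (1 2) pairing_mk) (use c d in \<open>auto simp: ev_def restr_def\<close>)
qed

text \<open>Both halves come from evaluation into the double dual: \<open>ev_inject\<close>
  separates the vectors of V, and \<open>double_dual\<close> produces the preimage of the component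
  in the double dual.\<close>

lemma tau_bij: assumes x: "x \<in> carrier A" shows "bij_betw (tau_swap P x) (E x) (E' x)"
  unfolding bij_betw_def
proof
  show "inj_on (tau_swap P x) (E x)"
  proof (rule inj_onI)
    fix u u' assume u: "u \<in> E x" and u': "u' \<in> E x" and e: "tau_swap P x u = tau_swap P x u'"
    have "fst (cV u x) \<in> V x" "fst (cV u' x) \<in> V x"
      using u u' by (auto simp: cV_def fibre_base_sum)
    then have "fst (cV u x) = fst (cV u' x)"
      using c_tau(1)[OF x u] c_tau(1)[OF x u'] e ev_inject[OF x] by simp
    then show "u = u'"
      using c_tau[OF x u] c_tau[OF x u'] e by (intro c_eq[OF x u u']) (auto intro: prod_eqI)
  qed
  show "tau_swap P x ` E x = E' x"
  proof
    show "tau_swap P x ` E x \<subseteq> E' x" using tau_in[OF x] by blast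
    show "E' x \<subseteq> tau_swap P x ` E x"
    proof
      fix u' assume "u' \<in> E' x"
      then obtain f w p g where c: "f \<in> dV x" "w \<in> TM x" "p \<in> dual_space (dV x)" "g \<in> dual_space (TM x)"
        "u' = mk (dV x) (TM x) f w p g"
        using Q.E_mk_cases[of x u', unfolded base_eq bundle_eq fibre_dual_bundle, OF x] by blast
      obtain v where v: "v \<in> V x" "ev x v = p" using double_dual[OF x c(3)] by blast
      show "u' \<in> tau_swap P x ` E x"
        using tau_mk[OF x v(1) c(2,1,4)] E_mk_in[OF x v(1) c(2,1,4)] v c(5) by (metis image_eqI)
    qed
  qed
qed

abbreviation "tauinv x \<equiv> inv_into (E x) (tau_swap P x)"

lemma tauinv:
  assumes x: "x \<in> carrier A"
  shows "u \<in> E x \<Longrightarrow> tauinv x (tau_swap P x u) = u" "u' \<in> E' x \<Longrightarrow> tau_swap P x (tauinv x u') = u'"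
    "u' \<in> E' x \<Longrightarrow> tauinv x u' \<in> E x"
  using bij_betw_inv_into_left[OF tau_bij[OF x]] bij_betw_inv_into_right[OF tau_bij[OF x]]
    bij_betw_imp_surj_on[OF bij_betw_inv_into[OF tau_bij[OF x]]] by blast+

lemma sec_tau:
  assumes x: "x \<in> carrier A" and u: "sec A (gen_bundle (base_sum P)) x u"
  shows "sec A (gen_bundle (base_sum Q)) x (\<lambda>y. tau_swap P y (u y))"
proof -
  note s = u[unfolded sec_E[OF x]]
  have n: "near A x (\<lambda>y. u y \<in> E y)" using s by (rule conjunct1)
  have v: "near A x (\<lambda>y. fst (cV (u y) y) \<in> V y)"
    by (rule near_mono[OF n]) (auto simp: cV_def fibre_base_sum)
  have e: "sec A (dual_bundle (dual_bundle B)) x (\<lambda>y. ev y (fst (cV (u y) y)))"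
    using sec_ev_iff[OF x v] s by blast
  note goal = Q.sec_E[of x, unfolded base_eq bundle_eq, OF x]
  show ?thesis
    unfolding goal
  proof (intro conjI)
    show "near A x (\<lambda>y. tau_swap P y (u y) \<in> E' y)" by (rule near_mono[OF n]) (rule tau_in)
    show "sec A (dual_bundle B) x (\<lambda>y. fst (Q.cV (tau_swap P y (u y)) y))"
      by (rule sec_cong[OF near_mono[OF n], of "\<lambda>y. snd (cV (u y) y)"]) (use s in \<open>simp_all add: c_tau del: fibre_gen_bundle\<close>)
    show "sec A (dual_bundle (dual_bundle B)) x (\<lambda>y. snd (Q.cV (tau_swap P y (u y)) y))"
      by (rule sec_cong[OF near_mono[OF n] e]) (simp add: c_tau del: fibre_gen_bundle)
    show "sec A (tbundle A) x (\<lambda>y. fst (Q.cT (tau_swap P y (u y)) y))"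
      by (rule sec_cong[OF near_mono[OF n], of "\<lambda>y. fst (cT (u y) y)"]) (use s in \<open>simp_all add: c_tau del: fibre_gen_bundle\<close>)
    show "sec A (dual_bundle (tbundle A)) x (\<lambda>y. snd (Q.cT (tau_swap P y (u y)) y))"
      by (rule sec_cong[OF near_mono[OF n], of "\<lambda>y. snd (cT (u y) y)"]) (use s in \<open>simp_all add: c_tau del: fibre_gen_bundle\<close>)
  qed
qed

text \<open>The V-component of the preimage is known only after evaluation.
  \<open>sec_ev_iff\<close> is needed in its reflecting direction: smoothness of the evaluated
  section implies smoothness of the section.\<close>

lemma sec_tauinv:
  assumes x: "x \<in> carrier A" and u: "sec A (gen_bundle (base_sum Q)) x u"
  shows "sec A (gen_bundle (base_sum P)) x (\<lambda>y. tauinv y (u y))"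
proof -
  note s = u[unfolded Q.sec_E[of x, unfolded base_eq bundle_eq, OF x]]
  have n0: "near A x (\<lambda>y. u y \<in> E' y)" using s by (rule conjunct1)
  have n: "near A x (\<lambda>y. tauinv y (u y) \<in> E y)"
    by (rule near_mono[OF n0]) (rule tauinv(3))
  have c: "Q.cV (u y) y = (snd (cV (tauinv y (u y)) y), ev y (fst (cV (tauinv y (u y)) y)))"
    "Q.cT (u y) y = cT (tauinv y (u y)) y" if "y \<in> carrier A" "u y \<in> E' y" for y
    using c_tau[OF that(1) tauinv(3)[OF that]] tauinv(2)[OF that] by simp_all
  have v: "near A x (\<lambda>y. fst (cV (tauinv y (u y)) y) \<in> V y)"
    by (rule near_mono[OF n]) (auto simp: cV_def fibre_base_sum)
  show ?thesis
    unfolding sec_E[OF x]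
  proof (intro conjI n)
    show "sec A B x (\<lambda>y. fst (cV (tauinv y (u y)) y))"
      unfolding sec_ev_iff[OF x v, symmetric]
      by (rule sec_cong[OF near_mono[OF n0], of "\<lambda>y. snd (Q.cV (u y) y)"]) (use s in \<open>simp_all add: c del: fibre_gen_bundle\<close>)
    show "sec A (dual_bundle B) x (\<lambda>y. snd (cV (tauinv y (u y)) y))"
      by (rule sec_cong[OF near_mono[OF n0], of "\<lambda>y. fst (Q.cV (u y) y)"]) (use s in \<open>simp_all add: c del: fibre_gen_bundle\<close>)
    show "sec A (tbundle A) x (\<lambda>y. fst (cT (tauinv y (u y)) y))"
      by (rule sec_cong[OF near_mono[OF n0], of "\<lambda>y. fst (Q.cT (u y) y)"]) (use s in \<open>simp_all add: c del: fibre_gen_bundle\<close>)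
    show "sec A (dual_bundle (tbundle A)) x (\<lambda>y. snd (cT (tauinv y (u y)) y))"
      by (rule sec_cong[OF near_mono[OF n0], of "\<lambda>y. snd (Q.cT (u y) y)"]) (use s in \<open>simp_all add: c del: fibre_gen_bundle\<close>)
  qed
qed

abbreviation "M \<equiv> mirror_base P K"

lemma M_eq: "M x u = tau_swap P x (K x (tauinv x u))"
  by (simp add: mirror_base_def)

lemma M_tau: "x \<in> carrier A \<Longrightarrow> u \<in> E x \<Longrightarrow> M x (tau_swap P x u) = tau_swap P x (K x u)"
  by (simp add: M_eq tauinv(1) del: fibre_gen_bundle)

lemma tau_minus: "x \<in> carrier A \<Longrightarrow> u \<in> E x \<Longrightarrow> tau_swap P x (- u) = - tau_swap P x u"
  using linear_on_setD(2)[OF tau_linear, of x u "-1"] by (simp add: scaleR_minus1_left)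

lemma gacs_M: "gacs A (base_sum Q) M"
proof (rule smooth_bundle.gacsI[OF Q.smooth_base_sum[unfolded base_eq]])
  show "smooth_bundle A (gen_bundle (base_sum Q))" by (rule Q.smooth_E[unfolded base_eq])
  fix x assume x: "x \<in> carrier A"
  note k = K_pointwise[OF x] and ti = tauinv[OF x]
  have lt: "linear_on_set (E' x) (tauinv x)"
    by (rule linear_on_set_inv_into[OF smooth_bundle.subspace_fibre[OF smooth_E x] tau_bij[OF x] tau_linear[OF x]])
  show "linear_on_set (E' x) (M x)"
    using linear_on_setD[OF lt] linear_on_setD[OF k(1)] linear_on_setD[OF tau_linear[OF x]] ti(3) k(2)
    by (simp add: linear_on_set_def M_eq del: fibre_gen_bundle)
  show "M x u \<in> E' x" if "u \<in> E' x" for u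
    unfolding M_eq by (rule tau_in[OF x k(2)[OF ti(3)[OF that]]])
  show "pairing (M x u) (M x u') = pairing u u'" if "u \<in> E' x" "u' \<in> E' x" for u u'
    using tau_pairing[OF x k(2)[OF ti(3)[OF that(1)]] k(2)[OF ti(3)[OF that(2)]]]
      k(3)[OF ti(3)[OF that(1)] ti(3)[OF that(2)]]
      tau_pairing[OF x ti(3)[OF that(1)] ti(3)[OF that(2)]] ti(2) that by (simp add: M_eq)
  show "M x (M x u) = - u" if "u \<in> E' x" for u
    using M_tau[OF x k(2)[OF ti(3)[OF that]]] k(4)[OF ti(3)[OF that]] tau_minus[OF x ti(3)[OF that]]
      ti(2)[OF that] by (simp add: M_eq[of x u])
  show "sec A (gen_bundle (base_sum Q)) x (\<lambda>y. M y (u y))" if "sec A (gen_bundle (base_sum Q)) x u" for u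
    unfolding M_eq by (intro sec_tau sec_K sec_tauinv x that)
qed

lemma M_incl_V:
  assumes x: "x \<in> carrier A" and "v \<in> V x" "f \<in> dV x"
  shows "M x (incl_V Q x (f, ev x v)) = tau_swap P x (K x (incl_V P x (v, f)))"
    "M x (incl_V Q x (f, ev x v)) = incl_T Q x (cT (K x (incl_V P x (v, f))) x)"
proof -
  have m: "(v, f) \<in> V x \<times> dV x" using assms by blast
  show e: "M x (incl_V Q x (f, ev x v)) = tau_swap P x (K x (incl_V P x (v, f)))"
    using M_tau[OF x incl_in(1)[OF x m]] tau_incl_V[OF assms] by simp
  show "M x (incl_V Q x (f, ev x v)) = incl_T Q x (cT (K x (incl_V P x (v, f))) x)"
    unfolding e using tau_incl_T[OF x K_incl_V(1)[OF x m]] K_incl_V(2)[OF x m] by simp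
qed

lemma adapted_M: "adapted Q M"
  unfolding adapted_def base_eq
proof
  fix x assume x: "x \<in> carrier A"
  have "M x ` incl_V Q x ` (dV x \<times> dual_space (dV x)) = incl_T Q x ` (TM x \<times> dual_space (TM x))"
  proof (intro subset_antisym subsetI)
    fix y assume "y \<in> M x ` incl_V Q x ` (dV x \<times> dual_space (dV x))"
    then obtain f p where fp: "f \<in> dV x" "p \<in> dual_space (dV x)" "y = M x (incl_V Q x (f, p))" by blast
    obtain v where v: "v \<in> V x" "ev x v = p" using double_dual[OF x fp(2)] by blast
    then have "y = incl_T Q x (cT (K x (incl_V P x (v, f))) x)" using M_incl_V(2)[OF x v(1) fp(1)] fp by simp
    moreover have "cT (K x (incl_V P x (v, f))) x \<in> TM x \<times> dual_space (TM x)"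
      by (rule K_incl_V(1)[OF x]) (use v fp in simp)
    ultimately show "y \<in> incl_T Q x ` (TM x \<times> dual_space (TM x))" by (rule image_eqI)
  next
    fix y assume "y \<in> incl_T Q x ` (TM x \<times> dual_space (TM x))"
    then obtain b where b: "b \<in> TM x \<times> dual_space (TM x)" "y = incl_T Q x b" by blast
    have "incl_T P x b \<in> K x ` incl_V P x ` (V x \<times> dV x)"
      using adapted_K x b unfolding adapted_def by fastforce
    then obtain v f where vf: "v \<in> V x" "f \<in> dV x" "incl_T P x b = K x (incl_V P x (v, f))" by blast
    have "y = M x (incl_V Q x (f, ev x v))"
      using M_incl_V(1)[OF x vf(1,2)] vf(3) tau_incl_T[OF x b(1)] b(2) by simp
    then show "y \<in> M x ` incl_V Q x ` (dV x \<times> dual_space (dV x))" using vf(2) ev_in by blast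
  qed
  then show "M x ` incl_V Q x ` fibre (gen_bundle (pbundle Q)) x = incl_T Q x ` fibre (gen_bundle (tbundle A)) x"
    by (simp add: bundle_eq)
qed

sublocale Qm: adapted_str Q M
  by (rule adapted_str.intro[OF Q.flat_pres_axioms adapted_str_axioms.intro])
    (unfold base_eq, rule gacs_M, rule adapted_M)

lemma to_Delta_mirror:
  assumes x: "x \<in> carrier A"
  shows "f \<in> dV x \<Longrightarrow> to_Delta Q M x f = to_Delta_hat P K x f"
    "v \<in> V x \<Longrightarrow> to_Delta_hat Q M x (ev x v) = to_Delta P K x v"
proof -
  note q = Qm.to_Delta_eq[of x, unfolded base_eq bundle_eq fibre_dual_bundle, OF x]
  note ct = Q.c_incl(3)[of x, unfolded base_eq, OF x]
  show "to_Delta Q M x f = to_Delta_hat P K x f" if f: "f \<in> dV x"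
    using q(1)[OF f] M_incl_V(2)[OF x V0[OF x] f] ev_0[OF x] ct K_incl_V(1)[OF x, of "(0, f)"]
      to_Delta_eq(2)[OF x f] V0[OF x] f by auto
  show "to_Delta_hat Q M x (ev x v) = to_Delta P K x v" if v: "v \<in> V x"
    using q(2)[OF ev_in] M_incl_V(2)[OF x v zero_dual_space] ct K_incl_V(1)[OF x, of "(v, 0)"]
      to_Delta_eq(1)[OF x v] zero_dual_space[of "V x"] v by auto
qed

lemma Delta_mirror:
  assumes x: "x \<in> carrier A"
  shows "Delta Q M x = Delta_hat P K x" "Delta_hat Q M x = Delta P K x"
proof -
  note q = Qm.Delta_image[of x, unfolded base_eq bundle_eq fibre_dual_bundle, OF x]
  show "Delta Q M x = Delta_hat P K x"
    unfolding q Delta_image(2)[OF x] using to_Delta_mirror(1)[OF x] by (intro image_cong) auto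
  have "dual_space (dV x) = ev x ` V x" using double_dual[OF x] ev_in by blast
  then show "Delta_hat Q M x = Delta P K x"
    unfolding q Delta_image(1)[OF x] using to_Delta_mirror(2)[OF x] by (simp add: image_image)
qed

lemma almost_dirac_Delta_hat: "almost_dirac A (Delta_hat P K)"
  by (rule almost_dirac_cong[OF satlas_axioms Delta_mirror(1) Qm.almost_dirac_Delta[unfolded base_eq]])

lemma sec_from_Delta_hat:
  assumes s: "sec A (gen_bundle (tbundle A)) x \<sigma>" and d: "near A x (\<lambda>y. \<sigma> y \<in> Delta_hat P K y)"
  shows "sec A (dual_bundle B) x (\<lambda>y. inv_into (fibre (dual_bundle B) y) (to_Delta_hat P K y) (\<sigma> y))"
proof -
  have "near A x (\<lambda>y. \<sigma> y \<in> Delta Q M y)" by (rule near_mono[OF d]) (simp add: Delta_mirror)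
  from Qm.sec_from_Delta[unfolded base_eq bundle_eq, OF s this]
  have *: "sec A (dual_bundle B) x (\<lambda>y. inv_into (fibre (dual_bundle B) y) (to_Delta Q M y) (\<sigma> y))" .
  show ?thesis
    by (rule sec_cong[OF near_mono[OF d] *], rule inv_into_cong_fun) (simp add: to_Delta_mirror(1))
qed

text \<open>\<open>to_Delta\<close> of the mirror and \<open>to_Delta_hat\<close> agree only over
  the carrier and on the fibres, so the connection of the mirror is not literally
  \<open>conn_Delta_hat\<close>. The transport lemma is therefore applied anew to the dual bundle,
  with its premises taken over from the mirror.\<close>

lemma flat_connection_Delta_hat:
  "flat_connection A (sub_sections A (gen_bundle (tbundle A)) (Delta_hat P K)) (conn_Delta_hat P K)"
  unfolding conn_Delta_hat_def
proof (rule flat_bundle.flat_connection_transport[OF flat_bundle_dual flat_for_dual_conn[OF flat_for_P] _ _ _ sec_from_Delta_hat])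
  show "open_trivs A (gen_bundle (tbundle A))"
    by (rule smooth_bundle.trivs_open[OF smooth_bundle_gen[OF tangent_bundle]])
  fix y assume y: "y \<in> carrier A"
  have e: "to_Delta Q M y f = to_Delta_hat P K y f" if "f \<in> fibre (dual_bundle B) y" for f
    using to_Delta_mirror(1)[OF y] that by simp
  have "bij_betw (to_Delta Q M y) (fibre (dual_bundle B) y) (Delta_hat P K y)"
    using Qm.bij_to_Delta[of y, unfolded base_eq bundle_eq, OF y] Delta_mirror(1)[OF y] by simp
  then show "bij_betw (to_Delta_hat P K y) (fibre (dual_bundle B) y) (Delta_hat P K y)"
    by (rule bij_betw_cong[THEN iffD1, rotated]) (rule e)
  show "linear_on_set (fibre (dual_bundle B) y) (to_Delta_hat P K y)"
    by (rule linear_on_set_cong[OF _ e Qm.linear_to_Delta[of y, unfolded base_eq bundle_eq, OF y]])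
      (simp_all add: subspace_dual_space)
next
  fix x s assume s: "sec A (dual_bundle B) x s"
  have n: "near A x (\<lambda>y. s y \<in> dV y)" using s by (simp add: sec_def)
  show "sec A (gen_bundle (tbundle A)) x (\<lambda>y. to_Delta_hat P K y (s y))"
    by (rule sec_cong[OF near_mono[OF n] Qm.sec_to_Delta[unfolded base_eq bundle_eq, OF s]])
      (simp add: to_Delta_mirror(1))
qed

end

section \<open>The total space of a bundle\<close>

definition tchart ::
  "('m, 'v, 'f) vbundle \<Rightarrow> ('m, 'e) chart \<Rightarrow> 'm set \<times> ('m \<Rightarrow> 'v \<Rightarrow> 'f) \<Rightarrow> ('m \<times> 'v, 'e \<times> 'f) chart" where
  "tchart B c t = ({y. fst y \<in> fst c \<and> fst y \<in> fst t \<and> snd y \<in> fibre B (fst y)},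
     \<lambda>y. (snd c (fst y), snd t (fst y) (snd y)))"

lemma tot_atlas_iff: "k \<in> tot_atlas A B \<longleftrightarrow> (\<exists>c\<in>A. \<exists>t\<in>btriv B. k = tchart B c t)"
proof -
  have e: "({(x, v). x \<in> fst c \<and> x \<in> fst t \<and> v \<in> fibre B x}, \<lambda>(x, v). (snd c x, snd t x v)) = tchart B c t"
    for c t by (auto simp: tchart_def)
  show ?thesis unfolding tot_atlas_def mem_Collect_eq e by blast
qed

lemma tchart_simps:
  "y \<in> fst (tchart B c t) \<longleftrightarrow> fst y \<in> fst c \<and> fst y \<in> fst t \<and> snd y \<in> fibre B (fst y)"
  "snd (tchart B c t) y = (snd c (fst y), snd t (fst y) (snd y))"
  by (simp_all add: tchart_def)

context smooth_bundle
begin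

abbreviation "TOT \<equiv> tot_atlas A B"

lemma tchart_inv:
  assumes c: "c \<in> A" and t: "t \<in> btriv B" and y: "y \<in> fst (tchart B c t)"
  shows "chart_inv c (fst (snd (tchart B c t) y)) = fst y"
    "vinv t (fst y) (snd (snd (tchart B c t) y)) = snd y"
  using y chart_inv_left[OF chart_inj[OF c]] vinv_triv[OF t] by (auto simp: tchart_simps)

lemma tchart_inj: assumes "c \<in> A" "t \<in> btriv B" shows "inj_on (snd (tchart B c t)) (fst (tchart B c t))"
  by (rule inj_onI) (metis tchart_inv[OF assms] prod_eqI)

lemma tchart_image:
  assumes c: "c \<in> A" and t: "t \<in> btriv B"
  shows "snd (tchart B c t) ` {y. fst y \<in> U \<inter> fst c \<inter> fst t \<and> snd y \<in> fibre B (fst y)}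
    = (snd c ` (U \<inter> fst c \<inter> fst t)) \<times> UNIV"
proof (intro subset_antisym subsetI)
  fix p assume "p \<in> (snd c ` (U \<inter> fst c \<inter> fst t)) \<times> (UNIV :: 'f set)"
  then obtain x b where x: "x \<in> U \<inter> fst c \<inter> fst t" "p = (snd c x, b)" by auto
  then have "p = snd (tchart B c t) (x, vinv t x b)" "vinv t x b \<in> fibre B x"
    using triv_vinv[OF t] vinv_in[OF t] by (simp_all add: tchart_simps)
  then show "p \<in> snd (tchart B c t) ` {y. fst y \<in> U \<inter> fst c \<inter> fst t \<and> snd y \<in> fibre B (fst y)}"
    using x by (intro image_eqI[where x = "(x, vinv t x b)"]) auto
qed (auto simp: tchart_simps)

lemma tchart_open_image:
  assumes c: "c \<in> A" and t: "t \<in> btriv B" and U: "mopen A U"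
  shows "open (snd (tchart B c t) ` {y. fst y \<in> U \<inter> fst c \<inter> fst t \<and> snd y \<in> fibre B (fst y)})"
  unfolding tchart_image[OF c t]
  using mopen_chart[OF mopen_Int[OF U triv_open[OF t]] c] by (intro open_Times) (simp_all add: Int_ac)

text \<open>In product charts a transition consists of the transition of the base and a matrix,
  smooth in the base point, applied to the fibre coordinate.\<close>

lemma satlas_tot: "satlas TOT"
proof
  fix k assume "k \<in> TOT"
  then obtain c t where k: "c \<in> A" "t \<in> btriv B" "k = tchart B c t" unfolding tot_atlas_iff by blast
  show "inj_on (snd k) (fst k)" using tchart_inj k by blast
  have "fst k = {y. fst y \<in> carrier A \<inter> fst c \<inter> fst t \<and> snd y \<in> fibre B (fst y)}"
    using k(3) chart_carrier[OF k(1)] by (auto simp: tchart_simps)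
  then show "open (snd k ` fst k)" using tchart_open_image[OF k(1,2) mopen_carrier] k(3) by simp
next
  fix k l assume "k \<in> TOT" "l \<in> TOT"
  then obtain c t d s where k: "c \<in> A" "t \<in> btriv B" "k = tchart B c t"
    and l: "d \<in> A" "s \<in> btriv B" "l = tchart B d s" unfolding tot_atlas_iff by blast
  let ?U = "fst d \<inter> fst s"
  have U: "mopen A ?U" by (intro mopen_Int mopen_fst chart_mchart triv_open k l)
  have W: "mopen A (?U \<inter> fst c \<inter> fst t)" by (intro mopen_Int mopen_fst chart_mchart triv_open k l)
  have kl: "fst k \<inter> fst l = {y. fst y \<in> ?U \<inter> fst c \<inter> fst t \<and> snd y \<in> fibre B (fst y)}"
    using k l by (auto simp: tchart_simps)
  show o: "open (snd k ` (fst k \<inter> fst l))" unfolding kl using tchart_open_image[OF k(1,2) U] k(3) by simp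
  have S: "snd k ` (fst k \<inter> fst l) = (snd c ` (?U \<inter> fst c \<inter> fst t)) \<times> UNIV"
    unfolding kl unfolding k(3) by (rule tchart_image[OF k(1,2)])
  have oc: "open (snd c ` (?U \<inter> fst c \<inter> fst t))"
    using mopen_chart[OF W k(1)] by (simp add: Int_ac)
  have Dc: "?U \<inter> fst c \<inter> fst t \<inter> fst c = ?U \<inter> fst c \<inter> fst t" by blast
  have base: "smooth_on (snd k ` (fst k \<inter> fst l)) (\<lambda>p. (f \<circ> chart_inv c) (fst p))"
    if f: "\<And>x. x \<in> ?U \<inter> fst c \<inter> fst t \<Longrightarrow> smooth_at A x f" for f :: "'m \<Rightarrow> 'h::real_normed_vector"
  proof (rule smooth_on_compose[OF o oc])
    show "fst ` snd k ` (fst k \<inter> fst l) \<subseteq> snd c ` (?U \<inter> fst c \<inter> fst t)" unfolding S by auto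
    show "smooth_on (snd k ` (fst k \<inter> fst l)) fst"
      by (rule smooth_on_bounded_linear[OF bounded_linear_fst smooth_on_id])
    have "smooth_fun A (?U \<inter> fst c \<inter> fst t) f" using smooth_fun_iff[OF W] f by blast
    from bspec[OF this[unfolded smooth_fun_def] k(1)]
    show "smooth_on (snd c ` (?U \<inter> fst c \<inter> fst t)) (f \<circ> chart_inv c)" by (simp only: Dc)
  qed
  \<comment> \<open>The transition written out: the second component is the matrix in terms of its
    columns, so that each summand is a product of a fibre coordinate and a function pulled back from
    the base.\<close>
  have "smooth_on (snd k ` (fst k \<inter> fst l))
     (\<lambda>p. ((snd d \<circ> chart_inv c) (fst p),
        \<Sum>b\<in>Basis. (snd p \<bullet> b) *\<^sub>R ((\<lambda>x. snd s x (vinv t x b)) \<circ> chart_inv c) (fst p)))"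
  proof (intro smooth_on_Pair base)
    show "smooth_at A x (snd d)" if "x \<in> ?U \<inter> fst c \<inter> fst t" for x
      using smooth_at_chart[OF chart_mchart[OF l(1)]] that by blast
    have "smooth_on (snd k ` (fst k \<inter> fst l)) (\<lambda>p. (snd p \<bullet> b) *\<^sub>R ((\<lambda>x. snd s x (vinv t x b)) \<circ> chart_inv c) (fst p))" for b
    proof (intro smooth_on_bilinear[OF bounded_bilinear_scaleR o] base)
      show "smooth_on (snd k ` (fst k \<inter> fst l)) (\<lambda>p. snd p \<bullet> b)"
        by (intro smooth_on_bounded_linear[OF bounded_linear_inner_left]
            smooth_on_bounded_linear[OF bounded_linear_snd smooth_on_id])
      show "smooth_at A x (\<lambda>x. snd s x (vinv t x b))" if "x \<in> ?U \<inter> fst c \<inter> fst t" for x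
        unfolding vinv_def using transition_smooth_triv[OF l(2) k(2)] that by blast
    qed
    then show "smooth_on (snd k ` (fst k \<inter> fst l))
      (\<lambda>p. \<Sum>b\<in>Basis. (snd p \<bullet> b) *\<^sub>R ((\<lambda>x. snd s x (vinv t x b)) \<circ> chart_inv c) (fst p))"
      unfolding smooth_on_def by (intro allI Ck_on_sum) blast
  qed
  then show "smooth_on (snd k ` (fst k \<inter> fst l)) (snd l \<circ> chart_inv k)"
  proof (subst smooth_on_cong[OF o])
    fix p assume "p \<in> snd k ` (fst k \<inter> fst l)"
    then obtain y where y: "y \<in> fst k" "y \<in> fst l" "p = snd k y" by blast
    have iy: "chart_inv k p = y" using y chart_inv_left[of k y] tchart_inj k by blast
    note i = tchart_inv[OF k(1,2), folded k(3), OF y(1)]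
    have x: "fst y \<in> fst t" "fst y \<in> fst s" "snd y \<in> fibre B (fst y)"
      using y k l by (auto simp: tchart_simps)
    have "linear (\<lambda>a. snd s (fst y) (vinv t (fst y) a))"
      using linear_on_set_compose[OF linear_vinv[OF k(2) x(1)] vinv_in[OF k(2) x(1)] triv_linear[OF l(2) x(2)]] .
    from linear_euclidean_expand[OF this, of "snd p"]
    show "(snd l \<circ> chart_inv k) p = ((snd d \<circ> chart_inv c) (fst p),
        \<Sum>b\<in>Basis. (snd p \<bullet> b) *\<^sub>R ((\<lambda>x. snd s x (vinv t x b)) \<circ> chart_inv c) (fst p))"
      using i y(3) iy l(3) by (simp add: tchart_simps)
  qed
qed

lemma carrier_tot: "y \<in> carrier TOT \<longleftrightarrow> fst y \<in> carrier A \<and> snd y \<in> fibre B (fst y)"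
proof
  assume "y \<in> carrier TOT"
  then obtain k where "k \<in> TOT" "y \<in> fst k" using carrier_chart by metis
  then show "fst y \<in> carrier A \<and> snd y \<in> fibre B (fst y)"
    unfolding tot_atlas_iff using chart_carrier by (auto simp: tchart_simps)
next
  assume *: "fst y \<in> carrier A \<and> snd y \<in> fibre B (fst y)"
  then obtain c t where ct: "c \<in> A" "fst y \<in> fst c" "t \<in> btriv B" "fst y \<in> fst t"
    using carrier_chart triv_cover by metis
  then have "tchart B c t \<in> TOT" "y \<in> fst (tchart B c t)" unfolding tot_atlas_iff using * by (auto simp: tchart_simps)
  then show "y \<in> carrier TOT" unfolding carrier_def by blast
qed

lemma tchart_mchart: "c \<in> A \<Longrightarrow> t \<in> btriv B \<Longrightarrow> mchart TOT (tchart B c t)"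
  by (rule satlas.chart_mchart[OF satlas_tot]) (auto simp: tot_atlas_iff)

lemma smooth_map_at_fst: assumes y: "y \<in> carrier TOT" shows "smooth_map_at TOT A y fst"
proof -
  interpret XA: satlas2 TOT A using satlas_tot satlas_axioms by (simp add: satlas2_def)
  have "fst y \<in> carrier A" using y carrier_tot by blast
  then obtain c t where c: "c \<in> A" "fst y \<in> fst c" and t: "t \<in> btriv B" "fst y \<in> fst t"
    using carrier_chart triv_cover by metis
  let ?k = "tchart B c t"
  have k: "mchart TOT ?k" "y \<in> fst ?k"
    using tchart_mchart c t y carrier_tot by (auto simp: tchart_simps)
  show ?thesis
  proof (rule XA.smooth_map_atI[of c fst, OF chart_mchart[OF c(1)] c(2)])
    show "near TOT y (\<lambda>y'. fst y' \<in> fst c)"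
      by (rule XA.A.near_mono[OF XA.A.near_chart[OF k]]) (simp add: tchart_simps)
    show "smooth_at TOT y (\<lambda>y'. snd c (fst y'))"
      using XA.A.smooth_at_fst[OF XA.A.smooth_at_chart[OF k]] by (simp add: tchart_simps)
  qed
qed

text \<open>Adding a section that is constant in \<open>t\<close> is translation by
  \<open>(0, a)\<close> in the product chart. When \<open>a\<close> is a lattice vector these maps
  are the deck transformations of the covering.\<close>

lemma deck_smooth_map_at:
  assumes y: "y \<in> carrier TOT" and t: "t \<in> btriv B" "fst y \<in> fst t"
  shows "smooth_map_at TOT TOT y (\<lambda>y'. (fst y', snd y' + vinv t (fst y') a))"
    "near TOT y (\<lambda>y'. fst y' \<in> fst t \<and> snd y' \<in> fibre B (fst y'))"
proof -
  have x: "fst y \<in> carrier A" and v: "snd y \<in> fibre B (fst y)" using y carrier_tot by auto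
  obtain c where c: "c \<in> A" "fst y \<in> fst c" using carrier_chart[OF x] by metis
  have k: "mchart TOT (tchart B c t)" "y \<in> fst (tchart B c t)"
    using tchart_mchart[OF c(1) t(1)] c t v by (auto simp: tchart_simps)
  interpret TT: satlas2 TOT TOT using satlas_tot by (simp add: satlas2_def)
  note nk = TT.A.near_chart[OF k]
  show "near TOT y (\<lambda>y'. fst y' \<in> fst t \<and> snd y' \<in> fibre B (fst y'))"
    by (rule TT.A.near_mono[OF nk]) (simp add: tchart_simps)
  let ?s = "\<lambda>y'. (fst y', snd y' + vinv t (fst y') a)"
  have in_k: "?s y' \<in> fst (tchart B c t)" and co: "snd (tchart B c t) (?s y') = snd (tchart B c t) y' + (0, a)"
    if y': "y' \<in> fst (tchart B c t)" for y'
  proof -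
    have p: "fst y' \<in> fst c" "fst y' \<in> fst t" "snd y' \<in> fibre B (fst y')" using y' by (auto simp: tchart_simps)
    show "?s y' \<in> fst (tchart B c t)"
      using p subspace_add[OF fibre_subspace[OF t(1) p(2)] p(3) vinv_in[OF t(1) p(2)]]
      by (simp add: tchart_simps)
    show "snd (tchart B c t) (?s y') = snd (tchart B c t) y' + (0, a)"
      using linear_on_setD(1)[OF triv_linear[OF t(1) p(2)] p(3) vinv_in[OF t(1) p(2)]] triv_vinv[OF t(1) p(2)]
      by (simp add: tchart_simps)
  qed
  show "smooth_map_at TOT TOT y ?s"
  proof (rule TT.smooth_map_atI[of "tchart B c t" ?s, OF k(1) in_k[OF k(2)]])
    show "near TOT y (\<lambda>y'. ?s y' \<in> fst (tchart B c t))"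
      by (rule TT.A.near_mono[OF nk]) (rule in_k)
    show "smooth_at TOT y (\<lambda>y'. snd (tchart B c t) (?s y'))"
      by (rule TT.A.smooth_at_cong[OF TT.A.near_mono[OF nk]
            TT.A.smooth_at_add[OF TT.A.smooth_at_chart[OF k] TT.A.smooth_at_const[OF y, of "(0, a)"]]]) (simp add: co)
  qed
qed

end

section \<open>The splitting of a torus bundle in product charts\<close>

text \<open>A chart of \<open>Z\<close>: a local inverse of the covering \<open>tot(V) \<rightarrow> Z\<close> followed by a product chart of
  \<open>tot(V)\<close>.\<close>

definition pch :: "('m, 'e, 'v, 'f, 'z) torus_pres \<Rightarrow> ('m, 'e) chart \<Rightarrow> 'm set \<times> ('m \<Rightarrow> 'v \<Rightarrow> 'f) \<Rightarrow>
   ('m \<times> 'v) set \<Rightarrow> ('z, 'e \<times> 'f) chart" where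
  "pch P c t W = (pquot P ` W, \<lambda>z. snd (tchart (pbundle P) c t) (inv_into W (pquot P) z))"

text \<open>\<open>W\<close> is a sheet of the covering inside one product chart. Compatibility of
  the resulting chart is part of the definition because the two presentations prove it differently:
  for \<open>Z\<close> by comparison with the local trivialisations, for the dual because the chart
  belongs to the quotient atlas.\<close>

definition pc :: "('m, 'e::euclidean_space, 'v, 'f::euclidean_space, 'z) torus_pres \<Rightarrow> ('m, 'e) chart \<Rightarrow>
   'm set \<times> ('m \<Rightarrow> 'v \<Rightarrow> 'f) \<Rightarrow> ('m \<times> 'v) set \<Rightarrow> bool" where
  "pc P c t W \<longleftrightarrow> c \<in> pbase P \<and> t \<in> btriv (pbundle P) \<and>
     mopen (tot_atlas (pbase P) (pbundle P)) W \<and> W \<subseteq> fst (tchart (pbundle P) c t) \<and>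
     inj_on (pquot P) W \<and> mchart (ptotal P) (pch P c t W)"

text \<open>The interface shared by \<open>pres T\<close> and \<open>dual_pres T\<close>.
  \<open>q_shift\<close> expresses that the lattice is flat: the difference of two preimages of a
  point, continued as a constant in the trivialisation \<open>t\<close>, is a period of the quotient
  map near \<open>x\<close>.\<close>

locale flat_torus = flat_pres P
  for P :: "('m, 'e::euclidean_space, 'v::real_vector, 'f::euclidean_space, 'z) torus_pres" +
  assumes satlas_Z: "satlas (ptotal P)"
    and q_in: "x \<in> carrier (pbase P) \<Longrightarrow> v \<in> fibre (pbundle P) x \<Longrightarrow> pproj P (pquot P (x, v)) = x"
    and q_surj: "z \<in> carrier (ptotal P) \<Longrightarrow> pproj P z \<in> carrier (pbase P) \<and>
      (\<exists>v\<in>fibre (pbundle P) (pproj P z). pquot P (pproj P z, v) = z)"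
    and q_local: "c \<in> pbase P \<Longrightarrow> t \<in> btriv (pbundle P) \<Longrightarrow> y \<in> fst (tchart (pbundle P) c t) \<Longrightarrow>
      \<exists>W. y \<in> W \<and> pc P c t W"
    and q_shift: "t \<in> btriv (pbundle P) \<Longrightarrow> x \<in> fst t \<Longrightarrow> v \<in> fibre (pbundle P) x \<Longrightarrow>
      v' \<in> fibre (pbundle P) x \<Longrightarrow> pquot P (x, v) = pquot P (x, v') \<Longrightarrow>
      near (pbase P) x (\<lambda>y. \<forall>u\<in>fibre (pbundle P) y.
        pquot P (y, u + inv_into (fibre (pbundle P) y) (snd t y) (snd t x (v' - v))) = pquot P (y, u))"
begin

abbreviation "Z \<equiv> ptotal P"
abbreviation "q \<equiv> pquot P"
abbreviation "pr \<equiv> pproj P"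

sublocale ZA: satlas2 "ptotal P" "pbase P"
  using satlas_Z satlas_axioms by (simp add: satlas2_def)

sublocale TZ: satlas2 "tot_atlas (pbase P) (pbundle P)" "ptotal P"
  using satlas_Z satlas_tot by (simp add: satlas2_def)

lemma pcD:
  assumes "pc P c t W"
  shows "c \<in> A" "t \<in> btriv B" "mopen TOT W" "W \<subseteq> fst (tchart B c t)" "inj_on q W" "mchart Z (pch P c t W)"
  using assms by (simp_all add: pc_def)

lemma pc_exists:
  assumes z: "z \<in> carrier Z" and c: "c \<in> A" "pr z \<in> fst c" and t: "t \<in> btriv B" "pr z \<in> fst t"
  shows "\<exists>y W. y \<in> W \<and> pc P c t W \<and> q y = z \<and> fst y = pr z"
proof -
  obtain v where v: "v \<in> V (pr z)" "q (pr z, v) = z" using q_surj[OF z] by blast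
  have "(pr z, v) \<in> fst (tchart B c t)" using c t v by (simp add: tchart_simps)
  then obtain W where "(pr z, v) \<in> W" "pc P c t W" using q_local[OF c(1) t(1)] by blast
  then show ?thesis using v(2) by (intro exI[of _ "(pr z, v)"] exI[of _ W]) simp
qed

text \<open>The second term of \<open>pull_conn\<close> differentiates a constant extension and
  vanishes by flatness. What remains is the derivative of the fibre coordinate, and a constant
  matrix relates the trivialisation chosen by \<open>pull_conn\<close> to \<open>t\<close>.\<close>

lemma split_tot_eq:
  assumes y: "y \<in> carrier TOT" and t: "t \<in> btriv B" "fst y \<in> fst t"
  shows "split_tot P y w = vinv t (fst y) (dfun TOT (\<lambda>y'. snd t (fst y') (snd y')) y w)"
proof -
  have x: "fst y \<in> carrier A" and v: "snd y \<in> V (fst y)" using y carrier_tot by auto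
  let ?s = "triv_at B (fst y)"
  note s = triv_at[OF x]
  obtain c where c: "c \<in> A" "fst y \<in> fst c" using carrier_chart[OF x] by metis
  have k: "mchart TOT (tchart B c t)" "y \<in> fst (tchart B c t)"
    using tchart_mchart[OF c(1) t(1)] c t v by (auto simp: tchart_simps)
  have sm: "smooth_at TOT y (\<lambda>y'. snd t (fst y') (snd y'))"
    using TZ.A.smooth_at_snd[OF TZ.A.smooth_at_chart[OF k]] by (simp add: tchart_simps)
  interpret XA: satlas2 TOT A using satlas_tot satlas_axioms by (simp add: satlas2_def)
  obtain G where G: "linear G" "near A (fst y) (\<lambda>x. \<forall>v\<in>V x. snd ?s x v = G (snd t x v))"
    using transition_const[OF t(1) s(1) t(2) s(2)] by blast
  have n: "near TOT y (\<lambda>y'. snd ?s (fst y') (snd y') = G (snd t (fst y') (snd y')))"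
    by (rule TZ.A.near_mono[OF XA.smooth_map_at_near[OF smooth_map_at_fst[OF y] G(2)]]) (use carrier_tot in blast)
  have "split_tot P y w = vinv ?s (fst y) (dfun TOT (\<lambda>y'. snd ?s (fst y') (snd y')) y w)"
    using flat_for_const_ext[OF flat_for_P x v] by (simp add: split_tot_def pull_conn_def Let_def vinv_def)
  also have "\<dots> = vinv ?s (fst y) (G (dfun TOT (\<lambda>y'. snd t (fst y') (snd y')) y w))"
    using TZ.A.dfun_cong[OF n] TZ.A.dfun_linear[OF G(1) sm] by simp
  also have "\<dots> = vinv t (fst y) (dfun TOT (\<lambda>y'. snd t (fst y') (snd y')) y w)"
    using near_point[OF G(2)] vinv_in[OF t] triv_vinv[OF t] by (intro vinv_eqI[OF s]) auto
  finally show ?thesis .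
qed

lemma deck_continuous:
  assumes y: "y \<in> carrier TOT" and t: "t \<in> btriv B" "fst y \<in> fst t"
    and W: "mopen TOT W" "(fst y, snd y + vinv t (fst y) a) \<in> W"
  shows "near TOT y (\<lambda>y'. (fst y', snd y' + vinv t (fst y') a) \<in> W)"
    "near TOT y (\<lambda>y'. fst y' \<in> fst t \<and> snd y' \<in> V (fst y'))"
  by (rule smooth_map_atD(3)[OF deck_smooth_map_at(1)[OF y t] W], rule deck_smooth_map_at(2)[OF y t])

context
  fixes c t W y assumes pc: "pc P c t W" and yW: "y \<in> W"
begin

lemmas pcs = pcD[OF pc]

lemma y_carrier: "y \<in> carrier TOT" by (rule TZ.A.mopen_subset_carrier[OF pcs(3) yW])
lemma x_carrier: "fst y \<in> carrier A" using y_carrier carrier_tot by blast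
lemma v_fibre: "snd y \<in> V (fst y)" using y_carrier carrier_tot by blast
lemma x_c: "fst y \<in> fst c" using pcs(4) yW by (auto simp: tchart_simps)
lemma x_t: "fst y \<in> fst t" using pcs(4) yW by (auto simp: tchart_simps)

lemma pch_q: "y' \<in> W \<Longrightarrow> snd (pch P c t W) (q y') = snd (tchart B c t) y'" "y' \<in> W \<Longrightarrow> q y' \<in> fst (pch P c t W)"
  using inv_into_f_f[OF pcs(5)] by (simp_all add: pch_def)

lemma z_k: "q y \<in> fst (pch P c t W)" by (rule pch_q(2)[OF yW])

lemma pr_q: "pr (q y) = fst y"
  using q_in[OF x_carrier v_fibre] by simp

lemma smc: "mchart A c" by (rule chart_mchart[OF pcs(1)])

lemma tk: "mchart TOT (tchart B c t)" "y \<in> fst (tchart B c t)"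
  using tchart_mchart[OF pcs(1,2)] pcs(4) yW by auto

lemma near_W: "near TOT y (\<lambda>y'. y' \<in> W)"
  by (rule TZ.A.nearI[OF pcs(3) yW])

lemma smooth_map_at_q: "smooth_map_at TOT Z y q"
proof (rule TZ.smooth_map_atI[of "pch P c t W" q, OF pcs(6) z_k])
  show "near TOT y (\<lambda>y'. q y' \<in> fst (pch P c t W))"
    by (rule TZ.A.near_mono[OF near_W]) (rule pch_q)
  show "smooth_at TOT y (\<lambda>y'. snd (pch P c t W) (q y'))"
    by (rule TZ.A.smooth_at_cong[OF TZ.A.near_mono[OF near_W] TZ.A.smooth_at_chart[OF tk]]) (simp add: pch_q)
qed

lemma pr_chart:
  assumes "z \<in> fst (pch P c t W)"
  shows "pr z \<in> fst c" "pr z \<in> fst t" "fst (snd (pch P c t W) z) = snd c (pr z)"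
    "\<exists>y'\<in>W. z = q y' \<and> pr z = fst y'"
proof -
  obtain y' where y': "y' \<in> W" "z = q y'" using assms by (auto simp: pch_def)
  have y'': "y' \<in> carrier TOT" "y' \<in> fst (tchart B c t)"
    using TZ.A.mopen_subset_carrier[OF pcs(3) y'(1)] pcs(4) y'(1) by auto
  then have p: "pr z = fst y'" using q_in[of "fst y'" "snd y'"] carrier_tot y'(2) by simp
  then show "pr z \<in> fst c" "pr z \<in> fst t" "fst (snd (pch P c t W) z) = snd c (pr z)"
    "\<exists>y'\<in>W. z = q y' \<and> pr z = fst y'"
    using y'' y' pch_q(1)[OF y'(1)] by (auto simp: tchart_simps)
qed

lemma near_k: "near Z (q y) (\<lambda>z. z \<in> fst (pch P c t W))"
  by (rule ZA.A.near_chart[OF pcs(6) z_k])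

lemma smooth_map_at_pr: "smooth_map_at Z A (q y) pr"
proof (rule ZA.smooth_map_atI[of c pr, OF smc])
  show "pr (q y) \<in> fst c" using pr_q x_c by simp
  show "near Z (q y) (\<lambda>z. pr z \<in> fst c)"
    by (rule ZA.A.near_mono[OF near_k]) (rule pr_chart)
  show "smooth_at Z (q y) (\<lambda>z. snd c (pr z))"
    by (rule ZA.A.smooth_at_cong[OF ZA.A.near_mono[OF near_k] ZA.A.smooth_at_fst[OF ZA.A.smooth_at_chart[OF pcs(6) z_k]]])
      (simp add: pr_chart)
qed

lemma tco_q: "tco Z (pch P c t W) (q y) (mdiff TOT Z q y w) = tco TOT (tchart B c t) y w"
proof -
  have "tco Z (pch P c t W) (q y) (mdiff TOT Z q y w) = dfun TOT (\<lambda>y'. snd (pch P c t W) (q y')) y w"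
    by (rule TZ.tco_mdiff[OF smooth_map_at_q pcs(6) z_k])
  also have "\<dots> = tco TOT (tchart B c t) y w"
    unfolding tco_def by (rule TZ.A.dfun_cong[OF TZ.A.near_mono[OF near_W]]) (simp add: pch_q)
  finally show ?thesis .
qed

lemma tco_pr: "tco A c (fst y) (mdiff Z A pr (q y) w) = fst (tco Z (pch P c t W) (q y) w)"
proof -
  have "tco A c (fst y) (mdiff Z A pr (q y) w) = dfun Z (\<lambda>z. snd c (pr z)) (q y) w"
    using ZA.tco_mdiff[OF smooth_map_at_pr smc] pr_q x_c by simp
  also have "\<dots> = dfun Z (\<lambda>z. fst (snd (pch P c t W) z)) (q y) w"
    by (rule ZA.A.dfun_cong[OF ZA.A.near_mono[OF near_k]]) (simp add: pr_chart)
  also have "\<dots> = fst (tco Z (pch P c t W) (q y) w)"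
    using ZA.A.dfun_linear[OF _ ZA.A.smooth_at_chart[OF pcs(6) z_k], of fst] linear_fst by (simp add: tco_def)
  finally show ?thesis .
qed

text \<open>A second preimage \<open>v1\<close> of \<open>q y\<close> is moved to \<open>y\<close>
  by a translation that is constant in \<open>t\<close> and does not change the image under
  \<open>q\<close>.\<close>

lemma deck:
  assumes v1: "v1 \<in> V (fst y)" and q1: "q (fst y, v1) = q y"
  shows "near A (fst y) (\<lambda>x. \<forall>u\<in>V x. q (x, u + vinv t x (snd t (fst y) (snd y - v1))) = q (x, u))"
    "v1 + vinv t (fst y) (snd t (fst y) (snd y - v1)) = snd y"
proof -
  show "near A (fst y) (\<lambda>x. \<forall>u\<in>V x. q (x, u + vinv t x (snd t (fst y) (snd y - v1))) = q (x, u))"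
    using q_shift[OF pcs(2) x_t v1 v_fibre] q1 by (simp add: vinv_def)
  show "v1 + vinv t (fst y) (snd t (fst y) (snd y - v1)) = snd y"
    using vinv_triv[OF pcs(2) x_t subspace_diff[OF fibre_subspace[OF pcs(2) x_t] v_fibre v1]] by simp
qed

text \<open>Any other preimage of \<open>w\<close> is moved to one at \<open>y\<close> by a deck translation, which is locally
  constant in the flat coordinates and hence does not change \<open>D\<close>.\<close>

lemma split_preimage:
  assumes y1: "y1 \<in> carrier TOT" and q1: "q y1 = q y"
  shows "split_tot P y1 w1 = vinv t (fst y) (snd (tco Z (pch P c t W) (q y) (mdiff TOT Z q y1 w1)))"
proof -
  have f: "fst y1 = fst y"
    using q_in[of "fst y1" "snd y1"] y1 carrier_tot[of y1] pr_q q1 by simp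
  have v1: "snd y1 \<in> V (fst y)" using y1 carrier_tot f by metis
  have q1': "q (fst y, snd y1) = q y" using q1 f by (metis prod.collapse)
  let ?a = "snd t (fst y) (snd y - snd y1)"
  note d = deck[OF v1 q1']
  interpret XA: satlas2 TOT A using satlas_tot satlas_axioms by (simp add: satlas2_def)
  have x1: "fst y1 \<in> fst t" using f x_t by simp
  have W1: "(fst y1, snd y1 + vinv t (fst y1) ?a) \<in> W" using d(2) yW f by simp
  note dc = deck_continuous[OF y1 pcs(2) x1 pcs(3) W1]
  have nq: "near TOT y1 (\<lambda>y'. \<forall>u\<in>V (fst y'). q (fst y', u + vinv t (fst y') ?a) = q (fst y', u))"
    using XA.smooth_map_at_near[OF smooth_map_at_fst[OF y1], of "\<lambda>x. \<forall>u\<in>V x. q (x, u + vinv t x ?a) = q (x, u)"] d(1) f by simp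
  obtain W2 where W2: "y1 \<in> W2" "pc P c t W2"
    using q_local[OF pcs(1,2), of y1] x1 x_c f v1 by (auto simp: tchart_simps)
  have sq: "smooth_map_at TOT Z y1 q"
  proof (rule TZ.smooth_map_atI[of "pch P c t W2" q])
    show "mchart Z (pch P c t W2)" by (rule pcD(6)[OF W2(2)])
    show "q y1 \<in> fst (pch P c t W2)" using W2(1) by (simp add: pch_def)
    have n: "near TOT y1 (\<lambda>y'. y' \<in> W2)" by (rule TZ.A.nearI[OF pcD(3)[OF W2(2)] W2(1)])
    show "near TOT y1 (\<lambda>y'. q y' \<in> fst (pch P c t W2))"
      by (rule TZ.A.near_mono[OF n]) (simp add: pch_def)
    have "y1 \<in> fst (tchart B c t)" using pcD(4)[OF W2(2)] W2(1) by blast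
    from TZ.A.smooth_at_chart[OF tk(1) this]
    show "smooth_at TOT y1 (\<lambda>y'. snd (pch P c t W2) (q y'))"
      by (rule TZ.A.smooth_at_cong[OF TZ.A.near_mono[OF n], rotated])
        (simp add: pch_def inv_into_f_f[OF pcD(5)[OF W2(2)]])
  qed
  have k1: "y1 \<in> fst (tchart B c t)" using x1 x_c f v1 by (simp add: tchart_simps)
  have st: "smooth_at TOT y1 (\<lambda>y'. snd t (fst y') (snd y'))"
    using TZ.A.smooth_at_snd[OF TZ.A.smooth_at_chart[OF tk(1) k1]] by (simp add: tchart_simps)
  \<comment> \<open>Near \<open>y1\<close> the fibre coordinate in the chart based at
    \<open>y\<close> differs from the one at \<open>y1\<close> by the constant \<open>?a\<close>,
    whose derivative vanishes.\<close>
  have n: "near TOT y1 (\<lambda>y'. snd (snd (pch P c t W) (q y')) = snd t (fst y') (snd y') + ?a)"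
  proof (rule TZ.A.near_mono[OF TZ.A.near_conj[OF TZ.A.near_conj[OF dc] nq]])
    fix y' assume y': "((fst y', snd y' + vinv t (fst y') ?a) \<in> W \<and> fst y' \<in> fst t \<and> snd y' \<in> V (fst y')) \<and>
      (\<forall>u\<in>V (fst y'). q (fst y', u + vinv t (fst y') ?a) = q (fst y', u))"
    then have "q y' = q (fst y', snd y' + vinv t (fst y') ?a)" by (metis prod.collapse)
    then have "snd (snd (pch P c t W) (q y')) = snd t (fst y') (snd y' + vinv t (fst y') ?a)"
      using pch_q(1)[of "(fst y', snd y' + vinv t (fst y') ?a)"] y' by (simp add: tchart_simps)
    also have "\<dots> = snd t (fst y') (snd y') + ?a"
      using linear_on_setD(1)[OF triv_linear[OF pcs(2)]] vinv_in[OF pcs(2)] triv_vinv[OF pcs(2)] y' by simp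
    finally show "snd (snd (pch P c t W) (q y')) = snd t (fst y') (snd y') + ?a" .
  qed
  have zk: "q y1 \<in> fst (pch P c t W)" using z_k q1 by simp
  have sk: "smooth_at TOT y1 (\<lambda>y'. snd (pch P c t W) (q y'))" by (rule TZ.smooth_map_at_mchart[OF sq pcs(6) zk])
  have "snd (tco Z (pch P c t W) (q y) (mdiff TOT Z q y1 w1)) = snd (dfun TOT (\<lambda>y'. snd (pch P c t W) (q y')) y1 w1)"
    using TZ.tco_mdiff[OF sq pcs(6) zk] q1 by simp
  also have "\<dots> = dfun TOT (\<lambda>y'. snd (snd (pch P c t W) (q y'))) y1 w1"
    using TZ.A.dfun_linear[OF linear_snd sk] by simp
  also have "\<dots> = dfun TOT (\<lambda>y'. snd t (fst y') (snd y')) y1 w1"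
    unfolding TZ.A.dfun_cong[OF n] TZ.A.dfun_add[OF st TZ.A.smooth_at_const[OF y1]] TZ.A.dfun_const by simp
  finally show ?thesis using split_tot_eq[OF y1 pcs(2) x1] f by simp
qed

text \<open>This justifies the definite description in \<open>split_D\<close>: a preimage of
  \<open>w\<close> at \<open>y\<close> exists because \<open>q\<close> is a change of names in the
  chart \<open>pch\<close>, and by \<open>split_preimage\<close> every other preimage gives the same
  value.\<close>

lemma split_D_eq:
  assumes w: "w \<in> tangent_space Z (q y)"
  shows "split_D P (q y) w = vinv t (fst y) (snd (tco Z (pch P c t W) (q y) w))"
  unfolding split_D_def
proof (rule the_equality)
  let ?w = "tinv TOT (tchart B c t) y (tco Z (pch P c t W) (q y) w)"
  have wT: "?w \<in> tangent_space TOT y" by (rule TZ.A.tinv_in[OF tk])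
  have "mdiff TOT Z q y ?w = w"
    by (rule ZA.A.tco_inject[OF pcs(6) z_k TZ.mdiff_in[OF smooth_map_at_q] w])
      (simp add: tco_q TZ.A.tco_tinv[OF tk])
  then show "\<exists>y'\<in>carrier TOT. \<exists>w'\<in>tangent_space TOT y'. q y' = q y \<and> mdiff TOT Z q y' w' = w \<and>
       vinv t (fst y) (snd (tco Z (pch P c t W) (q y) w)) = split_tot P y' w'"
    using split_preimage[OF y_carrier refl, of ?w] y_carrier wT by (metis (no_types, lifting))
next
  fix u assume "\<exists>y'\<in>carrier TOT. \<exists>w'\<in>tangent_space TOT y'. q y' = q y \<and> mdiff TOT Z q y' w' = w \<and>
       u = split_tot P y' w'"
  then show "u = vinv t (fst y) (snd (tco Z (pch P c t W) (q y) w))"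
    using split_preimage by blast
qed

lemma vert_j_eq:
  assumes u: "u \<in> V (fst y)"
  shows "vert_j P (q y) u = tinv Z (pch P c t W) (q y) (0, snd t (fst y) u)"
proof -
  define v1 where "v1 = (SOME v. v \<in> V (fst y) \<and> q (fst y, v) = q y)"
  have "\<exists>v. v \<in> V (fst y) \<and> q (fst y, v) = q y" using v_fibre by auto
  then have "v1 \<in> V (fst y) \<and> q (fst y, v1) = q y" unfolding v1_def by (rule someI_ex)
  then have v1: "v1 \<in> V (fst y)" "q (fst y, v1) = q y" by auto
  note d = deck[OF v1] and sub = fibre_subspace[OF pcs(2) x_t]
  note L = linear_on_setD[OF triv_linear[OF pcs(2) x_t]]
  let ?g = "\<lambda>r. (fst y, snd y + r *\<^sub>R u)"
  \<comment> \<open>\<open>vert_j\<close> starts its curve at an arbitrarily chosen preimage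
    \<open>v1\<close>. The deck translation moves it to the curve through \<open>y\<close> without
    changing its image in \<open>Z\<close>.\<close>
  have e: "q (fst y, v1 + r *\<^sub>R u) = q (?g r)" for r
  proof -
    have "v1 + r *\<^sub>R u \<in> V (fst y)" by (intro subspace_add subspace_scale sub v1 u)
    then have "q (fst y, v1 + r *\<^sub>R u + vinv t (fst y) (snd t (fst y) (snd y - v1))) = q (fst y, v1 + r *\<^sub>R u)"
      using near_point[OF d(1)] by blast
    moreover have "v1 + r *\<^sub>R u + vinv t (fst y) (snd t (fst y) (snd y - v1)) = snd y + r *\<^sub>R u"
      using d(2) by (simp add: algebra_simps)
    ultimately show ?thesis by simp
  qed
  have gk: "?g r \<in> fst (tchart B c t)" for r
    using x_c x_t subspace_add[OF sub v_fibre subspace_scale[OF sub u]] by (simp add: tchart_simps)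
  have co: "snd (tchart B c t) (?g r) = (snd c (fst y), snd t (fst y) (snd y) + r *\<^sub>R snd t (fst y) u)" for r
    using L(1)[OF v_fibre subspace_scale[OF sub u]] L(2)[OF u] by (simp add: tchart_simps)
  \<comment> \<open>The times at which the curve stays in the sheet \<open>W\<close>; an open set,
    because the curve is an affine line in coordinates.\<close>
  let ?S = "(\<lambda>r. snd (tchart B c t) (?g r)) -` (snd (tchart B c t) ` (W \<inter> fst (tchart B c t)))"
  have oS: "open ?S"
  proof (rule open_vimage[OF TZ.A.mopen_image[OF tk(1) pcs(3)]])
    show "continuous_on UNIV (\<lambda>r. snd (tchart B c t) (?g r))"
      unfolding co by (intro continuous_intros)
  qed
  have gW: "?g r \<in> W" if r: "r \<in> ?S" for r
  proof -
    obtain y' where y': "y' \<in> W" "y' \<in> fst (tchart B c t)" "snd (tchart B c t) (?g r) = snd (tchart B c t) y'"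
      using r by blast
    then have "?g r = y'" using inj_onD[OF tchart_inj[OF pcs(1,2)] y'(3) gk y'(2)] by simp
    then show ?thesis using y' by simp
  qed
  have 0: "0 \<in> ?S" using yW tk(2) by auto
  have "velocity Z (\<lambda>r. q (?g r)) 0 = tinv Z (pch P c t W) (q (?g 0)) (0, snd t (fst y) u)"
  proof (rule ZA.A.velocity_eq[OF pcs(6) _ oS 0])
    show "q (?g 0) \<in> fst (pch P c t W)" using z_k by simp
    show "q (?g r) \<in> fst (pch P c t W)" if "r \<in> ?S" for r by (rule pch_q(2)[OF gW[OF that]])
    have "((\<lambda>r. (snd c (fst y), snd t (fst y) (snd y) + r *\<^sub>R snd t (fst y) u))
        has_vector_derivative (0, snd t (fst y) u)) (at 0)"
      by (auto intro!: derivative_eq_intros simp: has_vector_derivative_def)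
    then show "((\<lambda>r. snd (pch P c t W) (q (?g r))) has_vector_derivative (0, snd t (fst y) u)) (at 0)"
      by (rule has_vector_derivative_transform_within_open[OF _ oS 0]) (simp add: pch_q(1)[OF gW] co)
  qed
  then show ?thesis by (simp add: vert_j_def pr_q v1_def[symmetric] e)
qed

text \<open>The conditions on the projection and on D fix the base and the fibre component of the
  coordinate vector respectively, so the described vector exists and is unique.\<close>

lemma hor_alpha_eq:
  assumes s: "s \<in> TM (fst y)"
  shows "hor_alpha P (q y) s = tinv Z (pch P c t W) (q y) (tco A c (fst y) s, 0)"
  unfolding hor_alpha_def
proof (rule the_equality)
  let ?w = "tinv Z (pch P c t W) (q y) (tco A c (fst y) s, 0)"
  note T = ZA.A.tco_tinv[OF pcs(6) z_k] ZA.A.tinv_in[OF pcs(6) z_k]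
  have m: "mdiff Z A pr (q y) w = s \<longleftrightarrow> fst (tco Z (pch P c t W) (q y) w) = tco A c (fst y) s"
    if "w \<in> tangent_space Z (q y)" for w
    using tco_inject[OF smc x_c _ s, of "mdiff Z A pr (q y) w"] ZA.mdiff_in[OF smooth_map_at_pr] pr_q tco_pr by metis
  have z: "split_D P (q y) w = 0 \<longleftrightarrow> snd (tco Z (pch P c t W) (q y) w) = 0"
    if "w \<in> tangent_space Z (q y)" for w
    unfolding split_D_eq[OF that] using triv_vinv[OF pcs(2) x_t] linear_0[OF linear_vinv[OF pcs(2) x_t]] by metis
  show "?w \<in> tangent_space Z (q y) \<and> mdiff Z A pr (q y) ?w = s \<and> split_D P (q y) ?w = 0"
    using m z T by simp
  fix w assume w: "w \<in> tangent_space Z (q y) \<and> mdiff Z A pr (q y) w = s \<and> split_D P (q y) w = 0"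
  then have "tco Z (pch P c t W) (q y) w = (tco A c (fst y) s, 0)" using m z by (metis prod.collapse)
  then show "w = ?w" using ZA.A.tinv_tco[OF pcs(6) z_k] w by metis
qed

end

section \<open>Coordinates over the base and the isomorphism F\<close>

text \<open>Base components precede fibre components, as in the charts \<open>pch\<close> of
  \<open>Z\<close>, although \<open>base_sum\<close> lists V first. With this order F has the
  identity as its coordinate expression.\<close>

definition co :: "('m, 'e) chart \<Rightarrow> 'm set \<times> ('m \<Rightarrow> 'v \<Rightarrow> 'f) \<Rightarrow> 'm \<Rightarrow> ('v \<times> ('m, 'e) tvec) gen \<Rightarrow>
    ('e \<times> 'f) \<times> ('e \<times> 'f)" where
  "co c t x u = ((tco A c x (fst (cT u x)), snd t x (fst (cV u x))),
     (cco A c x (snd (cT u x)), dual_triv B t x (snd (cV u x))))"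

definition coinv :: "('m, 'e) chart \<Rightarrow> 'm set \<times> ('m \<Rightarrow> 'v \<Rightarrow> 'f) \<Rightarrow> 'm \<Rightarrow> ('e \<times> 'f) \<times> ('e \<times> 'f) \<Rightarrow>
    ('v \<times> ('m, 'e) tvec) gen" where
  "coinv c t x k = mkE x (vinv t x (snd (fst k))) (tinv A c x (fst (fst k)))
     (dinv t x (snd (snd k))) (cinv A c x (fst (snd k)))"

text \<open>In the chart \<open>pch\<close> the maps j and \<alpha> are the inclusions of the fibre
  and the base coordinates, and D and dp the projections; F therefore reads off the same coordinates
  as the chart.\<close>

lemma iso_F_eq:
  assumes pc: "pc P c t W" and yW: "y \<in> W"
    and u: "u \<in> fibre (gen_bundle (tbundle Z)) (q y)"
  shows "iso_F P (q y) u =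
    coinv c t (fst y) (tco Z (pch P c t W) (q y) (fst u), cco Z (pch P c t W) (q y) (snd u))"
proof -
  note p = pcD[OF pc] and xc = x_c[OF pc yW] and xt = x_t[OF pc yW] and zk = z_k[OF pc yW]
    and mc = smc[OF pc yW] and prq = pr_q[OF pc yW]
  let ?k = "pch P c t W" and ?x = "fst y"
  have w: "fst u \<in> tangent_space Z (q y)" and xi: "snd u \<in> dual_space (tangent_space Z (q y))"
    using u by auto
  have m: "mdiff Z A pr (q y) (fst u) \<in> TM ?x"
    using ZA.mdiff_in[OF smooth_map_at_pr[OF pc yW]] prq by simp
  have 1: "mdiff Z A pr (q y) (fst u) = tinv A c ?x (fst (tco Z ?k (q y) (fst u)))"
    using tinv_tco[OF mc xc m] tco_pr[OF pc yW] by simp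
  have c1: "snd u (vert_j P (q y) a) = dinv t ?x (snd (cco Z ?k (q y) (snd u))) a" if "a \<in> V ?x" for a
    using vert_j_eq[OF pc yW that] ZA.A.cco_inner[OF p(6) zk xi, of "(0, snd t ?x a)"] that
    by (simp add: dinv_def restr_def inner_prod_def)
  have c2: "snd u (hor_alpha P (q y) s) = cinv A c ?x (fst (cco Z ?k (q y) (snd u))) s" if "s \<in> TM ?x" for s
    using hor_alpha_eq[OF pc yW that] ZA.A.cco_inner[OF p(6) zk xi, of "(tco A c ?x s, 0)"] that
    by (simp add: cinv_def restr_def inner_prod_def)
  have "copair (V ?x) (TM ?x) (\<lambda>a. snd u (vert_j P (q y) a)) (\<lambda>s. snd u (hor_alpha P (q y) s))
      = copair (V ?x) (TM ?x) (dinv t ?x (snd (cco Z ?k (q y) (snd u)))) (cinv A c ?x (fst (cco Z ?k (q y) (snd u))))"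
    using c1 c2 by (auto simp: copair_def restr_def fun_eq_iff)
  then show ?thesis
    using 1 split_D_eq[OF pc yW w] by (simp add: iso_F_def case_prod_unfold coinv_def mk_def prq)
qed

lemma coinv_in:
  assumes "c \<in> A" "t \<in> btriv B" "x \<in> fst c" "x \<in> fst t"
  shows "coinv c t x k \<in> E x"
  unfolding coinv_def
  using assms by (intro E_mk_in vinv_in dinv_in tinv_in cinv_in chart_mchart) (auto intro: chart_carrier)

lemma co_coinv:
  assumes "c \<in> A" "t \<in> btriv B" "x \<in> fst c" "x \<in> fst t"
  shows "co c t x (coinv c t x k) = k"
proof -
  have x: "x \<in> carrier A" and m: "mchart A c" using assms chart_carrier chart_mchart by auto
  show ?thesis
    using c_mk[OF x dinv_in[OF assms(2,4)] cinv_in[OF m assms(3)]]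
    by (simp add: co_def coinv_def tco_tinv[OF m assms(3)] cco_cinv[OF m assms(3)]
        triv_vinv[OF assms(2,4)] dual_triv_dinv[OF assms(2,4)])
qed

lemma coinv_co:
  assumes "c \<in> A" "t \<in> btriv B" "x \<in> fst c" "x \<in> fst t" and u: "u \<in> E x"
  shows "coinv c t x (co c t x u) = u"
proof -
  have x: "x \<in> carrier A" and m: "mchart A c" using assms chart_carrier chart_mchart by auto
  obtain v w f g where d: "v \<in> V x" "w \<in> TM x" "f \<in> dual_space (V x)" "g \<in> dual_space (TM x)" "u = mkE x v w f g"
    using E_mk_cases[OF x u] by blast
  show ?thesis
    unfolding d(5) co_def coinv_def c_mk[OF x d(3,4)]
    by (simp add: tinv_tco[OF m assms(3) d(2)] vinv_triv[OF assms(2,4) d(1)]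
        cinv_cco[OF m assms(3) d(4)] dinv_dual_triv[OF assms(2,4) d(3)])
qed

lemma cV_add: "cV (u + u') x = cV u x + cV u' x" and cV_scale: "cV (k *\<^sub>R u) x = k *\<^sub>R cV u x"
  and cT_add: "cT (u + u') x = cT u x + cT u' x" and cT_scale: "cT (k *\<^sub>R u) x = k *\<^sub>R cT u x"
  by (auto simp: cV_def cT_def fpart_def spart_def restr_def fun_eq_iff scaleR_fun_apply)

lemma linear_co:
  assumes "c \<in> A" "t \<in> btriv B" "x \<in> fst c" "x \<in> fst t"
  shows "linear_on_set (E x) (co c t x)"
proof -
  have x: "x \<in> carrier A" and m: "mchart A c" using assms chart_carrier chart_mchart by auto
  have f: "fst (cV u x) \<in> V x" if "u \<in> E x" for u using that by (auto simp: cV_def fibre_base_sum)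
  note T = linear_tco[OF m assms(3)] and L = linear_on_setD[OF triv_linear[OF assms(2,4)]]
  show ?thesis
    by (auto simp: linear_on_set_def co_def cV_add cT_add cV_scale cT_scale linear_add[OF T] linear_scale[OF T]
        linear_add[OF linear_cco] linear_scale[OF linear_cco] linear_add[OF linear_dual_triv]
        linear_scale[OF linear_dual_triv] L f simp del: fibre_gen_bundle)
qed

lemma co_incl:
  assumes x: "x \<in> carrier A" and t: "t \<in> btriv B" "x \<in> fst t" and c: "c \<in> A" "x \<in> fst c"
  shows "a \<in> V x \<times> dual_space (V x) \<Longrightarrow>
      co c t x (incl_V P x a) = ((0, snd t x (fst a)), (0, dual_triv B t x (snd a)))"
    "b \<in> TM x \<times> dual_space (TM x) \<Longrightarrow>
      co c t x (incl_T P x b) = ((tco A c x (fst b), 0), (cco A c x (snd b), 0))"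
proof -
  note m = chart_mchart[OF c(1)]
  have z: "snd t x 0 = 0" using linear_on_setD(2)[OF triv_linear[OF t] V0[OF x], of 0] by simp
  show "a \<in> V x \<times> dual_space (V x) \<Longrightarrow>
      co c t x (incl_V P x a) = ((0, snd t x (fst a)), (0, dual_triv B t x (snd a)))"
    by (simp add: co_def c_incl[OF x] linear_0[OF linear_tco[OF m c(2)]] linear_0[OF linear_cco])
  show "b \<in> TM x \<times> dual_space (TM x) \<Longrightarrow>
      co c t x (incl_T P x b) = ((tco A c x (fst b), 0), (cco A c x (snd b), 0))"
    by (simp add: co_def c_incl[OF x] z linear_0[OF linear_dual_triv])
qed

end

section \<open>Semi-flat structures\<close>

context flat_torus
begin

abbreviation "EZ z \<equiv> fibre (gen_bundle (tbundle (ptotal P))) z"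

definition chart_co :: "('z, 'e \<times> 'f) chart \<Rightarrow> 'z \<Rightarrow> ('z, 'e \<times> 'f) tvec gen \<Rightarrow> ('e \<times> 'f) \<times> ('e \<times> 'f)" where
  "chart_co k z u = (tco Z k z (fst u), cco Z k z (snd u))"

lemma linear_coinv:
  assumes "c \<in> A" "t \<in> btriv B" "x \<in> fst c" "x \<in> fst t"
  shows "linear (coinv c t x)"
proof -
  note L = linear_on_setD[OF linear_co[OF assms]] and m = coinv_in[OF assms]
  have sub: "subspace (E x)" using smooth_bundle.subspace_fibre[OF smooth_E] assms chart_carrier by blast
  show ?thesis
  proof (rule linearI)
    show "coinv c t x (a + b) = coinv c t x a + coinv c t x b" for a b
      using coinv_co[OF assms subspace_add[OF sub m m], of a b] L(1)[OF m m] co_coinv[OF assms] by simp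
    show "coinv c t x (r *\<^sub>R a) = r *\<^sub>R coinv c t x a" for r a
      using coinv_co[OF assms subspace_scale[OF sub m], of r a] L(2)[OF m] co_coinv[OF assms] by simp
  qed
qed

lemma smooth_at_co:
  assumes c: "c \<in> A" "x \<in> fst c" and t: "t \<in> btriv B" "x \<in> fst t"
    and u: "sec A (gen_bundle (base_sum P)) x u"
  shows "smooth_at A x (\<lambda>y. co c t y (u y))"
proof -
  have x: "x \<in> carrier A" and m: "mchart A c" using c chart_carrier chart_mchart by auto
  note s = u[unfolded sec_E[OF x] sec_triv[OF t] sec_tbundle[OF m c(2)] sec_dual_tbundle[OF m c(2)]]
  have "(fst t, dual_triv B t) \<in> btriv (dual_bundle B)" using t unfolding btriv_dual by auto
  then have "smooth_at A x (\<lambda>y. dual_triv B t y (snd (cV (u y) y)))" using s t(2) unfolding sec_def by fastforce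
  then show ?thesis unfolding co_def using s by (intro smooth_at_Pair) auto
qed

lemma sec_coinv:
  assumes c: "c \<in> A" "x \<in> fst c" and t: "t \<in> btriv B" "x \<in> fst t"
  shows "sec A (gen_bundle (base_sum P)) x (\<lambda>y. coinv c t y k)"
proof -
  have x: "x \<in> carrier A" and m: "mchart A c" using c chart_carrier chart_mchart by auto
  have n: "near A x (\<lambda>y. y \<in> fst c \<and> y \<in> fst t)"
    by (rule near_conj[OF near_chart[OF m c(2)] near_triv[OF t]])
  have c_co: "cV (coinv c t y k) y = (vinv t y (snd (fst k)), dinv t y (snd (snd k)))"
    "cT (coinv c t y k) y = (tinv A c y (fst (fst k)), cinv A c y (fst (snd k)))"
    if "y \<in> fst c" "y \<in> fst t" for y
    unfolding coinv_def
    using c_mk[OF triv_carrier[OF t(1) that(2)] dinv_in[OF t(1) that(2)] cinv_in[OF m that(1)]] by simp_all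
  interpret dB: smooth_bundle A "dual_bundle B" by (rule smooth_bundle_dual)
  have dt: "(fst t, dual_triv B t) \<in> btriv (dual_bundle B)" "x \<in> fst (fst t, dual_triv B t)"
    using t unfolding btriv_dual by auto
  show ?thesis
    unfolding sec_E[OF x]
  proof (intro conjI)
    show "near A x (\<lambda>y. coinv c t y k \<in> E y)"
      by (rule near_mono[OF n]) (use coinv_in[OF c(1) t(1)] in blast)
    show "sec A B x (\<lambda>y. fst (cV (coinv c t y k) y))"
      by (rule sec_cong[OF near_mono[OF n] sec_vinv[OF t, of "snd (fst k)"]]) (simp add: c_co)
    show "sec A (dual_bundle B) x (\<lambda>y. snd (cV (coinv c t y k) y))"
      by (rule sec_cong[OF near_mono[OF n] dB.sec_vinv[OF dt, of "snd (snd k)"]])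
        (simp add: c_co dB.vinv_def inv_into_dual_triv[OF t(1)])
    show "sec A (tbundle A) x (\<lambda>y. fst (cT (coinv c t y k) y))"
      unfolding sec_tbundle[OF m c(2)]
    proof
      show "near A x (\<lambda>y. fst (cT (coinv c t y k) y) \<in> TM y)"
        by (rule near_mono[OF n]) (simp add: c_co tinv_in[OF m])
      show "smooth_at A x (\<lambda>y. tco A c y (fst (cT (coinv c t y k) y)))"
        by (rule smooth_at_cong[OF near_mono[OF n] smooth_at_const[OF x, of "fst (fst k)"]])
          (simp add: c_co tco_tinv[OF m])
    qed
    show "sec A (dual_bundle (tbundle A)) x (\<lambda>y. snd (cT (coinv c t y k) y))"
      unfolding sec_dual_tbundle[OF m c(2)]
    proof
      show "near A x (\<lambda>y. snd (cT (coinv c t y k) y) \<in> dual_space (TM y))"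
        by (rule near_mono[OF n]) (simp add: c_co cinv_in[OF m])
      show "smooth_at A x (\<lambda>y. cco A c y (snd (cT (coinv c t y k) y)))"
        by (rule smooth_at_cong[OF near_mono[OF n] smooth_at_const[OF x, of "fst (snd k)"]])
          (simp add: c_co cco_cinv[OF m])
    qed
  qed
qed

lemma pairing_coinv:
  assumes c: "c \<in> A" "x \<in> fst c" and t: "t \<in> btriv B" "x \<in> fst t"
  shows "pairing (coinv c t x k) (coinv c t x l) = - (1/2) * (snd k \<bullet> fst l + snd l \<bullet> fst k)"
proof -
  note m = chart_mchart[OF c(1)]
  show ?thesis
    unfolding coinv_def
    by (subst pairing_mk)
      (auto simp: vinv_in[OF t] tinv_in[OF m c(2)] dinv_def cinv_def restr_def triv_vinv[OF t]
        tco_tinv[OF m c(2)] inner_prod_def)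
qed

context
  fixes c t W y assumes pc: "pc P c t W" and yW: "y \<in> W"
begin

lemmas pcx = pcD[OF pc] and xcx = x_c[OF pc yW] and xtx = x_t[OF pc yW]
lemmas zkx = z_k[OF pc yW] and prx = pr_q[OF pc yW]

lemma co_iso_F: "u \<in> EZ (q y) \<Longrightarrow> co c t (fst y) (iso_F P (q y) u) = chart_co (pch P c t W) (q y) u"
  using iso_F_eq[OF pc yW] co_coinv[OF pcx(1,2) xcx xtx] by (simp add: chart_co_def del: fibre_gen_bundle)

lemma iso_F_chart_co: "u \<in> EZ (q y) \<Longrightarrow> iso_F P (q y) u = coinv c t (fst y) (chart_co (pch P c t W) (q y) u)"
  using iso_F_eq[OF pc yW] by (simp add: chart_co_def del: fibre_gen_bundle)

lemma linear_chart_co: "linear (chart_co (pch P c t W) (q y))"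
  using ZA.A.linear_tco[OF pcx(6) zkx] ZA.A.linear_cco[of "pch P c t W" "q y"]
  by (auto intro!: linearI simp: chart_co_def linear_add linear_scale)

lemma bij_iso_F: "bij_betw (iso_F P (q y)) (EZ (q y)) (E (fst y))"
proof (rule bij_betw_byWitness[of _ "\<lambda>e. (tinv Z (pch P c t W) (q y) (fst (co c t (fst y) e)),
      cinv Z (pch P c t W) (q y) (snd (co c t (fst y) e)))"])
  let ?g = "\<lambda>e. (tinv Z (pch P c t W) (q y) (fst (co c t (fst y) e)),
      cinv Z (pch P c t W) (q y) (snd (co c t (fst y) e)))"
  note ti = ZA.A.tinv_in[OF pcx(6) zkx] and ci = ZA.A.cinv_in[OF pcx(6) zkx]
  have m: "?g e \<in> EZ (q y)" for e using ti ci by simp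
  show "\<forall>u\<in>EZ (q y). ?g (iso_F P (q y) u) = u"
    using ZA.A.tinv_tco[OF pcx(6) zkx] ZA.A.cinv_cco[OF pcx(6) zkx]
    by (auto simp: co_iso_F chart_co_def simp del: fibre_gen_bundle) (auto)
  show "\<forall>e\<in>E (fst y). iso_F P (q y) (?g e) = e"
    using coinv_co[OF pcx(1,2) xcx xtx]
    by (simp add: iso_F_chart_co[OF m] chart_co_def ZA.A.tco_tinv[OF pcx(6) zkx] ZA.A.cco_cinv[OF pcx(6) zkx]
        del: fibre_gen_bundle)
  show "iso_F P (q y) ` EZ (q y) \<subseteq> E (fst y)"
    using coinv_in[OF pcx(1,2) xcx xtx] iso_F_chart_co by (metis image_subsetI)
  show "?g ` E (fst y) \<subseteq> EZ (q y)" using m by blast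
qed

lemma linear_iso_F: "linear_on_set (EZ (q y)) (iso_F P (q y))"
proof -
  have "subspace (EZ (q y))"
    using smooth_bundle.subspace_fibre[OF smooth_bundle_gen[OF ZA.A.smooth_bundle_tbundle]]
      mchart_carrier[OF pcx(6) zkx] by blast
  then show ?thesis
    using linear_compose[OF linear_chart_co linear_coinv[OF pcx(1,2) xcx xtx]]
    by (intro linear_on_set_cong[OF _ _ linear_on_set_linear]) (auto simp: iso_F_chart_co o_def simp del: fibre_gen_bundle)
qed

lemma pairing_iso_F:
  assumes u: "u \<in> EZ (q y)" and u': "u' \<in> EZ (q y)"
  shows "pairing (iso_F P (q y) u) (iso_F P (q y) u') = pairing u u'"
  unfolding iso_F_chart_co[OF u] iso_F_chart_co[OF u'] pairing_coinv[OF pcx(1) xcx pcx(2) xtx]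
  unfolding chart_co_def pairing_def
  using ZA.A.covector_apply[OF pcx(6) zkx, of "snd u" "fst u'"]
    ZA.A.covector_apply[OF pcx(6) zkx, of "snd u'" "fst u"] u u'
  by (simp add: mem_Times_iff)

lemma sec_Z_iff:
  "sec Z (gen_bundle (tbundle Z)) (q y) u \<longleftrightarrow>
    near Z (q y) (\<lambda>z. u z \<in> EZ z) \<and> smooth_at Z (q y) (\<lambda>z. chart_co (pch P c t W) z (u z))"
proof -
  have n: "near Z (q y) (\<lambda>z. u z \<in> EZ z) \<longleftrightarrow> near Z (q y) (\<lambda>z. fst (u z) \<in> tangent_space Z z)
      \<and> near Z (q y) (\<lambda>z. snd (u z) \<in> dual_space (tangent_space Z z))"
  proof
    assume a: "near Z (q y) (\<lambda>z. u z \<in> EZ z)"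
    show "near Z (q y) (\<lambda>z. fst (u z) \<in> tangent_space Z z)
      \<and> near Z (q y) (\<lambda>z. snd (u z) \<in> dual_space (tangent_space Z z))"
      by (intro conjI; rule ZA.A.near_mono[OF a]; simp add: mem_Times_iff)
  next
    assume "near Z (q y) (\<lambda>z. fst (u z) \<in> tangent_space Z z)
      \<and> near Z (q y) (\<lambda>z. snd (u z) \<in> dual_space (tangent_space Z z))"
    then show "near Z (q y) (\<lambda>z. u z \<in> EZ z)"
      by (intro ZA.A.near_mono[OF ZA.A.near_conj[OF conjunct1 conjunct2]]) (auto simp: mem_Times_iff)
  qed
  have s: "smooth_at Z (q y) (\<lambda>z. chart_co (pch P c t W) z (u z)) \<longleftrightarrow>
      smooth_at Z (q y) (\<lambda>z. tco Z (pch P c t W) z (fst (u z))) \<and> smooth_at Z (q y) (\<lambda>z. cco Z (pch P c t W) z (snd (u z)))"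
    unfolding chart_co_def
    using ZA.A.smooth_at_Pair ZA.A.smooth_at_fst[of "q y" "\<lambda>z. (tco Z (pch P c t W) z (fst (u z)), cco Z (pch P c t W) z (snd (u z)))"]
      ZA.A.smooth_at_snd[of "q y" "\<lambda>z. (tco Z (pch P c t W) z (fst (u z)), cco Z (pch P c t W) z (snd (u z)))"] by auto
  show ?thesis
    unfolding ZA.A.sec_gen[OF mchart_carrier[OF pcx(6) zkx]] ZA.A.sec_tbundle[OF pcx(6) zkx]
      ZA.A.sec_dual_tbundle[OF pcx(6) zkx] n s by blast
qed

end

lemma Z_cases:
  assumes z: "z \<in> carrier Z"
  obtains c t W y where "pc P c t W" "y \<in> W" "z = q y" "pr z = fst y"
proof -
  have "pr z \<in> carrier A" using q_surj[OF z] by blast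
  then obtain c t where "c \<in> A" "pr z \<in> fst c" "t \<in> btriv B" "pr z \<in> fst t"
    using carrier_chart triv_cover by metis
  from pc_exists[OF z this] obtain y W where "y \<in> W" "pc P c t W" "q y = z" "fst y = pr z" by blast
  then show thesis using that by metis
qed

lemma iso_F_Z:
  assumes z: "z \<in> carrier Z"
  shows "bij_betw (iso_F P z) (EZ z) (E (pr z))" "linear_on_set (EZ z) (iso_F P z)"
    "u \<in> EZ z \<Longrightarrow> u' \<in> EZ z \<Longrightarrow> pairing (iso_F P z u) (iso_F P z u') = pairing u u'"
    "pr z \<in> carrier A"
proof -
  obtain c t W y where y: "pc P c t W" "y \<in> W" "z = q y" "pr z = fst y" using Z_cases[OF z] .
  show "bij_betw (iso_F P z) (EZ z) (E (pr z))" "linear_on_set (EZ z) (iso_F P z)"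
    "u \<in> EZ z \<Longrightarrow> u' \<in> EZ z \<Longrightarrow> pairing (iso_F P z u) (iso_F P z u') = pairing u u'"
    using bij_iso_F[OF y(1,2)] linear_iso_F[OF y(1,2)] pairing_iso_F[OF y(1,2)] y(3,4)
    by (simp_all del: fibre_gen_bundle)
  show "pr z \<in> carrier A" using q_surj[OF z] by blast
qed

section \<open>Lifting sections from the base\<close>

text \<open>\<open>F\<^sup>-\<^sup>1(p\<^sup>*e)\<close>\<close>

definition pull_F :: "('m \<Rightarrow> ('v \<times> ('m, 'e) tvec) gen) \<Rightarrow> 'z \<Rightarrow> ('z, 'e \<times> 'f) tvec gen" where
  "pull_F e z = inv_into (EZ z) (iso_F P z) (e (pr z))"

lemma pull_F:
  assumes z: "z \<in> carrier Z" and e: "e (pr z) \<in> E (pr z)"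
  shows "pull_F e z \<in> EZ z" "iso_F P z (pull_F e z) = e (pr z)"
proof -
  show "iso_F P z (pull_F e z) = e (pr z)"
    unfolding pull_F_def by (rule bij_betw_inv_into_right[OF iso_F_Z(1)[OF z] e])
  show "pull_F e z \<in> EZ z"
    unfolding pull_F_def using bij_betw_imp_surj_on[OF bij_betw_inv_into[OF iso_F_Z(1)[OF z]]] e by blast
qed

text \<open>The right-hand side depends on \<open>z\<close> through \<open>pr z\<close> alone: in
  product charts a lift has coefficients that are constant along the fibres.\<close>

lemma chart_co_pull_F:
  assumes pc: "pc P c t W" and z: "z \<in> fst (pch P c t W)" and e: "e (pr z) \<in> E (pr z)"
  shows "chart_co (pch P c t W) z (pull_F e z) = co c t (pr z) (e (pr z))"
proof -
  obtain y where y: "y \<in> W" "z = q y" using z by (auto simp: pch_def)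
  have zc: "z \<in> carrier Z" by (rule mchart_carrier[OF pcD(6)[OF pc] z])
  show ?thesis
    using co_iso_F[OF pc y(1), of "pull_F e z"] pull_F[of z e, OF zc e] y pr_q[OF pc y(1)] by (simp del: fibre_gen_bundle)
qed

lemma smooth_map_at_pr_Z: assumes z: "z \<in> carrier Z" shows "smooth_map_at Z A z pr"
proof -
  obtain c t W y where y: "pc P c t W" "y \<in> W" "z = q y" "pr z = fst y" using Z_cases[OF z] .
  then show ?thesis using smooth_map_at_pr by simp
qed

lemma sec_pull_F:
  assumes z: "z \<in> carrier Z" and e: "sec A (gen_bundle (base_sum P)) (pr z) e"
  shows "sec Z (gen_bundle (tbundle Z)) z (pull_F e)"
proof -
  obtain c t W y where y: "pc P c t W" "y \<in> W" "z = q y" "pr z = fst y" using Z_cases[OF z] .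
  have n: "near Z (q y) (\<lambda>z'. e (pr z') \<in> E (pr z'))"
    using ZA.smooth_map_at_near[OF smooth_map_at_pr_Z[OF z], of "\<lambda>x. e x \<in> E x"] e y(3) by (simp add: sec_def del: fibre_gen_bundle)
  have s: "smooth_at Z (q y) (\<lambda>z'. co c t (pr z') (e (pr z')))"
    using ZA.smooth_map_at_smooth_at[OF smooth_map_at_pr_Z[OF z] smooth_at_co[OF pcD(1)[OF y(1)] _ pcD(2)[OF y(1)] _ e]]
      x_c[OF y(1,2)] x_t[OF y(1,2)] y(3,4) by simp
  show ?thesis
    unfolding y(3) sec_Z_iff[OF y(1,2)]
  proof
    show "near Z (q y) (\<lambda>z. pull_F e z \<in> EZ z)"
      by (rule ZA.A.near_mono[OF n]) (rule pull_F(1))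
    show "smooth_at Z (q y) (\<lambda>z. chart_co (pch P c t W) z (pull_F e z))"
      by (rule ZA.A.smooth_at_cong[OF ZA.A.near_mono[OF ZA.A.near_conj[OF n near_k[OF y(1,2)]]] s])
        (simp add: chart_co_pull_F[OF y(1)] del: fibre_gen_bundle)
  qed
qed

text \<open>The projection forgets the fibre coordinates, so the fibre component of the direction
  drops out. In particular vertical vectors annihilate functions pulled back from M.\<close>

lemma chart_deriv_pr:
  assumes pc: "pc P c t W" and y: "y \<in> W" and f: "smooth_at A (fst y) f"
  shows "chart_deriv (pch P c t W) (\<lambda>z. f (pr z)) (q y) k = chart_deriv c f (fst y) (fst k)"
proof -
  note p = pcD[OF pc] and zk = z_k[OF pc y] and mc = smc[OF pc y] and xc = x_c[OF pc y]
  have f': "smooth_at A (pr (q y)) f" using f pr_q[OF pc y] by simp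
  have "chart_deriv (pch P c t W) (\<lambda>z. f (pr z)) (q y) k
      = dfun Z (\<lambda>z. f (pr z)) (q y) (tinv Z (pch P c t W) (q y) k)"
    using ZA.A.dfun_tco[OF p(6) zk ZA.smooth_map_at_smooth_at[OF smooth_map_at_pr[OF pc y] f']] ZA.A.tco_tinv[OF p(6) zk] by simp
  also have "\<dots> = dfun A f (fst y) (mdiff Z A pr (q y) (tinv Z (pch P c t W) (q y) k))"
    using ZA.dfun_comp[OF smooth_map_at_pr[OF pc y] f'] pr_q[OF pc y] by simp
  also have "\<dots> = chart_deriv c f (fst y) (fst k)"
    using dfun_tco[OF mc xc f] tco_pr[OF pc y] ZA.A.tco_tinv[OF p(6) zk] by simp
  finally show ?thesis .
qed

text \<open>For coefficients pulled back from M every derivative in the coordinate formula is a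
  derivative on M along the base component of its direction. The coefficients take values in all
  coordinates, base and fibre, so one formula serves lifts of tangent, cotangent and vertical
  sections alike.\<close>

lemma courant_pullback:
  assumes pc: "pc P c t W" and y: "y \<in> W"
    and s: "sec Z (gen_bundle (tbundle Z)) (q y) s" "near Z (q y) (\<lambda>z. chart_co (pch P c t W) z (s z) = (S (pr z), S1 (pr z)))"
    and r: "sec Z (gen_bundle (tbundle Z)) (q y) r" "near Z (q y) (\<lambda>z. chart_co (pch P c t W) z (r z) = (R (pr z), R1 (pr z)))"
    and sm: "smooth_at A (fst y) S" "smooth_at A (fst y) S1" "smooth_at A (fst y) R" "smooth_at A (fst y) R1"
  defines "x \<equiv> fst y"
  shows "fst (chart_co (pch P c t W) (q y) (courant Z s r (q y)))
      = chart_deriv c R x (fst (S x)) - chart_deriv c S x (fst (R x))"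
    "snd (chart_co (pch P c t W) (q y) (courant Z s r (q y))) \<bullet> k
      = chart_deriv c R1 x (fst (S x)) \<bullet> k + R1 x \<bullet> chart_deriv c S x (fst k)
        - (chart_deriv c S1 x (fst (R x)) \<bullet> k + S1 x \<bullet> chart_deriv c R x (fst k))
        + (1/2) * (S1 x \<bullet> chart_deriv c R x (fst k) + chart_deriv c S1 x (fst k) \<bullet> R x
            - (R1 x \<bullet> chart_deriv c S x (fst k) + chart_deriv c R1 x (fst k) \<bullet> S x))"
    "courant Z s r (q y) \<in> EZ (q y)"
proof -
  note p = pcD[OF pc] and zk = z_k[OF pc y]
  let ?k = "pch P c t W"
  have n: "near Z (q y) (\<lambda>z. tco Z ?k z (fst (s z)) = S (pr z))" "near Z (q y) (\<lambda>z. cco Z ?k z (snd (s z)) = S1 (pr z))"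
    "near Z (q y) (\<lambda>z. tco Z ?k z (fst (r z)) = R (pr z))" "near Z (q y) (\<lambda>z. cco Z ?k z (snd (r z)) = R1 (pr z))"
    by (rule ZA.A.near_mono[OF s(2)], simp add: chart_co_def, rule ZA.A.near_mono[OF s(2)], simp add: chart_co_def,
        rule ZA.A.near_mono[OF r(2)], simp add: chart_co_def, rule ZA.A.near_mono[OF r(2)], simp add: chart_co_def)
  note v = n[THEN ZA.A.near_point, unfolded pr_q[OF pc y]]
  note cd = n[THEN ZA.A.chart_deriv_cong[OF p(6) zk]]
  note C = ZA.A.courant_coordinates[OF p(6) zk s(1) r(1)]
  show "fst (chart_co ?k (q y) (courant Z s r (q y)))
      = chart_deriv c R x (fst (S x)) - chart_deriv c S x (fst (R x))"
    by (simp add: chart_co_def C(3) ZA.A.bracket_co_def cd v chart_deriv_pr[OF pc y] sm x_def)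
  show "snd (chart_co ?k (q y) (courant Z s r (q y))) \<bullet> k
      = chart_deriv c R1 x (fst (S x)) \<bullet> k + R1 x \<bullet> chart_deriv c S x (fst k)
        - (chart_deriv c S1 x (fst (R x)) \<bullet> k + S1 x \<bullet> chart_deriv c R x (fst k))
        + (1/2) * (S1 x \<bullet> chart_deriv c R x (fst k) + chart_deriv c S1 x (fst k) \<bullet> R x
            - (R1 x \<bullet> chart_deriv c S x (fst k) + chart_deriv c R1 x (fst k) \<bullet> S x))"
    by (simp add: chart_co_def C(4) ZA.A.courant_co_def Let_def cd v chart_deriv_pr[OF pc y] sm x_def)
  show "courant Z s r (q y) \<in> EZ (q y)" using C(1,2) by (simp add: mem_Times_iff)
qed

end

locale semi_flat_torus = adapted_str P K + flat_torus P
  for P :: "('m, 'e::euclidean_space, 'v::real_vector, 'f::euclidean_space, 'z) torus_pres"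
    and K :: "('m, 'e, 'v) base_str"
begin

abbreviation "JZ \<equiv> induced_str P K"

lemma JZ:
  assumes z: "z \<in> carrier Z" and u: "u \<in> EZ z"
  shows "JZ z u \<in> EZ z" "iso_F P z (JZ z u) = K (pr z) (iso_F P z u)"
proof -
  note b = iso_F_Z(1)[OF z]
  have "iso_F P z u \<in> E (pr z)" using b u unfolding bij_betw_def by blast
  then have m: "K (pr z) (iso_F P z u) \<in> E (pr z)" by (rule K_pointwise(2)[OF iso_F_Z(4)[OF z]])
  show "iso_F P z (JZ z u) = K (pr z) (iso_F P z u)"
    unfolding induced_str_def by (rule bij_betw_inv_into_right[OF b m])
  show "JZ z u \<in> EZ z"
    unfolding induced_str_def using m bij_betw_imp_surj_on[OF bij_betw_inv_into[OF b]] by blast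
qed

lemma iso_F_inj: "z \<in> carrier Z \<Longrightarrow> u \<in> EZ z \<Longrightarrow> u' \<in> EZ z \<Longrightarrow> iso_F P z u = iso_F P z u' \<Longrightarrow> u = u'"
  using iso_F_Z(1) unfolding bij_betw_def inj_on_def by blast

lemma iso_F_in: "z \<in> carrier Z \<Longrightarrow> u \<in> EZ z \<Longrightarrow> iso_F P z u \<in> E (pr z)"
  using iso_F_Z(1) unfolding bij_betw_def by blast

text \<open>The algebraic properties pass through the isometry F. The lemma serves twice: it gives
  the square of the induced structure on lifted sections, and for the dual presentation it shows
  that the mirror is again a generalized almost complex structure.\<close>

lemma gacs_JZ: "gacs Z (tbundle Z) JZ"
proof (rule smooth_bundle.gacsI[OF ZA.A.smooth_bundle_tbundle])
  show SB: "smooth_bundle Z (gen_bundle (tbundle Z))" by (rule smooth_bundle_gen[OF ZA.A.smooth_bundle_tbundle])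
  fix z assume z: "z \<in> carrier Z"
  note sub = smooth_bundle.subspace_fibre[OF SB z]
  note L = linear_on_setD[OF iso_F_Z(2)[OF z]] and LK = linear_on_setD[OF K_pointwise(1)[OF iso_F_Z(4)[OF z]]]
  note J = JZ[OF z] and i = iso_F_in[OF z] and inj = iso_F_inj[OF z]
  show "linear_on_set (EZ z) (JZ z)"
    unfolding linear_on_set_def
  proof (intro conjI ballI allI)
    show "JZ z (u + v) = JZ z u + JZ z v" if u: "u \<in> EZ z" and v: "v \<in> EZ z" for u v
      by (rule inj[OF J(1)[OF subspace_add[OF sub u v]] subspace_add[OF sub J(1)[OF u] J(1)[OF v]]])
        (simp only: J(2)[OF subspace_add[OF sub u v]] L(1)[OF u v] LK(1)[OF i[OF u] i[OF v]]
          L(1)[OF J(1)[OF u] J(1)[OF v]] J(2)[OF u] J(2)[OF v])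
    show "JZ z (r *\<^sub>R u) = r *\<^sub>R JZ z u" if u: "u \<in> EZ z" for u r
      by (rule inj[OF J(1)[OF subspace_scale[OF sub u]] subspace_scale[OF sub J(1)[OF u]]])
        (simp only: J(2)[OF subspace_scale[OF sub u]] L(2)[OF u] LK(2)[OF i[OF u]] L(2)[OF J(1)[OF u]] J(2)[OF u])
  qed
  show "JZ z u \<in> EZ z" if "u \<in> EZ z" for u by (rule J(1)[OF that])
  show "pairing (JZ z u) (JZ z u') = pairing u u'" if u: "u \<in> EZ z" and u': "u' \<in> EZ z" for u u'
    using iso_F_Z(3)[OF z J(1)[OF u] J(1)[OF u']] iso_F_Z(3)[OF z u u'] J(2)[OF u] J(2)[OF u']
      K_pointwise(3)[OF iso_F_Z(4)[OF z] i[OF u] i[OF u']] by simp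
  show "JZ z (JZ z u) = - u" if u: "u \<in> EZ z" for u
  proof (rule inj[OF J(1)[OF J(1)[OF u]] subspace_neg[OF sub u]])
    show "iso_F P z (JZ z (JZ z u)) = iso_F P z (- u)"
      using J(2)[OF J(1)[OF u]] J(2)[OF u] K_pointwise(4)[OF iso_F_Z(4)[OF z] i[OF u]] L(2)[OF u, of "-1"]
      by (simp add: scaleR_minus1_left)
  qed
  show "sec Z (gen_bundle (tbundle Z)) z (\<lambda>z. JZ z (u z))" if u: "sec Z (gen_bundle (tbundle Z)) z u" for u
  proof -
    obtain c t W y where y: "pc P c t W" "y \<in> W" "z = q y" "pr z = fst y" using Z_cases[OF z] .
    let ?k = "pch P c t W"
    note p = pcD[OF y(1)] and xc = x_c[OF y(1,2)] and xt = x_t[OF y(1,2)]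
    note u' = u[unfolded y(3) sec_Z_iff[OF y(1,2)]]
    have n: "near Z (q y) (\<lambda>z. z \<in> fst ?k \<and> u z \<in> EZ z)"
      by (rule ZA.A.near_conj[OF near_k[OF y(1,2)] conjunct1[OF u']])
    \<comment> \<open>Expanding in the constant frame \<open>coinv\<close> shows that the matrix of
      the induced structure is that of K at \<open>pr z'\<close>; its entries are smooth functions
      pulled back from M.\<close>
    have e: "chart_co ?k z' (JZ z' (u z')) =
        (\<Sum>b\<in>Basis. (chart_co ?k z' (u z') \<bullet> b) *\<^sub>R co c t (pr z') (K (pr z') (coinv c t (pr z') b)))"
      if z': "z' \<in> fst ?k" "u z' \<in> EZ z'" for z'
    proof -
      obtain y' where y': "y' \<in> W" "z' = q y'" using z'(1) by (auto simp: pch_def)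
      have zc: "z' \<in> carrier Z" by (rule mchart_carrier[OF p(6) z'(1)])
      have pr': "pr z' = fst y'" using pr_q[OF y(1) y'(1)] y'(2) by simp
      note xc' = x_c[OF y(1) y'(1)] and xt' = x_t[OF y(1) y'(1)] and xx = x_carrier[OF y(1) y'(1)]
      have j: "chart_co ?k z' (JZ z' (u z')) = co c t (fst y') (K (fst y') (coinv c t (fst y') (chart_co ?k z' (u z'))))"
        using co_iso_F[OF y(1) y'(1), of "JZ z' (u z')"] iso_F_chart_co[OF y(1) y'(1), of "u z'"] JZ[OF zc z'(2)]
          y'(2) z'(2) pr' by (simp del: fibre_gen_bundle)
      have "linear (\<lambda>a. co c t (fst y') (K (fst y') (coinv c t (fst y') a)))"
      proof -
        have "linear_on_set (E (fst y')) (\<lambda>a. co c t (fst y') (K (fst y') a))"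
          using linear_on_setD[OF linear_co[OF p(1,2) xc' xt']] linear_on_setD[OF K_pointwise(1)[OF xx]]
            K_pointwise(2)[OF xx] by (simp add: linear_on_set_def del: fibre_gen_bundle)
        then show ?thesis
          by (rule linear_on_set_compose[OF linear_coinv[OF p(1,2) xc' xt'] coinv_in[OF p(1,2) xc' xt']])
      qed
      from linear_euclidean_expand[OF this, of "chart_co ?k z' (u z')"] show ?thesis unfolding j pr' .
    qed
    have sm: "smooth_at Z (q y) (\<lambda>z'. co c t (pr z') (K (pr z') (coinv c t (pr z') b)))" for b
    proof -
      have "sec A (gen_bundle (base_sum P)) (fst y) (\<lambda>x. K x (coinv c t x b))"
        by (rule sec_K[OF x_carrier[OF y(1,2)] sec_coinv[OF p(1) xc p(2) xt]])
      from smooth_at_co[OF p(1) xc p(2) xt this]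
      have "smooth_at A (pr (q y)) (\<lambda>x. co c t x (K x (coinv c t x b)))" using pr_q[OF y(1,2)] by simp
      from ZA.smooth_map_at_smooth_at[OF smooth_map_at_pr[OF y(1,2)] this] show ?thesis .
    qed
    show ?thesis
      unfolding y(3) sec_Z_iff[OF y(1,2)]
    proof
      show "near Z (q y) (\<lambda>z. JZ z (u z) \<in> EZ z)"
        by (rule ZA.A.near_mono[OF n]) (use JZ(1) in blast)
      have "near Z (q y) (\<lambda>z'. (\<Sum>b\<in>Basis. (chart_co ?k z' (u z') \<bullet> b) *\<^sub>R co c t (pr z') (K (pr z') (coinv c t (pr z') b)))
          = chart_co ?k z' (JZ z' (u z')))"
        by (rule ZA.A.near_mono[OF n]) (rule e[symmetric]; blast)
      then show "smooth_at Z (q y) (\<lambda>z. chart_co ?k z (JZ z (u z)))"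
      proof (rule ZA.A.smooth_at_cong)
        have "smooth_at Z (q y) (\<lambda>z'. chart_co ?k z' (u z') \<bullet> b)" for b
          by (rule ZA.A.smooth_at_bounded_linear[OF bounded_linear_inner_left conjunct2[OF u']])
        from ZA.A.smooth_at_scaleR[OF this sm]
        show "smooth_at Z (q y) (\<lambda>z'. \<Sum>b\<in>Basis. (chart_co ?k z' (u z') \<bullet> b) *\<^sub>R co c t (pr z') (K (pr z') (coinv c t (pr z') b)))"
          by (rule ZA.A.smooth_at_sum[OF mchart_carrier[OF p(6) z_k[OF y(1,2)]]])
      qed
    qed
  qed
qed

end

section \<open>Integrability\<close>

context semi_flat_torus
begin

text \<open>\<open>F\<^sup>-\<^sup>1(p\<^sup>*\<sigma>) + \<i> F\<^sup>-\<^sup>1(p\<^sup>*a)\<close> is a section of the \<open>+\<i>\<close>-eigenbundle when \<open>K a = \<sigma>\<close>.\<close>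

lemma eigen_pull_F:
  assumes J: "\<And>z u. z \<in> carrier Z \<Longrightarrow> u \<in> EZ z \<Longrightarrow> J z u = JZ z u"
    and U: "mopen A U"
    and e: "\<And>x. x \<in> U \<Longrightarrow> sec A (gen_bundle (base_sum P)) x e"
    and a: "\<And>x. x \<in> U \<Longrightarrow> sec A (gen_bundle (base_sum P)) x a"
    and Ka: "\<And>x. x \<in> U \<Longrightarrow> K x (a x) = e x"
  defines "U' \<equiv> {z \<in> carrier Z. pr z \<in> U}"
  shows "mopen Z U'" "(\<lambda>z. (pull_F e z, pull_F a z)) \<in> eigen_sections Z J U'"
proof -
  show U': "mopen Z U'"
  proof (rule ZA.A.mopen_near)
    fix z assume z: "z \<in> U'"
    then have zc: "z \<in> carrier Z" and pz: "pr z \<in> U" by (auto simp: U'_def)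
    show "near Z z (\<lambda>z. z \<in> U')"
      by (rule ZA.A.near_mono[OF smooth_map_atD(3)[OF smooth_map_at_pr_Z[OF zc] U pz]]) (simp add: U'_def)
  qed
  have G: "open_trivs Z (gen_bundle (tbundle Z))"
    by (rule smooth_bundle.trivs_open[OF smooth_bundle_gen[OF ZA.A.smooth_bundle_tbundle]])
  have m: "e x \<in> E x" "a x \<in> E x" if "x \<in> U" for x
    using near_point[of x "\<lambda>x. e x \<in> E x"] near_point[of x "\<lambda>x. a x \<in> E x"] e[OF that] a[OF that]
    by (auto simp: sec_def simp del: fibre_gen_bundle)
  have "(\<lambda>z. (pull_F e z, pull_F a z)) \<in> smooth_sections Z (bsum (gen_bundle (tbundle Z)) (gen_bundle (tbundle Z))) U'"
    unfolding ZA.A.smooth_sections_iff[OF U' ZA.A.open_trivs_bsum[OF G G]]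
  proof
    fix z assume "z \<in> U'"
    then have zc: "z \<in> carrier Z" and pz: "pr z \<in> U" by (auto simp: U'_def)
    show "sec Z (bsum (gen_bundle (tbundle Z)) (gen_bundle (tbundle Z))) z (\<lambda>z. (pull_F e z, pull_F a z))"
      unfolding ZA.A.sec_bsum[OF G G zc] using sec_pull_F[OF zc] e[OF pz] a[OF pz] by simp
  qed
  moreover have "J z (pull_F e z) = - pull_F a z \<and> J z (pull_F a z) = pull_F e z" if z: "z \<in> U'" for z
  proof -
    have zc: "z \<in> carrier Z" and pz: "pr z \<in> U" using z by (auto simp: U'_def)
    note le = pull_F[of z e, OF zc m(1)[OF pz]] and la = pull_F[of z a, OF zc m(2)[OF pz]]
    \<comment> \<open>One of the two eigenvector equations; the other one is this equation after
      another application of the structure, whose square is -1.\<close>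
    have j: "JZ z (pull_F a z) = pull_F e z"
      by (rule iso_F_inj[OF zc JZ(1)[OF zc la(1)] le(1)]) (simp add: JZ(2)[OF zc la(1)] la(2) le(2) Ka[OF pz])
    have "JZ z (JZ z (pull_F a z)) = - pull_F a z"
      using gacs_JZ zc la(1) unfolding gacs_def Let_def by blast
    then show ?thesis using J[OF zc le(1)] J[OF zc la(1)] j by simp
  qed
  ultimately show "(\<lambda>z. (pull_F e z, pull_F a z)) \<in> eigen_sections Z J U'"
    unfolding eigen_sections_def by simp
qed

text \<open>The common core for V and its dual. The bracket of the two lifted eigensections is again
  an eigensection, so its real part is the structure applied to its imaginary part; the former turns
  out to be the lift of the bracket on M, the latter to be vertical. The last two conclusions record
  that an imaginary part built from sections of V alone stays in V, and likewise for the
  dual.\<close>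

lemma courant_in_image:
  assumes J: "\<And>z u. z \<in> carrier Z \<Longrightarrow> u \<in> EZ z \<Longrightarrow> J z u = JZ z u"
    and int: "integrable_gacs Z J" and U: "mopen A U" and xU: "x \<in> U"
    and s: "\<And>x. x \<in> U \<Longrightarrow> sec A (gen_bundle (tbundle A)) x \<sigma>"
    and r: "\<And>x. x \<in> U \<Longrightarrow> sec A (gen_bundle (tbundle A)) x \<tau>"
    and a1: "\<And>x. x \<in> U \<Longrightarrow> sec A B x v1" "\<And>x. x \<in> U \<Longrightarrow> sec A (dual_bundle B) x f1"
    and a2: "\<And>x. x \<in> U \<Longrightarrow> sec A B x v2" "\<And>x. x \<in> U \<Longrightarrow> sec A (dual_bundle B) x f2"
    and K1: "\<And>x. x \<in> U \<Longrightarrow> K x (incl_V P x (v1 x, f1 x)) = incl_T P x (\<sigma> x)"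
    and K2: "\<And>x. x \<in> U \<Longrightarrow> K x (incl_V P x (v2 x, f2 x)) = incl_T P x (\<tau> x)"
    and zero: "(\<forall>x\<in>U. f1 x = 0 \<and> f2 x = 0) \<or> (\<forall>x\<in>U. v1 x = 0 \<and> v2 x = 0)"
  shows "\<exists>v f. v \<in> V x \<and> f \<in> dual_space (V x) \<and> K x (incl_V P x (v, f)) = incl_T P x (courant A \<sigma> \<tau> x) \<and>
    ((\<forall>x\<in>U. f1 x = 0 \<and> f2 x = 0) \<longrightarrow> f = 0) \<and> ((\<forall>x\<in>U. v1 x = 0 \<and> v2 x = 0) \<longrightarrow> v = 0)"
proof -
  have x: "x \<in> carrier A" by (rule mopen_subset_carrier[OF U xU])
  obtain c t where c: "c \<in> A" "x \<in> fst c" and t: "t \<in> btriv B" "x \<in> fst t"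
    using carrier_chart[OF x] triv_cover[OF x] by metis
  \<comment> \<open>One point of \<open>Z\<close> over \<open>x\<close> suffices, because the
    bracket of lifts is expressed by coefficients over M; the zero vector is at hand.\<close>
  have "(x, 0) \<in> fst (tchart B c t)" using c t V0[OF x] by (simp add: tchart_simps)
  then obtain W where W: "(x, 0) \<in> W" "pc P c t W" using q_local[OF c(1) t(1)] by blast
  define y where "y = (x, 0::'v)"
  have y: "y \<in> W" and pc: "pc P c t W" and fy: "fst y = x" using W by (simp_all add: y_def)
  note p = pcD[OF pc] and zk = z_k[OF pc y] and m = chart_mchart[OF c(1)]
  define k where "k = pch P c t W"
  have prz: "pr (q y) = x" using pr_q[OF pc y] fy by simp
  have zc: "q y \<in> carrier Z" by (rule mchart_carrier[OF p(6) zk])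
  let ?E = "gen_bundle (base_sum P)"
  define e1 where "e1 x = incl_T P x (\<sigma> x)" for x
  define e2 where "e2 x = incl_T P x (\<tau> x)" for x
  define b1 where "b1 x = incl_V P x (v1 x, f1 x)" for x
  define b2 where "b2 x = incl_V P x (v2 x, f2 x)" for x
  have car: "x \<in> carrier A" if "x \<in> U" for x by (rule mopen_subset_carrier[OF U that])
  have se: "sec A ?E x e1" "sec A ?E x e2" "sec A ?E x b1" "sec A ?E x b2" if "x \<in> U" for x
    unfolding e1_def e2_def b1_def b2_def
    by (rule sec_incl_T[OF car[OF that] s[OF that]], rule sec_incl_T[OF car[OF that] r[OF that]],
        rule sec_incl_V[OF car[OF that] a1(1)[OF that] a1(2)[OF that]],
        rule sec_incl_V[OF car[OF that] a2(1)[OF that] a2(2)[OF that]])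
  let ?U' = "{z \<in> carrier Z. pr z \<in> U}"
  have Kb: "K x (b1 x) = e1 x" "K x (b2 x) = e2 x" if "x \<in> U" for x
    using K1[OF that] K2[OF that] by (simp_all add: b1_def b2_def e1_def e2_def)
  note ei1 = eigen_pull_F[OF J U se(1,3) Kb(1)] and ei2 = eigen_pull_F[OF J U se(2,4) Kb(2)]
  let ?s1 = "\<lambda>z. (pull_F e1 z, pull_F b1 z)" and ?s2 = "\<lambda>z. (pull_F e2 z, pull_F b2 z)"
  have "courant_cx Z ?s1 ?s2 \<in> eigen_sections Z J ?U'"
    using int ei1 ei2 unfolding integrable_gacs_def by blast
  moreover have zU: "q y \<in> ?U'" using zc prz xU by simp
  ultimately have eig: "J (q y) (snd (courant_cx Z ?s1 ?s2 (q y))) = fst (courant_cx Z ?s1 ?s2 (q y))"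
    unfolding eigen_sections_def by fastforce
  define Re where "Re = courant Z (pull_F e1) (pull_F e2) (q y) - courant Z (pull_F b1) (pull_F b2) (q y)"
  define Im where "Im = courant Z (pull_F e1) (pull_F b2) (q y) + courant Z (pull_F b1) (pull_F e2) (q y)"
  have cx: "courant_cx Z ?s1 ?s2 (q y) = (Re, Im)"
    by (simp add: courant_cx_def Let_def Re_def Im_def)
  \<comment> \<open>Coefficients of the four lifts. Tangent and cotangent sections have zero fibre
    components, sections of V and its dual have zero base components; the vanishing of mixed terms
    below rests on these zeros.\<close>
  define X1 where "X1 x = (tco A c x (fst (\<sigma> x)), 0::'f)" for x
  define A1 where "A1 x = (cco A c x (snd (\<sigma> x)), 0::'f)" for x
  define X2 where "X2 x = (tco A c x (fst (\<tau> x)), 0::'f)" for x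
  define A2 where "A2 x = (cco A c x (snd (\<tau> x)), 0::'f)" for x
  define n1 where "n1 x = (0::'e, snd t x (v1 x))" for x
  define g1 where "g1 x = (0::'e, dual_triv B t x (f1 x))" for x
  define n2 where "n2 x = (0::'e, snd t x (v2 x))" for x
  define g2 where "g2 x = (0::'e, dual_triv B t x (f2 x))" for x
  have dt: "(fst t, dual_triv B t) \<in> btriv (dual_bundle B)" using t unfolding btriv_dual by auto
  have sg: "sec A (tbundle A) x (\<lambda>x. fst (\<sigma> x))" "sec A (dual_bundle (tbundle A)) x (\<lambda>x. snd (\<sigma> x))"
    "sec A (tbundle A) x (\<lambda>x. fst (\<tau> x))" "sec A (dual_bundle (tbundle A)) x (\<lambda>x. snd (\<tau> x))"
    using s[OF xU] r[OF xU] sec_gen[OF x] by blast+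
  have sm0: "smooth_at A x (\<lambda>x. tco A c x (fst (\<sigma> x)))" "smooth_at A x (\<lambda>x. cco A c x (snd (\<sigma> x)))"
    "smooth_at A x (\<lambda>x. tco A c x (fst (\<tau> x)))" "smooth_at A x (\<lambda>x. cco A c x (snd (\<tau> x)))"
    "smooth_at A x (\<lambda>x. snd t x (v1 x))" "smooth_at A x (\<lambda>x. snd t x (v2 x))"
    using sg[unfolded sec_tbundle[OF m c(2)] sec_dual_tbundle[OF m c(2)]] a1(1)[OF xU] a2(1)[OF xU] t
    by (auto simp: sec_def)
  have sm1: "smooth_at A x (\<lambda>x. dual_triv B t x (f1 x))" "smooth_at A x (\<lambda>x. dual_triv B t x (f2 x))"
    using a1(2)[OF xU] a2(2)[OF xU] dt t(2) unfolding sec_def by fastforce+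
  have sm: "smooth_at A x X1" "smooth_at A x A1" "smooth_at A x X2" "smooth_at A x A2" "smooth_at A x n1" "smooth_at A x g1" "smooth_at A x n2" "smooth_at A x g2"
    unfolding X1_def[abs_def] A1_def[abs_def] X2_def[abs_def] A2_def[abs_def]
      n1_def[abs_def] g1_def[abs_def] n2_def[abs_def] g2_def[abs_def]
    by (intro smooth_at_Pair smooth_at_const x sm0 sm1)+
  have nU: "near Z (q y) (\<lambda>z. z \<in> fst k \<and> pr z \<in> U)"
    unfolding k_def by (rule ZA.A.near_conj[OF near_k[OF pc y]])
      (use smooth_map_atD(3)[OF smooth_map_at_pr[OF pc y] U] prz xU in simp)
  have mem: "\<sigma> x \<in> TM x \<times> dual_space (TM x)" "\<tau> x \<in> TM x \<times> dual_space (TM x)"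
    "(v1 x, f1 x) \<in> V x \<times> dual_space (V x)" "(v2 x, f2 x) \<in> V x \<times> dual_space (V x)" if "x \<in> U" for x
    using s[OF that] r[OF that] a1(1)[OF that] a1(2)[OF that] a2(1)[OF that] a2(2)[OF that]
      near_point[of x "\<lambda>x. \<sigma> x \<in> TM x \<times> dual_space (TM x)"] near_point[of x "\<lambda>x. \<tau> x \<in> TM x \<times> dual_space (TM x)"]
      near_point[of x "\<lambda>x. v1 x \<in> V x"] near_point[of x "\<lambda>x. v2 x \<in> V x"]
      near_point[of x "\<lambda>x. f1 x \<in> dual_space (V x)"] near_point[of x "\<lambda>x. f2 x \<in> dual_space (V x)"]
    by (simp_all add: sec_def)
  have zl: "chart_co k z (pull_F e1 z) = (X1 (pr z), A1 (pr z))" "chart_co k z (pull_F e2 z) = (X2 (pr z), A2 (pr z))"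
    "chart_co k z (pull_F b1 z) = (n1 (pr z), g1 (pr z))" "chart_co k z (pull_F b2 z) = (n2 (pr z), g2 (pr z))"
    if z: "z \<in> fst k" "pr z \<in> U" for z
  proof -
    note zz = z(1)[unfolded k_def]
    note mm = mem[OF z(2)] and cc = car[OF z(2)] and pc' = pr_chart(1,2)[OF pc y zz]
    note ci = co_incl[OF cc t(1) pc'(2) c(1) pc'(1)]
    show "chart_co k z (pull_F e1 z) = (X1 (pr z), A1 (pr z))"
      unfolding k_def using chart_co_pull_F[OF pc zz, of e1] incl_in(2)[OF cc mm(1)] ci(2)[OF mm(1)]
      by (simp add: e1_def X1_def A1_def del: fibre_gen_bundle)
    show "chart_co k z (pull_F e2 z) = (X2 (pr z), A2 (pr z))"
      unfolding k_def using chart_co_pull_F[OF pc zz, of e2] incl_in(2)[OF cc mm(2)] ci(2)[OF mm(2)]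
      by (simp add: e2_def X2_def A2_def del: fibre_gen_bundle)
    show "chart_co k z (pull_F b1 z) = (n1 (pr z), g1 (pr z))"
      unfolding k_def using chart_co_pull_F[OF pc zz, of b1] incl_in(1)[OF cc mm(3)] ci(1)[OF mm(3)]
      by (simp add: b1_def n1_def g1_def del: fibre_gen_bundle)
    show "chart_co k z (pull_F b2 z) = (n2 (pr z), g2 (pr z))"
      unfolding k_def using chart_co_pull_F[OF pc zz, of b2] incl_in(1)[OF cc mm(4)] ci(1)[OF mm(4)]
      by (simp add: b2_def n2_def g2_def del: fibre_gen_bundle)
  qed
  have zn: "near Z (q y) (\<lambda>z. chart_co k z (pull_F e1 z) = (X1 (pr z), A1 (pr z)))"
    "near Z (q y) (\<lambda>z. chart_co k z (pull_F e2 z) = (X2 (pr z), A2 (pr z)))"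
    "near Z (q y) (\<lambda>z. chart_co k z (pull_F b1 z) = (n1 (pr z), g1 (pr z)))"
    "near Z (q y) (\<lambda>z. chart_co k z (pull_F b2 z) = (n2 (pr z), g2 (pr z)))"
    by (rule ZA.A.near_mono[OF nU], use zl in blast)+
  have sl: "sec Z (gen_bundle (tbundle Z)) (q y) (pull_F e1)" "sec Z (gen_bundle (tbundle Z)) (q y) (pull_F e2)"
    "sec Z (gen_bundle (tbundle Z)) (q y) (pull_F b1)" "sec Z (gen_bundle (tbundle Z)) (q y) (pull_F b2)"
    using sec_pull_F[OF zc] se[OF xU] prz by simp_all
  note cb = courant_pullback[OF pc y, unfolded fy, folded k_def]
  note c11 = cb[OF sl(1) zn(1) sl(2) zn(2) sm(1-4)]
  note c22 = cb[OF sl(3) zn(3) sl(4) zn(4) sm(5-8)]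
  note c12 = cb[OF sl(1) zn(1) sl(4) zn(4) sm(1,2,7,8)]
  note c21 = cb[OF sl(3) zn(3) sl(2) zn(2) sm(5,6,3,4)]
  define d where "d f a = chart_deriv c f x a" for f :: "'m \<Rightarrow> 'f" and a
  define dd where "dd f a = chart_deriv c f x a" for f :: "'m \<Rightarrow> 'e" and a
  have D: "chart_deriv c X1 x a = (dd (\<lambda>x. tco A c x (fst (\<sigma> x))) a, 0)"
    "chart_deriv c A1 x a = (dd (\<lambda>x. cco A c x (snd (\<sigma> x))) a, 0)"
    "chart_deriv c X2 x a = (dd (\<lambda>x. tco A c x (fst (\<tau> x))) a, 0)"
    "chart_deriv c A2 x a = (dd (\<lambda>x. cco A c x (snd (\<tau> x))) a, 0)"
    "chart_deriv c n1 x a = (0, d (\<lambda>x. snd t x (v1 x)) a)"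
    "chart_deriv c g1 x a = (0, d (\<lambda>x. dual_triv B t x (f1 x)) a)"
    "chart_deriv c n2 x a = (0, d (\<lambda>x. snd t x (v2 x)) a)"
    "chart_deriv c g2 x a = (0, d (\<lambda>x. dual_triv B t x (f2 x)) a)" for a
    unfolding X1_def[abs_def] A1_def[abs_def] X2_def[abs_def] A2_def[abs_def] d_def dd_def
      n1_def[abs_def] g1_def[abs_def] n2_def[abs_def] g2_def[abs_def]
    by (simp_all add: chart_deriv_Pair[OF m c(2)] smooth_at_const[OF x] sm0 sm1 chart_deriv_const)
  have d0: "d f 0 = 0" if "smooth_at A x f" for f
    unfolding d_def by (rule linear_0[OF chart_deriv_linear[OF m c(2) that]])
  have dd0: "dd f 0 = 0" if "smooth_at A x f" for f
    unfolding dd_def by (rule linear_0[OF chart_deriv_linear[OF m c(2) that]])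
  have tz: "snd t x 0 = 0" if "x \<in> fst t" for x
    using linear_on_setD(2)[OF triv_linear[OF t(1) that] subspace_0[OF fibre_subspace[OF t(1) that]], of 0] by simp
  have nt: "near A x (\<lambda>x. x \<in> U \<and> x \<in> fst t)"
    by (rule near_conj[OF nearI[OF U xU] near_triv[OF t]])
  have gz: "g1 x = 0" "g2 x = 0" "d (\<lambda>x. dual_triv B t x (f1 x)) a = 0" "d (\<lambda>x. dual_triv B t x (f2 x)) a = 0"
    if z: "\<forall>x\<in>U. f1 x = 0 \<and> f2 x = 0" for a
  proof -
    note l0 = linear_0[OF linear_dual_triv, of t]
    show "g1 x = 0" "g2 x = 0" using z xU l0 by (simp_all add: g1_def g2_def zero_prod_def)
    have "near A x (\<lambda>x. dual_triv B t x (f1 x) = 0)" "near A x (\<lambda>x. dual_triv B t x (f2 x) = 0)"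
      by (rule near_mono[OF nt], use z l0 in simp)+
    from this[THEN chart_deriv_cong[OF m c(2)]]
    show "d (\<lambda>x. dual_triv B t x (f1 x)) a = 0" "d (\<lambda>x. dual_triv B t x (f2 x)) a = 0"
      by (simp_all add: d_def chart_deriv_const)
  qed
  have nz: "n1 x = 0" "n2 x = 0" "d (\<lambda>x. snd t x (v1 x)) a = 0" "d (\<lambda>x. snd t x (v2 x)) a = 0"
    if z: "\<forall>x\<in>U. v1 x = 0 \<and> v2 x = 0" for a
  proof -
    show "n1 x = 0" "n2 x = 0" using z xU tz[OF t(2)] by (simp_all add: n1_def n2_def zero_prod_def)
    have "near A x (\<lambda>x. snd t x (v1 x) = 0)" "near A x (\<lambda>x. snd t x (v2 x) = 0)"
      by (rule near_mono[OF nt], use z tz in simp)+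
    from this[THEN chart_deriv_cong[OF m c(2)]]
    show "d (\<lambda>x. snd t x (v1 x)) a = 0" "d (\<lambda>x. snd t x (v2 x)) a = 0"
      by (simp_all add: d_def chart_deriv_const)
  qed
  let ?z = "chart_co k (q y)"
  have pair0: "fst (n1 x) = 0" "fst (n2 x) = 0" "fst (g1 x) = 0" "fst (g2 x) = 0"
    "snd (X1 x) = 0" "snd (A1 x) = 0" "snd (X2 x) = 0" "snd (A2 x) = 0"
    by (simp_all add: n1_def n2_def g1_def g2_def X1_def A1_def X2_def A2_def)
  note Cb = courant_coordinates[OF m c(2) s[OF xU] r[OF xU]]
  have CT: "courant A \<sigma> \<tau> x \<in> TM x \<times> dual_space (TM x)" using Cb(1,2) by (simp add: mem_Times_iff)
  \<comment> \<open>The fibre components vanish identically, so the formula on \<open>Z\<close> is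
    term by term the formula on M in the chart \<open>c\<close>.\<close>
  have z11: "?z (courant Z (pull_F e1) (pull_F e2) (q y)) = co c t x (incl_T P x (courant A \<sigma> \<tau> x))"
  proof -
    have "fst (?z (courant Z (pull_F e1) (pull_F e2) (q y))) = (tco A c x (fst (courant A \<sigma> \<tau> x)), 0)"
      unfolding c11(1) D Cb(3) bracket_co_def by (simp add: X1_def X2_def dd_def)
    moreover have "snd (?z (courant Z (pull_F e1) (pull_F e2) (q y))) = (cco A c x (snd (courant A \<sigma> \<tau> x)), 0)"
    proof (rule euclidean_eqI)
      fix b :: "'e \<times> 'f"
      have "(cco A c x (snd (courant A \<sigma> \<tau> x)), 0::'f) \<bullet> b = courant_co c \<sigma> \<tau> x (fst b)"
        using Cb(4)[of "fst b"] by (simp add: inner_prod_def)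
      then show "snd (?z (courant Z (pull_F e1) (pull_F e2) (q y))) \<bullet> b = (cco A c x (snd (courant A \<sigma> \<tau> x)), 0) \<bullet> b"
        unfolding c11(2) D courant_co_def Let_def
        by (simp add: X1_def X2_def A1_def A2_def dd_def inner_prod_def)
    qed
    ultimately show ?thesis unfolding co_incl(2)[OF x t c CT] by (simp add: prod_eq_iff)
  qed
  \<comment> \<open>The vector part vanishes since there is no base direction to differentiate
    along. The covector part consists of products of a dual section with a derivative of a section
    of V, or the reverse; by \<open>zero\<close> one factor of each is 0.\<close>
  have z22: "?z (courant Z (pull_F b1) (pull_F b2) (q y)) = 0"
  proof -
    have "fst (?z (courant Z (pull_F b1) (pull_F b2) (q y))) = 0"
      unfolding c22(1) D pair0 by (simp add: d0 sm0 sm1 zero_prod_def)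
    moreover have "snd (?z (courant Z (pull_F b1) (pull_F b2) (q y))) = 0"
    proof (rule euclidean_eqI)
      fix b :: "'e \<times> 'f"
      show "snd (?z (courant Z (pull_F b1) (pull_F b2) (q y))) \<bullet> b = 0 \<bullet> b"
        unfolding c22(2) D pair0 using zero
      proof
        assume z: "\<forall>x\<in>U. f1 x = 0 \<and> f2 x = 0"
        show "(0, d (\<lambda>x. dual_triv B t x (f2 x)) 0) \<bullet> b + g2 x \<bullet> (0, d (\<lambda>x. snd t x (v1 x)) (fst b)) -
          ((0, d (\<lambda>x. dual_triv B t x (f1 x)) 0) \<bullet> b + g1 x \<bullet> (0, d (\<lambda>x. snd t x (v2 x)) (fst b))) +
          1 / 2 * (g1 x \<bullet> (0, d (\<lambda>x. snd t x (v2 x)) (fst b)) + (0, d (\<lambda>x. dual_triv B t x (f1 x)) (fst b)) \<bullet> n2 x -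
           (g2 x \<bullet> (0, d (\<lambda>x. snd t x (v1 x)) (fst b)) + (0, d (\<lambda>x. dual_triv B t x (f2 x)) (fst b)) \<bullet> n1 x)) = 0 \<bullet> b"
          using gz[OF z] by (simp add: inner_prod_def)
      next
        assume z: "\<forall>x\<in>U. v1 x = 0 \<and> v2 x = 0"
        show "(0, d (\<lambda>x. dual_triv B t x (f2 x)) 0) \<bullet> b + g2 x \<bullet> (0, d (\<lambda>x. snd t x (v1 x)) (fst b)) -
          ((0, d (\<lambda>x. dual_triv B t x (f1 x)) 0) \<bullet> b + g1 x \<bullet> (0, d (\<lambda>x. snd t x (v2 x)) (fst b))) +
          1 / 2 * (g1 x \<bullet> (0, d (\<lambda>x. snd t x (v2 x)) (fst b)) + (0, d (\<lambda>x. dual_triv B t x (f1 x)) (fst b)) \<bullet> n2 x -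
           (g2 x \<bullet> (0, d (\<lambda>x. snd t x (v1 x)) (fst b)) + (0, d (\<lambda>x. dual_triv B t x (f2 x)) (fst b)) \<bullet> n1 x)) = 0 \<bullet> b"
          using nz[OF z] d0 sm1 by (simp add: inner_prod_def)
      qed
    qed
    ultimately show ?thesis by (simp add: prod_eq_iff)
  qed
  \<comment> \<open>The fibre coordinates of the imaginary part: the vertical coefficients
    differentiated along the base directions of the tangent lifts, with the opposite sign for the
    second bracket. No base component survives.\<close>
  define n where "n = d (\<lambda>x. snd t x (v2 x)) (fst (X1 x)) - d (\<lambda>x. snd t x (v1 x)) (fst (X2 x))"
  define g where "g = d (\<lambda>x. dual_triv B t x (f2 x)) (fst (X1 x)) - d (\<lambda>x. dual_triv B t x (f1 x)) (fst (X2 x))"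
  have z12: "?z (courant Z (pull_F e1) (pull_F b2) (q y)) = ((0, d (\<lambda>x. snd t x (v2 x)) (fst (X1 x))),
      (0, d (\<lambda>x. dual_triv B t x (f2 x)) (fst (X1 x))))"
  proof -
    have "fst (?z (courant Z (pull_F e1) (pull_F b2) (q y))) = (0, d (\<lambda>x. snd t x (v2 x)) (fst (X1 x)))"
      unfolding c12(1) D pair0 by (simp add: dd0 sm0)
    moreover have "snd (?z (courant Z (pull_F e1) (pull_F b2) (q y))) = (0, d (\<lambda>x. dual_triv B t x (f2 x)) (fst (X1 x)))"
      by (rule euclidean_eqI) (unfold c12(2) D pair0, simp add: inner_prod_def dd0 sm0 pair0)
    ultimately show ?thesis by (simp add: prod_eq_iff)
  qed
  have z21: "?z (courant Z (pull_F b1) (pull_F e2) (q y)) = ((0, - d (\<lambda>x. snd t x (v1 x)) (fst (X2 x))),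
      (0, - d (\<lambda>x. dual_triv B t x (f1 x)) (fst (X2 x))))"
  proof -
    have "fst (?z (courant Z (pull_F b1) (pull_F e2) (q y))) = (0, - d (\<lambda>x. snd t x (v1 x)) (fst (X2 x)))"
      unfolding c21(1) D pair0 by (simp add: dd0 sm0)
    moreover have "snd (?z (courant Z (pull_F b1) (pull_F e2) (q y))) = (0, - d (\<lambda>x. dual_triv B t x (f1 x)) (fst (X2 x)))"
      by (rule euclidean_eqI) (unfold c21(2) D pair0, simp add: inner_prod_def dd0 sm0 pair0)
    ultimately show ?thesis by (simp add: prod_eq_iff)
  qed
  note lz = linear_chart_co[OF pc y, folded k_def]
  have sub: "subspace (EZ (q y))"
    by (rule smooth_bundle.subspace_fibre[OF smooth_bundle_gen[OF ZA.A.smooth_bundle_tbundle] zc])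
  have ReE: "Re \<in> EZ (q y)" and ImE: "Im \<in> EZ (q y)"
    unfolding Re_def Im_def using c11(3) c22(3) c12(3) c21(3)
    by (blast intro: subspace_diff[OF sub] subspace_add[OF sub])+
  define v where "v = vinv t x n"
  define f where "f = dinv t x g"
  have vf: "v \<in> V x" "f \<in> dual_space (V x)" unfolding v_def f_def by (rule vinv_in[OF t], rule dinv_in[OF t])
  have vf': "(v, f) \<in> V x \<times> dual_space (V x)" using vf by simp
  have "?z Re = co c t x (incl_T P x (courant A \<sigma> \<tau> x))"
    unfolding Re_def linear_diff[OF lz] z11 z22 by simp
  then have iR: "iso_F P (q y) Re = incl_T P x (courant A \<sigma> \<tau> x)"
    using iso_F_chart_co[OF pc y ReE, folded k_def] coinv_co[OF c(1) t(1) c(2) t(2) incl_in(2)[OF x CT]] fy by simp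
  have "?z Im = ((0, n), (0, g))"
    unfolding Im_def linear_add[OF lz] z12 z21 n_def g_def by simp
  also have "\<dots> = co c t x (incl_V P x (v, f))"
    unfolding co_incl(1)[OF x t c vf'] by (simp add: v_def f_def triv_vinv[OF t] dual_triv_dinv[OF t])
  finally have iI: "iso_F P (q y) Im = incl_V P x (v, f)"
    using iso_F_chart_co[OF pc y ImE, folded k_def] coinv_co[OF c(1) t(1) c(2) t(2) incl_in(1)[OF x vf']] fy by simp
  \<comment> \<open>The second eigenvector equation for the bracket; translated by F it says that K
    maps v + f to the bracket on M.\<close>
  have "JZ (q y) Im = Re" using eig J[OF zc ImE] by (simp add: cx)
  then have "K x (incl_V P x (v, f)) = incl_T P x (courant A \<sigma> \<tau> x)"
    using JZ(2)[OF zc ImE] iR iI prz by simp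
  moreover have "f = 0" if z: "\<forall>x\<in>U. f1 x = 0 \<and> f2 x = 0"
    unfolding f_def g_def gz(3,4)[OF z] by (simp add: dinv_def restr_def fun_eq_iff)
  moreover have "v = 0" if z: "\<forall>x\<in>U. v1 x = 0 \<and> v2 x = 0"
    unfolding v_def n_def nz(3,4)[OF z] by (simp add: linear_0[OF linear_vinv[OF t]])
  ultimately show ?thesis using vf by blast
qed

text \<open>Smoothness of the inverse of \<open>to_Delta\<close> is available here for V. For the
  dual bundle it is obtained by way of the mirror, which is not part of this locale, so the second
  claim takes it as a premise.\<close>

lemma integrable_dirac_Deltas:
  assumes J: "\<And>z u. z \<in> carrier Z \<Longrightarrow> u \<in> EZ z \<Longrightarrow> J z u = JZ z u"
    and int: "integrable_gacs Z J"
  shows "integrable_dirac A (Delta P K)"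
    and "(\<And>x \<sigma>. sec A (gen_bundle (tbundle A)) x \<sigma> \<Longrightarrow> near A x (\<lambda>y. \<sigma> y \<in> Delta_hat P K y) \<Longrightarrow>
      sec A (dual_bundle B) x (\<lambda>y. inv_into (dual_space (V y)) (to_Delta_hat P K y) (\<sigma> y))) \<Longrightarrow>
      integrable_dirac A (Delta_hat P K)"
proof -
  have ot: "open_trivs A (gen_bundle (tbundle A))"
    by (rule smooth_bundle.trivs_open[OF smooth_bundle_gen[OF tangent_bundle]])
  have ss: "\<sigma> \<in> sub_sections A (gen_bundle (tbundle A)) \<Delta> U \<longleftrightarrow>
      (\<forall>x\<in>U. sec A (gen_bundle (tbundle A)) x \<sigma> \<and> \<sigma> x \<in> \<Delta> x)" if "mopen A U" for \<sigma> U \<Delta>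
    unfolding sub_sections_def using smooth_sections_iff[OF that ot] by blast
  show "integrable_dirac A (Delta P K)"
    unfolding integrable_dirac_def
  proof (intro allI impI ballI)
    fix U \<sigma> \<tau> assume U: "mopen A U"
      and s: "\<sigma> \<in> sub_sections A (gen_bundle (tbundle A)) (Delta P K) U"
      and r: "\<tau> \<in> sub_sections A (gen_bundle (tbundle A)) (Delta P K) U"
    have car: "x \<in> carrier A" if "x \<in> U" for x by (rule mopen_subset_carrier[OF U that])
    have n: "near A x (\<lambda>x. \<rho> x \<in> Delta P K x)" if "x \<in> U" "\<rho> \<in> sub_sections A (gen_bundle (tbundle A)) (Delta P K) U" for x \<rho>
      by (rule nearI[OF U that(1)]) (use that(2) ss[OF U] in blast)
    let ?h = "\<lambda>\<rho> y. inv_into (V y) (to_Delta P K y) (\<rho> y)"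
    have h: "sec A B x (?h \<rho>)" "K x (incl_V P x (?h \<rho> x, 0)) = incl_T P x (\<rho> x)"
      if x: "x \<in> U" and m: "\<rho> \<in> sub_sections A (gen_bundle (tbundle A)) (Delta P K) U" for x \<rho>
    proof -
      show "sec A B x (?h \<rho>)" by (rule sec_from_Delta[OF _ n[OF x m]]) (use m ss[OF U] x in blast)
      have "\<rho> x \<in> to_Delta P K x ` V x" using m x ss[OF U] Delta_image(1)[OF car[OF x]] by blast
      then have "?h \<rho> x \<in> V x" "to_Delta P K x (?h \<rho> x) = \<rho> x"
        by (rule inv_into_into, rule f_inv_into_f)
      then show "K x (incl_V P x (?h \<rho> x, 0)) = incl_T P x (\<rho> x)"
        using incl_to_Delta(1)[OF car[OF x]] by metis
    qed
    have z: "sec A (dual_bundle B) x (\<lambda>x. 0)" if "x \<in> U" for x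
      by (rule smooth_bundle.sec_zero[OF smooth_bundle_dual car[OF that]])
    show "courant A \<sigma> \<tau> \<in> sub_sections A (gen_bundle (tbundle A)) (Delta P K) U"
      unfolding ss[OF U]
    proof (intro ballI conjI)
      fix x assume x: "x \<in> U"
      have sx: "sec A (gen_bundle (tbundle A)) x \<sigma>" "sec A (gen_bundle (tbundle A)) x \<tau>" if "x \<in> U" for x
        using s r ss[OF U] that by blast+
      show C: "sec A (gen_bundle (tbundle A)) x (courant A \<sigma> \<tau>)" by (rule sec_courant[OF car[OF x] sx[OF x]])
      obtain v f where vf: "v \<in> V x" "K x (incl_V P x (v, f)) = incl_T P x (courant A \<sigma> \<tau> x)" "f = 0"
        using courant_in_image[OF J int U x sx(1) sx(2) h(1)[OF _ s] z h(1)[OF _ r] z h(2)[OF _ s] h(2)[OF _ r]] by auto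
      have "courant A \<sigma> \<tau> x \<in> fibre (gen_bundle (tbundle A)) x"
        using C near_point[of x "\<lambda>y. courant A \<sigma> \<tau> y \<in> fibre (gen_bundle (tbundle A)) y"] by (simp add: sec_def)
      moreover have "incl_T P x (courant A \<sigma> \<tau> x) = K x (incl_V P x (v, 0))" using vf(2,3) by simp
      ultimately show "courant A \<sigma> \<tau> x \<in> Delta P K x" unfolding Delta_def using vf(1) by blast
    qed
  qed
  assume sfd: "\<And>x \<sigma>. sec A (gen_bundle (tbundle A)) x \<sigma> \<Longrightarrow> near A x (\<lambda>y. \<sigma> y \<in> Delta_hat P K y) \<Longrightarrow>
      sec A (dual_bundle B) x (\<lambda>y. inv_into (dual_space (V y)) (to_Delta_hat P K y) (\<sigma> y))"
  show "integrable_dirac A (Delta_hat P K)"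
    unfolding integrable_dirac_def
  proof (intro allI impI ballI)
    fix U \<sigma> \<tau> assume U: "mopen A U"
      and s: "\<sigma> \<in> sub_sections A (gen_bundle (tbundle A)) (Delta_hat P K) U"
      and r: "\<tau> \<in> sub_sections A (gen_bundle (tbundle A)) (Delta_hat P K) U"
    have car: "x \<in> carrier A" if "x \<in> U" for x by (rule mopen_subset_carrier[OF U that])
    have n: "near A x (\<lambda>x. \<rho> x \<in> Delta_hat P K x)" if "x \<in> U" "\<rho> \<in> sub_sections A (gen_bundle (tbundle A)) (Delta_hat P K) U" for x \<rho>
      by (rule nearI[OF U that(1)]) (use that(2) ss[OF U] in blast)
    let ?h = "\<lambda>\<rho> y. inv_into (dual_space (V y)) (to_Delta_hat P K y) (\<rho> y)"
    have h: "sec A (dual_bundle B) x (?h \<rho>)" "K x (incl_V P x (0, ?h \<rho> x)) = incl_T P x (\<rho> x)"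
      if x: "x \<in> U" and m: "\<rho> \<in> sub_sections A (gen_bundle (tbundle A)) (Delta_hat P K) U" for x \<rho>
    proof -
      show "sec A (dual_bundle B) x (?h \<rho>)" by (rule sfd[OF _ n[OF x m]]) (use m ss[OF U] x in blast)
      have "\<rho> x \<in> to_Delta_hat P K x ` dual_space (V x)" using m x ss[OF U] Delta_image(2)[OF car[OF x]] by blast
      then have "?h \<rho> x \<in> dual_space (V x)" "to_Delta_hat P K x (?h \<rho> x) = \<rho> x"
        by (rule inv_into_into, rule f_inv_into_f)
      then show "K x (incl_V P x (0, ?h \<rho> x)) = incl_T P x (\<rho> x)"
        using incl_to_Delta(3)[OF car[OF x]] by metis
    qed
    have z: "sec A B x (\<lambda>x. 0)" if "x \<in> U" for x
      by (rule sec_zero[OF car[OF that]])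
    show "courant A \<sigma> \<tau> \<in> sub_sections A (gen_bundle (tbundle A)) (Delta_hat P K) U"
      unfolding ss[OF U]
    proof (intro ballI conjI)
      fix x assume x: "x \<in> U"
      have sx: "sec A (gen_bundle (tbundle A)) x \<sigma>" "sec A (gen_bundle (tbundle A)) x \<tau>" if "x \<in> U" for x
        using s r ss[OF U] that by blast+
      show C: "sec A (gen_bundle (tbundle A)) x (courant A \<sigma> \<tau>)" by (rule sec_courant[OF car[OF x] sx[OF x]])
      obtain v f where vf: "f \<in> dual_space (V x)" "K x (incl_V P x (v, f)) = incl_T P x (courant A \<sigma> \<tau> x)" "v = 0"
        using courant_in_image[OF J int U x sx(1) sx(2) z h(1)[OF _ s] z h(1)[OF _ r] h(2)[OF _ s] h(2)[OF _ r]] by auto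
      have "courant A \<sigma> \<tau> x \<in> fibre (gen_bundle (tbundle A)) x"
        using C near_point[of x "\<lambda>y. courant A \<sigma> \<tau> y \<in> fibre (gen_bundle (tbundle A)) y"] by (simp add: sec_def)
      moreover have "incl_T P x (courant A \<sigma> \<tau> x) = K x (incl_V P x (0, f))" using vf(2,3) by simp
      ultimately show "courant A \<sigma> \<tau> x \<in> Delta_hat P K x" unfolding Delta_hat_def using vf(1) by simp
    qed
  qed
qed

end

section \<open>Quotients by lattice bundles\<close>

lemma quotient_atlas_iff: "k \<in> quotient_atlas A q \<longleftrightarrow>
    (\<exists>c W. k = (q ` W, snd c \<circ> inv_into W q) \<and> c \<in> A \<and> W \<subseteq> fst c \<and> mopen A W \<and> inj_on q W)"
  unfolding quotient_atlas_def mem_Collect_eq by blast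

text \<open>A transition between two sheets is locally a deck transformation read in charts of
  \<open>X\<close>. The hypothesis provides one as a smooth germ for every pair of points with the
  same image.\<close>

lemma satlas_quotient:
  assumes X: "satlas X"
    and deck: "\<And>w w'. w \<in> carrier X \<Longrightarrow> w' \<in> carrier X \<Longrightarrow> Q w = Q w' \<Longrightarrow>
      \<exists>s. smooth_map_at X X w s \<and> s w = w' \<and> near X w (\<lambda>y. Q (s y) = Q y)"
  shows "satlas (quotient_atlas X Q)"
proof
  interpret XX: satlas2 X X using X by (simp add: satlas2_def)
  have val: "(snd c \<circ> inv_into W Q) (Q w) = snd c w" if "inj_on Q W" "w \<in> W" for c :: "('a, 'b) chart" and W w
    using inv_into_f_f[OF that] by simp
  fix k assume "k \<in> quotient_atlas X Q"
  then obtain c W where k: "k = (Q ` W, snd c \<circ> inv_into W Q)" "c \<in> X" "W \<subseteq> fst c" "mopen X W" "inj_on Q W"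
    unfolding quotient_atlas_iff by blast
  note inj = inj_onD[OF XX.A.chart_inj[OF k(2)]]
  show ik: "inj_on (snd k) (fst k)"
  proof (rule inj_onI)
    fix z z' assume "z \<in> fst k" "z' \<in> fst k" and e: "snd k z = snd k z'"
    then obtain w w' where w: "w \<in> W" "z = Q w" "w' \<in> W" "z' = Q w'" using k(1) by auto
    have "snd c w = snd c w'" using e val[OF k(5)] w k(1) by simp
    then have "w = w'" using inj w k(3) by blast
    then show "z = z'" using w by simp
  qed
  have "snd k ` fst k = snd c ` (W \<inter> fst c)"
    using k(1,3) val[OF k(5)] by (auto simp: image_image Int_absorb2)
  then show "open (snd k ` fst k)" using mopen_chart[OF k(4,2)] by simp
  fix k' assume "k' \<in> quotient_atlas X Q"
  then obtain c' W' where k': "k' = (Q ` W', snd c' \<circ> inv_into W' Q)" "c' \<in> X" "W' \<subseteq> fst c'" "mopen X W'" "inj_on Q W'"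
    unfolding quotient_atlas_iff by blast
  \<comment> \<open>\<open>N\<close> is the overlap of the two charts as seen in the sheet
    \<open>W\<close>, and \<open>F\<close> the second coordinate map on it. Near each point of
    \<open>N\<close>, \<open>F\<close> is a deck germ followed by the chart
    \<open>c'\<close>.\<close>
  define N where "N = {w \<in> W. Q w \<in> Q ` W'}"
  define F where "F w = snd c' (inv_into W' Q (Q w))" for w
  have *: "near X w (\<lambda>y. y \<in> N) \<and> smooth_at X w F" if w: "w \<in> N" for w
  proof -
    obtain w' where w': "w' \<in> W'" "Q w = Q w'" using w by (auto simp: N_def)
    have car: "w \<in> carrier X" "w' \<in> carrier X"
      using w w' XX.A.mopen_subset_carrier[OF k(4)] XX.A.mopen_subset_carrier[OF k'(4)] by (auto simp: N_def)
    obtain s where s: "smooth_map_at X X w s" "s w = w'" "near X w (\<lambda>y. Q (s y) = Q y)"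
      using deck[OF car w'(2)] by blast
    have n: "near X w (\<lambda>y. (y \<in> W \<and> s y \<in> W') \<and> Q (s y) = Q y)"
    proof (intro XX.A.near_conj)
      show "near X w (\<lambda>y. y \<in> W)" by (rule XX.A.nearI[OF k(4)]) (use w in \<open>auto simp: N_def\<close>)
      show "near X w (\<lambda>y. s y \<in> W')" by (rule smooth_map_atD(3)[OF s(1) k'(4)]) (use s(2) w'(1) in simp)
    qed (rule s(3))
    have "near X w (\<lambda>y. y \<in> N)"
      by (rule XX.A.near_mono[OF n]) (auto simp: N_def intro: image_eqI[OF sym])
    moreover have "smooth_at X w F"
    proof (rule XX.A.smooth_at_cong[OF XX.A.near_mono[OF n]])
      show "smooth_at X w (\<lambda>y. snd c' (s y))"
        by (rule XX.smooth_map_at_mchart[OF s(1) XX.A.chart_mchart[OF k'(2)]]) (use s(2) w'(1) k'(3) in blast)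
      fix y assume "(y \<in> W \<and> s y \<in> W') \<and> Q (s y) = Q y"
      then show "snd c' (s y) = F y" using inv_into_f_f[OF k'(5), of "s y"] by (simp add: F_def)
    qed
    ultimately show ?thesis by blast
  qed
  have N: "mopen X N" by (rule XX.A.mopen_near) (use * in blast)
  have Nc: "N \<inter> fst c = N" using k(3) by (auto simp: N_def)
  have kk: "fst k \<inter> fst k' = Q ` N" using k(1) k'(1) by (auto simp: N_def)
  have im: "snd k ` (fst k \<inter> fst k') = snd c ` (N \<inter> fst c)"
    unfolding kk Nc image_image using val[OF k(5)] k(1) by (intro image_cong) (auto simp: N_def)
  show o: "open (snd k ` (fst k \<inter> fst k'))" unfolding im by (rule mopen_chart[OF N k(2)])
  have "smooth_fun X N F" using XX.A.smooth_fun_iff[OF N] * by blast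
  then have "smooth_on (snd c ` (N \<inter> fst c)) (F \<circ> chart_inv c)" using k(2) by (simp add: smooth_fun_def)
  then show "smooth_on (snd k ` (fst k \<inter> fst k')) (snd k' \<circ> chart_inv k)"
  proof (subst smooth_on_cong[OF o, of _ "F \<circ> chart_inv c"])
    fix p assume "p \<in> snd k ` (fst k \<inter> fst k')"
    then obtain w where w: "w \<in> N" "p = snd c w" unfolding im by blast
    then have wW: "w \<in> W" "w \<in> fst c" using k(3) by (auto simp: N_def)
    have "snd k (Q w) = p" using val[OF k(5) wW(1)] k(1) w(2) by simp
    then have "chart_inv k p = Q w" using chart_inv_left[OF ik, of "Q w"] wW k(1) by auto
    then show "(snd k' \<circ> chart_inv k) p = (F \<circ> chart_inv c) p"
      using k'(1) chart_inv_left[OF XX.A.chart_inj[OF k(2)] wW(2)] w(2) by (simp add: F_def)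
  qed (simp add: im)
qed

section \<open>Integral lattices and their quotients\<close>

lemma small_integral_zero:
  fixes a :: "'f::euclidean_space"
  assumes "\<And>b. b \<in> Basis \<Longrightarrow> a \<bullet> b \<in> \<int>" "norm a < 1"
  shows "a = 0"
proof (rule euclidean_eqI)
  fix b :: 'f assume b: "b \<in> Basis"
  have "\<bar>a \<bullet> b\<bar> < 1" using Basis_le_norm[OF b, of a] assms(2) by linarith
  then show "a \<bullet> b = 0 \<bullet> b" using Ints_nonzero_abs_less1[OF assms(1)[OF b]] by simp
qed

text \<open>Origin of the radius 1/2 used for all sheets: two points of such a ball differ by less
  than 1, hence by no integral vector other than 0.\<close>

lemma ball_diff_small: "a \<in> ball c (1/2) \<Longrightarrow> b \<in> ball c (1/2) \<Longrightarrow> norm (a - b) < 1"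
  for a b c :: "'f::euclidean_space"
  using norm_triangle_ineq4[of "c - b" "c - a"] by (simp add: dist_norm)

locale lattice_bundle = flat_bundle A B
  for A :: "('m, 'e::euclidean_space) atlas" and B :: "('m, 'v::real_vector, 'f::euclidean_space) vbundle" +
  fixes L :: "'m \<Rightarrow> 'v set"
  assumes L_triv: "t \<in> btriv B \<Longrightarrow> x \<in> fst t \<Longrightarrow> L x = {g \<in> fibre B x. \<forall>b\<in>Basis. snd t x g \<bullet> b \<in> \<int>}"
begin

text \<open>\<open>dual_quot\<close> for a general lattice bundle, with which it agrees for the dual
  lattice.\<close>

definition Q :: "'m \<times> 'v \<Rightarrow> 'm \<times> 'v set" where
  "Q = (\<lambda>(x, f). (x, {g \<in> fibre B x. g - f \<in> L x}))"

lemma L_group: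
  assumes x: "x \<in> carrier A"
  shows "0 \<in> L x" "g \<in> L x \<Longrightarrow> - g \<in> L x" "g \<in> L x \<Longrightarrow> h \<in> L x \<Longrightarrow> g + h \<in> L x"
proof -
  obtain t where t: "t \<in> btriv B" "x \<in> fst t" using triv_cover[OF x] by blast
  note l = linear_on_setD[OF triv_linear[OF t]] and sub = fibre_subspace[OF t]
  have z: "snd t x 0 = 0" using l(2)[OF subspace_0[OF sub], of 0] by simp
  show "0 \<in> L x" using subspace_0[OF sub] z by (simp add: L_triv[OF t])
  show "- g \<in> L x" if "g \<in> L x"
    using that l(2)[of g "-1"] subspace_neg[OF sub, of g] by (simp add: L_triv[OF t] scaleR_minus1_left)
  show "g + h \<in> L x" if "g \<in> L x" "h \<in> L x"
    using that l(1)[of g h] subspace_add[OF sub, of g h] by (simp add: L_triv[OF t] inner_add_left)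
qed

lemma Q_eq_iff:
  assumes x: "x \<in> carrier A" and "f \<in> fibre B x" "f' \<in> fibre B x"
  shows "Q (x, f) = Q (x, f') \<longleftrightarrow> f' - f \<in> L x"
proof
  assume "Q (x, f) = Q (x, f')"
  then have "{g \<in> fibre B x. g - f \<in> L x} = {g \<in> fibre B x. g - f' \<in> L x}" by (simp add: Q_def)
  moreover have "f' \<in> {g \<in> fibre B x. g - f' \<in> L x}" using L_group(1)[OF x] assms by simp
  ultimately show "f' - f \<in> L x" by blast
next
  assume *: "f' - f \<in> L x"
  have "g - f \<in> L x \<longleftrightarrow> g - f' \<in> L x" for g
    using L_group(3)[OF x, of "g - f'" "f' - f"] L_group(3)[OF x, of "g - f" "- (f' - f)"]
      L_group(2)[OF x *] * by auto
  then show "Q (x, f) = Q (x, f')" by (simp add: Q_def)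
qed

lemma fst_Q: "fst (Q w) = fst w"
  by (simp add: Q_def case_prod_unfold)

lemma Q_shift:
  assumes t: "t \<in> btriv B" "y \<in> fst t" and u: "u \<in> fibre B y" and a: "\<forall>b\<in>Basis. a \<bullet> b \<in> \<int>"
  shows "Q (y, u + vinv t y a) = Q (y, u)"
proof -
  have "vinv t y a \<in> L y" using a by (simp add: L_triv[OF t] vinv_in[OF t] triv_vinv[OF t])
  then have "u - (u + vinv t y a) \<in> L y" using L_group(2)[OF triv_carrier[OF t]] by simp
  then show ?thesis
    using Q_eq_iff[OF triv_carrier[OF t] subspace_add[OF fibre_subspace[OF t] u vinv_in[OF t]] u] by simp
qed

text \<open>The difference of the two points is integral in a trivialisation, and remains a lattice
  vector when continued with constant coordinates. Adding it is the required deck germ.\<close>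

lemma Q_deck:
  assumes w: "w \<in> carrier TOT" and w': "w' \<in> carrier TOT" and e: "Q w = Q w'"
  shows "\<exists>s. smooth_map_at TOT TOT w s \<and> s w = w' \<and> near TOT w (\<lambda>y. Q (s y) = Q y)"
proof -
  obtain x v where wx: "w = (x, v)" "x \<in> carrier A" "v \<in> fibre B x" using w carrier_tot[of w] by (metis prod.collapse)
  have "fst w' = x" using fst_Q[of w] fst_Q[of w'] e wx by simp
  then obtain v' where wx': "w' = (x, v')" "v' \<in> fibre B x" using w' carrier_tot[of w'] by (metis prod.collapse)
  obtain t where t: "t \<in> btriv B" "x \<in> fst t" using triv_cover[OF wx(2)] by blast
  have d: "v' - v \<in> L x" using e wx wx' Q_eq_iff by simp
  define a where "a = snd t x (v' - v)"
  have a: "\<forall>b\<in>Basis. a \<bullet> b \<in> \<int>" using d L_triv[OF t] by (simp add: a_def)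
  have dv: "vinv t x a = v' - v"
    unfolding a_def by (rule vinv_triv[OF t subspace_diff[OF fibre_subspace[OF t] wx'(2) wx(3)]])
  have ft: "fst w \<in> fst t" using t wx by simp
  show ?thesis
  proof (intro exI conjI)
    show "smooth_map_at TOT TOT w (\<lambda>y'. (fst y', snd y' + vinv t (fst y') a))" by (rule deck_smooth_map_at(1)[OF w t(1) ft])
    show "(fst w, snd w + vinv t (fst w) a) = w'" using wx wx' dv by simp
    show "near TOT w (\<lambda>y. Q (fst y, snd y + vinv t (fst y) a) = Q y)"
      by (rule satlas.near_mono[OF satlas_tot deck_smooth_map_at(2)[OF w t(1) ft]]) (simp add: Q_shift[OF t(1) _ _ a])
  qed
qed

lemma flat_torus_quotient:
  fixes P :: "('m, 'e, 'v, 'f, 'm \<times> 'v set) torus_pres"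
  assumes P: "pbase P = A" "pbundle P = B" "ptotal P = quotient_atlas (tot_atlas A B) Q" "pproj P = fst" "pquot P = Q"
    and conn: "flat_for (pconn P)"
  shows "flat_torus P"
proof (intro flat_torus.intro flat_pres.intro flat_torus_axioms.intro; unfold P)
  interpret TT: satlas TOT by (rule satlas_tot)
  show "flat_bundle A B" by (rule flat_bundle_axioms)
  show "flat_for (pconn P)" by (rule conn)
  show sZ: "satlas (quotient_atlas TOT Q)" by (rule satlas_quotient[OF satlas_tot Q_deck])
  show "fst (Q (x, v)) = x" for x v by (simp add: fst_Q)
  show "fst z \<in> carrier A \<and> (\<exists>v\<in>fibre B (fst z). Q (fst z, v) = z)" if z: "z \<in> carrier (quotient_atlas TOT Q)" for z
  proof -
    obtain k where "k \<in> quotient_atlas TOT Q" "z \<in> fst k" using carrier_chart[OF z] by metis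
    then obtain W where "mopen TOT W" "z \<in> Q ` W" unfolding quotient_atlas_iff by auto
    then obtain w where w: "w \<in> carrier TOT" "z = Q w" using TT.mopen_subset_carrier by blast
    then show ?thesis using carrier_tot[of w] fst_Q[of w] by (intro conjI bexI[of _ "snd w"]) auto
  qed
  show "\<exists>W. y \<in> W \<and> pc P c t W" if c: "c \<in> A" and t: "t \<in> btriv B" and y: "y \<in> fst (tchart B c t)" for c t y
  proof -
    let ?k = "tchart B c t"
    \<comment> \<open>Only the fibre coordinate is confined: points of different fibres have
      different images anyway.\<close>
    let ?D = "ball (snd (snd ?k y)) (1/2)"
    define W where "W = {y' \<in> fst ?k. snd ?k y' \<in> UNIV \<times> ?D}"
    have W: "mopen TOT W" unfolding W_def by (rule TT.mopen_preimage[OF tchart_mchart[OF c t]]) (simp add: open_Times)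
    have inj: "inj_on Q W"
    proof (rule inj_onI)
      fix w w' assume w: "w \<in> W" and w': "w' \<in> W" and e: "Q w = Q w'"
      have f: "fst w' = fst w" using fst_Q[of w] fst_Q[of w'] e by simp
      have m: "fst w \<in> fst t" "snd w \<in> fibre B (fst w)" "snd w' \<in> fibre B (fst w)"
        using w w' f by (auto simp: W_def tchart_simps)
      have "snd w' - snd w \<in> L (fst w)"
        using Q_eq_iff[OF triv_carrier[OF t m(1)] m(2,3)] e f by (metis prod.collapse)
      then have "\<forall>b\<in>Basis. snd t (fst w) (snd w' - snd w) \<bullet> b \<in> \<int>" using L_triv[OF t m(1)] by simp
      moreover have "snd t (fst w) (snd w' - snd w) = snd t (fst w) (snd w') - snd t (fst w) (snd w)"
        using linear_on_setD[OF triv_linear[OF t m(1)]] m subspace_neg[OF fibre_subspace[OF t m(1)]]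
        by (metis diff_conv_add_uminus scaleR_minus1_left)
      moreover have "norm (snd t (fst w) (snd w') - snd t (fst w) (snd w)) < 1"
        by (rule ball_diff_small[of _ "snd (snd ?k y)"]) (use w w' f in \<open>auto simp: W_def tchart_simps\<close>)
      ultimately have "snd t (fst w) (snd w') = snd t (fst w) (snd w)"
        using small_integral_zero[of "snd t (fst w) (snd w' - snd w)"] by auto
      then have "snd w' = snd w" using vinv_triv[OF t m(1)] m by metis
      then show "w = w'" using f by (simp add: prod_eq_iff)
    qed
    have "pch P c t W = (Q ` W, snd ?k \<circ> inv_into W Q)" by (simp add: pch_def P o_def)
    then have "pch P c t W \<in> quotient_atlas TOT Q"
      unfolding quotient_atlas_iff using W inj c t by (intro exI[of _ ?k] exI[of _ W]) (auto simp: W_def tot_atlas_iff)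
    then have "pc P c t W"
      unfolding pc_def P using c t W inj satlas.chart_mchart[OF sZ] by (auto simp: W_def)
    moreover have "y \<in> W" using y by (simp add: W_def mem_Times_iff)
    ultimately show ?thesis by blast
  qed
  show "near A x (\<lambda>y. \<forall>u\<in>fibre B y. Q (y, u + inv_into (fibre B y) (snd t y) (snd t x (v' - v))) = Q (y, u))"
    if t: "t \<in> btriv B" "x \<in> fst t" and v: "v \<in> fibre B x" "v' \<in> fibre B x" "Q (x, v) = Q (x, v')" for t x v v'
  proof -
    have "v' - v \<in> L x" using Q_eq_iff[OF triv_carrier[OF t] v(1,2)] v(3) by simp
    then have a: "\<forall>b\<in>Basis. snd t x (v' - v) \<bullet> b \<in> \<int>" using L_triv[OF t] by simp
    show ?thesis
      by (rule near_mono[OF near_triv[OF t]]) (use Q_shift[OF t(1) _ _ a] in \<open>simp add: vinv_def\<close>)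
  qed
qed

end

section \<open>Torus bundles\<close>

text \<open>A chart pulled back along a diffeomorphism need not belong to the atlas
  \<open>R\<close>; smoothness of the map and of its inverse gives compatibility in the two
  directions.\<close>

lemma diffeo_mchart:
  fixes R :: "('a, 'e::euclidean_space) atlas" and S :: "('b, 'e) atlas"
  assumes \<Phi>: "diffeo R S \<Phi>" and e: "e \<in> S" "inj_on (snd e) (fst e)"
  shows "mchart R ({z \<in> carrier R. \<Phi> z \<in> fst e}, \<lambda>z. snd e (\<Phi> z))" (is "mchart R ?k")
proof -
  define \<Psi> where "\<Psi> = inv_into (carrier R) \<Phi>"
  have bij: "bij_betw \<Phi> (carrier R) (carrier S)" and s: "smooth_map R S \<Phi>" "smooth_map S R \<Psi>"
    using \<Phi> by (simp_all add: diffeo_def \<Psi>_def)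
  have \<Psi>\<Phi>: "\<Psi> (\<Phi> z) = z" if "z \<in> carrier R" for z
    unfolding \<Psi>_def using bij_betw_inv_into_left[OF bij that] .
  have \<Phi>\<Psi>: "\<Phi> (\<Psi> y) = y" "\<Psi> y \<in> carrier R" if "y \<in> fst e" for y
    using bij_betw_inv_into_right[OF bij] bij_betw_inv_into[OF bij] that e(1)
    unfolding \<Psi>_def bij_betw_def carrier_def by blast+
  have inj: "inj_on (snd ?k) (fst ?k)"
  proof (rule inj_onI)
    fix z z' assume "z \<in> fst ?k" "z' \<in> fst ?k" "snd ?k z = snd ?k z'"
    then show "z = z'" using inj_onD[OF e(2), of "\<Phi> z" "\<Phi> z'"] \<Psi>\<Phi> by (metis (mono_tags) fst_conv mem_Collect_eq snd_conv)
  qed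
  show ?thesis
    unfolding mchart_def
  proof (intro conjI ballI inj)
    show "fst ?k \<subseteq> carrier R" by auto
    fix d assume d: "d \<in> R"
    have dc: "fst d \<subseteq> carrier R" using d by (auto simp: carrier_def)
    have O: "fst ?k \<inter> fst d = fst d \<inter> \<Phi> -` fst e" using dc by auto
    have im: "snd ?k ` (fst ?k \<inter> fst d) = snd e ` (fst e \<inter> \<Psi> -` fst d)"
    proof (intro subset_antisym subsetI)
      fix p assume "p \<in> snd ?k ` (fst ?k \<inter> fst d)"
      then obtain z where "z \<in> carrier R" "\<Phi> z \<in> fst e" "z \<in> fst d" "p = snd e (\<Phi> z)" by auto
      then show "p \<in> snd e ` (fst e \<inter> \<Psi> -` fst d)" using \<Psi>\<Phi> by (intro image_eqI[of _ _ "\<Phi> z"]) auto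
    next
      fix p assume "p \<in> snd e ` (fst e \<inter> \<Psi> -` fst d)"
      then obtain y where "y \<in> fst e" "\<Psi> y \<in> fst d" "p = snd e y" by auto
      then show "p \<in> snd ?k ` (fst ?k \<inter> fst d)" using \<Phi>\<Psi> by (intro image_eqI[of _ _ "\<Psi> y"]) auto
    qed
    show o: "open (snd ?k ` (fst ?k \<inter> fst d))"
      unfolding im using s(2) d e(1) by (simp add: smooth_map_def)
    show "open (snd d ` (fst ?k \<inter> fst d))"
      unfolding O using s(1) d e(1) by (simp add: smooth_map_def)
    have "smooth_on (snd d ` (fst ?k \<inter> fst d)) (snd e \<circ> \<Phi> \<circ> chart_inv d)"
      unfolding O using s(1) d e(1) by (simp add: smooth_map_def)
    then show "smooth_on (snd d ` (fst ?k \<inter> fst d)) (snd ?k \<circ> chart_inv d)" by (simp add: o_def)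
    have "smooth_on (snd ?k ` (fst ?k \<inter> fst d)) (snd d \<circ> \<Psi> \<circ> chart_inv e)"
      unfolding im using s(2) d e(1) by (simp add: smooth_map_def)
    then show "smooth_on (snd ?k ` (fst ?k \<inter> fst d)) (snd d \<circ> chart_inv ?k)"
    proof (subst smooth_on_cong[OF o])
      fix p assume "p \<in> snd ?k ` (fst ?k \<inter> fst d)"
      then obtain z where z: "z \<in> fst ?k" "p = snd ?k z" by blast
      have "chart_inv ?k p = z" using chart_inv_left[OF inj z(1)] z(2) by simp
      moreover have "chart_inv e p = \<Phi> z" using chart_inv_left[OF e(2), of "\<Phi> z"] z by simp
      ultimately show "(snd d \<circ> chart_inv ?k) p = (snd d \<circ> \<Psi> \<circ> chart_inv e) p" using \<Psi>\<Phi> z(1) by simp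
    qed
  qed
qed

lemma carrier_restrict: "carrier (restrict_atlas A S) = carrier A \<inter> S"
proof -
  have "carrier (restrict_atlas A S) = \<Union> ((\<lambda>c. fst c \<inter> S) ` A)"
    by (force simp: restrict_atlas_def carrier_def)
  then show ?thesis by (simp add: carrier_def)
qed

text \<open>The domain of \<open>k\<close> lies in \<open>S\<close>, so it meets a chart and the
  restriction of that chart in the same set, and the compatibility conditions coincide.\<close>

lemma mchart_restrict:
  assumes A: "satlas A" and k: "mchart (restrict_atlas A S) k"
  shows "mchart A k"
proof -
  interpret satlas A by fact
  have sub: "fst k \<subseteq> carrier A \<inter> S" using k by (simp add: mchart_def carrier_restrict)
  show ?thesis
    unfolding mchart_def
  proof (intro conjI ballI)
    show "fst k \<subseteq> carrier A" using sub by simp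
    show "inj_on (snd k) (fst k)" using k by (simp add: mchart_def)
    fix d assume d: "d \<in> A"
    let ?d = "(fst d \<inter> S, snd d)"
    have d': "?d \<in> restrict_atlas A S" using d unfolding restrict_atlas_def by blast
    have O: "fst k \<inter> fst ?d = fst k \<inter> fst d" using sub unfolding fst_conv by blast
    note m = mchartD[OF k d', unfolded O snd_conv]
    show "open (snd k ` (fst k \<inter> fst d))" "open (snd d ` (fst k \<inter> fst d))"
      "smooth_on (snd k ` (fst k \<inter> fst d)) (snd d \<circ> chart_inv k)" using m(1-3) .
    show "smooth_on (snd d ` (fst k \<inter> fst d)) (snd k \<circ> chart_inv d)"
    proof (subst smooth_on_cong[OF m(2)])
      fix p assume "p \<in> snd d ` (fst k \<inter> fst d)"
      then obtain z where z: "z \<in> fst k" "z \<in> fst d" "p = snd d z" by blast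
      have "inj_on (snd ?d) (fst ?d)" using inj_on_subset[OF chart_inj[OF d], of "fst d \<inter> S"] by simp
      moreover have "z \<in> fst ?d" using z sub unfolding fst_conv by blast
      ultimately have "chart_inv ?d p = z" using chart_inv_left[of ?d z] z(3) by simp
      then show "(snd k \<circ> chart_inv d) p = (snd k \<circ> chart_inv ?d) p"
        using chart_inv_left[OF chart_inj[OF d] z(2)] z(3) by simp
    qed (rule m(4))
  qed
qed

lemma carrier_prod: "carrier (prod_atlas A B) = carrier A \<times> carrier B"
proof -
  have "carrier (prod_atlas A B) = \<Union> ((\<lambda>(c, d). fst c \<times> fst d) ` (A \<times> B))"
    by (force simp: prod_atlas_def carrier_def)
  then show ?thesis by (force simp: carrier_def)
qed

lemma torus_proj_eq_iff: "torus_proj a = torus_proj b \<longleftrightarrow> (\<forall>i. b $ i - a $ i \<in> \<int>)"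
proof
  assume "torus_proj a = torus_proj b"
  moreover have "b \<in> torus_proj b" by (simp add: torus_proj_def)
  ultimately show "\<forall>i. b $ i - a $ i \<in> \<int>" by (auto simp: torus_proj_def)
next
  assume *: "\<forall>i. b $ i - a $ i \<in> \<int>"
  have "g $ i - a $ i \<in> \<int> \<longleftrightarrow> g $ i - b $ i \<in> \<int>" for g i
    using Ints_add[of "g $ i - b $ i" "b $ i - a $ i"] Ints_diff[of "g $ i - a $ i" "b $ i - a $ i"] * by auto
  then show "torus_proj a = torus_proj b" by (simp add: torus_proj_def)
qed

lemma ball_integral: "(\<forall>b\<in>Basis. a \<bullet> b \<in> \<int>) \<longleftrightarrow> (\<forall>i. (a :: real ^ 'n) $ i \<in> \<int>)"
  by (auto simp: Basis_vec_def inner_axis)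

lemma inj_torus_proj: "inj_on torus_proj (ball (c :: real ^ 'n) (1/2))"
proof (rule inj_onI)
  fix a b assume a: "a \<in> ball c (1/2)" and b: "b \<in> ball c (1/2)" and "torus_proj a = torus_proj b"
  then have "\<forall>i. (b - a) $ i \<in> \<int>" by (simp add: torus_proj_eq_iff)
  then have "b - a = 0" using small_integral_zero[of "b - a"] ball_integral ball_diff_small[OF b a] by blast
  then show "a = b" by simp
qed

text \<open>The standard chart of the torus around [a]. The identity map is kept in the composition
  to match the form of charts in \<open>quotient_atlas\<close>.\<close>

definition proj_chart :: "real ^ 'n \<Rightarrow> ((real ^ 'n) set, real ^ 'n) chart" where
  "proj_chart a = (torus_proj ` ball a (1/2), (\<lambda>b. b) \<circ> inv_into (ball a (1/2)) torus_proj)"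

lemma proj_chart_in: "proj_chart a \<in> torus_atlas"
  unfolding torus_atlas_def quotient_atlas_iff proj_chart_def
  by (intro exI[of _ "(UNIV, \<lambda>a. a)"] exI[of _ "ball a (1/2)"])
    (simp add: mopen_def carrier_def inj_torus_proj)

lemma proj_chart_simps: "b \<in> ball a (1/2) \<Longrightarrow> snd (proj_chart a) (torus_proj b) = b"
  "b \<in> ball a (1/2) \<Longrightarrow> torus_proj b \<in> fst (proj_chart a)"
  by (simp_all add: proj_chart_def inj_torus_proj del: mem_ball)

lemma carrier_torus: "carrier torus_atlas = range torus_proj"
proof
  have "torus_proj a \<in> carrier torus_atlas" for a :: "real ^ 'n"
    using proj_chart_in[of a] proj_chart_simps(2)[of a a] unfolding carrier_def by force
  then show "range torus_proj \<subseteq> (carrier torus_atlas :: (real ^ 'n) set set)" by blast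
qed (auto simp: torus_atlas_def quotient_atlas_def carrier_def)

lemma proj_chart_inj: "inj_on (snd (proj_chart a)) (fst (proj_chart a))"
  by (rule inj_onI) (auto simp: proj_chart_def inv_into_into f_inv_into_f dest: inv_into_injective)

section \<open>Product charts and vertical frames of a torus bundle\<close>

locale torus_bdl =
  fixes T :: "('m, 'z, 'n::finite) torus_data"
  assumes T: "torus_bundle T"
begin

abbreviation "A \<equiv> base T"
abbreviation "Z \<equiv> total T"
abbreviation "B \<equiv> rel_tangent T"

sublocale satlas "base T"
  using T smooth_manifold_satlas by (auto simp: torus_bundle_def)

sublocale ZA: satlas2 "total T" "base T"
  using T smooth_manifold_satlas satlas_axioms by (auto simp: torus_bundle_def satlas2_def)

lemma proj_smooth: "smooth_map Z A (proj T)" and zero_smooth: "smooth_map A Z (zero_sec T)"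
  and proj_zero: "x \<in> carrier A \<Longrightarrow> proj T (zero_sec T x) = x"
  and trivs_cover: "x \<in> carrier A \<Longrightarrow> \<exists>t\<in>trivs T. x \<in> fst t"
  using T by (simp_all add: torus_bundle_def)

lemma
  assumes "t \<in> trivs T"
  shows trivs_mopen: "mopen A (fst t)"
    and trivs_diffeo: "diffeo (restrict_atlas Z (over T (fst t))) (prod_atlas (restrict_atlas A (fst t)) torus_atlas)
      (\<lambda>z. (proj T z, snd t z))"
    and trivs_zero: "x \<in> fst t \<Longrightarrow> snd t (zero_sec T x) = torus_proj 0"
  using T assms by (simp_all add: torus_bundle_def)

lemma trivs_carrier: "t \<in> trivs T \<Longrightarrow> x \<in> fst t \<Longrightarrow> x \<in> carrier A"
  by (rule mopen_subset_carrier[OF trivs_mopen])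

lemma trivs_bij:
  assumes t: "t \<in> trivs T"
  shows "bij_betw (\<lambda>z. (proj T z, snd t z)) (over T (fst t)) (fst t \<times> range torus_proj)"
proof -
  have "carrier Z \<inter> over T (fst t) = over T (fst t)" "carrier A \<inter> fst t = fst t"
    using trivs_carrier[OF t] by (auto simp: over_def)
  then show ?thesis
    using trivs_diffeo[OF t] by (simp add: diffeo_def carrier_restrict carrier_prod carrier_torus)
qed

lemma triv_point:
  assumes t: "t \<in> trivs T" "x \<in> fst t"
  shows "triv_point T t x a \<in> over T (fst t)" "proj T (triv_point T t x a) = x"
    "snd t (triv_point T t x a) = torus_proj a" "triv_point T t x a \<in> carrier Z"
proof -
  have p: "(x, torus_proj a) \<in> fst t \<times> range torus_proj" using t by simp
  show o: "triv_point T t x a \<in> over T (fst t)"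
    unfolding triv_point_def using bij_betw_inv_into[OF trivs_bij[OF t(1)]] p by (auto simp: bij_betw_def)
  show "proj T (triv_point T t x a) = x" "snd t (triv_point T t x a) = torus_proj a"
    using bij_betw_inv_into_right[OF trivs_bij[OF t(1)] p] by (simp_all add: triv_point_def)
  show "triv_point T t x a \<in> carrier Z" using o by (simp add: over_def)
qed

lemma triv_point_eqI:
  assumes t: "t \<in> trivs T" "x \<in> fst t" and z: "z \<in> carrier Z" "proj T z = x" "snd t z = torus_proj a"
  shows "triv_point T t x a = z"
  unfolding triv_point_def
  using bij_betw_inv_into_left[OF trivs_bij[OF t(1)], of z] z t by (simp add: over_def)

lemma triv_point_eq_iff:
  assumes t: "t \<in> trivs T" "x \<in> fst t"
  shows "triv_point T t x a = triv_point T t x b \<longleftrightarrow> torus_proj a = torus_proj b"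
proof
  show "triv_point T t x a = triv_point T t x b \<Longrightarrow> torus_proj a = torus_proj b"
    using triv_point(3)[OF t, of a] triv_point(3)[OF t, of b] by simp
qed (simp add: triv_point_def)

lemma triv_point_surj:
  assumes t: "t \<in> trivs T" and z: "z \<in> carrier Z" "proj T z \<in> fst t"
  shows "\<exists>a. triv_point T t (proj T z) a = z"
proof -
  have "(proj T z, snd t z) \<in> fst t \<times> range torus_proj"
    using bij_betwE[OF trivs_bij[OF t]] z by (auto simp: over_def)
  then show ?thesis using triv_point_eqI[OF t z(2) z(1) refl] by auto
qed

lemma zero_carrier: "x \<in> carrier A \<Longrightarrow> zero_sec T x \<in> carrier Z"
  using zero_smooth by (auto simp: smooth_map_def)

lemma triv_point_0: "t \<in> trivs T \<Longrightarrow> x \<in> fst t \<Longrightarrow> triv_point T t x 0 = zero_sec T x"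
  by (rule triv_point_eqI) (simp_all add: trivs_carrier zero_carrier proj_zero trivs_zero)

definition torus_chart :: "('m, real ^ 'n) chart \<Rightarrow> 'm set \<times> ('z \<Rightarrow> (real ^ 'n) set) \<Rightarrow> real ^ 'n \<Rightarrow>
    ('z, (real ^ 'n) \<times> (real ^ 'n)) chart" where
  "torus_chart c t a = ({z \<in> over T (fst t). proj T z \<in> fst c \<and> snd t z \<in> fst (proj_chart a)},
     \<lambda>z. (snd c (proj T z), snd (proj_chart a) (snd t z)))"

lemma torus_chart_mchart:
  assumes c: "c \<in> A" and t: "t \<in> trivs T" shows "mchart Z (torus_chart c t a)"
proof -
  let ?c = "(fst c \<inter> fst t, snd c)"
  let ?d = "(fst ?c \<times> fst (proj_chart a), \<lambda>(x, y). (snd ?c x, snd (proj_chart a) y))"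
  have "?c \<in> restrict_atlas A (fst t)" using c unfolding restrict_atlas_def by blast
  then have d: "?d \<in> prod_atlas (restrict_atlas A (fst t)) torus_atlas"
    using proj_chart_in[of a] unfolding prod_atlas_def by blast
  have inj: "inj_on (snd ?d) (fst ?d)"
    using inj_onD[OF chart_inj[OF c]] inj_onD[OF proj_chart_inj[of a]] by (auto intro!: inj_onI)
  have "{z \<in> over T (fst t). proj T z \<in> fst c \<and> snd t z \<in> fst (proj_chart a)}
      = {z \<in> carrier (restrict_atlas Z (over T (fst t))). (proj T z, snd t z) \<in> fst ?d}"
    unfolding carrier_restrict fst_conv over_def by blast
  then have "torus_chart c t a = ({z \<in> carrier (restrict_atlas Z (over T (fst t))). (proj T z, snd t z) \<in> fst ?d},
      \<lambda>z. snd ?d (proj T z, snd t z))"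
    unfolding torus_chart_def by (simp only: snd_conv prod.case)
  then have "mchart (restrict_atlas Z (over T (fst t))) (torus_chart c t a)"
    using diffeo_mchart[OF trivs_diffeo[OF t] d inj] by simp
  then show ?thesis by (rule mchart_restrict[OF ZA.A.satlas_axioms])
qed

lemma torus_chart_triv_point:
  assumes "c \<in> A" and t: "t \<in> trivs T" "x \<in> fst t" and "x \<in> fst c" "b \<in> ball a (1/2)"
  shows "triv_point T t x b \<in> fst (torus_chart c t a)" "snd (torus_chart c t a) (triv_point T t x b) = (snd c x, b)"
  using triv_point[OF t, of b] assms proj_chart_simps[of b a] by (simp_all add: torus_chart_def)

end

text \<open>Coordinate maps are arbitrary off their domains, so \<open>pch\<close> and
  \<open>torus_chart\<close> can be compared on the common domain only.\<close>

lemma mchart_cong: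
  assumes k: "mchart A k" and e: "fst k' = fst k" "\<And>z. z \<in> fst k \<Longrightarrow> snd k' z = snd k z" and A: "satlas A"
  shows "mchart A k'"
proof -
  interpret satlas A by fact
  have inv: "chart_inv k' = chart_inv k"
    unfolding chart_inv_def e(1) by (rule ext, rule inv_into_cong_fun) (rule e(2))
  have im: "snd k' ` (fst k' \<inter> S) = snd k ` (fst k \<inter> S)" for S
    unfolding e(1) by (rule image_cong) (simp_all add: e(2))
  show ?thesis
    unfolding mchart_def im
  proof (intro conjI ballI)
    show "fst k' \<subseteq> carrier A" using k e(1) by (simp add: mchart_def)
    show "inj_on (snd k') (fst k')"
      unfolding e(1) using inj_on_cong[of "fst k" "snd k'" "snd k"] e(2) mchart_inj[OF k] by simp
    fix d assume d: "d \<in> A"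
    note m = mchartD[OF k d]
    show "open (snd k ` (fst k \<inter> fst d))" "open (snd d ` (fst k' \<inter> fst d))"
      "smooth_on (snd k ` (fst k \<inter> fst d)) (snd d \<circ> chart_inv k')"
      using m(1-3) by (simp_all only: e(1) inv)
    show "smooth_on (snd d ` (fst k' \<inter> fst d)) (snd k' \<circ> chart_inv d)"
      unfolding e(1)
    proof (subst smooth_on_cong[OF m(2)])
      fix p assume "p \<in> snd d ` (fst k \<inter> fst d)"
      then obtain z where z: "z \<in> fst k" "z \<in> fst d" "p = snd d z" by blast
      then show "(snd k' \<circ> chart_inv d) p = (snd k \<circ> chart_inv d) p"
        using chart_inv_left[OF chart_inj[OF d] z(2)] e(2) by simp
    qed (rule m(4))
  qed
qed

lemma linear_on_set_diff:
  assumes "linear_on_set S f" "subspace S" "u \<in> S" "v \<in> S"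
  shows "f (u - v) = f u - f v"
  using linear_on_setD[OF assms(1)] subspace_scale[OF assms(2,4), of "-1"] assms(3,4)
  by (metis diff_conv_add_uminus scaleR_minus1_left)

context torus_bdl
begin

lemma zero_torus_chart:
  assumes c: "c \<in> A" "x \<in> fst c" and t: "t \<in> trivs T" "x \<in> fst t"
  shows "mchart Z (torus_chart c t 0)" "zero_sec T x \<in> fst (torus_chart c t 0)"
  using torus_chart_mchart[OF c(1) t(1)] torus_chart_triv_point(1)[OF c(1) t c(2), of 0 0] triv_point_0[OF t] by simp_all

text \<open>In the product chart around the zero section the curve [r a] is the straight line r a,
  as long as it stays in the ball of radius 1/2.\<close>

lemma fibre_frame_eq:
  assumes c: "c \<in> A" "x \<in> fst c" and t: "t \<in> trivs T" "x \<in> fst t"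
  shows "fibre_frame T t x a = tinv Z (torus_chart c t 0) (zero_sec T x) (0, a)"
proof -
  let ?\<gamma> = "\<lambda>r. triv_point T t x (r *\<^sub>R a)" and ?S = "{r :: real. r *\<^sub>R a \<in> ball 0 (1/2)}"
  have S: "open ?S" "0 \<in> ?S"
  proof -
    have "open ((\<lambda>r :: real. r *\<^sub>R a) -` ball 0 (1/2))" by (intro open_vimage open_ball continuous_intros)
    then show "open ?S" by (simp add: vimage_def)
  qed simp
  note kp = torus_chart_triv_point[OF c(1) t c(2)]
  have 0: "?\<gamma> 0 = zero_sec T x" by (simp add: triv_point_0[OF t])
  have "((\<lambda>r :: real. (snd c x, r *\<^sub>R a)) has_vector_derivative (0, a)) (at 0)"
    by (auto intro!: derivative_eq_intros)
  then have "((\<lambda>r. snd (torus_chart c t 0) (?\<gamma> r)) has_vector_derivative (0, a)) (at 0)"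
    by (rule has_vector_derivative_transform_within_open[OF _ S]) (use kp(2) in simp)
  then show ?thesis
    unfolding fibre_frame_def
    by (subst ZA.A.velocity_eq[OF zero_torus_chart(1)[OF c t] _ S]) (use kp(1) zero_torus_chart(2)[OF c t] 0 in simp_all)
qed

text \<open>The projection is the base coordinate of the product chart, so the kernel of dp consists
  of the vectors without base component.\<close>

lemma fibre_rel_tangent:
  assumes c: "c \<in> A" "x \<in> fst c" and t: "t \<in> trivs T" "x \<in> fst t"
  shows "v \<in> fibre B x \<longleftrightarrow> v \<in> tangent_space Z (zero_sec T x) \<and> fst (tco Z (torus_chart c t 0) (zero_sec T x) v) = 0"
proof -
  let ?k = "torus_chart c t 0" and ?s = "zero_sec T x"
  note k = zero_torus_chart[OF c t]
  have x: "x \<in> carrier A" by (rule trivs_carrier[OF t])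
  have ps: "proj T ?s = x" by (rule proj_zero[OF x])
  have sp: "smooth_map_at Z A ?s (proj T)" by (rule ZA.smooth_map_smooth_map_at[OF proj_smooth zero_carrier[OF x]])
  have c': "mchart A c" "proj T ?s \<in> fst c" using chart_mchart c ps by simp_all
  have "tco A c (proj T ?s) (mdiff Z A (proj T) ?s v) = dfun Z (\<lambda>y. fst (snd ?k y)) ?s v"
    unfolding ZA.tco_mdiff[OF sp c'] by (simp add: torus_chart_def)
  also have "\<dots> = fst (tco Z ?k ?s v)"
    unfolding tco_def by (rule ZA.A.dfun_linear[OF linear_fst ZA.A.smooth_at_chart[OF k]])
  finally have e: "tco A c (proj T ?s) (mdiff Z A (proj T) ?s v) = fst (tco Z ?k ?s v)" .
  have "mdiff Z A (proj T) ?s v = 0 \<longleftrightarrow> tco A c (proj T ?s) (mdiff Z A (proj T) ?s v) = 0"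
  proof
    assume *: "tco A c (proj T ?s) (mdiff Z A (proj T) ?s v) = 0"
    show "mdiff Z A (proj T) ?s v = 0"
      by (rule tco_inject[OF c' ZA.mdiff_in[OF sp] subspace_0[OF subspace_tangent[OF mchart_carrier[OF c']]]])
        (simp add: * linear_0[OF linear_tco[OF c']])
  qed (simp add: linear_0[OF linear_tco[OF c']])
  then show ?thesis by (simp add: rel_tangent_def e)
qed

lemma linear_frame:
  assumes t: "t \<in> trivs T" "x \<in> fst t" shows "linear (fibre_frame T t x)"
proof -
  have x: "x \<in> carrier A" by (rule trivs_carrier[OF t])
  note c = chart_at[OF x]
  note k = zero_torus_chart[OF conjunct1[OF c] conjunct2[OF c] t] and e = fibre_frame_eq[OF conjunct1[OF c] conjunct2[OF c] t]
  show ?thesis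
    unfolding e[abs_def]
    using linear_compose[OF _ ZA.A.linear_tinv[OF k], of "\<lambda>a. (0, a)"]
    by (simp add: o_def module_hom_iff_linear linear_iff)
qed

lemma bij_frame:
  assumes t: "t \<in> trivs T" "x \<in> fst t" shows "bij_betw (fibre_frame T t x) UNIV (fibre B x)"
proof -
  have x: "x \<in> carrier A" by (rule trivs_carrier[OF t])
  obtain c where c: "c \<in> A" "x \<in> fst c" using carrier_chart[OF x] by blast
  note k = zero_torus_chart[OF c t] and e = fibre_frame_eq[OF c t] and f = fibre_rel_tangent[OF c t]
  let ?\<tau> = "tco Z (torus_chart c t 0) (zero_sec T x)"
  show ?thesis
  proof (rule bij_betw_byWitness[where f' = "\<lambda>v. snd (?\<tau> v)"])
    show "\<forall>a\<in>UNIV. snd (?\<tau> (fibre_frame T t x a)) = a" by (simp add: e ZA.A.tco_tinv[OF k])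
    show "\<forall>v\<in>fibre B x. fibre_frame T t x (snd (?\<tau> v)) = v"
    proof
      fix v assume v: "v \<in> fibre B x"
      then have "(0, snd (?\<tau> v)) = ?\<tau> v" using f[of v] by (simp add: prod_eq_iff)
      then show "fibre_frame T t x (snd (?\<tau> v)) = v" using v f[of v] ZA.A.tinv_tco[OF k, of v] by (simp add: e)
    qed
    show "fibre_frame T t x ` UNIV \<subseteq> fibre B x"
      using f ZA.A.tinv_in[OF k] ZA.A.tco_tinv[OF k] e by auto
  qed auto
qed

definition theta :: "'m set \<times> ('z \<Rightarrow> (real ^ 'n) set) \<Rightarrow> 'm \<Rightarrow> ('z, (real ^ 'n) \<times> (real ^ 'n)) tvec \<Rightarrow> real ^ 'n"
  where "theta t x = inv_into UNIV (fibre_frame T t x)"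

lemma btriv_rel: "b \<in> btriv B \<longleftrightarrow> (\<exists>t\<in>trivs T. b = (fst t, theta t))"
  unfolding rel_tangent_def vbundle.simps theta_def[abs_def] mem_Collect_eq by blast

lemma theta_bij: "t \<in> trivs T \<Longrightarrow> x \<in> fst t \<Longrightarrow> bij_betw (theta t x) (fibre B x) UNIV"
  unfolding theta_def by (rule bij_betw_inv_into[OF bij_frame])

lemma theta_frame: "t \<in> trivs T \<Longrightarrow> x \<in> fst t \<Longrightarrow> theta t x (fibre_frame T t x a) = a"
  unfolding theta_def using bij_betw_inv_into_left[OF bij_frame] by blast

lemma frame_theta: "t \<in> trivs T \<Longrightarrow> x \<in> fst t \<Longrightarrow> v \<in> fibre B x \<Longrightarrow> fibre_frame T t x (theta t x v) = v"
  unfolding theta_def using bij_betw_inv_into_right[OF bij_frame] by blast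

lemma frame_in: "t \<in> trivs T \<Longrightarrow> x \<in> fst t \<Longrightarrow> fibre_frame T t x a \<in> fibre B x"
  using bij_betwE[OF bij_frame] by blast

text \<open>\<open>G\<close> acts linearly on the fibre coordinates, so it carries the one-parameter
  subgroup of \<open>a\<close> to that of \<open>G *v a\<close>. Taking velocities at 0 shows that
  the vertical frames change by the same constant matrix as the points.\<close>

lemma theta_transition:
  assumes t: "t \<in> trivs T" "x \<in> fst t" and t': "t' \<in> trivs T" "x \<in> fst t'"
  shows "\<exists>G. near A x (\<lambda>y. y \<in> fst t \<inter> fst t' \<and> (\<forall>a. triv_point T t' y (G *v a) = triv_point T t y a) \<and>
    (\<forall>v\<in>fibre B y. theta t' y v = G *v theta t y v))"
proof -
  have "\<exists>N. \<exists>G\<in>GL_int. mopen A N \<and> x \<in> N \<and> N \<subseteq> fst t \<inter> fst t' \<and>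
      (\<forall>z\<in>over T N. \<forall>a. snd t z = torus_proj a \<longrightarrow> snd t' z = torus_proj (G *v a))"
    using T t t' unfolding torus_bundle_def by blast
  then obtain N G where N: "mopen A N" "x \<in> N" "N \<subseteq> fst t \<inter> fst t'"
    "\<And>z a. z \<in> over T N \<Longrightarrow> snd t z = torus_proj a \<Longrightarrow> snd t' z = torus_proj (G *v a)" by blast
  have "near A x (\<lambda>y. y \<in> fst t \<inter> fst t' \<and> (\<forall>a. triv_point T t' y (G *v a) = triv_point T t y a) \<and>
    (\<forall>v\<in>fibre B y. theta t' y v = G *v theta t y v))"
  proof (rule nearI[OF N(1,2)], intro conjI allI ballI)
    fix y assume y: "y \<in> N"
    then show "y \<in> fst t \<inter> fst t'" using N(3) by blast
    then have yt: "y \<in> fst t" "y \<in> fst t'" by auto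
    show p: "triv_point T t' y (G *v a) = triv_point T t y a" for a
    proof (rule triv_point_eqI[OF t'(1) yt(2)])
      note q = triv_point[OF t(1) yt(1), of a]
      show "triv_point T t y a \<in> carrier Z" "proj T (triv_point T t y a) = y" using q by blast+
      have "triv_point T t y a \<in> over T N" using q y by (simp add: over_def)
      then show "snd t' (triv_point T t y a) = torus_proj (G *v a)" using N(4) q(3) by blast
    qed
    fix v assume v: "v \<in> fibre B y"
    have "fibre_frame T t' y (G *v theta t y v) = fibre_frame T t y (theta t y v)"
      unfolding fibre_frame_def by (simp add: p[symmetric] matrix_vector_mult_scaleR scaleR_matrix_vector_assoc)
    also have "\<dots> = v" by (rule frame_theta[OF t(1) yt(1) v])
    finally show "theta t' y v = G *v theta t y v" using theta_frame[OF t'(1) yt(2)] by metis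
  qed
  then show ?thesis by blast
qed

lemma flat_bundle_rel: "flat_bundle A B"
proof (rule flat_bundleI[OF satlas_axioms])
  show "open_trivs A B"
    unfolding open_trivs_def Ball_def Bex_def btriv_rel using trivs_mopen trivs_cover by (metis fst_conv)
  show fs: "subspace (fibre B x)" if b: "b \<in> btriv B" "x \<in> fst b" for b x
  proof -
    obtain t where "t \<in> trivs T" "b = (fst t, theta t)" using b(1) unfolding btriv_rel by blast
    then have t: "t \<in> trivs T" "x \<in> fst t" using b(2) by simp_all
    show ?thesis
      using linear_subspace_image[OF linear_frame[OF t] subspace_UNIV] bij_frame[OF t] by (simp add: bij_betw_def)
  qed
  show "bij_betw (snd b x) (fibre B x) UNIV" if "b \<in> btriv B" "x \<in> fst b" for b x
    using that theta_bij unfolding btriv_rel by auto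
  show "linear_on_set (fibre B x) (snd b x)" if b: "b \<in> btriv B" "x \<in> fst b" for b x
  proof -
    obtain t where "t \<in> trivs T" "b = (fst t, theta t)" using b(1) unfolding btriv_rel by blast
    then have t: "t \<in> trivs T" "x \<in> fst t" "b = (fst t, theta t)" using b(2) by simp_all
    show ?thesis
      using linear_on_set_inv_into[OF subspace_UNIV bij_frame[OF t(1,2)]] linear_frame[OF t(1,2)]
      by (simp add: t(3) theta_def linear_on_set_def linear_add linear_scale)
  qed
  show "\<exists>G. linear G \<and> near A x (\<lambda>y. \<forall>v\<in>fibre B y. snd b' y v = G (snd b y v))"
    if b: "b \<in> btriv B" "b' \<in> btriv B" "x \<in> fst b" "x \<in> fst b'" for b b' x
  proof -
    obtain t t' where t: "t \<in> trivs T" "b = (fst t, theta t)" "t' \<in> trivs T" "b' = (fst t', theta t')"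
      using b unfolding btriv_rel by blast
    then have x: "x \<in> fst t" "x \<in> fst t'" using b by simp_all
    obtain G where "near A x (\<lambda>y. y \<in> fst t \<inter> fst t' \<and> (\<forall>a. triv_point T t' y (G *v a) = triv_point T t y a) \<and>
        (\<forall>v\<in>fibre B y. theta t' y v = G *v theta t y v))"
      using theta_transition[OF t(1) x(1) t(3) x(2)] by blast
    then have "near A x (\<lambda>y. \<forall>v\<in>fibre B y. snd b' y v = G *v snd b y v)"
      by (rule near_mono) (simp add: t)
    then show ?thesis using matrix_vector_mul_linear[of G] by blast
  qed
qed

sublocale fb: flat_bundle "base T" "rel_tangent T" by (rule flat_bundle_rel)

text \<open>\<open>expo\<close> selects a trivialisation by choice; points and frames change by the
  same matrix, so the choice does not affect the value.\<close>

lemma expo_eq: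
  assumes t: "t \<in> trivs T" "x \<in> fst t" and v: "v \<in> fibre B x"
  shows "expo T (x, v) = triv_point T t x (theta t x v)"
proof -
  define s where "s = (SOME t. t \<in> trivs T \<and> x \<in> fst t)"
  have s: "s \<in> trivs T" "x \<in> fst s"
    using someI[of "\<lambda>t. t \<in> trivs T \<and> x \<in> fst t" t] t unfolding s_def by blast+
  obtain G where "near A x (\<lambda>y. y \<in> fst t \<inter> fst s \<and> (\<forall>a. triv_point T s y (G *v a) = triv_point T t y a) \<and>
      (\<forall>v\<in>fibre B y. theta s y v = G *v theta t y v))"
    using theta_transition[OF t s] by blast
  from near_point[OF this] have "triv_point T s x (theta s x v) = triv_point T t x (theta t x v)" using v by simp
  then show ?thesis by (simp add: expo_def Let_def s_def theta_def)
qed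

lemma expo_eq_iff:
  assumes t: "t \<in> trivs T" "x \<in> fst t" and v: "v \<in> fibre B x" "v' \<in> fibre B x"
  shows "expo T (x, v) = expo T (x, v') \<longleftrightarrow> (\<forall>b\<in>Basis. theta t x (v' - v) \<bullet> b \<in> \<int>)"
proof -
  have "(fst t, theta t) \<in> btriv B" using t(1) unfolding btriv_rel by blast
  from linear_on_set_diff[OF fb.triv_linear[OF this] fb.fibre_subspace[OF this] v(2,1)]
  have "theta t x (v' - v) = theta t x v' - theta t x v" using t(2) by simp
  then show ?thesis
    using t by (simp add: expo_eq v triv_point_eq_iff torus_proj_eq_iff ball_integral)
qed

lemma lattice_iff:
  assumes t: "t \<in> trivs T" "x \<in> fst t"
  shows "v \<in> lattice T x \<longleftrightarrow> v \<in> fibre B x \<and> (\<forall>b\<in>Basis. theta t x v \<bullet> b \<in> \<int>)"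
proof -
  have 0: "0 \<in> fibre B x" by (rule subspace_0[OF fb.subspace_fibre[OF trivs_carrier[OF t]]])
  have "theta t x 0 = 0" using theta_frame[OF t, of 0] linear_0[OF linear_frame[OF t]] by simp
  then have "expo T (x, 0) = zero_sec T x" using expo_eq[OF t 0] triv_point_0[OF t] by simp
  then show ?thesis using expo_eq_iff[OF t 0, of v] by (auto simp: lattice_def)
qed

end

section \<open>The torus bundle and its dual as lattice quotients\<close>

lemma pres_simps:
  "pbase (pres T) = base T" "ptotal (pres T) = total T" "pproj (pres T) = proj T"
  "pbundle (pres T) = rel_tangent T" "pquot (pres T) = expo T"
  "pconn (pres T) = flat_conn (base T) (rel_tangent T)"
  "pbase (dual_pres T) = base T" "pproj (dual_pres T) = fst"
  "ptotal (dual_pres T) = quotient_atlas (tot_atlas (base T) (dual_bundle (rel_tangent T))) (dual_quot T)"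
  "pbundle (dual_pres T) = dual_bundle (rel_tangent T)" "pquot (dual_pres T) = dual_quot T"
  "pconn (dual_pres T) = dual_conn (base T) (rel_tangent T) (flat_conn (base T) (rel_tangent T))"
  by (simp_all add: pres_def dual_pres_def)

context torus_bdl
begin

text \<open>The sheet confines the fibre coordinate to the ball of radius 1/2 around that of
  \<open>y\<close>. On it the chart \<open>pch\<close> coincides with
  \<open>torus_chart c t a\<close>, whose compatibility with the atlas of \<open>Z\<close> is
  known.\<close>

lemma expo_local:
  assumes c: "c \<in> A" and b: "b \<in> btriv B" and y: "y \<in> fst (tchart B c b)"
  shows "\<exists>W. y \<in> W \<and> pc (pres T) c b W"
proof -
  obtain t where t: "t \<in> trivs T" and bt: "b = (fst t, theta t)" using b unfolding btriv_rel by blast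
  let ?k = "tchart B c b"
  define a where "a = snd (snd ?k y)"
  define W where "W = {w \<in> fst ?k. snd ?k w \<in> UNIV \<times> ball a (1/2)}"
  have W: "mopen fb.TOT W"
    unfolding W_def by (rule satlas.mopen_preimage[OF fb.satlas_tot fb.tchart_mchart[OF c b]]) (simp add: open_Times)
  have w: "fst w \<in> fst c" "fst w \<in> fst t" "snd w \<in> fibre B (fst w)" "theta t (fst w) (snd w) \<in> ball a (1/2)"
    if "w \<in> W" for w
    using that unfolding W_def mem_Collect_eq tchart_simps mem_Times_iff by (simp_all add: bt del: mem_ball)
  have e: "expo T w = triv_point T t (fst w) (theta t (fst w) (snd w))" if "w \<in> W" for w
    using expo_eq[OF t w(2,3)[OF that]] by simp
  have k: "snd (torus_chart c t a) (expo T w) = snd ?k w" "expo T w \<in> fst (torus_chart c t a)" if "w \<in> W" for w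
    using torus_chart_triv_point[OF c t w(2,1,4)[OF that]] e[OF that] by (simp_all add: tchart_simps bt)
  have inj: "inj_on (expo T) W"
  proof (rule inj_onI)
    fix w w' assume w: "w \<in> W" "w' \<in> W" "expo T w = expo T w'"
    then have "snd ?k w = snd ?k w'" using k(1) by metis
    then show "w = w'" using inj_onD[OF fb.tchart_inj[OF c b]] w by (auto simp: W_def)
  qed
  \<comment> \<open>Compatibility is transferred between charts with equal domains, so the image of
    the sheet has to exhaust the torus chart.\<close>
  have "fst (torus_chart c t a) \<subseteq> expo T ` W"
  proof
    fix z assume "z \<in> fst (torus_chart c t a)"
    then have z: "z \<in> carrier Z" "proj T z \<in> fst t" "proj T z \<in> fst c" "snd t z \<in> fst (proj_chart a)"
      by (simp_all add: torus_chart_def over_def)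
    then obtain d where d: "d \<in> ball a (1/2)" "snd t z = torus_proj d" by (auto simp: proj_chart_def)
    let ?w = "(proj T z, fibre_frame T t (proj T z) d)"
    have "?w \<in> W"
      unfolding W_def mem_Collect_eq tchart_simps mem_Times_iff
      using frame_in[OF t z(2)] theta_frame[OF t z(2)] z(2,3) d(1) by (simp add: bt)
    moreover from e[OF this] have "expo T ?w = z"
      using theta_frame[OF t z(2)] triv_point_eqI[OF t z(2,1) refl d(2)] by simp
    ultimately show "z \<in> expo T ` W" by (metis imageI)
  qed
  then have im: "fst (pch (pres T) c b W) = fst (torus_chart c t a)"
    using k(2) by (auto simp: pch_def pres_simps)
  have "mchart Z (pch (pres T) c b W)"
  proof (rule mchart_cong[OF torus_chart_mchart[OF c t, of a] im _ ZA.A.satlas_axioms])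
    fix z assume "z \<in> fst (torus_chart c t a)"
    then obtain w where "w \<in> W" "z = expo T w" unfolding im[symmetric] by (auto simp: pch_def pres_simps)
    then show "snd (pch (pres T) c b W) z = snd (torus_chart c t a) z"
      using k(1) inv_into_f_f[OF inj] by (simp add: pch_def pres_simps)
  qed
  then have "pc (pres T) c b W" unfolding pc_def pres_simps using c b W inj by (auto simp: W_def)
  moreover have "y \<in> W" using y by (simp add: W_def a_def mem_Times_iff)
  ultimately show ?thesis by blast
qed

lemma flat_torus_pres: "flat_torus (pres T)"
proof (intro flat_torus.intro flat_pres.intro flat_torus_axioms.intro; unfold pres_simps)
  show "flat_bundle A B" by (rule flat_bundle_rel)
  show "fb.flat_for (flat_conn A B)" by (rule fb.flat_for_flat_conn)
  show "satlas Z" by (rule ZA.A.satlas_axioms)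
  show "proj T (expo T (x, v)) = x" if x: "x \<in> carrier A" and v: "v \<in> fibre B x" for x v
  proof -
    obtain t where t: "t \<in> trivs T" "x \<in> fst t" using trivs_cover[OF x] by blast
    show ?thesis using expo_eq[OF t v] triv_point(2)[OF t] by simp
  qed
  show "proj T z \<in> carrier A \<and> (\<exists>v\<in>fibre B (proj T z). expo T (proj T z, v) = z)" if z: "z \<in> carrier Z" for z
  proof -
    have x: "proj T z \<in> carrier A" using proj_smooth z by (auto simp: smooth_map_def)
    obtain t where t: "t \<in> trivs T" "proj T z \<in> fst t" using trivs_cover[OF x] by blast
    obtain a where a: "triv_point T t (proj T z) a = z" using triv_point_surj[OF t(1) z t(2)] by blast
    have "expo T (proj T z, fibre_frame T t (proj T z) a) = z"
      unfolding expo_eq[OF t frame_in[OF t]] theta_frame[OF t] by (rule a)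
    then show ?thesis using x frame_in[OF t] by blast
  qed
  show "\<exists>W. y \<in> W \<and> pc (pres T) c b W" if "c \<in> A" "b \<in> btriv B" "y \<in> fst (tchart B c b)" for c b y
    by (rule expo_local[OF that])
  show "near A x (\<lambda>y. \<forall>u\<in>fibre B y. expo T (y, u + inv_into (fibre B y) (snd b y) (snd b x (v' - v))) = expo T (y, u))"
    if b: "b \<in> btriv B" "x \<in> fst b" and v: "v \<in> fibre B x" "v' \<in> fibre B x" "expo T (x, v) = expo T (x, v')" for b x v v'
  proof -
    obtain t where t: "t \<in> trivs T" and bt: "b = (fst t, theta t)" using b unfolding btriv_rel by blast
    have x: "x \<in> fst t" using b bt by simp
    have m: "\<forall>j\<in>Basis. theta t x (v' - v) \<bullet> j \<in> \<int>" using expo_eq_iff[OF t x v(1,2)] v(3) by blast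
    show ?thesis
    proof (rule near_mono[OF fb.near_triv[OF b]], intro ballI)
      fix y u assume yb: "y \<in> fst b" and u: "u \<in> fibre B y"
      let ?m = "fb.vinv b y (snd b x (v' - v))"
      have y: "y \<in> fst t" using yb bt by simp
      note sub = fb.fibre_subspace[OF b(1) yb]
      have mi: "?m \<in> fibre B y" by (rule fb.vinv_in[OF b(1) yb])
      \<comment> \<open>The continued vector has the same coordinates over \<open>y\<close> as over
        \<open>x\<close>. They are integral there, hence here as well.\<close>
      have "theta t y ?m = theta t x (v' - v)" using fb.triv_vinv[OF b(1) yb] bt by simp
      then have "expo T (y, u) = expo T (y, u + ?m)"
        using expo_eq_iff[OF t y u subspace_add[OF sub u mi]] m by simp
      then show "expo T (y, u + inv_into (fibre B y) (snd b y) (snd b x (v' - v))) = expo T (y, u)"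
        by (simp add: fb.vinv_def)
    qed
  qed
qed

text \<open>The coordinates of a functional in the dual trivialisation are its values on the vectors
  \<open>fb.vinv b x j\<close>, a basis of the lattice; integrality on the lattice and integrality
  of the coordinates are therefore the same.\<close>

sublocale dual: lattice_bundle "base T" "dual_bundle (rel_tangent T)" "dual_lattice T"
proof (intro lattice_bundle.intro lattice_bundle_axioms.intro fb.flat_bundle_dual)
  fix s x assume s: "s \<in> btriv (dual_bundle B)" "x \<in> fst s"
  then obtain b where b: "b \<in> btriv B" and sb: "s = (fst b, dual_triv B b)" unfolding btriv_dual by blast
  then obtain t where t: "t \<in> trivs T" and bt: "b = (fst t, theta t)" unfolding btriv_rel by blast
  have xt: "x \<in> fst t" and xb: "x \<in> fst b" using s(2) sb bt by simp_all
  have "(\<forall>v\<in>lattice T x. f v \<in> \<int>) \<longleftrightarrow> (\<forall>j\<in>Basis. dual_triv B b x f \<bullet> j \<in> \<int>)"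
    if f: "f \<in> dual_space (fibre B x)" for f
  proof
    assume *: "\<forall>v\<in>lattice T x. f v \<in> \<int>"
    show "\<forall>j\<in>Basis. dual_triv B b x f \<bullet> j \<in> \<int>"
    proof
      fix j :: "real ^ 'n" assume j: "j \<in> Basis"
      have "theta t x (fb.vinv b x j) = j" using fb.triv_vinv[OF b xb, of j] bt by simp
      then have "fb.vinv b x j \<in> lattice T x"
        unfolding lattice_iff[OF t xt] using fb.vinv_in[OF b xb, of j] j by (simp add: inner_Basis)
      then show "dual_triv B b x f \<bullet> j \<in> \<int>" unfolding fb.dual_triv_inner[OF b xb f] using * by blast
    qed
  next
    assume *: "\<forall>j\<in>Basis. dual_triv B b x f \<bullet> j \<in> \<int>"
    show "\<forall>v\<in>lattice T x. f v \<in> \<int>"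
    proof
      fix v assume "v \<in> lattice T x"
      then have v: "v \<in> fibre B x" "\<forall>j\<in>Basis. snd b x v \<bullet> j \<in> \<int>" unfolding lattice_iff[OF t xt] by (simp_all add: bt)
      show "f v \<in> \<int>"
        unfolding fb.dual_apply[OF b xb f v(1)] using * v(2)
        by (subst euclidean_inner) (intro Ints_sum Ints_mult, auto)
    qed
  qed
  then show "dual_lattice T x = {g \<in> fibre (dual_bundle B) x. \<forall>j\<in>Basis. snd s x g \<bullet> j \<in> \<int>}"
    by (auto simp: dual_lattice_def sb)
qed

lemma flat_torus_dual_pres: "flat_torus (dual_pres T)"
proof (rule dual.flat_torus_quotient)
  show Q: "pquot (dual_pres T) = dual.Q" by (simp add: pres_simps dual_quot_def dual.Q_def)
  then show "ptotal (dual_pres T) = quotient_atlas (tot_atlas A (dual_bundle B)) dual.Q" by (simp add: pres_simps)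
  show "dual.flat_for (pconn (dual_pres T))"
    unfolding pres_simps by (rule fb.flat_for_dual_conn[OF fb.flat_for_flat_conn])
qed (simp_all add: pres_simps)

end

section \<open>The pair of Dirac structures of a semi-flat structure\<close>

theorem corollary8p7:
  fixes T :: "('m, 'z, 'n::finite) torus_data"
    and J :: "'z \<Rightarrow> ('z, (real ^ 'n) \<times> (real ^ 'n)) tvec gen \<Rightarrow> ('z, (real ^ 'n) \<times> (real ^ 'n)) tvec gen"
    and K :: "('m, real ^ 'n, ('z, (real ^ 'n) \<times> (real ^ 'n)) tvec) base_str"
  assumes "torus_bundle T"
    and "semi_flat (pres T) J K"
  shows "almost_dirac (base T) (Delta (pres T) K)
    \<and> almost_dirac (base T) (Delta_hat (pres T) K)
    \<and> flat_connection (base T)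
        (sub_sections (base T) (gen_bundle (tbundle (base T))) (Delta (pres T) K))
        (conn_Delta (pres T) K)
    \<and> flat_connection (base T)
        (sub_sections (base T) (gen_bundle (tbundle (base T))) (Delta_hat (pres T) K))
        (conn_Delta_hat (pres T) K)
    \<and> semi_flat (dual_pres T)
        (induced_str (dual_pres T) (mirror_base (pres T) K)) (mirror_base (pres T) K)
    \<and> (\<forall>x\<in>carrier (base T).
         Delta (dual_pres T) (mirror_base (pres T) K) x = Delta_hat (pres T) K x
       \<and> Delta_hat (dual_pres T) (mirror_base (pres T) K) x = Delta (pres T) K x)
    \<and> (integrable_gacs (total T) J \<longrightarrow>
         integrable_dirac (base T) (Delta (pres T) K)
       \<and> integrable_dirac (base T) (Delta_hat (pres T) K))"
proof -
  interpret torus_bdl T by (rule torus_bdl.intro) fact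
  have sf: "gacs (pbase (pres T)) (base_sum (pres T)) K" "adapted (pres T) K"
    and J: "\<And>z u. z \<in> carrier (ptotal (pres T)) \<Longrightarrow> u \<in> fibre (gen_bundle (tbundle (ptotal (pres T)))) z \<Longrightarrow>
      J z u = induced_str (pres T) K z u"
    using assms(2) unfolding semi_flat_def by blast+
  have ft: "flat_pres (pres T)" by (rule flat_torus.axioms(1)[OF flat_torus_pres])
  interpret S: semi_flat_torus "pres T" K
    by (intro semi_flat_torus.intro adapted_str.intro adapted_str_axioms.intro flat_torus_pres ft sf)
  interpret mp: mirror_pair "pres T" K "dual_pres T"
    by (intro mirror_pair.intro S.adapted_str_axioms mirror_pair_axioms.intro) (simp_all add: pres_simps)
  interpret D: semi_flat_torus "dual_pres T" "mirror_base (pres T) K"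
    by (intro semi_flat_torus.intro mp.Qm.adapted_str_axioms flat_torus_dual_pres)
  \<comment> \<open>The dual presentation is another instance of the same locale, so the induced
    structure of the mirror is covered by \<open>gacs_JZ\<close>.\<close>
  have "semi_flat (dual_pres T) (induced_str (dual_pres T) (mirror_base (pres T) K)) (mirror_base (pres T) K)"
    unfolding semi_flat_def using D.gacs_JZ mp.Qm.gacs_K mp.Qm.adapted_K by blast
  moreover have "integrable_dirac (base T) (Delta (pres T) K) \<and> integrable_dirac (base T) (Delta_hat (pres T) K)"
    if i: "integrable_gacs (total T) J"
  proof -
    \<comment> \<open>The premise of the second part, smoothness of the inverse of
      \<open>to_Delta_hat\<close>, is supplied by the mirror pair; integrability is used for
      \<open>J\<close> itself and not for the mirror.\<close>
    note d = S.integrable_dirac_Deltas[OF J, unfolded pres_simps, OF _ _ i]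
    show ?thesis
      using d(1) d(2) mp.sec_from_Delta_hat[unfolded pres_simps fibre_dual_bundle] by blast
  qed
  ultimately show ?thesis
    using S.almost_dirac_Delta mp.almost_dirac_Delta_hat S.flat_connection_Delta mp.flat_connection_Delta_hat
      mp.Delta_mirror unfolding pres_simps by blast
qed

end
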